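(* Let $G=\mathrm{SO}(2,n)$ with $n\ge3$, realized as in the context. Let $H$ be a closed, connected subgroup of $AN$, with Lie algebra $\mathfrak h$, such that $H=(H\cap A)\ltimes(H\cap N)$. The subgroup $H$ is a Cartan-decomposition subgroup of $G$ if and only if either (1) $A\subset H$; or (2) $H\cap N$ is a Cartan-decomposition subgroup of $G$; or (3) $H\cap A=\ker\alpha$, and we have $\phi=\eta=0$ and $\dim\langle x,y\rangle=1$ for every nonidentity $h\in H\cap N$; or (4) $H\cap A=\ker\beta$, and we have $y=0$ and $\|x\|^2=-2\phi\eta$ for every element of $H\cap N$; or (5) there is a positive root $\omega$ such that $\mathfrak h\cap\mathfrak n\subset\mathfrak u_\omega$, and $H$ satisfies the following conditions: $\mathfrak h=\mathfrak t+\mathfrak u$ for some one-dimensional subspace $\mathfrak t$ of $\mathfrak a$ and some nontrivial subalgebra $\mathfrak u$ of $\mathfrak u_\omega$, and $\mathfrak t^+\smallsetminus\{0\}$ is not contained in the interior of the region $\mathcal C$ associated (as in the context) to $\omega$ and $\mathfrak t$.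
   Context: A closed subgroup $H$ of $G$ is a Cartan-decomposition subgroup of $G$ if $H$ is connected and there is a compact subset $C$ of $G$ with $CHC=G$. $\mathrm{SO}(2,n)$ is the group of determinant-one linear isometries of $\langle v\mid v\rangle=2v_1v_{n+2}+2v_2v_{n+1}+\sum_{i=3}^n v_i^2$ on $\mathbb{R}^{n+2}$. $A$ is the group of diagonal matrices in $\mathrm{SO}(2,n)$ with positive diagonal entries, i.e. $a=\mathrm{diag}(a_1,a_2,1,\dots,1,a_2^{-1},a_1^{-1})$, and $N$ is the group of upper-triangular matrices in $\mathrm{SO}(2,n)$ with all diagonal entries $1$; $\mathfrak a,\mathfrak n$ are their Lie algebras. $\mathfrak n$ consists of the matrices (block sizes $1,1,n-2,1,1$) $$\begin{pmatrix}0&\phi&x&\eta&0\\0&0&y&0&-\eta\\0&0&0&-y^T&-x^T\\0&0&0&0&-\phi\\0&0&0&0&0\end{pmatrix},\qquad \phi,\eta\in\mathbb{R},\ x,y\in\mathbb{R}^{n-2}.$$ For $h\in N$, the values $\phi,x,y,\eta$ of $h$ are those of $\log h\in\mathfrak n$. $\langle x,y\rangle$ is the linear span. The simple roots are $\alpha(a)=a_1/a_2$ and $\beta(a)=a_2$; the positive roots are $\alpha,\beta,\alpha+\beta,\alpha+2\beta$, with root spaces: $\mathfrak u_\alpha$ = $\phi$-axis, $\mathfrak u_\beta$ = $y$-subspace, $\mathfrak u_{\alpha+\beta}$ = $x$-subspace, $\mathfrak u_{\alpha+2\beta}$ = $\eta$-axis. $\ker\omega$ denotes the kernel of $\omega$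 in $A$. Region $\mathcal C$: for a positive root $\omega$ and a one-dimensional subspace $\mathfrak t\subset\mathfrak a$, let $\mathfrak a_\omega=[\mathfrak u_\omega,\mathfrak u_{-\omega}]\cap\mathfrak a$ (one-dimensional). Choose rays (from $0$) $\mathfrak t^+\subset\mathfrak t$ and $\mathfrak a_\omega^+\subset\mathfrak a_\omega$ such that $\langle t\mid a\rangle\ge0$ for all $t\in\mathfrak t^+$, $a\in\mathfrak a_\omega^+$, where $\langle\cdot\mid\cdot\rangle$ is the inner product on $\mathfrak a$ given by the Killing form. If $\mathfrak a_\omega^+$ (minus $0$) is contained in the interior of a Weyl chamber of $\mathfrak a$, then $\mathcal C$ is the interior of that Weyl chamber; if $\mathfrak a_\omega^+$ is the wall between two Weyl chambers $\mathcal C_1,\mathcal C_2$, then $\mathcal C$ is the interior of $\mathcal C_1\cup\mathfrak a_\omega^+\cup\mathcal C_2$.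
   Formalization: In (3) and (4) it is additionally required that H∩N be nontrivial; as printed, H = ker α or H = ker β with H∩N trivial would satisfy (3) or (4) without being a Cartan-decomposition subgroup. *)

theory Defs
  imports "HOL-Analysis.Analysis" "HOL-Algebra.Coset"
begin

text \<open>
  Vectors of length \<open>n + 2\<close> and square matrices of that size are indexed by a finite linearly
  ordered type with \<open>n + 2\<close> elements; \<open>ix k\<close> is its \<open>k\<close>-th element, counted from 1, so that
  \<open>v $ ix k\<close> is the coordinate \<open>v\<^sub>k\<close>.
\<close>

type_synonym 'm sqmat = "real ^ 'm ^ 'm"

definition ix :: "nat \<Rightarrow> 'm :: {finite, linorder}" where
  "ix k = sorted_list_of_set UNIV ! (k - 1)"


section \<open>Matrix groups and their Lie algebras\<close>

definition mat_group :: "'m::finite sqmat set \<Rightarrow> 'm sqmat monoid" where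
  "mat_group S = \<lparr>carrier = S, monoid.mult = (**), one = mat 1\<rparr>"

definition closed_subgroup :: "'m::finite sqmat set \<Rightarrow> 'm sqmat set \<Rightarrow> bool" where
  "closed_subgroup H G \<longleftrightarrow> subgroup H (mat_group G) \<and> closedin (top_of_set G) H"

text \<open>\<open>H\<close> is the internal semidirect product of the subgroup \<open>K\<close> and the normal subgroup \<open>L\<close>.\<close>

definition inner_semidirect :: "'m::finite sqmat set \<Rightarrow> 'm sqmat set \<Rightarrow> 'm sqmat set \<Rightarrow> bool" where
  "inner_semidirect H K L \<longleftrightarrow>
     subgroup K (mat_group H) \<and> L \<lhd> mat_group H \<and> K \<inter> L = {mat 1} \<and>
     K <#>\<^bsub>mat_group H\<^esub> L = H"

definition CDS :: "'m::finite sqmat set \<Rightarrow> 'm sqmat set \<Rightarrow> bool" where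
  "CDS G H \<longleftrightarrow> closed_subgroup H G \<and> connected H \<and>
     (\<exists>C \<subseteq> G. compact C \<and> {c ** h ** d | c h d. c \<in> C \<and> h \<in> H \<and> d \<in> C} = G)"

text \<open>
  The type \<^typ>\<open>real ^ 'm ^ 'm\<close> carries componentwise multiplication, so the library's \<open>exp\<close> and
  \<open>^\<close> are not the ones for matrices.
\<close>

definition mexp :: "'m::finite sqmat \<Rightarrow> 'm sqmat" where
  "mexp X = (\<Sum>k. (1 / fact k) *\<^sub>R (((**) X ^^ k) (mat 1)))"

definition bracket :: "'m::finite sqmat \<Rightarrow> 'm sqmat \<Rightarrow> 'm sqmat" where
  "bracket X Y = X ** Y - Y ** X"

text \<open>The Lie algebra of a closed matrix group.\<close>

definition lie :: "'m::finite sqmat set \<Rightarrow> 'm sqmat set" where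
  "lie H = {X. \<forall>t::real. mexp (t *\<^sub>R X) \<in> H}"

definition subalgebra :: "'m::finite sqmat set \<Rightarrow> bool" where
  "subalgebra U \<longleftrightarrow> subspace U \<and> (\<forall>X\<in>U. \<forall>Y\<in>U. bracket X Y \<in> U)"

text \<open>
  The trace of an endomorphism \<open>f\<close> of a linear subspace \<open>V\<close>, computed in an arbitrary basis of \<open>V\<close>.
\<close>

definition trace_on :: "'v::euclidean_space set \<Rightarrow> ('v \<Rightarrow> 'v) \<Rightarrow> real" where
  "trace_on V f = (let B = (SOME B. independent B \<and> span B = V) in
     \<Sum>b\<in>B. representation B (f b) b)"

definition killing :: "'m::finite sqmat set \<Rightarrow> 'm sqmat \<Rightarrow> 'm sqmat \<Rightarrow> real" where
  "killing \<gg> X Y = trace_on \<gg> (\<lambda>Z. bracket X (bracket Y Z))"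


section \<open>The group \<open>SO(2,n)\<close> and its subgroups \<open>A\<close> and \<open>N\<close>\<close>

definition qform :: "nat \<Rightarrow> real ^ 'm::{finite, linorder} \<Rightarrow> real" where
  "qform n v = 2 * v $ ix 1 * v $ ix (n + 2) + 2 * v $ ix 2 * v $ ix (n + 1)
               + (\<Sum>i = 3..n. (v $ ix i)\<^sup>2)"

definition SO2 :: "nat \<Rightarrow> 'm::{finite, linorder} sqmat set" where
  "SO2 n = {g. (\<forall>v. qform n (g *v v) = qform n v) \<and> det g = 1}"

definition grpA :: "nat \<Rightarrow> 'm::{finite, linorder} sqmat set" where
  "grpA n = {a \<in> SO2 n. (\<forall>i j. i \<noteq> j \<longrightarrow> a $ i $ j = 0) \<and> (\<forall>i. a $ i $ i > 0)}"

definition grpN :: "nat \<Rightarrow> 'm::{finite, linorder} sqmat set" where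
  "grpN n = {h \<in> SO2 n. (\<forall>i j. j < i \<longrightarrow> h $ i $ j = 0) \<and> (\<forall>i. h $ i $ i = 1)}"

definition grpAN :: "nat \<Rightarrow> 'm::{finite, linorder} sqmat set" where
  "grpAN n = {a ** h | a h. a \<in> grpA n \<and> h \<in> grpN n}"

text \<open>The exponential map restricts to a bijection from the Lie algebra of \<open>N\<close> onto \<open>N\<close>.\<close>

definition logN :: "nat \<Rightarrow> 'm::{finite, linorder} sqmat \<Rightarrow> 'm sqmat" where
  "logN n h = (THE X. X \<in> lie (grpN n) \<and> mexp X = h)"

text \<open>
  The parameters of an element of \<open>N\<close>, read off the first two rows of its logarithm. The vectors
  \<open>x, y \<in> \<real>\<^sup>n\<^sup>-\<^sup>2\<close> keep their positions \<open>3, \<dots>, n\<close> in the row and are padded with zeros elsewhere,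
  which changes neither norms nor dimensions of spans.
\<close>

definition par_phi :: "nat \<Rightarrow> 'm::{finite, linorder} sqmat \<Rightarrow> real" where
  "par_phi n h = logN n h $ ix 1 $ ix 2"

definition par_eta :: "nat \<Rightarrow> 'm::{finite, linorder} sqmat \<Rightarrow> real" where
  "par_eta n h = logN n h $ ix 1 $ ix (n + 1)"

definition par_x :: "nat \<Rightarrow> 'm::{finite, linorder} sqmat \<Rightarrow> real ^ ('m::{finite, linorder})" where
  "par_x n h = (\<chi> j. if j \<in> ix ` {3..n} then logN n h $ ix 1 $ j else 0)"

definition par_y :: "nat \<Rightarrow> 'm::{finite, linorder} sqmat \<Rightarrow> real ^ ('m::{finite, linorder})" where
  "par_y n h = (\<chi> j. if j \<in> ix ` {3..n} then logN n h $ ix 2 $ j else 0)"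


section \<open>Roots\<close>

text \<open>
  Roots are written additively in the literature, but here they are multiplicative characters of
  \<open>A\<close>: \<open>\<alpha> + 2\<beta>\<close> is the character \<open>\<alpha> \<cdot> \<beta>\<^sup>2\<close> and \<open>-\<omega>\<close> is \<open>\<omega>\<^sup>-\<^sup>1\<close>.
\<close>

definition root_alpha :: "'m::{finite, linorder} sqmat \<Rightarrow> real" where
  "root_alpha a = a $ ix 1 $ ix 1 / a $ ix 2 $ ix 2"

definition root_beta :: "'m::{finite, linorder} sqmat \<Rightarrow> real" where
  "root_beta a = a $ ix 2 $ ix 2"

definition pos_roots :: "('m::{finite, linorder} sqmat \<Rightarrow> real) set" where
  "pos_roots = {root_alpha, root_beta,
                \<lambda>a. root_alpha a * root_beta a,
                \<lambda>a. root_alpha a * (root_beta a)\<^sup>2}"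

definition root_ker :: "nat \<Rightarrow> ('m::{finite, linorder} sqmat \<Rightarrow> real) \<Rightarrow> 'm sqmat set" where
  "root_ker n \<omega> = {a \<in> grpA n. \<omega> a = 1}"

text \<open>
  For the four positive roots these are the \<open>\<phi>\<close>-axis, the \<open>y\<close>-subspace, the \<open>x\<close>-subspace and the
  \<open>\<eta>\<close>-axis of the Lie algebra of \<open>N\<close>.
\<close>

definition root_space :: "nat \<Rightarrow> ('m::{finite, linorder} sqmat \<Rightarrow> real) \<Rightarrow> 'm sqmat set" where
  "root_space n \<omega> = {X \<in> lie (SO2 n). \<forall>a \<in> grpA n. a ** X ** matrix_inv a = \<omega> a *\<^sub>R X}"


section \<open>Weyl chambers and the region attached to a root\<close>

text \<open>Weyl chambers are taken to be closed.\<close>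

definition weyl_chambers :: "nat \<Rightarrow> 'm::{finite, linorder} sqmat set set" where
  "weyl_chambers n = closure `
     components (lie (grpA n) - (\<Union>\<omega>\<in>pos_roots. {X. \<omega> (mexp X) = 1}))"

definition coroot_line :: "nat \<Rightarrow> ('m::{finite, linorder} sqmat \<Rightarrow> real) \<Rightarrow> 'm sqmat set" where
  "coroot_line n \<omega> =
     span {bracket X Y | X Y. X \<in> root_space n \<omega> \<and> Y \<in> root_space n (\<lambda>a. inverse (\<omega> a))}
       \<inter> lie (grpA n)"

definition ray :: "'v::real_vector set \<Rightarrow> bool" where
  "ray R \<longleftrightarrow> (\<exists>v. v \<noteq> 0 \<and> R = {s *\<^sub>R v | s. s \<ge> 0})"

definition intA :: "nat \<Rightarrow> 'm::{finite, linorder} sqmat set \<Rightarrow> 'm sqmat set" where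
  "intA n S = (top_of_set (lie (grpA n))) interior_of S"

text \<open>
  \<open>R\<close> is the chosen ray in the line of the coroot. For \<open>SO(2,n)\<close> only the second case occurs.
\<close>

definition region_of_ray :: "nat \<Rightarrow> 'm::{finite, linorder} sqmat set \<Rightarrow> 'm sqmat set \<Rightarrow> bool" where
  "region_of_ray n R \<C> \<longleftrightarrow>
     (\<exists>W \<in> weyl_chambers n. R - {0} \<subseteq> intA n W \<and> \<C> = intA n W) \<or>
     (\<exists>W\<^sub>1 \<in> weyl_chambers n. \<exists>W\<^sub>2 \<in> weyl_chambers n.
        W\<^sub>1 \<noteq> W\<^sub>2 \<and> R = W\<^sub>1 \<inter> W\<^sub>2 \<and> \<C> = intA n (W\<^sub>1 \<union> R \<union> W\<^sub>2))"

text \<open>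
  \<open>T\<close> is a permissible choice of the ray in the line \<open>\<tt>\<close>, and \<open>\<C>\<close> is the region that goes with
  it. The possible choices, at most four, come in opposite pairs \<open>(T, \<C>)\<close>, \<open>(-T, -\<C>)\<close>; \<open>T\<close> is
  ambiguous relative to \<open>\<C>\<close> only if \<open>\<tt>\<close> is orthogonal to the line of the coroot, and then neither
  of its rays lies in \<open>\<C>\<close>.
\<close>

definition ray_and_region ::
  "nat \<Rightarrow> ('m::{finite, linorder} sqmat \<Rightarrow> real) \<Rightarrow> 'm sqmat set \<Rightarrow> 'm sqmat set \<Rightarrow> 'm sqmat set \<Rightarrow> bool"
  where
  "ray_and_region n \<omega> \<tt> T \<C> \<longleftrightarrow>
     (\<exists>R. ray T \<and> T \<subseteq> \<tt> \<and> ray R \<and> R \<subseteq> coroot_line n \<omega> \<and>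
          (\<forall>X\<in>T. \<forall>Y\<in>R. killing (lie (SO2 n)) X Y \<ge> 0) \<and>
          region_of_ray n R \<C>)"

end

theory Submission
  imports Defs
begin

text \<open>
  By the Cartan decomposition \<open>G = K A K\<close>, whether \<open>C H C = G\<close> for some compact \<open>C\<close> depends only on the
  possible sizes of two functions on \<open>H\<close>: the norm \<open>|h|\<close> and the norm \<open>L2 h\<close> of \<open>h\<close> on the exterior square,
  which for \<open>diag(a, b, 1, \<dots>, 1, 1/b, 1/a)\<close> with \<open>a \<ge> b \<ge> 1\<close> are about \<open>a\<close> and \<open>a b\<close>. So \<open>H\<close> is a
  Cartan-decomposition subgroup iff the pairs \<open>(|h|, L2 h)\<close> fill, up to bounded factors, the region between
  \<open>L2 = |h|\<close> and \<open>L2 = |h|\<^sup>2\<close>. By the intermediate value theorem it suffices to exhibit, for every large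
  \<open>N\<close>, a path in \<open>H\<close> of norm about \<open>N\<close> that joins the two boundary curves. Conversely \<open>H\<close> fails as soon as
  \<open>L2 \<le> C |h|^\<kappa>\<close> with \<open>\<kappa> < 2\<close>, or \<open>|h|^\<kappa> \<le> C L2\<close> with \<open>\<kappa> > 1\<close>, on \<open>H\<close>. If \<open>dim (H \<inter> A) = 1\<close>,
  a case analysis on the invariance of the Lie algebra of \<open>H \<inter> N\<close> under \<open>H \<inter> A\<close> decides which occurs.
\<close>

section \<open>Entries, norms and two by two minors\<close>

text \<open>The obstacle is that the Lie algebra of \<open>H \<inter> N\<close> need not be a sum of
  subspaces of root spaces. A one-dimensional torus with direction (t1, t2) only splits it by the
  weights t1 - t2, t1, t2, t1 + t2 of phi, x, y, eta, and these are distinct except on four lines: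
  t1 = t2, t2 = 0, t1 = 0 and t1 = 2 t2. The first two are the kernels of \<alpha> and \<beta> and
  yield conditions (3) and (4); the other two yield nothing new. Off these lines the unipotent part
  either fills by itself or lies in one root space. There everything depends on whether the torus
  line makes an angle of less than 45 degrees with the root, which is the region of condition (5)
  because the chambers of the root system B2 are 45 degree sectors. All negative results for a
  one-dimensional torus use one device. The torus scales the unipotent factor to norm 1, so that an
  element becomes a bounded matrix between two torus elements. The upper bounds are then automatic,
  and a lower bound for a single matrix entry or a single minor finishes the argument.\<close>

lemma abs_entry_le_norm: "\<bar>g $ i $ j\<bar> <= norm g" for g :: "'n::finite sqmat"
 by (meson component_le_norm_cart norm_bound_component_le_cart order_trans Finite_Cartesian_Product.norm_nth_le real_norm_def)

lemma norm_le_entries: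
 fixes g :: "'n::finite sqmat"
 assumes "\<And>i j. \<bar>g $ i $ j\<bar> <= B"
 shows "norm g <= (real CARD('n))\<^sup>2 * B"
proof -
 have "norm g <= (\<Sum>i\<in>UNIV. norm (g $ i))"
  unfolding norm_vec_def by (rule L2_set_le_sum) simp
 also have "\<dots> <= (\<Sum>i\<in>(UNIV::'n set). \<Sum>j\<in>(UNIV::'n set). B)"
  by (intro sum_mono order_trans[OF norm_le_l1_cart] assms)
 finally show ?thesis by (simp add: power2_eq_square)
qed

lemma norm_matrix_mult_le:
 fixes g h :: "'n::finite sqmat"
 shows "norm (g ** h) <= (real CARD('n))^3 * norm g * norm h"
proof -
 have "\<bar>(g ** h) $ i $ j\<bar> <= real CARD('n) * (norm g * norm h)" for i j
 proof -
  have "\<bar>(g ** h) $ i $ j\<bar> <= (\<Sum>k\<in>(UNIV::'n set). \<bar>g $ i $ k\<bar> * \<bar>h $ k $ j\<bar>)"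
   unfolding matrix_matrix_mult_def by (simp add: order_trans[OF sum_abs] abs_mult)
  also have "\<dots> <= (\<Sum>k\<in>(UNIV::'n set). norm g * norm h)"
   by (intro sum_mono mult_mono abs_entry_le_norm) auto
  finally show ?thesis by simp
 qed
 from norm_le_entries[OF this] show ?thesis by (simp add: power2_eq_square power3_eq_cube mult_ac)
qed

section \<open>Two by two minors and the exterior square\<close>

definition minor2 :: "'n::finite sqmat => 'n => 'n => 'n => 'n => real" where
 "minor2 g i j k l = g $ i $ k * g $ j $ l - g $ i $ l * g $ j $ k"

text \<open>Four times the l1 norm of the matrix of the exterior square, since rows and columns are
  counted in both orders. Only its order of growth matters.\<close>

definition L2 :: "'n::finite sqmat => real" where
 "L2 g = (\<Sum>i\<in>UNIV. \<Sum>j\<in>UNIV. \<Sum>k\<in>UNIV. \<Sum>l\<in>UNIV. \<bar>minor2 g i j k l\<bar>)"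

lemma L2_nonneg: "L2 g >= 0"
 unfolding L2_def by (intro sum_nonneg) auto

lemma minor2_le_L2: "\<bar>minor2 g i j k l\<bar> <= L2 g"
proof -
 have "\<bar>minor2 g i j k l\<bar> <= (\<Sum>l\<in>UNIV. \<bar>minor2 g i j k l\<bar>)"
  by (rule member_le_sum) auto
 also have "\<dots> <= (\<Sum>k\<in>UNIV. \<Sum>l\<in>UNIV. \<bar>minor2 g i j k l\<bar>)"
  by (rule member_le_sum) (auto intro: sum_nonneg)
 also have "\<dots> <= (\<Sum>j\<in>UNIV. \<Sum>k\<in>UNIV. \<Sum>l\<in>UNIV. \<bar>minor2 g i j k l\<bar>)"
  by (rule member_le_sum) (auto intro!: sum_nonneg)
 also have "\<dots> <= L2 g" unfolding L2_def
  by (rule member_le_sum) (auto intro!: sum_nonneg)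
 finally show ?thesis .
qed

lemma L2_le_minors:
 fixes g :: "'n::finite sqmat"
 assumes "\<And>i j k l. \<bar>minor2 g i j k l\<bar> <= B"
 shows "L2 g <= (real CARD('n))^4 * B"
proof -
 have "L2 g <= (\<Sum>i\<in>(UNIV::'n set). \<Sum>j\<in>(UNIV::'n set). \<Sum>k\<in>(UNIV::'n set). \<Sum>l\<in>(UNIV::'n set). B)"
  unfolding L2_def by (intro sum_mono assms)
 then show ?thesis by (simp add: power4_eq_xxxx mult_ac)
qed

lemma L2_le_norm: "L2 g <= 2 * (real CARD('n))^4 * (norm g)\<^sup>2" for g :: "'n::finite sqmat"
proof -
 have "\<bar>minor2 g i j k l\<bar> <= 2 * (norm g)\<^sup>2" for i j k l
 proof -
  have "\<bar>g $ i $ k * g $ j $ l\<bar> <= norm g * norm g" "\<bar>g $ i $ l * g $ j $ k\<bar> <= norm g * norm g"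
   unfolding abs_mult by (intro mult_mono abs_entry_le_norm; simp)+
  then show ?thesis unfolding minor2_def power2_eq_square by linarith
 qed
 from L2_le_minors[OF this] show ?thesis by (simp add: mult_ac)
qed

text \<open>Cauchy-Binet. The sum runs over ordered pairs \<open>(p, q)\<close>, so each product of
  minors occurs twice, which the division by 2 corrects.\<close>

lemma minor2_mult:
 "minor2 (g ** h) i j k l = (\<Sum>p\<in>UNIV. \<Sum>q\<in>UNIV. minor2 g i j p q * minor2 h p q k l) / 2"
proof -
 let ?S = "\<lambda>f. \<Sum>p\<in>UNIV. \<Sum>q\<in>UNIV. f p q :: real"
 have prod: "(g ** h) $ i $ k * (g ** h) $ j $ l = ?S (\<lambda>p q. g $ i $ p * h $ p $ k * (g $ j $ q * h $ q $ l))"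
  for i j k l
  unfolding matrix_matrix_mult_def by (simp add: sum_product)
 have m: "minor2 (g ** h) i j k l = ?S (\<lambda>p q. g $ i $ p * g $ j $ q * minor2 h p q k l)" for i j k l
  unfolding minor2_def prod sum_subtractf[symmetric]
  by (intro sum.cong refl) (simp add: algebra_simps)
 have "?S (\<lambda>p q. minor2 g i j p q * minor2 h p q k l)
   = ?S (\<lambda>p q. g $ i $ p * g $ j $ q * minor2 h p q k l) - ?S (\<lambda>p q. g $ i $ q * g $ j $ p * minor2 h p q k l)"
  unfolding sum_subtractf[symmetric] by (intro sum.cong refl) (simp add: minor2_def algebra_simps)
 also have "?S (\<lambda>p q. g $ i $ q * g $ j $ p * minor2 h p q k l) = ?S (\<lambda>q p. g $ i $ q * g $ j $ p * minor2 h p q k l)"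
  by (rule sum.swap)
 also have "\<dots> = - ?S (\<lambda>p q. g $ i $ p * g $ j $ q * minor2 h p q k l)"
  unfolding sum_negf[symmetric] by (intro sum.cong refl) (simp add: minor2_def algebra_simps)
 finally show ?thesis unfolding m by simp
qed

lemma L2_mult: "L2 (g ** h) <= L2 g * L2 h"
proof -
 let ?U = "UNIV :: 'a set"
 let ?P = "?U \<times> ?U"
 have L2': "L2 g = (\<Sum>x\<in>?P. \<Sum>y\<in>?P. \<bar>minor2 g (fst x) (snd x) (fst y) (snd y)\<bar>)" for g :: "'a sqmat"
  unfolding L2_def sum.cartesian_product' by (simp add: sum.cartesian_product' case_prod_unfold)
 have "L2 (g ** h) <= (\<Sum>x\<in>?P. \<Sum>y\<in>?P. \<Sum>z\<in>?P. \<bar>minor2 g (fst x) (snd x) (fst z) (snd z)\<bar> * \<bar>minor2 h (fst z) (snd z) (fst y) (snd y)\<bar>)"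
  unfolding L2'
 proof (intro sum_mono)
  fix x y :: "'a \<times> 'a"
  let ?T = "\<Sum>z\<in>?P. \<bar>minor2 g (fst x) (snd x) (fst z) (snd z)\<bar> * \<bar>minor2 h (fst z) (snd z) (fst y) (snd y)\<bar>"
  have "\<bar>minor2 (g ** h) (fst x) (snd x) (fst y) (snd y)\<bar>
    = \<bar>\<Sum>z\<in>?P. minor2 g (fst x) (snd x) (fst z) (snd z) * minor2 h (fst z) (snd z) (fst y) (snd y)\<bar> / 2"
   unfolding minor2_mult by (simp add: sum.cartesian_product' case_prod_unfold del: UNIV_Times_UNIV)
  also have "\<dots> <= ?T / 2"
   by (intro divide_right_mono order_trans[OF sum_abs]) (auto simp: abs_mult)
  also have "\<dots> <= ?T" by (simp add: sum_nonneg)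
  finally show "\<bar>minor2 (g ** h) (fst x) (snd x) (fst y) (snd y)\<bar> <= ?T" .
 qed
 also have "\<dots> = (\<Sum>x\<in>?P. \<Sum>z\<in>?P. \<Sum>y\<in>?P. \<bar>minor2 g (fst x) (snd x) (fst z) (snd z)\<bar> * \<bar>minor2 h (fst z) (snd z) (fst y) (snd y)\<bar>)"
  by (rule sum.cong[OF refl], rule sum.swap)
 also have "\<dots> = (\<Sum>z\<in>?P. \<Sum>x\<in>?P. \<Sum>y\<in>?P. \<bar>minor2 g (fst x) (snd x) (fst z) (snd z)\<bar> * \<bar>minor2 h (fst z) (snd z) (fst y) (snd y)\<bar>)"
  by (rule sum.swap)
 also have "\<dots> = (\<Sum>z\<in>?P. (\<Sum>x\<in>?P. \<bar>minor2 g (fst x) (snd x) (fst z) (snd z)\<bar>) * (\<Sum>y\<in>?P. \<bar>minor2 h (fst z) (snd z) (fst y) (snd y)\<bar>))"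
  unfolding sum_product ..
 also have "\<dots> <= (\<Sum>z\<in>?P. (\<Sum>x\<in>?P. \<bar>minor2 g (fst x) (snd x) (fst z) (snd z)\<bar>) * L2 h)"
 proof (intro sum_mono mult_left_mono)
  fix z :: "'a \<times> 'a" assume "z \<in> ?P"
  show "(\<Sum>y\<in>?P. \<bar>minor2 h (fst z) (snd z) (fst y) (snd y)\<bar>) <= L2 h"
   unfolding L2' by (rule member_le_sum[of z ?P "\<lambda>z. \<Sum>y\<in>?P. \<bar>minor2 h (fst z) (snd z) (fst y) (snd y)\<bar>"])
    (auto intro!: sum_nonneg)
 qed (auto intro!: sum_nonneg)
 also have "\<dots> = L2 g * L2 h"
  unfolding L2' by (simp add: sum_distrib_right[symmetric]) (subst sum.swap, simp)
 finally show ?thesis .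
qed

text \<open>All minors of a rank one matrix vanish, so every surviving term contains the error, and
  the bound is linear in \<open>N\<close> instead of quadratic. This detects elements whose
  \<open>L2\<close> is only of the order of their norm.\<close>

lemma L2_rank_one:
 fixes g :: "'n::finite sqmat"
 assumes g: "\<And>i j. \<bar>g $ i $ j\<bar> <= N" and E: "\<And>i j. \<bar>g $ i $ j - u i * v j\<bar> <= B"
 shows "L2 g <= (real CARD('n))^4 * (4 * N * B + 2 * B\<^sup>2)"
proof (rule L2_le_minors)
 fix i j k l
 define E where "E = (\<lambda>i j. g $ i $ j - u i * v j)"
 have E': "\<bar>E i j\<bar> <= B" for i j using assms(2) by (simp add: E_def)
 have b: "\<bar>g $ i $ k * E j l\<bar> <= N * B" "\<bar>E j k * E i l\<bar> <= B * B" for i j k l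
  unfolding abs_mult using order_trans[OF abs_ge_zero g] order_trans[OF abs_ge_zero E']
  by (intro mult_mono g E'; simp)+
 \<comment> \<open>Write \<open>u i * v j\<close> as \<open>g - E\<close> and compare the two
   factorizations of \<open>u i * u j * v k * v l\<close>.\<close>
 have "minor2 g i j k l = g $ i $ k * E j l + g $ j $ l * E i k - E i k * E j l
   - (g $ i $ l * E j k + g $ j $ k * E i l - E i l * E j k)"
  unfolding minor2_def E_def by (simp add: algebra_simps)
 then show "\<bar>minor2 g i j k l\<bar> <= 4 * N * B + 2 * B\<^sup>2"
  using b(1)[of i k j l] b(1)[of j l i k] b(1)[of i l j k] b(1)[of j k i l] b(2)[of j l i k] b(2)[of i l j k]
   b(2)[of i k j l] b(2)[of j k i l]
  unfolding power2_eq_square by linarith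
qed

lemma continuous_on_L2: "continuous_on S f ==> continuous_on S (\<lambda>x. L2 (f x))"
 unfolding L2_def minor2_def by (intro continuous_intros)

section \<open>The group and its Cartan decomposition\<close>

type_synonym 'm vc = "real ^ 'm"

text \<open>The four named indices are those of the isotropic basis vectors, with \<open>e1\<close>,
  \<open>f1\<close> and \<open>e2\<close>, \<open>f2\<close> as dual pairs; the indices in between
  belong to the definite part of the form. The assumption \<open>ex_mid\<close> expresses n >=
  3.\<close>

locale levels =
 fixes e1 e2 f2 f1 :: "'m::{finite, linorder}"
 assumes e1_less_e2: "e1 < e2" and f2_less_f1: "f2 < f1"
  and ex_mid: "\<exists>m. e2 < m \<and> m < f2"
  and level_cases: "\<And>i. i = e1 \<or> i = e2 \<or> i = f2 \<or> i = f1 \<or> e2 < i \<and> i < f2"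
begin

definition mid :: "'m set" where "mid = {i. e2 < i \<and> i < f2}"

definition opp :: "'m => 'm" where
 "opp i = (if i = e1 then f1 else if i = e2 then f2 else if i = f2 then e2 else if i = f1 then e1 else i)"

text \<open>The Gram matrix of the bilinear form that polarizes \<open>qform\<close>. It is a
  symmetric permutation matrix, hence orthogonal and its own inverse.\<close>

definition J :: "'m sqmat" where "J = (\<chi> i j. if j = opp i then 1 else 0)"

definition SOJ :: "'m sqmat set" where "SOJ = {g. transpose g ** J ** g = J \<and> det g = 1}"

lemma e2_less_f2: "e2 < f2" using ex_mid by (auto intro: less_trans)

lemma levels_distinct [simp]:
 "e1 ~= e2" "e1 ~= f2" "e1 ~= f1" "e2 ~= e1" "e2 ~= f2" "e2 ~= f1"
 "f2 ~= e1" "f2 ~= e2" "f2 ~= f1" "f1 ~= e1" "f1 ~= e2" "f1 ~= f2"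
 using e1_less_e2 f2_less_f1 e2_less_f2 by auto

lemma not_mid [simp]: "e1 \<notin> mid" "e2 \<notin> mid" "f2 \<notin> mid" "f1 \<notin> mid"
 using e1_less_e2 f2_less_f1 by (auto simp: mid_def)

lemma mid_neq: "m \<in> mid ==> m ~= e1 \<and> m ~= e2 \<and> m ~= f2 \<and> m ~= f1
   \<and> e1 ~= m \<and> e2 ~= m \<and> f2 ~= m \<and> f1 ~= m"
 using not_mid by metis

lemma level5: obtains "i = e1" | "i = e2" | "i \<in> mid" | "i = f2" | "i = f1"
 using level_cases[of i] by (auto simp: mid_def)

lemma UNIV_levels: "UNIV = insert e1 (insert e2 (insert f2 (insert f1 mid)))"
 using level_cases by (auto simp: mid_def)

lemma sum_levels: "sum g UNIV = g e1 + g e2 + sum g mid + g f2 + g f1" for g :: "'m => 'b::comm_monoid_add"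
 by (subst UNIV_levels) (simp add: ac_simps)

lemma opp_simps [simp]: "opp e1 = f1" "opp e2 = f2" "opp f2 = e2" "opp f1 = e1" "m \<in> mid ==> opp m = m"
 by (auto simp: opp_def)

lemma opp_opp [simp]: "opp (opp i) = i"
 by (cases rule: level5[of i]) auto

lemma opp_eq_iff: "opp i = j \<longleftrightarrow> i = opp j" by (metis opp_opp)

lemma J_mult: "(J ** g) $ i $ j = g $ opp i $ j"
 by (simp add: J_def matrix_matrix_mult_def if_distrib[of "\<lambda>x. x * _"] cong: if_cong)

lemma mult_J: "(g ** J) $ i $ j = g $ i $ opp j"
proof -
 have *: "(j = opp k) = (k = opp j)" for k by (metis opp_opp)
 show ?thesis
  by (simp add: J_def matrix_matrix_mult_def * if_distrib[of "\<lambda>x. _ * x"] cong: if_cong)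
qed

lemma J_vec: "(J *v v) $ i = v $ opp i"
 by (simp add: J_def matrix_vector_mult_def if_distrib[of "\<lambda>x. x * _"] cong: if_cong)

lemma transpose_J [simp]: "transpose J = J"
 by (auto simp: J_def transpose_def vec_eq_iff)

lemma J_J [simp]: "J ** J = mat 1"
 by (simp add: vec_eq_iff J_mult) (auto simp: J_def mat_def)

lemma J_Jv [simp]: "J *v (J *v v) = v"
 by (simp add: vec_eq_iff J_vec)

lemma J_J_assoc [simp]: "A ** J ** J = A"
 by (simp add: matrix_mul_assoc[symmetric])

text \<open>On the isometry group this is the inverse. It is linear in \<open>g\<close>, which makes
  norm bounds and continuity of inversion immediate.\<close>

definition jinv :: "'m sqmat => 'm sqmat" where "jinv g = J ** transpose g ** J"

lemma jinv_entry: "jinv g $ i $ j = g $ opp j $ opp i"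
 by (simp add: jinv_def mult_J J_mult transpose_def)

lemma jinv_left: "transpose g ** J ** g = J ==> jinv g ** g = mat 1"
 unfolding jinv_def by (metis J_J matrix_mul_assoc)

lemma jinv_right: "transpose g ** J ** g = J ==> g ** jinv g = mat 1"
 using jinv_left matrix_left_right_inverse by blast

lemma form_transpose: "transpose g ** J ** g = J ==> g ** J ** transpose g = J"
 using jinv_right[of g] unfolding jinv_def by (metis J_J_assoc matrix_mul_assoc matrix_mul_lid)

lemma SOJ_mult: "g \<in> SOJ ==> h \<in> SOJ ==> g ** h \<in> SOJ"
 unfolding SOJ_def by (auto simp: matrix_transpose_mul det_mul) (metis matrix_mul_assoc)

lemma SOJ_transpose: "g \<in> SOJ ==> transpose g \<in> SOJ"
 unfolding SOJ_def by (auto simp: form_transpose)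

lemma det_J_sq: "det J * det J = 1"
 using det_mul[of J J] by simp

lemma SOJ_jinv: "g \<in> SOJ ==> jinv g \<in> SOJ"
 unfolding SOJ_def jinv_def
 by (auto simp: det_mul matrix_transpose_mul det_J_sq) (metis J_J_assoc form_transpose matrix_mul_assoc)

lemma norm_jinv: "norm (jinv g) <= (real CARD('m))\<^sup>2 * norm g"
 by (rule norm_le_entries) (simp add: jinv_entry abs_entry_le_norm)

definition adiag :: "real => real => 'm => real" where
 "adiag a b i = (if i = e1 then a else if i = e2 then b else if i = f2 then inverse b
   else if i = f1 then inverse a else 1)"

definition dA :: "real => real => 'm sqmat" where
 "dA a b = (\<chi> i j. if i = j then adiag a b i else 0)"

lemma adiag_simps [simp]: "adiag a b e1 = a" "adiag a b e2 = b" "adiag a b f2 = inverse b"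
 "adiag a b f1 = inverse a" "m \<in> mid ==> adiag a b m = 1"
 by (auto simp: adiag_def)

lemma dA_mult: "(dA a b ** g) $ i $ j = adiag a b i * g $ i $ j"
 by (simp add: dA_def matrix_matrix_mult_def if_distrib[of "\<lambda>x. x * _"] cong: if_cong)

lemma mult_dA: "(g ** dA a b) $ i $ j = g $ i $ j * adiag a b j"
 by (simp add: dA_def matrix_matrix_mult_def if_distrib[of "\<lambda>x. _ * x"] cong: if_cong)

lemma adiag_mult: "adiag a b i * adiag c d i = adiag (a * c) (b * d) i"
 by (cases rule: level5[of i]) auto

lemma dA_dA: "dA a b ** dA c d = dA (a * c) (b * d)"
 by (auto simp: vec_eq_iff dA_mult adiag_mult) (auto simp: dA_def adiag_mult)

lemma dA_1 [simp]: "dA 1 1 = mat 1"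
 by (auto simp: vec_eq_iff dA_def mat_def adiag_def)

lemma dA_inverse: "a ~= 0 ==> b ~= 0 ==> dA a b ** dA (inverse a) (inverse b) = mat 1"
 "a ~= 0 ==> b ~= 0 ==> dA (inverse a) (inverse b) ** dA a b = mat 1"
 by (simp_all add: dA_dA)

lemma transpose_dA [simp]: "transpose (dA a b) = dA a b"
 by (auto simp: vec_eq_iff dA_def transpose_def)

lemma adiag_opp: "a ~= 0 ==> b ~= 0 ==> adiag a b i * adiag a b (opp i) = 1"
 by (cases rule: level5[of i]) auto

lemma prod_levels: "prod g UNIV = g e1 * g e2 * prod g mid * g f2 * g f1" for g :: "'m => 'b::comm_monoid_mult"
 by (subst UNIV_levels) (simp add: ac_simps)

lemma det_dA: "a ~= 0 ==> b ~= 0 ==> det (dA a b) = 1"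
 by (subst det_diagonal) (auto simp: dA_def prod_levels field_simps)

lemma dA_form: "a ~= 0 ==> b ~= 0 ==> transpose (dA a b) ** J ** dA a b = J"
 by (simp add: vec_eq_iff mult_dA dA_mult)
   (simp add: J_def adiag_opp)

lemma dA_SOJ: "a ~= 0 ==> b ~= 0 ==> dA a b \<in> SOJ"
 using dA_form det_dA unfolding SOJ_def by auto

section \<open>The maximal compact subgroup, O(2) x O(n) acting on the two eigenspaces of J\<close>

definition KJ :: "'m sqmat set" where "KJ = {k. transpose k ** k = mat 1 \<and> J ** k = k ** J}"

lemma KJ_right: "k \<in> KJ ==> k ** transpose k = mat 1"
 unfolding KJ_def using matrix_left_right_inverse by blast

lemma KJ_mult: "k \<in> KJ ==> l \<in> KJ ==> k ** l \<in> KJ"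
 unfolding KJ_def by (auto simp: matrix_transpose_mul) (metis matrix_mul_assoc matrix_mul_lid, metis matrix_mul_assoc)

lemma KJ_transpose: "k \<in> KJ ==> transpose k \<in> KJ"
 using KJ_right unfolding KJ_def by (auto) (metis transpose_J matrix_transpose_mul)

lemma KJ_form: "k \<in> KJ ==> transpose k ** J ** k = J"
 unfolding KJ_def by auto (metis matrix_mul_assoc matrix_mul_lid)

lemma KJ_1: "mat 1 \<in> KJ" unfolding KJ_def by (auto simp: transpose_mat)

lemma KJ_inner: "k \<in> KJ ==> (k *v x) \<bullet> (k *v y) = x \<bullet> y"
 unfolding KJ_def by (metis (mono_tags, lifting) dot_lmul_matrix matrix_vector_mul_assoc matrix_vector_mul_lid
   mem_Collect_eq transpose_matrix_vector)

lemma KJ_J: "k \<in> KJ ==> J *v (k *v x) = k *v (J *v x)"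
 unfolding KJ_def by (auto simp: matrix_vector_mul_assoc)

lemma KJ_norm: "k \<in> KJ ==> norm k <= (real CARD('m))\<^sup>2"
proof -
 assume k: "k \<in> KJ"
 have "\<bar>k $ i $ j\<bar> <= 1" for i j
 proof -
  have "\<bar>k $ i $ j\<bar> = \<bar>(k *v axis j 1) $ i\<bar>" by (simp add: matrix_vector_mult_basis column_def)
  also have "\<dots> <= norm (k *v axis j 1)" by (rule component_le_norm_cart)
  also have "\<dots> = 1" using KJ_inner[OF k, of "axis j 1" "axis j 1"] by (simp add: norm_eq_sqrt_inner)
  finally show ?thesis .
 qed
 from norm_le_entries[OF this] show ?thesis by simp
qed

lemma det_KJ: "k \<in> KJ ==> det k = 1 \<or> det k = -1"
proof -
 assume "k \<in> KJ"
 then have "det k * det k = 1" unfolding KJ_def by auto (metis det_I det_mul det_transpose)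
 then show ?thesis by (simp add: square_eq_1_iff)
qed

definition householder :: "'m vc => 'm sqmat" where
 "householder w = (\<chi> i j. (if i = j then 1 else 0) - 2 * w $ i * w $ j / (w \<bullet> w))"

lemma householder_vec: "householder w *v z = z - (2 * (w \<bullet> z) / (w \<bullet> w)) *\<^sub>R w"
proof -
 have "(\<Sum>j\<in>UNIV. ((if i = j then 1 else 0) - 2 * w $ i * w $ j / (w \<bullet> w)) * z $ j)
   = z $ i - (2 * (w \<bullet> z) / (w \<bullet> w)) * w $ i" for i
 proof -
  have "(\<Sum>j\<in>UNIV. ((if i = j then 1 else 0) - 2 * w $ i * w $ j / (w \<bullet> w)) * z $ j)
    = (\<Sum>j\<in>UNIV. (if i = j then z $ j else 0) - (2 * w $ i / (w \<bullet> w)) * (w $ j * z $ j))"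
   by (intro sum.cong refl) (simp add: algebra_simps)
  also have "\<dots> = z $ i - (2 * w $ i / (w \<bullet> w)) * (w \<bullet> z)"
   unfolding sum_subtractf sum_distrib_left[symmetric] by (simp add: inner_vec_def)
  finally show ?thesis by simp
 qed
 then show ?thesis by (simp add: vec_eq_iff householder_def matrix_vector_mult_def)
qed

text \<open>A reflection in an eigenvector of \<open>J\<close> preserves both eigenspaces of
  \<open>J\<close>. These reflections are the only source of nontrivial elements of
  \<open>KJ\<close> in the Cartan decomposition, apart from \<open>mid_flip\<close>.\<close>

lemma householder_KJ:
 assumes w: "w ~= 0" and Jw: "J *v w = sg *\<^sub>R w"
 shows "householder w \<in> KJ"
proof -
 have t: "transpose (householder w) = householder w"
  by (auto simp: householder_def transpose_def vec_eq_iff)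
 have 1: "householder w ** householder w = mat 1"
  unfolding matrix_eq
 proof
  fix z
  have "2 * (w \<bullet> (z - (2 * (w \<bullet> z) / (w \<bullet> w)) *\<^sub>R w)) / (w \<bullet> w) = - (2 * (w \<bullet> z) / (w \<bullet> w))"
   using w by (simp add: inner_diff_right)
  then show "(householder w ** householder w) *v z = mat 1 *v z"
   by (simp add: matrix_vector_mul_assoc[symmetric] householder_vec[of w])
 qed
 have sym: "w \<bullet> (J *v x) = (J *v w) \<bullet> x" for x
  by (metis dot_lmul_matrix transpose_J transpose_matrix_vector)
 have 2: "J ** householder w = householder w ** J"
  unfolding matrix_eq
  by (simp add: matrix_vector_mul_assoc[symmetric] householder_vec sym Jw
    matrix_vector_mult_diff_distrib scaleR_matrix_vector_assoc[symmetric] matrix_vector_mult_scaleR)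
 show ?thesis using t 1 2 by (simp add: KJ_def)
qed

text \<open>The reflection in \<open>u - v\<close> exchanges two unit vectors of one eigenspace and
  fixes what is orthogonal to both. Its determinant is -1, which is why \<open>KJ\<close> leaves the
  determinant open.\<close>

lemma KJ_transitive:
 assumes u: "norm u = 1" "J *v u = sg *\<^sub>R u" and v: "norm v = 1" "J *v v = sg *\<^sub>R v"
 obtains k where "k \<in> KJ" "k *v u = v" "\<And>z. z \<bullet> u = 0 ==> z \<bullet> v = 0 ==> k *v z = z"
proof (cases "u = v")
 case True
 then show ?thesis using that[of "mat 1"] KJ_1 by auto
next
 case False
 let ?w = "u - v"
 have "J *v ?w = sg *\<^sub>R ?w"
  using u v by (simp add: matrix_vector_mult_diff_distrib algebra_simps)
 then have "householder ?w \<in> KJ" using householder_KJ[of ?w sg] False by simp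
 moreover have "householder ?w *v u = v"
 proof -
  have uv: "u \<bullet> u = 1" "v \<bullet> v = 1" using u v by (auto simp: norm_eq_1)
  have "2 * (?w \<bullet> u) = ?w \<bullet> ?w" using uv by (simp add: inner_diff_left inner_diff_right inner_commute)
  moreover have "?w \<bullet> ?w ~= 0" using False by (simp only: inner_eq_zero_iff right_minus_eq not_False_eq_True)
  ultimately have one: "2 * (?w \<bullet> u) / (?w \<bullet> ?w) = 1" by (simp only: divide_self not_False_eq_True)
  show ?thesis unfolding householder_vec one by simp
 qed
 moreover have "householder ?w *v z = z" if "z \<bullet> u = 0" "z \<bullet> v = 0" for z
  unfolding householder_vec inner_diff_left using that by (simp add: inner_commute)
 ultimately show ?thesis using that by blast
qed

text \<open>
 With \<open>S = g\<^sup>T g\<close> one has \<open>S\<^sup>-\<^sup>1 = J S J\<close>. The matrix \<open>T = S + S\<^sup>-\<^sup>1\<close> commutes with \<open>J\<close>, so it is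
 diagonalizable on the plane where \<open>J = -1\<close>, and \<open>D = S - S\<^sup>-\<^sup>1\<close> maps the eigenvectors to
 orthogonal vectors in the space where \<open>J = 1\<close>.
\<close>

definition em :: "'m => 'm vc" where "em i = (1 / sqrt 2) *\<^sub>R (axis i 1 - axis (opp i) 1)"
definition ep :: "'m => 'm vc" where "ep i = (1 / sqrt 2) *\<^sub>R (axis i 1 + axis (opp i) 1)"

lemma J_axis: "J *v axis i 1 = axis (opp i) 1"
 by (simp add: vec_eq_iff J_vec axis_def opp_eq_iff)

lemma J_em: "J *v em i = - em i" and J_ep: "J *v ep i = ep i"
 unfolding em_def ep_def
 by (simp_all add: matrix_vector_mult_scaleR matrix_vector_mult_diff_distrib matrix_vector_right_distrib J_axis
   add.commute algebra_simps)

lemma inner_axis2: "(axis i 1 :: 'm vc) \<bullet> axis j 1 = (if i = j then 1 else 0)"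
 unfolding inner_axis by (simp add: axis_def)

lemma mv_minus: "A *v (- x) = - (A *v x)" for A :: "'m sqmat"
 by (metis matrix_vector_mult_scaleR scaleR_minus1_left)

lemma matrix_add_rdist: "(A + B) ** C = A ** C + B ** C" for A B C :: "'m sqmat"
 by (simp add: matrix_matrix_mult_def vec_eq_iff sum.distrib algebra_simps)

lemma half_sqrt: "1 / sqrt 2 * (1 / sqrt 2) = (1/2::real)" by simp

lemma em_ep_inner:
 "em e1 \<bullet> em e1 = 1" "em e2 \<bullet> em e2 = 1" "em e1 \<bullet> em e2 = 0"
 "ep e1 \<bullet> ep e1 = 1" "ep e2 \<bullet> ep e2 = 1" "ep e1 \<bullet> ep e2 = 0"
 by (simp_all add: em_def ep_def inner_diff_left inner_diff_right inner_add_left inner_add_right inner_axis2)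

lemma axis_em_ep:
 "axis e1 1 = (1 / sqrt 2) *\<^sub>R (em e1 + ep e1)" "axis f1 1 = (1 / sqrt 2) *\<^sub>R (ep e1 - em e1)"
 "axis e2 1 = (1 / sqrt 2) *\<^sub>R (em e2 + ep e2)" "axis f2 1 = (1 / sqrt 2) *\<^sub>R (ep e2 - em e2)"
proof -
 have *: "(1 / sqrt 2) *\<^sub>R ((1 / sqrt 2) *\<^sub>R (x - y) + (1 / sqrt 2) *\<^sub>R (x + y)) = x"
    "(1 / sqrt 2) *\<^sub>R ((1 / sqrt 2) *\<^sub>R (x + y) - (1 / sqrt 2) *\<^sub>R (x - y)) = y" for x y :: "'m vc"
  unfolding scaleR_right_distrib[symmetric] scaleR_right_diff_distrib[symmetric] scaleR_scaleR half_sqrt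
  by (simp_all add: vec_eq_iff)
 show "axis e1 1 = (1 / sqrt 2) *\<^sub>R (em e1 + ep e1)" "axis f1 1 = (1 / sqrt 2) *\<^sub>R (ep e1 - em e1)"
 "axis e2 1 = (1 / sqrt 2) *\<^sub>R (em e2 + ep e2)" "axis f2 1 = (1 / sqrt 2) *\<^sub>R (ep e2 - em e2)"
  unfolding em_def ep_def by (simp_all only: * opp_simps)
qed

lemma em_expand: "J *v v = - v ==> v = (v \<bullet> em e1) *\<^sub>R em e1 + (v \<bullet> em e2) *\<^sub>R em e2"
proof -
 assume "J *v v = - v"
 then have v: "v $ opp i = - v $ i" for i by (metis J_vec vector_uminus_component)
 have v': "v $ f1 = - v $ e1" "v $ f2 = - v $ e2" using v[of e1] v[of e2] by simp_all
 have m: "v $ m = 0" if "m \<in> mid" for m using v[of m] that by simp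
 have "v $ i = ((v \<bullet> em e1) *\<^sub>R em e1 + (v \<bullet> em e2) *\<^sub>R em e2) $ i" for i
  using m mid_neq[of i]
  by (cases rule: level5[of i])
   (simp_all add: em_def inner_diff_right inner_axis v', simp_all add: axis_def v')
 then show ?thesis by (simp add: vec_eq_iff)
qed

lemma inner_transpose: "x \<bullet> (A *v y) = (transpose A *v x) \<bullet> y" for A :: "'m sqmat"
 by (simp add: dot_lmul_matrix)

text \<open>The spectral theorem on the plane where \<open>J = -1\<close>: a maximizer of the
  Rayleigh quotient on the unit circle is an eigenvector. The matrix \<open>k\<close> is made to fix
  the other eigenspace, so that it does not disturb the frame chosen there later.\<close>

lemma em_eigen:
 fixes T :: "'m sqmat"
 assumes sym: "transpose T = T" and com: "J ** T = T ** J"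
 obtains k c1 c2 where "k \<in> KJ" "c1 >= c2" "\<And>z. J *v z = z ==> k *v z = z"
  "T *v (k *v em e1) = c1 *\<^sub>R (k *v em e1)" "T *v (k *v em e2) = c2 *\<^sub>R (k *v em e2)"
proof -
 have Tsym: "x \<bullet> (T *v y) = (T *v x) \<bullet> y" for x y using inner_transpose[of x T y] sym by simp
 have TJ: "J *v (T *v x) = T *v (J *v x)" for x using com by (simp add: matrix_vector_mul_assoc)
 define F where "F = {v :: 'm vc. norm v = 1 \<and> J *v v = - v}"
 have "compact F"
 proof -
  have "F = sphere 0 1 \<inter> {v. J *v v = - v}" by (auto simp: F_def)
  moreover have "closed {v. J *v v = - v}"
   by (intro closed_Collect_eq continuous_intros matrix_vector_mult_linear_continuous_on)
  ultimately show ?thesis by (simp add: compact_Int_closed)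
 qed
 moreover have "F ~= {}" using J_em[of e1] em_ep_inner(1) by (auto simp: F_def norm_eq_1)
 moreover have "continuous_on F (\<lambda>v. v \<bullet> (T *v v))"
  by (intro continuous_intros matrix_vector_mult_linear_continuous_on)
 ultimately obtain u where u: "u \<in> F" and umax: "\<And>v. v \<in> F ==> v \<bullet> (T *v v) <= u \<bullet> (T *v u)"
  using continuous_attains_sup by metis
 define c1 where "c1 = u \<bullet> (T *v u)"
 have u1: "norm u = 1" "u \<bullet> u = 1" "J *v u = - u" using u by (auto simp: F_def norm_eq_1)
 have *: "norm (em e1) = 1" "J *v em e1 = (-1) *\<^sub>R em e1" "J *v u = (-1) *\<^sub>R u"
  using em_ep_inner u1 by (simp_all add: norm_eq_1 J_em)
 obtain k where k: "k \<in> KJ" "k *v em e1 = u" "\<And>z. z \<bullet> em e1 = 0 ==> z \<bullet> u = 0 ==> k *v z = z"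
  using KJ_transitive[OF *(1,2) u1(1) *(3)] by metis
 have kid: "k *v z = z" if "J *v z = z" for z
 proof (rule k(3))
  have "z \<bullet> w = 0" if w: "J *v w = - w" for w
  proof -
   have "z \<bullet> w = (J *v z) \<bullet> w" using \<open>J *v z = z\<close> by simp
   also have "\<dots> = z \<bullet> (J *v w)" using inner_transpose[of z J w] by simp
   finally show ?thesis using w by simp
  qed
  then show "z \<bullet> em e1 = 0" "z \<bullet> u = 0" using J_em u1 by auto
 qed
 define v where "v = k *v em e2"
 have v1: "v \<bullet> v = 1" "u \<bullet> v = 0" "J *v v = - v"
  using em_ep_inner by (simp_all add: v_def k(2)[symmetric] KJ_inner[OF k(1)] KJ_J[OF k(1)] J_em mv_minus)
 have expand: "w = (w \<bullet> u) *\<^sub>R u + (w \<bullet> v) *\<^sub>R v" if w: "J *v w = - w" for w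
 proof -
  let ?w = "transpose k *v w"
  have kt: "k *v (transpose k *v x) = x" for x
   using KJ_right[OF k(1)] by (metis matrix_vector_mul_assoc matrix_vector_mul_lid)
  have "J *v ?w = - ?w" using KJ_J[OF KJ_transpose[OF k(1)]] w mv_minus by metis
  from em_expand[OF this] have "k *v ?w = k *v ((?w \<bullet> em e1) *\<^sub>R em e1 + (?w \<bullet> em e2) *\<^sub>R em e2)" by metis
  moreover have "?w \<bullet> x = w \<bullet> (k *v x)" for x by (metis KJ_inner k(1) kt)
  ultimately show ?thesis
   by (simp add: kt matrix_vector_right_distrib matrix_vector_mult_scaleR k(2) v_def[symmetric]
     del: transpose_matrix_vector)
 qed
 define b c2 where "b = v \<bullet> (T *v u)" and "c2 = v \<bullet> (T *v v)"
 \<comment> \<open>The maximal value \<open>c1\<close> is compared with the value at the normalized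
   vector \<open>u + t *\<^sub>R v\<close>.\<close>
 have max: "2 * b * t <= (c1 - c2) * t\<^sup>2" for t
 proof -
  let ?w = "u + t *\<^sub>R v" let ?r = "norm ?w"
  have n: "?r\<^sup>2 = 1 + t\<^sup>2" unfolding power2_norm_eq_inner using u1(2) v1
   by (simp add: inner_add_left inner_add_right inner_commute[of v u] power2_eq_square)
  then have r0: "?r ~= 0" by (metis add.commute add_nonneg_eq_0_iff norm_eq_zero one_neq_zero power2_eq_square zero_le_power2 zero_le_one mult_zero_left)
  have "norm ((1 / ?r) *\<^sub>R ?w) = 1" using r0 by simp
  moreover have "J *v ((1 / ?r) *\<^sub>R ?w) = - ((1 / ?r) *\<^sub>R ?w)" using u1 v1
   by (simp add: matrix_vector_mult_scaleR matrix_vector_right_distrib algebra_simps)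
  ultimately have "(1 / ?r) *\<^sub>R ?w \<in> F" unfolding F_def by blast
  then have "((1 / ?r) *\<^sub>R ?w) \<bullet> (T *v ((1 / ?r) *\<^sub>R ?w)) <= c1" unfolding c1_def by (rule umax)
  then have "?w \<bullet> (T *v ?w) / ?r\<^sup>2 <= c1"
   by (simp add: matrix_vector_mult_scaleR power2_eq_square)
  then have "?w \<bullet> (T *v ?w) <= c1 * (1 + t\<^sup>2)" using n by (simp add: pos_divide_le_eq add_pos_nonneg)
  moreover have "u \<bullet> (T *v v) = b" unfolding b_def using Tsym[of u v] by (simp add: inner_commute)
  ultimately show ?thesis
   by (simp add: c1_def[symmetric] b_def[symmetric] c2_def[symmetric] inner_add_left inner_add_right
     matrix_vector_right_distrib matrix_vector_mult_scaleR power2_eq_square algebra_simps)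
 qed
 have c12: "c2 <= c1" using max[of 1] max[of "-1"] by simp
 \<comment> \<open>If \<open>b\<close> were nonzero, the linear term would beat the quadratic one at
   \<open>t = b / (c1 - c2 + 1)\<close>.\<close>
 have b0: "b = 0"
 proof (rule ccontr)
  assume "b ~= 0"
  define q where "q = c1 - c2 + 1"
  have q: "q > 0" using c12 by (simp add: q_def)
  define r where "r = b / q"
  have r: "b = r * q" "r ~= 0" using q \<open>b ~= 0\<close> by (auto simp: r_def)
  have "2 * b * r <= (q - 1) * r\<^sup>2" using max[of r] by (simp add: q_def)
  then have "(2 * q) * r\<^sup>2 <= (q - 1) * r\<^sup>2" unfolding r(1) by (simp add: power2_eq_square mult_ac)
  then have "2 * q <= q - 1" using r(2) by (simp add: mult_le_cancel_right)
  then show False using q by simp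
 qed
 have "T *v u = c1 *\<^sub>R u"
  using expand[of "T *v u"] TJ[of u] u1 b0 by (simp add: c1_def b_def inner_commute mv_minus)
 moreover have "T *v v = c2 *\<^sub>R v"
 proof -
  have "(T *v v) \<bullet> u = 0" using b0 Tsym[of v u] by (simp add: b_def)
  then show ?thesis using expand[of "T *v v"] TJ[of v] v1 by (simp add: c2_def inner_commute mv_minus)
 qed
 ultimately show ?thesis using that[OF k(1) c12 kid] k(2) v_def by metis
qed

text \<open>Two successive reflections. The second vector is first pulled back by the first
  reflection; it is then orthogonal to \<open>ep e1\<close>, so the second reflection leaves
  \<open>ep e1\<close> alone. The vectors may be zero, and then their directions are free.\<close>

lemma ep_frame:
 assumes z: "J *v z1 = z1" "J *v z2 = z2" "z1 \<bullet> z2 = 0"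
 obtains k where "k \<in> KJ" "\<And>v. J *v v = - v ==> k *v v = v"
  "z1 = norm z1 *\<^sub>R (k *v ep e1)" "z2 = norm z2 *\<^sub>R (k *v ep e2)"
proof -
 have orth: "x \<bullet> y = 0" if "J *v x = - x" "J *v y = y" for x y
 proof -
  have "x \<bullet> y = x \<bullet> (J *v y)" using that by simp
  also have "\<dots> = (J *v x) \<bullet> y" using inner_transpose[of x J y] by simp
  finally show ?thesis using that by simp
 qed
 have ep1: "norm (ep i) = 1" "J *v ep i = 1 *\<^sub>R ep i" if "i = e1 \<or> i = e2" for i
  using that em_ep_inner by (auto simp: norm_eq_1 J_ep)
 have move: "\<exists>k\<in>KJ. z = norm z *\<^sub>R (k *v ep i) \<and> (\<forall>v. J *v v = - v \<longrightarrow> k *v v = v)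
   \<and> (\<forall>v. v \<bullet> ep i = 0 \<longrightarrow> v \<bullet> z = 0 \<longrightarrow> k *v v = v)" if "J *v z = z" and i: "i = e1 \<or> i = e2" for z i
 proof (cases "z = 0")
  case True
  then show ?thesis using KJ_1 by (auto intro!: bexI[of _ "mat 1"])
 next
  case False
  let ?z = "(1 / norm z) *\<^sub>R z"
  have z: "norm ?z = 1" "J *v ?z = 1 *\<^sub>R ?z"
   using False that by (simp_all add: matrix_vector_mult_scaleR)
  from KJ_transitive[OF ep1[OF i] this] obtain k where k: "k \<in> KJ" "k *v ep i = ?z"
   "\<And>v. v \<bullet> ep i = 0 ==> v \<bullet> ?z = 0 ==> k *v v = v" by metis
  have "k *v v = v" if "J *v v = - v" for v
  proof (rule k(3))
   show "v \<bullet> ep i = 0" "v \<bullet> ?z = 0" using orth[OF that] J_ep[of i] z(2) by (metis scaleR_one)+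
  qed
  then show ?thesis using k False by (auto intro!: bexI[of _ k])
 qed
 obtain ka where ka: "ka \<in> KJ" "z1 = norm z1 *\<^sub>R (ka *v ep e1)" "\<And>v. J *v v = - v ==> ka *v v = v"
  using move[OF z(1), of e1] by auto
 show ?thesis
 proof (cases "z1 = 0")
  case True
  then show ?thesis using move[OF z(2), of e2] that by auto
 next
  case False
  let ?y = "transpose ka *v z2"
  have kt: "ka *v (transpose ka *v x) = x" for x
   using KJ_right[OF ka(1)] by (metis matrix_vector_mul_assoc matrix_vector_mul_lid)
  have ny: "norm ?y = norm z2"
   using KJ_inner[OF KJ_transpose[OF ka(1)]] by (simp add: norm_eq_sqrt_inner)
  have "ep e1 \<bullet> ?y = (ka *v ep e1) \<bullet> z2" by (metis KJ_inner ka(1) kt)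
  also have "\<dots> = 0"
  proof -
   have "z1 \<bullet> z2 = norm z1 * ((ka *v ep e1) \<bullet> z2)" by (subst ka(2)) simp
   then show ?thesis using z(3) False by simp
  qed
  finally have y0: "ep e1 \<bullet> ?y = 0" .
  have "J *v ?y = ?y" using KJ_J[OF KJ_transpose[OF ka(1)]] z by metis
  from move[OF this, of e2] obtain kb where kb: "kb \<in> KJ" "?y = norm ?y *\<^sub>R (kb *v ep e2)"
   "\<And>v. J *v v = - v ==> kb *v v = v" "\<And>v. v \<bullet> ep e2 = 0 ==> v \<bullet> ?y = 0 ==> kb *v v = v"
   by auto
  have "kb *v ep e1 = ep e1" using kb(4) em_ep_inner y0 by auto
  then have 1: "z1 = norm z1 *\<^sub>R ((ka ** kb) *v ep e1)" using ka(2) by (simp add: matrix_vector_mul_assoc[symmetric])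
  have "z2 = ka *v (norm z2 *\<^sub>R (kb *v ep e2))" using kb(2) kt ny by metis
  then have 2: "z2 = norm z2 *\<^sub>R ((ka ** kb) *v ep e2)"
   by (simp add: matrix_vector_mul_assoc[symmetric] matrix_vector_mult_scaleR)
  show ?thesis using that[of "ka ** kb"] 1 2 KJ_mult[OF ka(1) kb(1)] ka(3) kb(3)
   by (simp add: matrix_vector_mul_assoc[symmetric])
 qed
qed

text \<open>An element of \<open>KJ\<close> of determinant -1 that commutes with the torus; it
  repairs the determinant of a frame without changing what the frame diagonalizes.\<close>

definition mid_flip :: "'m sqmat" where
 "mid_flip = (let m = (SOME m. m \<in> mid) in (\<chi> i j. if i = j then (if i = m then -1 else 1) else 0))"

lemma mid_flip: "mid_flip \<in> KJ" "det mid_flip = -1" "dA a b ** mid_flip = mid_flip ** dA a b"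
proof -
 define m where "m = (SOME m. m \<in> mid)"
 have m: "m \<in> mid" unfolding m_def by (rule someI_ex) (use ex_mid in \<open>auto simp: mid_def\<close>)
 have eq: "mid_flip = (\<chi> i j. if i = j then (if i = m then -1 else 1) else 0)"
  unfolding mid_flip_def m_def Let_def ..
 have mm: "(mid_flip ** A) $ i $ j = (if i = m then -1 else 1) * A $ i $ j" for A i j
  by (simp add: eq matrix_matrix_mult_def if_distrib[of "\<lambda>x. x * _"] cong: if_cong)
 have mm': "(A ** mid_flip) $ i $ j = A $ i $ j * (if j = m then -1 else 1)" for A i j
  by (simp add: eq matrix_matrix_mult_def if_distrib[of "\<lambda>x. _ * x"] cong: if_cong)
 have t: "transpose mid_flip = mid_flip" by (auto simp: eq transpose_def vec_eq_iff)
 have o: "opp i = m \<longleftrightarrow> i = m" for i using m by (simp add: opp_eq_iff)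
 show "mid_flip \<in> KJ"
  unfolding KJ_def by (auto simp: t vec_eq_iff mm mm' J_mult mult_J o) (auto simp: eq mat_def o opp_eq_iff m)
 have "det mid_flip = (\<Prod>i\<in>UNIV. if i = m then -1 else 1)"
  by (subst det_diagonal) (auto simp: eq)
 then show "det mid_flip = -1" by simp
 show "dA a b ** mid_flip = mid_flip ** dA a b"
  by (auto simp: vec_eq_iff mm mm' ) (auto simp: dA_def)
qed

text \<open>Polar decomposition with a frame adapted to \<open>J\<close>. Once \<open>S\<close> is
  diagonalized by \<open>k'\<close> in the compact group, with eigenvalues that are the squares of
  the entries of \<open>dA a b\<close>, the matrix
  \<open>g ** k' ** dA (inverse a) (inverse b)\<close> is orthogonal; as it also preserves the form,
  it lies in the compact group.\<close>

theorem cartan_decomposition: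
 assumes g: "g \<in> SOJ"
 obtains k l a b where "k \<in> KJ \<inter> SOJ" "l \<in> KJ \<inter> SOJ" "1 <= b" "b <= a" "g = k ** dA a b ** l"
proof -
 have gJ: "transpose g ** J ** g = J" and dg: "det g = 1" using g by (auto simp: SOJ_def)
 define S where "S = transpose g ** g"
 define S' where "S' = J ** S ** J"
 have Ssym: "transpose S = S" by (simp add: S_def matrix_transpose_mul)
 have S'sym: "transpose S' = S'" by (simp add: S'_def matrix_transpose_mul Ssym matrix_mul_assoc)
 have "S ** J ** S = J" unfolding S_def
  using gJ form_transpose[OF gJ] by (metis matrix_mul_assoc)
 then have SS': "S ** S' = mat 1" unfolding S'_def by (metis J_J matrix_mul_assoc)
 then have S'S: "S' ** S = mat 1" using matrix_left_right_inverse by blast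
 have JSJ: "J ** S = S' ** J" "J ** S' = S ** J"
  unfolding S'_def by (simp_all add: matrix_mul_assoc)
 have v: "S *v (S' *v x) = x" "S' *v (S *v x) = x" "J *v (S *v x) = S' *v (J *v x)"
   "J *v (S' *v x) = S *v (J *v x)" for x
  using SS' S'S JSJ by (metis matrix_vector_mul_assoc matrix_vector_mul_lid)+
 have Spos: "x \<bullet> (S *v x) >= 0" for x
 proof -
  have "x \<bullet> (S *v x) = (g *v x) \<bullet> (g *v x)"
   using inner_transpose[of x "transpose g" "g *v x"]
   by (simp add: S_def matrix_vector_mul_assoc[symmetric] del: transpose_matrix_vector)
  then show ?thesis by simp
 qed
 \<comment> \<open>The square of \<open>S\<close> fixes \<open>x\<close>, and positivity excludes
   the eigenvalue -1 of \<open>S\<close>.\<close>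
 have fix_S: "S *v x = x" if "S *v x = S' *v x" for x
 proof -
  have 2: "S *v (S *v x) = x" using that v(1)[of x] by simp
  let ?z = "S *v x - x"
  have "S *v ?z = - ?z" using 2 by (simp add: matrix_vector_mult_diff_distrib)
  then have "0 <= ?z \<bullet> (- ?z)" using Spos[of ?z] by metis
  then have "?z \<bullet> ?z <= 0" by (simp only: inner_minus_right)
  then have "?z = 0" by (metis inner_eq_zero_iff inner_ge_zero order_antisym)
  then show ?thesis by simp
 qed
 have symS: "x \<bullet> (S *v y) = (S *v x) \<bullet> y" "x \<bullet> (S' *v y) = (S' *v x) \<bullet> y" for x y
  using inner_transpose[of x S y] inner_transpose[of x S' y] Ssym S'sym by simp_all
 define T where "T = S + S'"
 have Tv: "T *v x = S *v x + S' *v x" for x by (simp add: T_def matrix_vector_mult_add_rdistrib)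
 have "transpose T = T" using Ssym S'sym by (simp add: T_def transpose_def vec_eq_iff)
 moreover have "J ** T = T ** J" by (simp add: T_def matrix_add_ldistrib matrix_add_rdist JSJ add.commute)
 ultimately obtain k1 c1 c2 where k1: "k1 \<in> KJ" "c2 <= c1" "\<And>z. J *v z = z ==> k1 *v z = z"
  "T *v (k1 *v em e1) = c1 *\<^sub>R (k1 *v em e1)" "T *v (k1 *v em e2) = c2 *\<^sub>R (k1 *v em e2)"
  using em_eigen[of T] by metis
 define u where "u i = k1 *v em i" for i
 define c where "c i = (if i = e1 then c1 else c2)" for i
 define D where "D x = S *v x - S' *v x" for x
 have u: "T *v u i = c i *\<^sub>R u i" "J *v u i = - u i" "u i \<bullet> u i = 1" if "i = e1 \<or> i = e2" for i
  using that k1 em_ep_inner by (auto simp: u_def c_def KJ_J J_em mv_minus KJ_inner)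
 have u12: "u e1 \<bullet> u e2 = 0" using em_ep_inner by (simp add: u_def KJ_inner k1)
 have JD: "J *v D (u i) = D (u i)" if "i = e1 \<or> i = e2" for i
  using u(2)[OF that] by (simp add: D_def matrix_vector_mult_diff_distrib v mv_minus)
 \<comment> \<open>The identity \<open>D^2 = T^2 - 4\<close>, tested on vectors. It makes
   \<open>D\<close> send orthogonal eigenvectors of \<open>T\<close> to orthogonal vectors.\<close>
 have DD: "D x \<bullet> D y = (T *v x) \<bullet> (T *v y) - 4 * (x \<bullet> y)" for x y
 proof -
  have "(S *v x) \<bullet> (S' *v y) = x \<bullet> y" "(S' *v x) \<bullet> (S *v y) = x \<bullet> y"
   using symS[of x] v by metis+
  then show ?thesis unfolding D_def Tv by (simp add: inner_diff_left inner_diff_right inner_add_left inner_add_right)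
 qed
 have Dsym: "x \<bullet> D y = D x \<bullet> y" for x y
  unfolding D_def by (simp add: inner_diff_left inner_diff_right symS)
 have TD: "T *v D x = D (T *v x)" for x
  unfolding D_def Tv by (simp add: v(1,2) matrix_vector_right_distrib matrix_vector_mult_diff_distrib)
 have "D (u e1) \<bullet> D (u e2) = 0" using u12 by (simp add: DD u)
 from ep_frame[OF JD JD this] obtain k2 where k2: "k2 \<in> KJ" "\<And>v. J *v v = - v ==> k2 *v v = v"
  "D (u e1) = norm (D (u e1)) *\<^sub>R (k2 *v ep e1)" "D (u e2) = norm (D (u e2)) *\<^sub>R (k2 *v ep e2)"
  by auto
 define k where "k = k2 ** k1"
 define w where "w i = k2 *v ep i" for i
 define d where "d i = norm (D (u i))" for i
 have Du: "D (u i) = d i *\<^sub>R w i" if "i = e1 \<or> i = e2" for i using that k2 by (auto simp: d_def w_def)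
 have k: "k \<in> KJ" unfolding k_def by (rule KJ_mult[OF k2(1) k1(1)])
 have kem: "k *v em i = u i" if "i = e1 \<or> i = e2" for i
  using k2(2) u(2)[OF that] by (simp add: k_def u_def matrix_vector_mul_assoc[symmetric])
 have kep: "k *v ep i = w i" for i
  using k1(3)[OF J_ep] by (simp add: k_def w_def matrix_vector_mul_assoc[symmetric])
 have d2: "(d i)\<^sup>2 = (c i)\<^sup>2 - 4" if "i = e1 \<or> i = e2" for i
  using DD[of "u i" "u i"] u[OF that] by (simp add: d_def power2_norm_eq_inner) (simp add: power2_eq_square)
 have c0: "c i >= 0" if "i = e1 \<or> i = e2" for i
 proof -
  have "c i = u i \<bullet> (T *v u i)" using u[OF that] by simp
  also have "\<dots> = u i \<bullet> (S *v u i) + (S' *v u i) \<bullet> (S *v (S' *v u i))"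
   by (simp add: Tv inner_add_right v(1) symS(2)[symmetric] inner_commute)
  finally show ?thesis using Spos[of "u i"] Spos[of "S' *v u i"] by simp
 qed
 have c2': "c i >= 2" if "i = e1 \<or> i = e2" for i
 proof -
  have "(c i)\<^sup>2 >= 2\<^sup>2" using d2[OF that] zero_le_power2[of "d i"] unfolding power2_eq_square by linarith
  then show ?thesis using c0[OF that] by (rule power2_le_imp_le)
 qed
 \<comment> \<open>\<open>D\<close> maps the space where \<open>J = 1\<close> into the plane where
   \<open>J = -1\<close>, which is spanned by \<open>u e1\<close> and \<open>u e2\<close>; the
   symmetry of \<open>D\<close> turns the hypotheses into orthogonality to both.\<close>
 have D_pos: "D x = 0" if "J *v x = x" "x \<bullet> D (u e1) = 0" "x \<bullet> D (u e2) = 0" for x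
 proof -
  let ?y = "transpose k1 *v D x"
  have "J *v D x = - D x" using that(1) by (simp add: D_def matrix_vector_mult_diff_distrib v)
  then have "J *v ?y = - ?y" using KJ_J[OF KJ_transpose[OF k1(1)]] mv_minus by metis
  moreover have "?y \<bullet> em i = 0" if "i = e1 \<or> i = e2" for i
  proof -
   have "?y \<bullet> em i = (k1 *v ?y) \<bullet> u i" by (simp add: u_def KJ_inner k1 del: transpose_matrix_vector)
   also have "k1 *v ?y = D x"
    using KJ_right[OF k1(1)] by (metis matrix_vector_mul_assoc matrix_vector_mul_lid)
   finally show ?thesis using Dsym[of x "u i"] that \<open>x \<bullet> D (u e1) = 0\<close> \<open>x \<bullet> D (u e2) = 0\<close> by auto
  qed
  ultimately have "?y = 0" using em_expand[of ?y] by simp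
  then have "k1 *v ?y = 0" by simp
  moreover have "k1 *v ?y = D x"
   using KJ_right[OF k1(1)] by (metis matrix_vector_mul_assoc matrix_vector_mul_lid)
  ultimately show ?thesis by simp
 qed
 have w: "J *v w i = w i" for i using KJ_J[OF k2(1)] J_ep by (simp add: w_def)
 have ww: "w e1 \<bullet> w e2 = 0" using em_ep_inner by (simp add: w_def KJ_inner k2)
 have Sx: "2 *\<^sub>R (S *v x) = T *v x + D x" for x by (simp add: Tv D_def scaleR_2)
 have TDw: "T *v w i = c i *\<^sub>R w i \<and> D (w i) = d i *\<^sub>R u i" if i: "i = e1 \<or> i = e2" for i
 proof (cases "d i = 0")
  \<comment> \<open>Here \<open>D (u i) = 0\<close>, so \<open>w i\<close> is just some vector of
    the frame; it is fixed by \<open>S\<close> because \<open>D\<close> vanishes on it as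
    well.\<close>
  case True
  then have "c i = 2" using d2[OF i] c0[OF i] by (simp add: power2_eq_iff_nonneg[of "c i" 2, simplified])
  have "w i \<bullet> D (u e1) = 0 \<and> w i \<bullet> D (u e2) = 0" using i True ww Du by (auto simp: inner_commute)
  then have D0: "D (w i) = 0" using D_pos[OF w] by blast
  then have "S *v w i = S' *v w i" by (simp add: D_def)
  from fix_S[OF this] have "T *v w i = 2 *\<^sub>R w i" using Sx[of "w i"] D0 by simp
  then show ?thesis using D0 True \<open>c i = 2\<close> by simp
 next
  case False
  have wi: "w i = (1 / d i) *\<^sub>R D (u i)" using Du[OF i] False by simp
  have Dsc: "D (a *\<^sub>R x) = a *\<^sub>R D x" for a x by (simp add: D_def matrix_vector_mult_scaleR algebra_simps)
  have "T *v w i = c i *\<^sub>R w i"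
   unfolding wi by (simp add: matrix_vector_mult_scaleR TD u[OF i] Dsc)
  moreover have "D (w i) = d i *\<^sub>R u i"
  proof -
   have DDx: "D (D x) = T *v (T *v x) - 4 *\<^sub>R x" for x
    unfolding D_def Tv by (simp add: matrix_vector_right_distrib matrix_vector_mult_diff_distrib v algebra_simps)
     (simp add: vec_eq_iff)
   have "D (D (u i)) = c i *\<^sub>R (c i *\<^sub>R u i) - 4 *\<^sub>R u i"
    unfolding DDx by (simp add: u[OF i] matrix_vector_mult_scaleR)
   also have "\<dots> = (d i)\<^sup>2 *\<^sub>R u i" unfolding d2[OF i] by (simp add: scaleR_left_diff_distrib power2_eq_square)
   finally have "D (D (u i)) = (d i)\<^sup>2 *\<^sub>R u i" .
   then show ?thesis unfolding wi Dsc using False by (simp add: power2_eq_square)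
  qed
  ultimately show ?thesis ..
 qed
 \<comment> \<open>\<open>S\<close> has the eigenvalue \<open>lam\<close> on
   \<open>u i + w i\<close> and its inverse on \<open>w i - u i\<close>; thus \<open>c\<close> is
   their sum and \<open>d\<close> their difference.\<close>
 define lam where "lam i = (c i + d i) / 2" for i
 have d0: "d i >= 0" for i by (simp add: d_def)
 have lam1: "lam i >= 1" and lam_inv: "(c i - d i) / 2 = inverse (lam i)" if "i = e1 \<or> i = e2" for i
 proof -
  show "lam i >= 1" using c2'[OF that] d0[of i] by (simp add: lam_def)
  have "(c i - d i) / 2 * lam i = 1" using d2[OF that] by (simp add: lam_def field_simps power2_eq_square)
  then show "(c i - d i) / 2 = inverse (lam i)" by (metis inverse_unique mult.commute)
 qed
 have lam12: "lam e2 <= lam e1"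
 proof -
  have "c e2 <= c e1" using k1(2) by (simp add: c_def)
  moreover have "d e2 <= d e1"
  proof (rule power2_le_imp_le)
   show "(d e2)\<^sup>2 <= (d e1)\<^sup>2" using d2[of e1] d2[of e2] power_mono[OF \<open>c e2 <= c e1\<close>, of 2] c0[of e2] by simp
  qed (rule d0)
  ultimately show ?thesis by (simp add: lam_def)
 qed
 have Suw: "S *v (u i + w i) = lam i *\<^sub>R (u i + w i)" "S *v (w i - u i) = inverse (lam i) *\<^sub>R (w i - u i)"
  if i: "i = e1 \<or> i = e2" for i
 proof -
  have Dadd: "D (x + y) = D x + D y" "D (x - y) = D x - D y" for x y
   by (simp_all add: D_def matrix_vector_right_distrib matrix_vector_mult_diff_distrib)
  have "2 *\<^sub>R (S *v (u i + w i)) = (c i + d i) *\<^sub>R (u i + w i)"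
   unfolding Sx Dadd by (simp add: matrix_vector_right_distrib u[OF i] TDw[OF i] Du[OF i] algebra_simps)
  also have "\<dots> = 2 *\<^sub>R (lam i *\<^sub>R (u i + w i))" by (simp add: lam_def del: scaleR_right_distrib)
  finally show "S *v (u i + w i) = lam i *\<^sub>R (u i + w i)" by (subst (asm) scaleR_cancel_left) simp
  have "2 *\<^sub>R (S *v (w i - u i)) = (c i - d i) *\<^sub>R (w i - u i)"
   unfolding Sx Dadd by (simp add: matrix_vector_mult_diff_distrib u[OF i] TDw[OF i] Du[OF i] algebra_simps)
  also have "\<dots> = 2 *\<^sub>R (((c i - d i) / 2) *\<^sub>R (w i - u i))" by simp
  finally show "S *v (w i - u i) = inverse (lam i) *\<^sub>R (w i - u i)"
   by (subst (asm) scaleR_cancel_left) (simp add: lam_inv[OF i])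
 qed
 have Smid: "S *v (k *v axis m 1) = k *v axis m 1" if m: "m \<in> mid" for m
 proof -
  have J1: "J *v axis m 1 = axis m 1" using m by (simp add: J_axis)
  then have "J *v (k *v axis m 1) = k *v axis m 1" using KJ_J[OF k] by simp
  moreover have "(k *v axis m 1) \<bullet> w i = 0" if "i = e1 \<or> i = e2" for i
   using that m mid_neq[OF m] unfolding kep[symmetric] KJ_inner[OF k] ep_def
   by (auto simp: inner_add_right inner_axis2)
  ultimately have "D (k *v axis m 1) = 0" using D_pos Du by simp
  then show ?thesis using fix_S by (simp add: D_def)
 qed
 have Sk: "S ** k = k ** dA (lam e1) (lam e2)"
 proof -
  have scl: "S *v (r *\<^sub>R x) = t *\<^sub>R (r *\<^sub>R x)" if "S *v x = t *\<^sub>R x" for r t x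
   using that by (simp only: matrix_vector_mult_scaleR scaleR_left_commute)
  have kx: "k *v axis e1 1 = (1 / sqrt 2) *\<^sub>R (u e1 + w e1)" "k *v axis f1 1 = (1 / sqrt 2) *\<^sub>R (w e1 - u e1)"
   "k *v axis e2 1 = (1 / sqrt 2) *\<^sub>R (u e2 + w e2)" "k *v axis f2 1 = (1 / sqrt 2) *\<^sub>R (w e2 - u e2)"
   using kem[of e1] kem[of e2] unfolding axis_em_ep
   by (simp_all only: matrix_vector_mult_scaleR matrix_vector_right_distrib matrix_vector_mult_diff_distrib kep simp_thms)
  have "S *v (k *v axis j 1) = adiag (lam e1) (lam e2) j *\<^sub>R (k *v axis j 1)" for j
   by (cases rule: level5[of j]) (simp_all only: kx Smid adiag_simps scl Suw simp_thms scaleR_one)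
  then have "((S ** k) *v axis j 1) $ i = (adiag (lam e1) (lam e2) j *\<^sub>R (k *v axis j 1)) $ i" for i j
   by (simp add: matrix_vector_mul_assoc)
  then show ?thesis
   by (simp add: vec_eq_iff mult_dA matrix_vector_mult_basis column_def mult.commute)
 qed
 obtain k' where k': "k' \<in> KJ" "det k' = 1" "S ** k' = k' ** dA (lam e1) (lam e2)"
 proof (cases "det k = 1")
  case True then show ?thesis using that k Sk by blast
 next
  case False
  then have "det (k ** mid_flip) = 1" using det_KJ[OF k] by (simp add: det_mul mid_flip)
  moreover have "S ** (k ** mid_flip) = (k ** mid_flip) ** dA (lam e1) (lam e2)"
   by (metis Sk matrix_mul_assoc mid_flip(3))
  ultimately show ?thesis using that KJ_mult[OF k mid_flip(1)] by blast
 qed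
 define a b where "a = sqrt (lam e1)" and "b = sqrt (lam e2)"
 have ab: "1 <= b" "b <= a" using lam1 lam12 by (auto simp: a_def b_def)
 then have ab0: "a ~= 0" "b ~= 0" by auto
 have lam_ab: "dA (lam e1) (lam e2) = dA a b ** dA a b"
  using lam1[of e1] lam1[of e2] by (simp add: dA_dA a_def b_def)
 let ?ai = "dA (inverse a) (inverse b)"
 define k0 where "k0 = g ** k' ** ?ai"
 have inv: "k' ** transpose k' = mat 1" "transpose k' ** k' = mat 1"
  using k'(1) KJ_right by (auto simp: KJ_def)
 have "transpose k0 ** k0 = ?ai ** transpose k' ** (S ** k') ** ?ai"
  by (simp add: k0_def S_def matrix_transpose_mul matrix_mul_assoc)
 also have "\<dots> = ?ai ** (transpose k' ** k') ** (dA a b ** dA a b) ** ?ai"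
  unfolding k' lam_ab by (simp add: matrix_mul_assoc)
 also have "\<dots> = mat 1" using ab0 by (simp add: inv dA_dA mult.assoc)
 finally have k0orth: "transpose k0 ** k0 = mat 1" .
 have "k' \<in> SOJ" using k' KJ_form by (auto simp: SOJ_def)
 then have k0S: "k0 \<in> SOJ" unfolding k0_def by (intro SOJ_mult g dA_SOJ) (use ab0 in auto)
 then have k0form: "transpose k0 ** J ** k0 = J" by (simp add: SOJ_def)
 have "k0 ** transpose k0 = mat 1" using k0orth matrix_left_right_inverse by blast
 then have "J ** k0 = k0 ** J"
  by (metis k0form matrix_mul_assoc matrix_mul_lid)
 then have k0K: "k0 \<in> KJ" using k0orth by (simp add: KJ_def)
 have "k0 ** dA a b ** transpose k' = g ** k' ** (?ai ** dA a b) ** transpose k'"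
  by (simp add: k0_def matrix_mul_assoc)
 also have "\<dots> = g ** (k' ** transpose k')" using ab0 by (simp add: dA_inverse matrix_mul_assoc[symmetric])
 finally have "g = k0 ** dA a b ** transpose k'" by (simp add: inv)
 then show ?thesis
  using that[of k0 "transpose k'" b a] ab k0K k0S KJ_transpose[OF k'(1)] SOJ_transpose[OF \<open>k' \<in> SOJ\<close>] by blast
qed

end

section \<open>Cartan projections\<close>

lemma continuous_on_matrix_mult [continuous_intros]:
 fixes f g :: "'a::topological_space => 'n::finite sqmat"
 shows "continuous_on S f ==> continuous_on S g ==> continuous_on S (\<lambda>x. f x ** g x)"
 unfolding matrix_matrix_mult_def by (intro continuous_intros)

lemma continuous_on_transpose [continuous_intros]:
 fixes f :: "'a::topological_space => 'n::finite sqmat"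
 shows "continuous_on S f ==> continuous_on S (\<lambda>x. transpose (f x))"
 unfolding transpose_def by (intro continuous_intros)

lemma continuous_on_det [continuous_intros]:
 fixes f :: "'a::topological_space => 'n::finite sqmat"
 shows "continuous_on S f ==> continuous_on S (\<lambda>x. det (f x))"
 unfolding det_def by (intro continuous_intros)

context levels
begin

lemma DM_ge_1: "(real CARD('m)) >= 1" by (simp add: Suc_leI)

lemma closed_SOJ: "closed SOJ"
 unfolding SOJ_def Collect_conj_eq by (intro closed_Int closed_Collect_eq continuous_intros)

text \<open>The region \<open>1 <= b <= a\<close> is the closed Weyl chamber in exponentiated
  coordinates, and \<open>(a, a * b)\<close> is the pair of sizes of \<open>dA a b\<close>. A single
  \<open>C\<close> for all \<open>a\<close> and \<open>b\<close> is what corresponds to one compact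
  set.\<close>

definition fills :: "'m sqmat set => bool" where
 "fills S \<longleftrightarrow> (\<exists>C>0. \<forall>a b. 1 <= b \<longrightarrow> b <= a \<longrightarrow>
   (\<exists>h\<in>S. a / C <= norm h \<and> norm h <= C * a \<and> a * b / C <= L2 h \<and> L2 h <= C * (a * b)))"

lemma fills_mono: "fills S ==> S \<subseteq> S' ==> fills S'"
 unfolding fills_def by (meson subsetD)

definition dE :: "real => real => 'm sqmat" where "dE s t = dA (exp s) (exp t)"

definition wt :: "real => real => 'm => real" where
 "wt s t i = (if i = e1 then s else if i = e2 then t else if i = f2 then - t else if i = f1 then - s else 0)"

lemma wt_simps [simp]: "wt s t e1 = s" "wt s t e2 = t" "wt s t f2 = - t" "wt s t f1 = - s" "m \<in> mid ==> wt s t m = 0"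
 by (auto simp: wt_def)

lemma adiag_exp: "adiag (exp s) (exp t) i = exp (wt s t i)"
 by (cases rule: level5[of i]) (auto simp: exp_minus)

lemma dE_entry: "dE s t $ i $ j = (if i = j then exp (wt s t i) else 0)"
 by (simp add: dE_def dA_def adiag_exp)

lemma dE_mult: "(dE s t ** g) $ i $ j = exp (wt s t i) * g $ i $ j"
 and mult_dE: "(g ** dE s t) $ i $ j = g $ i $ j * exp (wt s t j)"
 by (simp_all add: dE_def dA_mult mult_dA adiag_exp)

lemma dE_dE: "dE s t ** dE s' t' = dE (s + s') (t + t')"
 by (simp add: dE_def dA_dA exp_add)

lemma dE_0 [simp]: "dE 0 0 = mat 1"
 by (simp add: dE_def)

lemma dE_SOJ: "dE s t \<in> SOJ"
 by (simp add: dE_def dA_SOJ)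

lemma norm_dE_le: "norm (dE s t) <= (real CARD('m))\<^sup>2 * exp (max \<bar>s\<bar> \<bar>t\<bar>)"
proof (rule norm_le_entries)
 fix i j
 have "wt s t i <= max \<bar>s\<bar> \<bar>t\<bar>" by (cases rule: level5[of i]) auto
 then show "\<bar>dE s t $ i $ j\<bar> <= exp (max \<bar>s\<bar> \<bar>t\<bar>)" by (cases "i = j") (auto simp: dE_entry)
qed

lemma L2_dE_le: "L2 (dE s t) <= (real CARD('m))^4 * exp (\<bar>s\<bar> + \<bar>t\<bar>)"
proof (rule L2_le_minors)
 fix i j k l
 have *: "exp (wt s t i) * exp (wt s t j) <= exp (\<bar>s\<bar> + \<bar>t\<bar>)" if "i ~= j" for i j
 proof -
  have "wt s t i + wt s t j <= \<bar>s\<bar> + \<bar>t\<bar>"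
   using that by (cases rule: level5[of i]; cases rule: level5[of j]) auto
  then show ?thesis by (simp add: exp_add[symmetric])
 qed
 show "\<bar>minor2 (dE s t) i j k l\<bar> <= exp (\<bar>s\<bar> + \<bar>t\<bar>)"
 proof (cases "i = j")
  case False
  then show ?thesis using *[OF False] by (auto simp: minor2_def dE_entry abs_mult mult.commute)
 qed (simp add: minor2_def)
qed

lemma dA_as_dE: "0 < a ==> 0 < b ==> dA a b = dE (ln a) (ln b)"
 by (simp add: dE_def)

lemma norm_dA_bounds: assumes "1 <= b" "b <= a" shows "a <= norm (dA a b)" "norm (dA a b) <= (real CARD('m))\<^sup>2 * a"
proof -
 have "dA a b $ e1 $ e1 = a" by (simp add: dA_def)
 then show "a <= norm (dA a b)" using abs_entry_le_norm[of "dA a b" e1 e1] by simp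
 have "max \<bar>ln a\<bar> \<bar>ln b\<bar> = ln a" using assms by simp
 then show "norm (dA a b) <= (real CARD('m))\<^sup>2 * a" using norm_dE_le[of "ln a" "ln b"] assms by (simp add: dA_as_dE)
qed

lemma L2_dA_bounds: assumes "1 <= b" "b <= a" shows "a * b <= L2 (dA a b)" "L2 (dA a b) <= (real CARD('m))^4 * (a * b)"
proof -
 have "minor2 (dA a b) e1 e2 e1 e2 = a * b" by (simp add: dA_def minor2_def)
 then show "a * b <= L2 (dA a b)" using minor2_le_L2[of "dA a b" e1 e2 e1 e2] by simp
 have "exp (\<bar>ln a\<bar> + \<bar>ln b\<bar>) = a * b" using assms by (simp add: exp_add)
 then show "L2 (dA a b) <= (real CARD('m))^4 * (a * b)" using L2_dE_le[of "ln a" "ln b"] assms by (simp add: dA_as_dE)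
qed

lemma norm_conj_le:
 fixes k h l :: "'m sqmat"
 assumes "norm k <= R" "norm l <= R'"
 shows "norm (k ** h ** l) <= (real CARD('m))^6 * (R * R') * norm h"
proof -
 have "norm (k ** h ** l) <= (real CARD('m))^3 * norm (k ** h) * norm l" by (rule norm_matrix_mult_le)
 also have "\<dots> <= (real CARD('m))^3 * ((real CARD('m))^3 * norm k * norm h) * norm l"
  by (intro mult_right_mono mult_left_mono norm_matrix_mult_le) auto
 also have "\<dots> <= (real CARD('m))^3 * ((real CARD('m))^3 * R * norm h) * R'"
  using assms order_trans[OF norm_ge_zero assms(1)]
  by (intro mult_mono mult_right_mono mult_left_mono) auto
 finally show ?thesis by (simp add: power_numeral_reduce mult_ac)
qed

lemma L2_conj_le:
 fixes k h l :: "'m sqmat"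
 assumes "L2 k <= R" "L2 l <= R'"
 shows "L2 (k ** h ** l) <= (R * R') * L2 h"
proof -
 have "L2 (k ** h ** l) <= L2 (k ** h) * L2 l" by (rule L2_mult)
 also have "\<dots> <= (L2 k * L2 h) * L2 l"
  by (intro mult_right_mono L2_mult L2_nonneg)
 also have "\<dots> <= (R * L2 h) * R'"
  using assms order_trans[OF L2_nonneg assms(1)] by (intro mult_mono) (auto simp: L2_nonneg)
 finally show ?thesis by (simp add: mult_ac)
qed

lemma L2_bdd: "norm g <= R ==> L2 g <= 2 * (real CARD('m))^4 * R\<^sup>2" for g :: "'m sqmat"
 by (rule order_trans[OF L2_le_norm]) (intro mult_left_mono power_mono; simp)

text \<open>Solving \<open>dA a b = c ** h ** d\<close> for \<open>h\<close> changes norms and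
  minors only by factors that are bounded on the compact set.\<close>

lemma fills_if_dense:
 assumes C: "compact C" "C \<subseteq> SOJ" and full: "SOJ \<subseteq> {c ** h ** d | c h d. c \<in> C \<and> h \<in> H \<and> d \<in> C}"
 shows "fills H"
proof -
 obtain R where R: "R > 0" "\<And>c. c \<in> C ==> norm c <= R"
  using compact_imp_bounded[OF C(1)] bounded_pos by blast
 define R' where "R' = (real CARD('m))\<^sup>2 * R"
 define F where "F = 2 * (real CARD('m))^4 * R\<^sup>2 + 2 * (real CARD('m))^4 * R'\<^sup>2"
 define Q where "Q = 1 + (real CARD('m))^6 * (R * R) + (real CARD('m))^6 * (R' * R') + F * F"
 have "R' > 0" "(real CARD('m)) > 0" using R DM_ge_1 by (auto simp: R'_def)
 moreover have "F > 0" unfolding F_def using R DM_ge_1 by (intro add_pos_nonneg) auto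
 moreover have "Q > 0" unfolding Q_def by (intro add_pos_nonneg) auto
 ultimately have pos: "R' > 0" "F > 0" "Q > 0" "(real CARD('m)) > 0" by auto
 have b: "norm c <= R" "norm (jinv c) <= R'" "L2 c <= F" "L2 (jinv c) <= F" if "c \<in> C" for c
 proof -
  show 1: "norm c <= R" by (rule R(2)[OF that])
  show 2: "norm (jinv c) <= R'" unfolding R'_def
   by (rule order_trans[OF norm_jinv mult_left_mono[OF 1]]) simp
  show "L2 c <= F" "L2 (jinv c) <= F" using L2_bdd[OF 1] L2_bdd[OF 2] by (auto simp: F_def add_increasing add_increasing2)
 qed
 have Q: "(real CARD('m))^6 * (R * R) <= Q" "(real CARD('m))^6 * (R' * R') <= Q" "F * F <= Q"
  unfolding Q_def using pos R(1) by (auto intro!: add_nonneg_nonneg add_increasing add_increasing2)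
 show ?thesis unfolding fills_def
 proof (intro exI conjI allI impI)
  show "Q * (real CARD('m))^4 > 0" using pos by simp
  fix a b :: real assume ab: "1 <= b" "b <= a"
  have "dA a b \<in> SOJ" using ab by (intro dA_SOJ) auto
  then obtain c h d where h: "dA a b = c ** h ** d" "c \<in> C" "h \<in> H" "d \<in> C" using full by blast
  have "jinv c ** c = mat 1" "d ** jinv d = mat 1"
   using h C(2) jinv_left[of c] jinv_right[of d] by (auto simp: SOJ_def)
  then have h': "h = jinv c ** dA a b ** jinv d"
   unfolding h(1) by (metis matrix_mul_assoc matrix_mul_lid matrix_mul_rid)
  have dmf: "1 <= (real CARD('m))^4" "(real CARD('m))\<^sup>2 <= (real CARD('m))^4" using DM_ge_1 by (auto intro: power_increasing)
  have "a <= Q * norm h"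
  proof -
   have "a <= (real CARD('m))^6 * (R * R) * norm h"
    using norm_conj_le[OF b(1)[OF h(2)] b(1)[OF h(4)], of h] norm_dA_bounds(1)[OF ab] by (simp add: h(1))
   also have "\<dots> <= Q * norm h" by (intro mult_right_mono Q) simp
   finally show ?thesis .
  qed
  also have "\<dots> <= (Q * (real CARD('m))^4) * norm h" using pos dmf by (intro mult_right_mono) auto
  finally have "a / (Q * (real CARD('m))^4) <= norm h" using pos by (simp add: pos_divide_le_eq mult_ac)
  moreover have "norm h <= Q * (real CARD('m))^4 * a"
  proof -
   have "norm h <= (real CARD('m))^6 * (R' * R') * norm (dA a b)"
    using norm_conj_le[OF b(2)[OF h(2)] b(2)[OF h(4)], of "dA a b"] by (simp add: h')
   also have "\<dots> <= Q * ((real CARD('m))^4 * a)"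
    using order_trans[OF norm_dA_bounds(2)[OF ab] mult_right_mono[OF dmf(2), of a]] Q(2) pos ab by (intro mult_mono) auto
   finally show ?thesis by (simp add: mult_ac)
  qed
  moreover have "a * b <= Q * L2 h"
  proof -
   have "a * b <= F * F * L2 h"
    using L2_conj_le[OF b(3)[OF h(2)] b(3)[OF h(4)], of h] L2_dA_bounds(1)[OF ab] by (simp add: h(1))
   also have "\<dots> <= Q * L2 h" by (intro mult_right_mono Q L2_nonneg)
   finally show ?thesis .
  qed
  then have "a * b <= (Q * (real CARD('m))^4) * L2 h"
  proof (rule order_trans)
   show "Q * L2 h <= Q * (real CARD('m))^4 * L2 h"
    using mult_left_mono[OF mult_right_mono[OF dmf(1) L2_nonneg[of h]], of Q] pos(3)
    by (simp only: mult_1_left mult.assoc less_imp_le)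
  qed
  then have "a * b / (Q * (real CARD('m))^4) <= L2 h" using pos by (simp add: pos_divide_le_eq mult_ac)
  moreover have "L2 h <= Q * (real CARD('m))^4 * (a * b)"
  proof -
   have "L2 h <= F * F * L2 (dA a b)"
    using L2_conj_le[OF b(4)[OF h(2)] b(4)[OF h(4)], of "dA a b"] by (simp add: h')
   also have "\<dots> <= Q * ((real CARD('m))^4 * (a * b))"
    using L2_dA_bounds(2)[OF ab] Q(3) pos ab by (intro mult_mono L2_nonneg) auto
   finally show ?thesis by (simp add: mult_ac)
  qed
  ultimately show "\<exists>h\<in>H. a / (Q * (real CARD('m))^4) <= norm h \<and> norm h <= Q * (real CARD('m))^4 * a \<and>
    a * b / (Q * (real CARD('m))^4) <= L2 h \<and> L2 h <= Q * (real CARD('m))^4 * (a * b)"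
   using h(3) by blast
 qed
qed

text \<open>Two chamber elements with comparable norm and comparable \<open>L2\<close> have
  comparable entries, so they differ by a bounded torus element \<open>e\<close>. Hence the element
  of \<open>H\<close> of the right size differs from a given \<open>g\<close> only by bounded
  factors on both sides.\<close>

lemma dense_if_fills:
 assumes H: "H \<subseteq> SOJ" and fills: "fills H"
 obtains C where "compact C" "C \<subseteq> SOJ" "{c ** h ** d | c h d. c \<in> C \<and> h \<in> H \<and> d \<in> C} = SOJ"
proof -
 obtain C0 where C0: "C0 > 0" "\<And>a b. 1 <= b ==> b <= a ==>
   (\<exists>h\<in>H. a / C0 <= norm h \<and> norm h <= C0 * a \<and> a * b / C0 <= L2 h \<and> L2 h <= C0 * (a * b))"
  using fills unfolding fills_def by metis
 define F where "F = 2 * (real CARD('m))^4 * ((real CARD('m))\<^sup>2)\<^sup>2"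
 define E where "E = (real CARD('m))^6 * ((real CARD('m))\<^sup>2 * (real CARD('m))\<^sup>2)"
 define Q where "Q = E * C0 * (real CARD('m))\<^sup>2 + F * F * C0 * (real CARD('m))^4"
 have D0: "(real CARD('m)) > 0" using DM_ge_1 by linarith
 have pos: "F > 0" "E > 0" "Q > 0" using C0(1) D0
  by (auto simp: F_def E_def Q_def intro!: add_pos_pos mult_pos_pos zero_less_power)
 define R where "R = (real CARD('m))\<^sup>2 + (real CARD('m))^6 * ((real CARD('m))\<^sup>2 * (real CARD('m))\<^sup>2) * ((real CARD('m))\<^sup>2 * (Q * Q + Q))"
 define C where "C = {g \<in> SOJ. norm g <= R}"
 have KF: "L2 k <= F" if "k \<in> KJ" for k unfolding F_def by (rule L2_bdd[OF KJ_norm[OF that]])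
 have "C = SOJ \<inter> cball 0 R" by (auto simp: C_def)
 then have "compact C" using closed_SOJ by (simp add: closed_Int_compact)
 moreover have "C \<subseteq> SOJ" by (auto simp: C_def)
 moreover have "SOJ \<subseteq> {c ** h ** d | c h d. c \<in> C \<and> h \<in> H \<and> d \<in> C}"
 proof
  fix g assume "g \<in> SOJ"
  then obtain k l a b where g: "k \<in> KJ \<inter> SOJ" "l \<in> KJ \<inter> SOJ" "1 <= b" "b <= a" "g = k ** dA a b ** l"
   using cartan_decomposition[of g] by metis
  obtain h where h: "h \<in> H" "a / C0 <= norm h" "norm h <= C0 * a" "a * b / C0 <= L2 h" "L2 h <= C0 * (a * b)"
   using C0(2)[OF g(3,4)] by blast
  have "h \<in> SOJ" using h(1) H by blast
  then obtain k1 l1 a1 b1 where h1: "k1 \<in> KJ \<inter> SOJ" "l1 \<in> KJ \<inter> SOJ" "1 <= b1" "b1 <= a1"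
   "h = k1 ** dA a1 b1 ** l1" using cartan_decomposition[of h] by metis
  have kl: "transpose k1 ** k1 = mat 1" "l1 ** transpose l1 = mat 1" using h1 KJ_right by (auto simp: KJ_def)
  have d1: "dA a1 b1 = transpose k1 ** h ** transpose l1"
   unfolding h1(5) using kl by (metis matrix_mul_assoc matrix_mul_lid matrix_mul_rid)
  have kt: "transpose k1 \<in> KJ \<inter> SOJ" "transpose l1 \<in> KJ \<inter> SOJ" using h1 KJ_transpose SOJ_transpose by auto
  have n1: "a1 <= E * norm h" "norm h <= E * norm (dA a1 b1)" "a1 * b1 <= F * F * L2 h" "L2 h <= F * F * L2 (dA a1 b1)"
  proof -
   show "a1 <= E * norm h"
    using norm_conj_le[of "transpose k1" "(real CARD('m))\<^sup>2" "transpose l1" "(real CARD('m))\<^sup>2" h] kt KJ_norm norm_dA_bounds(1)[OF h1(3,4)]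
    by (simp add: d1[symmetric] E_def)
   show "norm h <= E * norm (dA a1 b1)"
    using norm_conj_le[of k1 "(real CARD('m))\<^sup>2" l1 "(real CARD('m))\<^sup>2" "dA a1 b1"] h1(1,2) KJ_norm by (simp add: h1(5)[symmetric] E_def)
   show "a1 * b1 <= F * F * L2 h"
    using L2_conj_le[of "transpose k1" F "transpose l1" F h] kt KF L2_dA_bounds(1)[OF h1(3,4)]
    by (simp add: d1[symmetric])
   show "L2 h <= F * F * L2 (dA a1 b1)"
    using L2_conj_le[of k1 F l1 F "dA a1 b1"] h1(1,2) KF by (simp add: h1(5)[symmetric])
  qed
  have p: "a > 0" "b > 0" "a1 > 0" "b1 > 0" using g h1 by auto
  have QE: "E * C0 * (real CARD('m))\<^sup>2 <= Q" "F * F * C0 * (real CARD('m))^4 <= Q" unfolding Q_def using pos C0(1) by auto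
  have dmf: "1 <= (real CARD('m))\<^sup>2" "1 <= (real CARD('m))^4" using DM_ge_1 by auto
  have 1: "a <= Q * a1"
  proof -
   have "a <= C0 * norm h" using h(2) C0(1) by (simp add: pos_divide_le_eq mult.commute)
   also have "\<dots> <= C0 * (E * ((real CARD('m))\<^sup>2 * a1))"
    using n1(2) norm_dA_bounds(2)[OF h1(3,4)] C0(1) pos(2)
    by (intro mult_left_mono) (auto intro: order_trans mult_left_mono)
   also have "\<dots> = (E * C0 * (real CARD('m))\<^sup>2) * a1" by (simp add: mult_ac)
   also have "\<dots> <= Q * a1" using QE p by (intro mult_right_mono) auto
   finally show ?thesis .
  qed
  have 2: "a1 <= Q * a"
  proof -
   have "a1 <= E * (C0 * a)" using n1(1) h(3) pos(2) by (auto intro: order_trans mult_left_mono)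
   also have "\<dots> <= (E * C0 * (real CARD('m))\<^sup>2) * a"
    using mult_left_mono[OF dmf(1), of "E * C0 * a"] pos C0(1) p by (simp add: mult_ac)
   also have "\<dots> <= Q * a" using QE p by (intro mult_right_mono) auto
   finally show ?thesis .
  qed
  have 3: "a * b <= Q * (a1 * b1)"
  proof -
   have "a * b <= C0 * L2 h" using h(4) C0(1) by (simp add: pos_divide_le_eq mult.commute)
   also have "\<dots> <= C0 * (F * F * ((real CARD('m))^4 * (a1 * b1)))"
    using n1(4) L2_dA_bounds(2)[OF h1(3,4)] C0(1) pos(1)
    by (intro mult_left_mono) (auto intro: order_trans mult_left_mono)
   also have "\<dots> = (F * F * C0 * (real CARD('m))^4) * (a1 * b1)" by (simp add: mult_ac)
   also have "\<dots> <= Q * (a1 * b1)" using QE p by (intro mult_right_mono) auto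
   finally show ?thesis .
  qed
  have a1a: "a / a1 <= Q" "a1 / a <= Q" using 1 2 p by (simp_all add: pos_divide_le_eq)
  have "b / b1 <= Q * Q"
  proof -
   have "a * b <= Q * ((Q * a) * b1)"
    using 3 mult_left_mono[OF mult_right_mono[OF 2, of b1], of Q] pos p by linarith
   then have "a * b <= a * (Q * Q * b1)" by (simp add: mult_ac)
   then show ?thesis using p by (simp add: pos_divide_le_eq)
  qed
  moreover have "b1 / b <= Q * Q"
  proof -
   have "a1 * b1 <= F * F * (C0 * (a * b))" using n1(3) h(5) pos(1) by (auto intro: order_trans mult_left_mono)
   also have "\<dots> <= (F * F * C0 * (real CARD('m))^4) * (a * b)"
    using mult_left_mono[OF dmf(2), of "F * F * C0 * (a * b)"] pos C0(1) p by (simp add: mult_ac)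
   also have "\<dots> <= Q * (a * b)" using QE p by (intro mult_right_mono) auto
   also have "\<dots> <= Q * ((Q * a1) * b)" using 1 pos p by (intro mult_left_mono mult_right_mono) auto
   finally have "a1 * b1 <= a1 * (Q * Q * b)" by (simp add: mult_ac)
   then show ?thesis using p by (simp add: pos_divide_le_eq)
  qed
  moreover define e where "e = dA (a / a1) (b / b1)"
  ultimately have "norm e <= (real CARD('m))\<^sup>2 * (Q * Q + Q)"
  proof -
   have "\<bar>e $ i $ j\<bar> <= Q * Q + Q" for i j
   proof -
    \<comment> \<open>This covers the entries 1 of \<open>e\<close> in the middle levels. It holds
      because the reciprocal numbers \<open>a / a1\<close> and \<open>a1 / a\<close> are both at
      most \<open>Q\<close>.\<close>
    have "1 <= Q * Q + Q"
    proof (cases "Q >= 1")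
     case False
     then have "a / a1 < 1" "a1 / a < 1" using a1a by linarith+
     then show ?thesis using p by (simp add: divide_less_eq)
    qed (use pos in \<open>simp add: add_increasing\<close>)
    then have "adiag (a / a1) (b / b1) i <= Q * Q + Q"
     using a1a \<open>b / b1 <= Q * Q\<close> \<open>b1 / b <= Q * Q\<close> pos by (cases rule: level5[of i]) (auto simp: inverse_eq_divide intro: add_increasing add_increasing2)
    moreover have "adiag (a / a1) (b / b1) i >= 0" using p by (cases rule: level5[of i]) auto
    ultimately show ?thesis using pos by (auto simp: e_def dA_def)
   qed
   from norm_le_entries[OF this] show ?thesis .
  qed
  have eS: "e \<in> SOJ" unfolding e_def using p by (intro dA_SOJ) auto
  have "dA a b = dA a1 b1 ** e" using p by (simp add: e_def dA_dA)
  then have "g = (k ** transpose k1) ** h ** (transpose l1 ** e ** l)"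
   unfolding g(5) d1 by (simp add: matrix_mul_assoc)
  moreover have "k ** transpose k1 \<in> C"
   using g kt KJ_norm[of "k ** transpose k1"] KJ_mult[of k "transpose k1"] SOJ_mult[of k "transpose k1"] pos
   by (auto simp: C_def R_def intro!: add_increasing2)
  moreover have "transpose l1 ** e ** l \<in> C"
  proof -
   have "norm (transpose l1 ** e ** l) <= (real CARD('m))^6 * ((real CARD('m))\<^sup>2 * (real CARD('m))\<^sup>2) * norm e"
    using kt g KJ_norm by (intro norm_conj_le) auto
   also have "\<dots> <= (real CARD('m))^6 * ((real CARD('m))\<^sup>2 * (real CARD('m))\<^sup>2) * ((real CARD('m))\<^sup>2 * (Q * Q + Q))"
    using \<open>norm e <= _\<close> by (intro mult_left_mono) auto
   also have "\<dots> <= R" by (simp add: R_def)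
   finally show ?thesis using kt g eS by (auto simp: C_def intro!: SOJ_mult)
  qed
  ultimately show "g \<in> {c ** h ** d | c h d. c \<in> C \<and> h \<in> H \<and> d \<in> C}" using h(1) by blast
 qed
 moreover have "{c ** h ** d | c h d. c \<in> C \<and> h \<in> H \<and> d \<in> C} \<subseteq> SOJ"
  using H by (auto simp: C_def intro!: SOJ_mult)
 ultimately show ?thesis using that by blast
qed

text \<open>The target value \<open>a * b\<close> lies between \<open>a\<close> and the square of
  \<open>a\<close>. Either the intermediate value theorem reaches it on the path, or it lies beyond
  an end value of \<open>L2\<close> and is comparable to that value.\<close>

lemma fills_by_paths:
 assumes "C >= 1" and path: "\<And>N. N >= 1 ==> \<exists>ga. continuous_on {0..1::real} ga \<and> (\<forall>ta\<in>{0..1}. ga ta \<in> S \<and>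
   N <= C * norm (ga ta) \<and> norm (ga ta) <= C * N) \<and> L2 (ga 0) <= C * N \<and> N\<^sup>2 <= C * L2 (ga 1)"
 shows "fills S"
 unfolding fills_def
proof (intro exI conjI allI impI)
 show "C > 0" using assms(1) by simp
 fix a b :: real assume ab: "1 <= b" "b <= a"
 obtain ga where ga: "continuous_on {0..1::real} ga" "\<And>ta. ta \<in> {0..1} ==> ga ta \<in> S"
   "\<And>ta. ta \<in> {0..1} ==> a <= C * norm (ga ta)" "\<And>ta. ta \<in> {0..1} ==> norm (ga ta) <= C * a"
   "L2 (ga 0) <= C * a" "a\<^sup>2 <= C * L2 (ga 1)"
  using path[of a] ab by auto
 have "\<exists>ta\<in>{0..1}. a * b <= C * L2 (ga ta) \<and> L2 (ga ta) <= C * (a * b)"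
 proof -
  have C: "x <= C * x" if "x >= 0" for x using mult_right_mono[OF assms(1) that] by simp
  have aab: "a <= a * b" "a * b <= a\<^sup>2" using ab by (auto simp: power2_eq_square)
  consider "L2 (ga 0) > a * b" | "L2 (ga 1) < a * b" | "L2 (ga 0) <= a * b" "a * b <= L2 (ga 1)" by linarith
  then show ?thesis
  proof cases
   case 1
   then have "a * b <= C * L2 (ga 0)" using C[OF L2_nonneg[of "ga 0"]] by linarith
   moreover have "L2 (ga 0) <= C * (a * b)"
    using ga(5) mult_left_mono[OF aab(1), of C] assms(1) by linarith
   ultimately show ?thesis by (intro bexI[of _ 0]) auto
  next
   case 2
   have "a * b >= 0" using ab by auto
   then show ?thesis using ga(6) aab C[of "a * b"] 2 by (intro bexI[of _ 1]) auto
  next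
   case 3
   obtain ta where "ta \<in> {0..1}" "L2 (ga ta) = a * b"
    using IVT'[of "\<lambda>x. L2 (ga x)" 0 "a * b" 1] 3 continuous_on_L2[OF ga(1)] by auto
   moreover have "a * b >= 0" using ab by auto
   ultimately show ?thesis using C[of "a * b"] by (intro bexI[of _ ta]) auto
  qed
 qed
 then obtain ta where t: "ta \<in> {0..1}" "a * b <= C * L2 (ga ta)" "L2 (ga ta) <= C * (a * b)" by blast
 show "\<exists>h\<in>S. a / C <= norm h \<and> norm h <= C * a \<and> a * b / C <= L2 h \<and> L2 h <= C * (a * b)"
  using ga(2-4)[OF t(1)] t assms(1) by (intro bexI[of _ "ga ta"]) (auto simp: pos_divide_le_eq mult_ac)
qed

section \<open>Power laws between norm and L2 as obstructions\<close>

lemma large_exp: assumes "(p::real) > 0" shows "\<exists>m\<ge>0. K < exp (p * m)"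
proof -
 have "K < exp (max K 0)" using exp_ge_add_one_self[of "max K 0"] max.cobounded1[of K 0] by linarith
 then have "K < exp (p * (max K 0 / p))" using assms by simp
 then show ?thesis using assms by (intro exI[of _ "max K 0 / p"]) auto
qed

text \<open>Tested on the wall \<open>a = b\<close>, where \<open>L2\<close> would have to be of the
  order of the squared norm.\<close>

lemma not_fills_upper:
 assumes kp: "0 < kp" "kp < 2" "C > 0" and L2: "\<And>h. h \<in> S ==> L2 h <= C * norm h powr kp"
 shows "\<not> fills S"
proof
 assume "fills S"
 then obtain C0 where C0: "C0 > 0" "\<And>a b. 1 <= b ==> b <= a ==>
   (\<exists>h\<in>S. a / C0 <= norm h \<and> norm h <= C0 * a \<and> a * b / C0 <= L2 h \<and> L2 h <= C0 * (a * b))"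
  unfolding fills_def by metis
 obtain m where m: "m >= 0" "C0 * (C * C0 powr kp) < exp ((2 - kp) * m)" using large_exp[of "2 - kp"] kp by auto
 obtain h where h: "h \<in> S" "norm h <= C0 * exp m" "exp m * exp m / C0 <= L2 h"
  using C0(2)[of "exp m" "exp m"] m(1) by auto
 have "exp m * exp m / C0 <= C * (C0 * exp m) powr kp"
  using h(3) L2[OF h(1)] powr_mono2[OF less_imp_le[OF kp(1)] norm_ge_zero h(2)] kp(3)
   mult_left_mono[of "norm h powr kp" "(C0 * exp m) powr kp" C] by linarith
 also have "\<dots> = C * C0 powr kp * exp (kp * m)" using C0(1) by (simp add: powr_mult exp_powr_real mult.commute)
 finally have "exp m * exp m <= C0 * (C * C0 powr kp) * exp (kp * m)"
  using C0(1) by (simp add: pos_divide_le_eq mult_ac)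
 also have "\<dots> < exp ((2 - kp) * m) * exp (kp * m)" using m(2) by (intro mult_strict_right_mono) auto
 also have "\<dots> = exp m * exp m" by (simp add: exp_add[symmetric] algebra_simps)
 finally show False by simp
qed

text \<open>Tested on the wall \<open>b = 1\<close>, where \<open>L2\<close> would have to be of the
  order of the norm.\<close>

lemma not_fills_lower:
 assumes kp: "1 < kp" "C > 0" and L2: "\<And>h. h \<in> S ==> norm h powr kp <= C * L2 h"
 shows "\<not> fills S"
proof
 assume "fills S"
 then obtain C0 where C0: "C0 > 0" "\<And>a b. 1 <= b ==> b <= a ==>
   (\<exists>h\<in>S. a / C0 <= norm h \<and> norm h <= C0 * a \<and> a * b / C0 <= L2 h \<and> L2 h <= C0 * (a * b))"
  unfolding fills_def by metis
 obtain m where m: "m >= 0" "C * C0 * C0 powr kp < exp ((kp - 1) * m)" using large_exp[of "kp - 1"] kp by auto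
 obtain h where h: "h \<in> S" "exp m / C0 <= norm h" "L2 h <= C0 * exp m"
  using C0(2)[of 1 "exp m"] m(1) by auto
 have "exp (kp * m) / C0 powr kp = (exp m / C0) powr kp" using C0(1) by (simp add: powr_divide exp_powr_real mult.commute)
 also have "\<dots> <= norm h powr kp" using kp C0(1) h(2) by (intro powr_mono2) auto
 also have "\<dots> <= C * (C0 * exp m)" using L2[OF h(1)] mult_left_mono[OF h(3), of C] kp by linarith
 finally have "exp (kp * m) <= C * C0 * C0 powr kp * exp m"
  using C0(1) by (simp add: pos_divide_le_eq mult_ac)
 also have "\<dots> < exp ((kp - 1) * m) * exp m" using m(2) by (intro mult_strict_right_mono) auto
 also have "\<dots> = exp (kp * m)" by (simp add: exp_add[symmetric] algebra_simps)
 finally show False by simp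
qed

text \<open>
 If the elements of \<open>S\<close> are conjugated by a one-parameter subgroup of \<open>A\<close> into that subgroup times a bounded
 set, then their norms and minors are bounded by exponentials in \<open>\<bar>s + l\<bar> + l = max (- s) (s + 2 * l)\<close>.
\<close>

lemma scaled_L2:
 assumes "l >= 0" "norm Y <= B" "h = dE ((s + l) * tu1) ((s + l) * tu2) ** Y ** dE (- l * tu1) (- l * tu2)"
 shows "L2 h <= (real CARD('m))^8 * (2 * (real CARD('m))^4 * B\<^sup>2) * exp ((\<bar>tu1\<bar> + \<bar>tu2\<bar>) * max (- s) (s + 2 * l))"
  and "norm h <= (real CARD('m))^6 * ((real CARD('m))\<^sup>2 * (real CARD('m))\<^sup>2) * B * exp (max \<bar>tu1\<bar> \<bar>tu2\<bar> * max (- s) (s + 2 * l))"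
proof -
 let ?a = "\<bar>tu1\<bar> + \<bar>tu2\<bar>" and ?m = "max \<bar>tu1\<bar> \<bar>tu2\<bar>"
 have E: "\<bar>s + l\<bar> + l = max (- s) (s + 2 * l)" using assms(1) by auto
 have 1: "L2 (dE (r * tu1) (r * tu2)) <= (real CARD('m))^4 * exp (\<bar>r\<bar> * ?a)" for r
  using L2_dE_le[of "r * tu1" "r * tu2"] by (simp add: abs_mult distrib_left)
 have 2: "norm (dE (r * tu1) (r * tu2)) <= (real CARD('m))\<^sup>2 * exp (\<bar>r\<bar> * ?m)" for r
 proof -
  have "max \<bar>r * tu1\<bar> \<bar>r * tu2\<bar> = \<bar>r\<bar> * ?m" by (auto simp: abs_mult max_def mult_left_mono_neg mult_le_cancel_left)
  then show ?thesis using norm_dE_le[of "r * tu1" "r * tu2"] by simp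
 qed
 have e: "exp (\<bar>s + l\<bar> * x) * exp (\<bar>- l\<bar> * x) = exp (x * max (- s) (s + 2 * l))" for x
  unfolding E[symmetric] using assms(1) by (simp add: exp_add[symmetric] algebra_simps)
 have "L2 h <= (((real CARD('m))^4 * exp (\<bar>s + l\<bar> * ?a)) * ((real CARD('m))^4 * exp (\<bar>- l\<bar> * ?a))) * L2 Y"
  unfolding assms(3) by (rule L2_conj_le[OF 1 1])
 also have "\<dots> = (real CARD('m))^8 * L2 Y * exp (?a * max (- s) (s + 2 * l))"
  unfolding e[symmetric] by (simp add: power_numeral_reduce mult_ac)
 also have "\<dots> <= (real CARD('m))^8 * (2 * (real CARD('m))^4 * B\<^sup>2) * exp (?a * max (- s) (s + 2 * l))"
  by (intro mult_right_mono mult_left_mono L2_bdd assms) auto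
 finally show "L2 h <= (real CARD('m))^8 * (2 * (real CARD('m))^4 * B\<^sup>2) * exp (?a * max (- s) (s + 2 * l))" .
 have "norm h <= (real CARD('m))^6 * (((real CARD('m))\<^sup>2 * exp (\<bar>s + l\<bar> * ?m)) * ((real CARD('m))\<^sup>2 * exp (\<bar>- l\<bar> * ?m))) * norm Y"
  unfolding assms(3) by (rule norm_conj_le[OF 2 2])
 also have "\<dots> = (real CARD('m))^6 * ((real CARD('m))\<^sup>2 * (real CARD('m))\<^sup>2) * norm Y * exp (?m * max (- s) (s + 2 * l))"
  unfolding e[symmetric] by (simp add: mult_ac)
 also have "\<dots> <= (real CARD('m))^6 * ((real CARD('m))\<^sup>2 * (real CARD('m))\<^sup>2) * B * exp (?m * max (- s) (s + 2 * l))"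
  by (intro mult_right_mono mult_left_mono assms) auto
 finally show "norm h <= (real CARD('m))^6 * ((real CARD('m))\<^sup>2 * (real CARD('m))\<^sup>2) * B * exp (?m * max (- s) (s + 2 * l))" .
qed

text \<open>With \<open>E = max (- s) (s + 2 * l)\<close>, \<open>L2\<close> is at most of order
  \<open>exp ((\<bar>tu1\<bar> + \<bar>tu2\<bar>) * E)\<close> while the norm is at least of order
  \<open>exp (mu * E)\<close>. The quotient of the two exponents is the power \<open>kp\<close>,
  which is less than 2.\<close>

lemma not_fills_scaled_upper:
 assumes c: "c > 0" "B > 0" and mu: "mu > 0" "\<bar>tu1\<bar> + \<bar>tu2\<bar> > 0" "\<bar>tu1\<bar> + \<bar>tu2\<bar> < 2 * mu"
  and S: "\<And>h. h \<in> S ==> \<exists>s l Y. l >= 0 \<and> norm Y <= B \<and>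
   h = dE ((s + l) * tu1) ((s + l) * tu2) ** Y ** dE (- l * tu1) (- l * tu2) \<and>
   c * exp (- mu * s) <= norm h \<and> c * exp (mu * (s + 2 * l)) <= norm h"
 shows "\<not> fills S"
proof (rule not_fills_upper)
 define kp where "kp = (\<bar>tu1\<bar> + \<bar>tu2\<bar>) / mu"
 let ?K = "(real CARD('m))^8 * (2 * (real CARD('m))^4 * B\<^sup>2)"
 show "0 < kp" "kp < 2" using mu by (auto simp: kp_def field_simps)
 have K: "?K > 0" using c DM_ge_1 by auto
 then show "?K / c powr kp > 0" using c by auto
 fix h assume "h \<in> S"
 then obtain s l Y where h: "l >= 0" "norm Y <= B"
   "h = dE ((s + l) * tu1) ((s + l) * tu2) ** Y ** dE (- l * tu1) (- l * tu2)"
   "c * exp (- mu * s) <= norm h" "c * exp (mu * (s + 2 * l)) <= norm h"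
  using S by blast
 have "c * exp (mu * max (- s) (s + 2 * l)) <= norm h" using h(4,5) by (auto simp: max_def)
 then have "(c * exp (mu * max (- s) (s + 2 * l))) powr kp <= norm h powr kp"
  using c \<open>0 < kp\<close> by (intro powr_mono2) auto
 then have "c powr kp * exp (kp * mu * max (- s) (s + 2 * l)) <= norm h powr kp"
  using c by (simp add: powr_mult exp_powr_real mult_ac)
 then have "c powr kp * exp ((\<bar>tu1\<bar> + \<bar>tu2\<bar>) * max (- s) (s + 2 * l)) <= norm h powr kp"
  using mu by (simp add: kp_def)
 then have "exp ((\<bar>tu1\<bar> + \<bar>tu2\<bar>) * max (- s) (s + 2 * l)) <= norm h powr kp / c powr kp"
  using c by (simp add: pos_le_divide_eq mult.commute)
 from order_trans[OF scaled_L2(1)[OF h(1-3)] mult_left_mono[OF this]] K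
 show "L2 h <= ?K / c powr kp * norm h powr kp" by simp
qed

text \<open>The mirror image: the norm has exponent at most
  \<open>max \<bar>tu1\<bar> \<bar>tu2\<bar>\<close>, \<open>L2\<close> at least \<open>mu\<close>,
  and the quotient exceeds 1.\<close>

lemma not_fills_scaled_lower:
 assumes c: "c > 0" "B > 0" and mu: "max \<bar>tu1\<bar> \<bar>tu2\<bar> > 0" "max \<bar>tu1\<bar> \<bar>tu2\<bar> < mu"
  and S: "\<And>h. h \<in> S ==> \<exists>s l Y. l >= 0 \<and> norm Y <= B \<and>
   h = dE ((s + l) * tu1) ((s + l) * tu2) ** Y ** dE (- l * tu1) (- l * tu2) \<and>
   c * exp (- mu * s) <= L2 h \<and> c * exp (mu * (s + 2 * l)) <= L2 h"
 shows "\<not> fills S"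
proof (rule not_fills_lower)
 define kp where "kp = mu / max \<bar>tu1\<bar> \<bar>tu2\<bar>"
 let ?K = "(real CARD('m))^6 * ((real CARD('m))\<^sup>2 * (real CARD('m))\<^sup>2) * B"
 show k1: "1 < kp" using mu by (simp add: kp_def)
 have K: "?K > 0" using c DM_ge_1 by auto
 then show "?K powr kp / c > 0" using c by auto
 fix h assume "h \<in> S"
 then obtain s l Y where h: "l >= 0" "norm Y <= B"
   "h = dE ((s + l) * tu1) ((s + l) * tu2) ** Y ** dE (- l * tu1) (- l * tu2)"
   "c * exp (- mu * s) <= L2 h" "c * exp (mu * (s + 2 * l)) <= L2 h"
  using S by blast
 let ?E = "max (- s) (s + 2 * l)"
 have "norm h powr kp <= (?K * exp (max \<bar>tu1\<bar> \<bar>tu2\<bar> * ?E)) powr kp"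
  using scaled_L2(2)[OF h(1-3)] k1 by (intro powr_mono2) auto
 also have "\<dots> = ?K powr kp * exp (kp * max \<bar>tu1\<bar> \<bar>tu2\<bar> * ?E)"
  using K by (simp only: powr_mult exp_powr_real mult_ac)
 also have "\<dots> = ?K powr kp * exp (mu * ?E)" using mu(1) by (simp add: kp_def)
 also have "\<dots> <= ?K powr kp * (L2 h / c)"
  using h(4,5) c by (intro mult_left_mono) (auto simp: max_def pos_le_divide_eq mult.commute)
 finally show "norm h powr kp <= ?K powr kp / c * L2 h" by simp
qed

end

section \<open>Coordinates on the unipotent group\<close>

type_synonym 'm nco = "real \<times> 'm vc \<times> 'm vc \<times> real"

context levels
begin

lemma mid_neq_simps [simp]: "m \<in> mid ==> (m = e1) = False" "m \<in> mid ==> (m = e2) = False"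
 "m \<in> mid ==> (m = f2) = False" "m \<in> mid ==> (m = f1) = False"
 "m \<in> mid ==> (e1 = m) = False" "m \<in> mid ==> (e2 = m) = False"
 "m \<in> mid ==> (f2 = m) = False" "m \<in> mid ==> (f1 = m) = False"
 using mid_neq[of m] by auto

text \<open>Vectors of length n - 2 are kept in the full index space, extended by zero.\<close>

definition supp :: "'m vc => bool" where "supp x \<longleftrightarrow> (\<forall>i. i \<notin> mid \<longrightarrow> x $ i = 0)"

lemma supp_simps [simp]: "supp 0" "supp x ==> supp y ==> supp (x + y)" "supp x ==> supp y ==> supp (x - y)"
 "supp x ==> supp (r *\<^sub>R x)" "supp x ==> supp (- x)"
 by (auto simp: supp_def)

lemma sum_mid_inner: "supp x ==> (\<Sum>k\<in>mid. x $ k * y $ k) = x \<bullet> y"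
 by (simp add: inner_vec_def sum_levels supp_def)

text \<open>The exponential of \<open>nmat p\<close> (proved in \<open>mexp_nmat\<close>), written
  out because the series stops after the fourth power. Polynomial entries reduce the group law,
  inverses and norm bounds to a comparison of blocks.\<close>

definition nexp :: "'m nco => 'm sqmat" where
 "nexp p = (case p of (pp, x, y, et) => \<chi> i j.
   if i = e1 then
    (if j = e1 then 1 else if j = e2 then pp else if j = f2 then et - x \<bullet> y / 2 - pp * (y \<bullet> y) / 6
    else if j = f1 then - pp * et - x \<bullet> x / 2 + pp\<^sup>2 * (y \<bullet> y) / 24 else x $ j + pp * y $ j / 2)
   else if i = e2 then
    (if j = e1 then 0 else if j = e2 then 1 else if j = f2 then - (y \<bullet> y) / 2
    else if j = f1 then - et - x \<bullet> y / 2 + pp * (y \<bullet> y) / 6 else y $ j)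
   else if i = f2 then (if j = f2 then 1 else if j = f1 then - pp else 0)
   else if i = f1 then (if j = f1 then 1 else 0)
   else (if j = f2 then - y $ i else if j = f1 then - x $ i + pp * y $ i / 2 else if j = i then 1 else 0))"

definition nmat :: "'m nco => 'm sqmat" where
 "nmat p = (case p of (pp, x, y, et) => \<chi> i j.
   if i = e1 then (if j = e2 then pp else if j = f2 then et else if j \<in> mid then x $ j else 0)
   else if i = e2 then (if j = f1 then - et else if j \<in> mid then y $ j else 0)
   else if i = f2 then (if j = f1 then - pp else 0)
   else if i = f1 then 0
   else (if j = f2 then - y $ i else if j = f1 then - x $ i else 0))"

definition ncar :: "'m nco set" where "ncar = {(pp, x, y, et). supp x \<and> supp y}"

lemma ncar_iff [simp]: "(pp, x, y, et) \<in> ncar \<longleftrightarrow> supp x \<and> supp y"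
 by (simp add: ncar_def)

lemma subspace_ncar: "subspace ncar"
 unfolding subspace_def by (auto simp: zero_prod_def)

text \<open>The Baker-Campbell-Hausdorff series up to its cubic terms. Brackets of four elements
  vanish in this algebra, so the truncated formula is exact; \<open>bch_nbr\<close> states it with
  brackets.\<close>

fun bch :: "'m nco => 'm nco => 'm nco" where
 "bch (pp, x, y, et) (pp', x', y', et') =
   (pp + pp', x + x' + (1/2) *\<^sub>R (pp *\<^sub>R y' - pp' *\<^sub>R y), y + y',
   et + et' + (x' \<bullet> y - x \<bullet> y') / 2 + ((pp *\<^sub>R y' - pp' *\<^sub>R y) \<bullet> (y - y')) / 12)"

lemma mult_entry: "(A ** B) $ i $ j = A $ i $ e1 * B $ e1 $ j + A $ i $ e2 * B $ e2 $ j
  + (\<Sum>k\<in>mid. A $ i $ k * B $ k $ j) + A $ i $ f2 * B $ f2 $ j + A $ i $ f1 * B $ f1 $ j"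
 by (simp add: matrix_matrix_mult_def sum_levels)

lemma sum_mid_pick [simp]:
 "j \<in> mid ==> (\<Sum>k\<in>mid. f k * (if j = k then 1 else 0)) = (f j :: real)"
 "j \<in> mid ==> (\<Sum>k\<in>mid. (if k = j then 1 else 0) * f k) = (f j :: real)"
 "j \<in> mid ==> (\<Sum>k\<in>mid. f k * (if k = j then 1 else 0)) = (f j :: real)"
 "j \<in> mid ==> (\<Sum>k\<in>mid. (if j = k then 1 else 0) * f k) = (f j :: real)"
 by (simp_all add: if_distrib[of "\<lambda>x. _ * x"] if_distrib[of "\<lambda>x. x * _"] cong: if_cong)

lemma sum_mid_shapes:
 assumes "supp x" "supp y"
 shows "(\<Sum>k\<in>mid. (x $ k + r * y $ k / 2) * z $ k) = x \<bullet> z + r * (y \<bullet> z) / 2"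
  "(\<Sum>k\<in>mid. (x $ k + r * y $ k / 2) * (s * z $ k / 2 - u $ k)) =
    - (x \<bullet> u) + s * (x \<bullet> z) / 2 - r * (y \<bullet> u) / 2 + r * s * (y \<bullet> z) / 4"
proof -
 have i: "x \<bullet> v = (\<Sum>k\<in>mid. x $ k * v $ k)" "y \<bullet> v = (\<Sum>k\<in>mid. y $ k * v $ k)" for v
  using assms by (simp_all add: sum_mid_inner)
 have "(\<Sum>k\<in>mid. (x $ k + r * y $ k / 2) * z $ k) = (\<Sum>k\<in>mid. x $ k * z $ k + (r / 2) * (y $ k * z $ k))"
  by (intro sum.cong refl) (simp add: algebra_simps)
 then show "(\<Sum>k\<in>mid. (x $ k + r * y $ k / 2) * z $ k) = x \<bullet> z + r * (y \<bullet> z) / 2"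
  unfolding sum.distrib sum_distrib_left[symmetric] i by simp
 have "(\<Sum>k\<in>mid. (x $ k + r * y $ k / 2) * (s * z $ k / 2 - u $ k)) =
   (\<Sum>k\<in>mid. - (x $ k * u $ k) + (s / 2) * (x $ k * z $ k) - (r / 2) * (y $ k * u $ k) + (r * s / 4) * (y $ k * z $ k))"
  by (intro sum.cong refl) (simp add: algebra_simps)
 then show "(\<Sum>k\<in>mid. (x $ k + r * y $ k / 2) * (s * z $ k / 2 - u $ k)) =
    - (x \<bullet> u) + s * (x \<bullet> z) / 2 - r * (y \<bullet> u) / 2 + r * s * (y \<bullet> z) / 4"
  unfolding sum.distrib sum_subtractf sum_negf sum_distrib_left[symmetric] i by simp
qed

lemma sum_mid_shape3:
 assumes "supp y"
 shows "(\<Sum>k\<in>mid. y $ k * (s * z $ k / 2 - u $ k)) = - (y \<bullet> u) + s * (y \<bullet> z) / 2"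
proof -
 have "(\<Sum>k\<in>mid. y $ k * (s * z $ k / 2 - u $ k)) = (\<Sum>k\<in>mid. - (y $ k * u $ k) + (s / 2) * (y $ k * z $ k))"
  by (intro sum.cong refl) (simp add: algebra_simps)
 then show ?thesis unfolding sum.distrib sum_negf sum_distrib_left[symmetric] sum_mid_inner[OF assms] by simp
qed

lemma nexp_mult:
 assumes "p \<in> ncar" "q \<in> ncar"
 shows "nexp p ** nexp q = nexp (bch p q)"
proof -
 obtain pp x y et where p: "p = (pp, x, y, et)" "supp x" "supp y" using assms(1) by (cases p) auto
 obtain pp' x' y' et' where q: "q = (pp', x', y', et')" "supp x'" "supp y'" using assms(2) by (cases q) auto
 have "(nexp p ** nexp q) $ i $ j = nexp (bch p q) $ i $ j" for i j
  unfolding mult_entry p(1) q(1)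
  by (cases rule: level5[of i]; cases rule: level5[of j])
    (simp_all add: nexp_def sum_mid_shapes sum_mid_shape3 p q sum_negf sum_mid_inner inner_add_left inner_add_right
     inner_diff_left inner_diff_right
     inner_commute[of y x] inner_commute[of x' x] inner_commute[of x' y] inner_commute[of y' x]
     inner_commute[of y' y] inner_commute[of y' x'],
    simp_all add: field_simps power2_eq_square)
 then show ?thesis by (simp add: vec_eq_iff)
qed

lemma nexp_0 [simp]: "nexp (0, 0, 0, 0) = mat 1" "nexp 0 = mat 1"
proof -
 have "nexp (0, 0, 0, 0) $ i $ j = mat 1 $ i $ j" for i j
  by (cases rule: level5[of i]; cases rule: level5[of j]) (simp_all add: nexp_def mat_def)
 then show "nexp (0, 0, 0, 0) = mat 1" by (simp add: vec_eq_iff)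
 then show "nexp 0 = mat 1" by (simp add: zero_prod_def)
qed

lemma nexp_inj: "p \<in> ncar ==> q \<in> ncar ==> nexp p = nexp q ==> p = q"
proof -
 assume a: "p \<in> ncar" "q \<in> ncar" "nexp p = nexp q"
 obtain pp x y et where p: "p = (pp, x, y, et)" "supp x" "supp y" using a(1) by (cases p) auto
 obtain pp' x' y' et' where q: "q = (pp', x', y', et')" "supp x'" "supp y'" using a(2) by (cases q) auto
 have e: "nexp p $ i $ j = nexp q $ i $ j" for i j using a(3) by simp
 have 1: "pp = pp'" using e[of e1 e2] by (simp add: nexp_def p q)
 have "y $ j = y' $ j" for j
  using e[of e2 j] p(3) q(3) by (cases "j \<in> mid") (simp_all add: nexp_def p q supp_def)
 then have 2: "y = y'" by (simp add: vec_eq_iff)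
 have "x $ j = x' $ j" for j
  using e[of e1 j] p(2) q(2) by (cases "j \<in> mid") (simp_all add: nexp_def p q supp_def 1 2)
 then have 3: "x = x'" by (simp add: vec_eq_iff)
 have "et = et'" using e[of e1 f2] by (simp add: nexp_def p q 1 2 3)
 then show "p = q" using 1 2 3 p q by simp
qed

lemma bch_ncar: "p \<in> ncar ==> q \<in> ncar ==> bch p q \<in> ncar"
 by (cases p; cases q) simp

fun nbr :: "'m nco => 'm nco => 'm nco" where
 "nbr (pp, x, y, et) (pp', x', y', et') = (0, pp *\<^sub>R y' - pp' *\<^sub>R y, 0, x' \<bullet> y - x \<bullet> y')"

lemma bch_nbr: "bch p q = p + q + (1/2) *\<^sub>R nbr p q + (1/12) *\<^sub>R (nbr p (nbr p q) - nbr q (nbr p q))"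
 by (cases p; cases q) (simp add: inner_diff_right diff_divide_distrib[symmetric])

lemma nbr_scale: "nbr (s *\<^sub>R p) q = s *\<^sub>R nbr p q" "nbr p (s *\<^sub>R q) = s *\<^sub>R nbr p q"
 by (cases p; cases q; simp add: algebra_simps)+

lemma nbr_minus: "nbr (- p) q = - nbr p q" "nbr p (- q) = - nbr p q"
 using nbr_scale(1)[of "-1" p q] nbr_scale(2)[of p "-1" q] by simp_all

lemma nbr_add: "nbr (p + q) r = nbr p r + nbr q r" "nbr r (p + q) = nbr r p + nbr r q"
 by (cases p; cases q; cases r; simp add: inner_add_left inner_add_right algebra_simps)+

lemma nbr_diff: "nbr (p - q) r = nbr p r - nbr q r" "nbr r (p - q) = nbr r p - nbr r q"
 using nbr_add(1)[of p "- q" r] nbr_add(2)[of r p "- q"] nbr_minus by simp_all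

lemma nbr_self [simp]: "nbr p p = 0" by (cases p) (simp add: zero_prod_def inner_commute)

lemma nbr_commute: "nbr p q = - nbr q p"
 by (cases p; cases q) (simp add: inner_commute)

lemma nbr_0 [simp]: "nbr p 0 = 0" "nbr 0 p = 0"
 by (cases p; simp add: zero_prod_def)+

lemma nbr_nilpotent: "nbr p (nbr q (nbr r s)) = 0" "nbr (nbr q (nbr r s)) p = 0" "nbr (nbr p q) (nbr r s) = 0"
 by (cases p; cases q; cases r; cases s; simp add: zero_prod_def)+

lemma bch_line: "bch (s *\<^sub>R p) (t *\<^sub>R p) = (s + t) *\<^sub>R p"
 unfolding bch_nbr nbr_scale by (simp add: algebra_simps)

lemma bch_neg: "bch (- p) p = 0" "bch p (- p) = 0" "bch 0 p = p"
 using bch_line[of "-1" p 1] bch_line[of 1 p "-1"] by (simp_all add: bch_nbr)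

lemma bch_inverse: "p \<in> ncar ==> q \<in> ncar ==> bch (- p) (bch p q) = q"
proof (rule nexp_inj)
 assume p: "p \<in> ncar" "q \<in> ncar"
 then have m: "- p \<in> ncar" by (simp add: subspace_neg[OF subspace_ncar])
 show "bch (- p) (bch p q) \<in> ncar" using p m by (intro bch_ncar)
 have "nexp (- p) ** nexp p = mat 1" using p m by (simp add: nexp_mult bch_neg)
 then show "nexp (bch (- p) (bch p q)) = nexp q"
  using p m by (simp add: nexp_mult[symmetric] bch_ncar matrix_mul_assoc)
qed

text \<open>The inverse of \<open>nexp\<close>, read off the first two rows. Its continuity on all
  matrices transports connectedness from the group to the coordinates.\<close>

definition nlog :: "'m sqmat => 'm nco" where
 "nlog h = (let pp = h $ e1 $ e2; y = (\<chi> j. if j \<in> mid then h $ e2 $ j else 0);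
   x = (\<chi> j. if j \<in> mid then h $ e1 $ j else 0) - (pp / 2) *\<^sub>R y
   in (pp, x, y, h $ e1 $ f2 + x \<bullet> y / 2 + pp * (y \<bullet> y) / 6))"

lemma nlog_nexp: "p \<in> ncar ==> nlog (nexp p) = p"
proof -
 assume a: "p \<in> ncar"
 obtain pp x y et where p: "p = (pp, x, y, et)" "supp x" "supp y" using a by (cases p) auto
 have y: "(\<chi> j. if j \<in> mid then nexp p $ e2 $ j else 0) = y"
  using p(3) by (auto simp: vec_eq_iff nexp_def p(1) supp_def)
 have x: "(\<chi> j. if j \<in> mid then nexp p $ e1 $ j else 0) = x + (pp / 2) *\<^sub>R y"
  using p(2,3) by (auto simp: vec_eq_iff nexp_def p(1) supp_def)
 have f: "nexp p $ e1 $ e2 = pp" "nexp p $ e1 $ f2 = et - x \<bullet> y / 2 - pp * (y \<bullet> y) / 6" by (simp_all add: nexp_def p)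
 show ?thesis unfolding nlog_def Let_def f x y by (simp add: p)
qed

lemma continuous_on_if_const:
 fixes f g :: "'a::topological_space => 'b::topological_space"
 shows "continuous_on S f ==> continuous_on S g ==> continuous_on S (\<lambda>x. if P then f x else g x)"
 by (cases P) auto

lemma continuous_on_nlog: "continuous_on S nlog"
 unfolding nlog_def Let_def by (intro continuous_intros continuous_on_if_const) auto

lemma continuous_on_nexp:
 assumes "continuous_on S pp" "continuous_on S x" "continuous_on S y" "continuous_on S et"
 shows "continuous_on S (\<lambda>t. nexp (pp t, x t, y t, et t))"
 unfolding nexp_def prod.case
 by (intro continuous_on_vec_lambda continuous_on_if_const continuous_intros assms) auto

lemma continuous_on_nexp': "continuous_on S nexp"
 using continuous_on_nexp[of S fst "\<lambda>p. fst (snd p)" "\<lambda>p. fst (snd (snd p))" "\<lambda>p. snd (snd (snd p))"]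
 by (simp add: continuous_intros)

text \<open>Preserving the form leaves only the determinants 1 and -1, and a path that starts at the
  identity cannot jump between them.\<close>

lemma SOJ_by_path:
 assumes f: "continuous_on {0..1} f" "f (0::real) = mat 1" and form: "\<And>t. t \<in> {0..1} ==> transpose (f t) ** J ** f t = J"
 shows "f 1 \<in> SOJ"
proof -
 have sq: "det (f t) * det (f t) = 1" if "t \<in> {0..1}" for t
 proof -
  have "det (f t) * det J * det (f t) = det J" using arg_cong[OF form[OF that], of det] by (simp add: det_mul)
  moreover have "det J ~= 0" using det_J_sq by auto
  ultimately show ?thesis by (simp add: mult_ac)
 qed
 have "det (f 1) = 1"
 proof (rule ccontr)
  assume "det (f 1) ~= 1"
  then have "det (f 1) = -1" using sq[of 1] by (simp add: square_eq_1_iff)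
  then obtain t where "t \<in> {0..1}" "det (f t) = 0"
   using IVT2'[of "\<lambda>t. det (f t)" 1 0 0] continuous_on_det[OF f(1)] f(2) by auto
  then show False using sq by force
 qed
 then show ?thesis using form[of 1] by (simp add: SOJ_def)
qed

lemma nexp_form: "p \<in> ncar ==> transpose (nexp p) ** J ** nexp p = J"
proof -
 assume a: "p \<in> ncar"
 obtain pp x y et where p: "p = (pp, x, y, et)" "supp x" "supp y" using a by (cases p) auto
 have "jinv (nexp p) $ i $ j = nexp (- p) $ i $ j" for i j
  by (cases rule: level5[of i]; cases rule: level5[of j]) (simp_all add: jinv_entry nexp_def p)
 then have "jinv (nexp p) = nexp (- p)" by (simp add: vec_eq_iff)
 moreover have "nexp (- p) ** nexp p = mat 1"
  using nexp_mult[of "- p" p] a p by (simp add: bch_neg)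
 ultimately have "J ** transpose (nexp p) ** J ** nexp p = mat 1" by (simp add: jinv_def)
 then show ?thesis by (metis J_J matrix_mul_assoc matrix_mul_lid matrix_mul_rid)
qed

lemma nexp_SOJ: "p \<in> ncar ==> nexp p \<in> SOJ"
 using SOJ_by_path[of "\<lambda>t. nexp (t *\<^sub>R p)"]
 by (simp add: nexp_form subspace_scale[OF subspace_ncar] continuous_on_compose2[OF continuous_on_nexp'[of UNIV]]
   continuous_intros)

text \<open>Conjugation by \<open>dE s t\<close> in coordinates: the four root spaces are scaled by
  the exponentials of the roots s - t, s, t and s + t.\<close>

definition nad :: "real => real => 'm nco => 'm nco" where
 "nad s t p = (case p of (pp, x, y, et) => (exp (s - t) * pp, exp s *\<^sub>R x, exp t *\<^sub>R y, exp (s + t) * et))"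

lemma nad_simp [simp]: "nad s t (pp, x, y, et) = (exp (s - t) * pp, exp s *\<^sub>R x, exp t *\<^sub>R y, exp (s + t) * et)"
 by (simp add: nad_def)

lemma dE_nexp: "dE s t ** nexp p = nexp (nad s t p) ** dE s t"
proof -
 obtain pp x y et where p: "p = (pp, x, y, et)" by (cases p) auto
 have e: "exp (2 * t) = exp t * exp t" "exp (2 * s) = exp s * exp s" for s t :: real
  by (simp_all add: exp_add[symmetric])
 have "(dE s t ** nexp p) $ i $ j = (nexp (nad s t p) ** dE s t) $ i $ j" for i j
  unfolding dE_mult mult_dE
  by (cases rule: level5[of i]; cases rule: level5[of j])
    (simp_all add: nexp_def p exp_add exp_diff exp_minus field_simps power2_eq_square)
 then show ?thesis by (simp add: vec_eq_iff)
qed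

lemma nexp_conj: "dE s t ** nexp p ** dE (- s) (- t) = nexp (nad s t p)"
 unfolding dE_nexp by (simp add: matrix_mul_assoc[symmetric] dE_dE)

lemma nexp_norm_le:
 assumes "supp x" "supp y" "1 <= B" "\<bar>pp\<bar> <= B" "norm x + \<bar>pp\<bar> * norm y <= B" "norm y <= B" "(norm y)\<^sup>2 <= B"
  "\<bar>et - x \<bullet> y / 2 - pp * (y \<bullet> y) / 6\<bar> <= B" "\<bar>- et - x \<bullet> y / 2 + pp * (y \<bullet> y) / 6\<bar> <= B"
  "\<bar>- pp * et - x \<bullet> x / 2 + pp\<^sup>2 * (y \<bullet> y) / 24\<bar> <= B"
 shows "norm (nexp (pp, x, y, et)) <= (real CARD('m))\<^sup>2 * B"
proof (rule norm_le_entries)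
 fix i j
 have c: "\<bar>x $ k\<bar> <= norm x" "\<bar>y $ k\<bar> <= norm y" for k by (rule component_le_norm_cart)+
 have c2: "\<bar>pp * y $ k / 2\<bar> <= \<bar>pp\<bar> * norm y" for k
  using mult_left_mono[OF c(2)[of k], of "\<bar>pp\<bar>"] by (simp add: abs_mult)
    (smt (verit) mult_nonneg_nonneg norm_ge_zero abs_ge_zero)
 have c3: "\<bar>x $ k + pp * y $ k / 2\<bar> <= B" "\<bar>- x $ k + pp * y $ k / 2\<bar> <= B" for k
  using c(1)[of k] c2[of k] assms(5) by linarith+
 have c4: "\<bar>y $ k\<bar> <= B" for k using c(2)[of k] assms(6) by linarith
 have yy: "\<bar>y \<bullet> y / 2\<bar> <= B" using assms(7) inner_ge_zero[of y] unfolding power2_norm_eq_inner by linarith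
 have c3': "\<bar>pp * y $ k / 2 - x $ k\<bar> <= B" for k using c3(2)[of k] by simp
 have B0: "0 <= B" "1 <= B" using assms(3) by auto
 have 9: "\<bar>pp * (y \<bullet> y) / 6 - x \<bullet> y / 2 - et\<bar> <= B" using assms(9) by linarith
 show "\<bar>nexp (pp, x, y, et) $ i $ j\<bar> <= B"
  by (cases rule: level5[of i]; cases rule: level5[of j])
   (simp_all add: nexp_def B0 assms(4,8,9,10)[simplified] c3 c3' c4 yy[simplified], (insert assms(8-10) 9 B0 yy, linarith)?)
qed

end

section \<open>Closed connected subgroups in exponential coordinates\<close>

lemma multiples_mem:
 fixes m :: "'a::real_vector => 'a => 'a"
 assumes "0 \<in> L" "\<And>p q. p \<in> L ==> q \<in> L ==> m p q \<in> L"
  and "\<And>p s t. m (s *\<^sub>R p) (t *\<^sub>R p) = (s + t) *\<^sub>R p" and "p \<in> L"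
 shows "real k *\<^sub>R p \<in> L"
proof (induction k)
 case (Suc k)
 have "real (Suc k) *\<^sub>R p = m (real k *\<^sub>R p) (1 *\<^sub>R p)" unfolding assms(3) by (simp add: add.commute)
 then show ?case using assms(2)[OF Suc assms(4)] by simp
qed (use assms in simp)

text \<open>The Lie product formula: \<open>k\<close> times the product of the \<open>k\<close>-th
  parts of \<open>t *\<^sub>R p\<close> and \<open>t *\<^sub>R q\<close> tends to
  \<open>t *\<^sub>R (p + q)\<close>, because a single product deviates from the sum only to second
  order.\<close>

lemma one_parameter_subspace:
 fixes m :: "'a::euclidean_space => 'a => 'a"
 assumes "closed L" and L: "0 \<in> L" "\<And>p q. p \<in> L ==> q \<in> L ==> m p q \<in> L"
  and sc: "\<And>p s t. m (s *\<^sub>R p) (t *\<^sub>R p) = (s + t) *\<^sub>R p"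
  and near: "\<And>p q. norm p <= 1 ==> norm q <= 1 ==> norm (m p q - p - q) <= C * norm p * norm q"
 shows "subspace {p. \<forall>t. t *\<^sub>R p \<in> L}"
 unfolding subspace_def
proof (intro conjI ballI allI)
 show "0 \<in> {p. \<forall>t. t *\<^sub>R p \<in> L}" using L by simp
 show "c *\<^sub>R p \<in> {p. \<forall>t. t *\<^sub>R p \<in> L}" if "p \<in> {p. \<forall>t. t *\<^sub>R p \<in> L}" for c p using that by simp
 fix p q assume p: "p \<in> {p. \<forall>t. t *\<^sub>R p \<in> L}" and q: "q \<in> {p. \<forall>t. t *\<^sub>R p \<in> L}"
 have "t *\<^sub>R (p + q) \<in> L" for t
 proof -
  define Z where "Z k = real k *\<^sub>R m ((t / real k) *\<^sub>R p) ((t / real k) *\<^sub>R q)" for k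
  have ZL: "Z k \<in> L" for k
   unfolding Z_def using p q by (intro multiples_mem[of L m] L sc) auto
  have lim: "(\<lambda>k. B / real k) \<longlonglongrightarrow> 0" for B :: real
   using tendsto_mult_right_zero[OF lim_inverse_n, of B] by (simp add: divide_inverse)
  have "eventually (\<lambda>k. norm (Z k - t *\<^sub>R (p + q)) <= (C * t\<^sup>2 * norm p * norm q) / real k) sequentially"
  proof -
   have "eventually (\<lambda>k. \<bar>t\<bar> * norm r / real k < 1) sequentially" for r :: 'a
    using order_tendstoD(2)[OF lim[of "\<bar>t\<bar> * norm r"], of 1] by simp
   then have "eventually (\<lambda>k. \<bar>t\<bar> * norm p / real k < 1 \<and> \<bar>t\<bar> * norm q / real k < 1 \<and> k > 0) sequentially"
    by (intro eventually_conj eventually_gt_at_top) auto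
   then show ?thesis
   proof (rule eventually_mono)
    fix k assume k: "\<bar>t\<bar> * norm p / real k < 1 \<and> \<bar>t\<bar> * norm q / real k < 1 \<and> k > 0"
    let ?p = "(t / real k) *\<^sub>R p" and ?q = "(t / real k) *\<^sub>R q"
    have "Z k - t *\<^sub>R (p + q) = real k *\<^sub>R (m ?p ?q - ?p - ?q)"
     using k by (simp add: Z_def scaleR_right_diff_distrib scaleR_right_distrib)
    also have "norm \<dots> = real k * norm (m ?p ?q - ?p - ?q)" by simp
    also have "\<dots> <= real k * (C * norm ?p * norm ?q)"
     by (rule mult_left_mono[OF near]) (use k in auto)
    also have "\<dots> = (C * t\<^sup>2 * norm p * norm q) / real k"
     using k by (simp add: power2_eq_square abs_mult_self_eq)
    finally show "norm (Z k - t *\<^sub>R (p + q)) <= (C * t\<^sup>2 * norm p * norm q) / real k" .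
   qed
  qed
  from Lim_null_comparison[OF this lim] have "Z \<longlonglongrightarrow> t *\<^sub>R (p + q)" by (rule Lim_null[THEN iffD2])
  then show ?thesis using closed_sequentially[OF \<open>closed L\<close>] ZL by blast
 qed
 then show "p + q \<in> {p. \<forall>t. t *\<^sub>R p \<in> L}" by simp
qed

text \<open>
 An element of \<open>L\<close> near the identity outside the subspace \<open>U\<close> of one-parameter subgroups is moved by \<open>U\<close> to one
 of minimal norm in its coset. A limit of directions of such minimal elements lies in \<open>U\<close>, and subtracting it
 shortens them, a contradiction.
\<close>

lemma subspace_of_closed_connected:
 fixes m :: "'a::euclidean_space => 'a => 'a"
 assumes "closed L" "connected L" and L: "0 \<in> L" "\<And>p q. p \<in> L ==> q \<in> L ==> m p q \<in> L" "\<And>p. p \<in> L ==> - p \<in> L"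
  and sc: "\<And>p s t. m (s *\<^sub>R p) (t *\<^sub>R p) = (s + t) *\<^sub>R p"
  and near: "\<And>p q. norm p <= 1 ==> norm q <= 1 ==> norm (m p q - p - q) <= C * norm p * norm q"
  and id: "\<And>p. m 0 p = p" and inv: "\<And>p q. p \<in> L ==> q \<in> L ==> m (- p) (m p q) = q"
  and assoc: "\<And>p q r. p \<in> L ==> q \<in> L ==> r \<in> L ==> m (m p q) r = m p (m q r)"
  and cont: "\<And>q. continuous_on UNIV (\<lambda>p. m p q)" "\<And>p. continuous_on UNIV (m p)"
  and U: "\<And>p q. (\<And>t. t *\<^sub>R p \<in> L) ==> (\<And>t. t *\<^sub>R q \<in> L) ==> \<forall>t. t *\<^sub>R m p q \<in> L"
 shows "subspace L" "\<And>p q. p \<in> L ==> q \<in> L ==> m p q \<in> L"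
proof -
 define U where "U = {p. \<forall>t. t *\<^sub>R p \<in> L}"
 have sub: "subspace U" unfolding U_def by (rule one_parameter_subspace[OF assms(1) L(1,2) sc near])
 have UL: "U \<subseteq> L" unfolding U_def by (auto dest: spec[of _ 1])
 have Um: "m p q \<in> U" if "p \<in> U" "q \<in> U" for p q using U that unfolding U_def by blast
 have cU: "closed U" using sub by (rule closed_subspace)
 have m0: "m p (- p) = 0" "m p 0 = p" for p
  using sc[of 1 p "-1"] sc[of 1 p 0] by simp_all
 \<comment> \<open>The nonzero elements of \<open>L\<close> that are shortest in their
   \<open>U\<close>-coset.\<close>
 define W where "W = {w \<in> L. w ~= 0 \<and> (\<forall>X\<in>U. norm w <= norm (m X w))}"
 have reduce: "\<exists>w\<in>W. norm w <= norm z" if z: "z \<in> L" "z \<notin> U" for z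
 proof -
  \<comment> \<open>The competitors that do not lengthen \<open>z\<close> form a compact set, since
    \<open>X\<close> is recovered from the bounded product \<open>m X z\<close> by multiplying with
    \<open>- z\<close>.\<close>
  let ?D = "U \<inter> (\<lambda>w. m w (- z)) ` cball 0 (norm z)"
  have "compact ((\<lambda>w. m w (- z)) ` cball 0 (norm z))"
   by (intro compact_continuous_image continuous_on_subset[OF cont(1)]) auto
  from compact_Int_closed[OF this cU] have "compact ?D" by (simp add: Int_commute)
  moreover have "0 \<in> ?D"
  proof
   show "0 \<in> U" using sub by (rule subspace_0)
   show "0 \<in> (\<lambda>w. m w (- z)) ` cball 0 (norm z)" using m0(1)[of z] by (intro image_eqI[of _ _ z]) auto
  qed
  ultimately obtain X0 where X0: "X0 \<in> ?D" "\<And>X. X \<in> ?D ==> norm (m X0 z) <= norm (m X z)"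
   using continuous_attains_inf[of ?D "\<lambda>X. norm (m X z)"] continuous_on_subset[OF continuous_on_norm[OF cont(1)]]
   by (metis empty_iff subset_UNIV)
  have zz: "norm (m X0 z) <= norm z" using X0(2)[OF \<open>0 \<in> ?D\<close>] id by simp
  have all: "norm (m X0 z) <= norm (m X z)" if "X \<in> U" for X
  proof (cases "norm (m X z) <= norm z")
   case True
   have "m (m X z) (- z) = X" using assoc[of X z "- z"] that UL L(3) z m0 by auto
   then have "X \<in> ?D" using True that by (intro IntI) (auto intro!: image_eqI[of _ _ "m X z"])
   then show ?thesis by (rule X0(2))
  qed (use zz in linarith)
  have X0U: "X0 \<in> U" using X0 by simp
  have "m X0 z ~= 0"
  proof
   assume "m X0 z = 0"
   then have "z = - X0" using inv[of X0 z] m0(2) UL X0U z(1) by auto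
   then show False using z(2) X0U sub by (simp add: subspace_neg)
  qed
  moreover have "norm (m X0 z) <= norm (m X (m X0 z))" if "X \<in> U" for X
   using all[OF Um[OF that X0U]] assoc[OF subsetD[OF UL that] subsetD[OF UL X0U] z(1)] by simp
  ultimately have "m X0 z \<in> W" unfolding W_def using L(2)[of X0 z] X0U UL z(1) by blast
  then show ?thesis using zz by blast
 qed
 have "\<exists>\<epsilon>>0. \<forall>z\<in>L. norm z < \<epsilon> \<longrightarrow> z \<in> U"
 proof (rule ccontr)
  assume "\<not> ?thesis"
  then have neg: "\<exists>z\<in>L. norm z < \<epsilon> \<and> z \<notin> U" if "\<epsilon> > 0" for \<epsilon> using that by blast
  have "\<exists>w\<in>W. norm w < 1 / real (Suc k)" for k
   using neg[of "1 / real (Suc k)"] reduce by (metis le_less_trans zero_less_divide_1_iff of_nat_0_less_iff zero_less_Suc)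
  then obtain w where w: "\<And>k. w k \<in> W" "\<And>k. norm (w k) < 1 / real (Suc k)" by metis
  have w0: "w k ~= 0" "w k \<in> L" for k using w(1) by (auto simp: W_def)
  define d where "d k = (1 / norm (w k)) *\<^sub>R w k" for k
  have "d k \<in> sphere 0 1" for k using w0 by (simp add: d_def)
  then obtain v r where v: "v \<in> sphere 0 1" "strict_mono (r :: nat => nat)" "(d \<circ> r) \<longlonglongrightarrow> v"
   using compact_sphere[of 0 1, unfolded compact_def] by metis
  have wlim: "(\<lambda>k. norm (w k)) \<longlonglongrightarrow> 0"
  proof (rule tendsto_sandwich[OF _ _ tendsto_const LIMSEQ_Suc[OF lim_inverse_n]])
   show "eventually (\<lambda>k. norm (w k) <= inverse (real (Suc k))) sequentially"
    using w(2) by (intro always_eventually) (auto simp: inverse_eq_divide less_imp_le)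
  qed auto
  then have wr: "(\<lambda>k. norm (w (r k))) \<longlonglongrightarrow> 0" using LIMSEQ_subseq_LIMSEQ[OF wlim v(2)] by (simp add: o_def)
  \<comment> \<open>For \<open>t >= 0\<close> the vector \<open>t *\<^sub>R v\<close> is a limit of
    integer multiples of \<open>w (r k)\<close>; rounding \<open>t / norm (w (r k))\<close> costs at
    most one step, whose length tends to 0.\<close>
  have "v \<in> U" unfolding U_def
  proof (intro CollectI allI)
   have pos: "t *\<^sub>R v \<in> L" if "t >= 0" for t
   proof -
    define N where "N k = nat \<lfloor>t / norm (w (r k))\<rfloor>" for k
    have NL: "real (N k) *\<^sub>R w (r k) \<in> L" for k by (intro multiples_mem[of L m] L sc w0)
    have NN: "\<bar>real (N k) * norm (w (r k)) - t\<bar> <= norm (w (r k))" for k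
    proof -
     let ?n = "norm (w (r k))"
     have n: "?n > 0" using w0 by simp
     have "t / ?n >= 0" using that by simp
     then have "real (N k) = of_int \<lfloor>t / ?n\<rfloor>" unfolding N_def by simp
     then have "real (N k) <= t / ?n" "t / ?n <= real (N k) + 1" by linarith+
     then have "real (N k) * ?n <= t" "t <= (real (N k) + 1) * ?n" using n by (simp_all add: pos_le_divide_eq pos_divide_le_eq)
     then show ?thesis by (simp add: distrib_right)
    qed
    have "(\<lambda>k. real (N k) * norm (w (r k)) - t) \<longlonglongrightarrow> 0"
     by (rule Lim_null_comparison[OF _ wr]) (use NN in auto)
    then have "(\<lambda>k. real (N k) * norm (w (r k))) \<longlonglongrightarrow> t" by (rule Lim_null[THEN iffD2])
    from tendsto_scaleR[OF this v(3)] have "(\<lambda>k. real (N k) *\<^sub>R w (r k)) \<longlonglongrightarrow> t *\<^sub>R v"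
     using w0 by (simp add: d_def o_def)
    then show ?thesis by (rule closed_sequentially[OF \<open>closed L\<close> NL])
   qed
   fix t
   show "t *\<^sub>R v \<in> L" using pos[of t] L(3)[OF pos[of "- t"]] by (cases "t >= 0") auto
  qed
  have "(\<lambda>k. norm (d (r k) - v) + C * norm (w (r k))) \<longlonglongrightarrow> 0 + C * 0"
   using tendsto_norm_zero[OF LIM_zero[OF v(3)[unfolded o_def]]] wr by (intro tendsto_add tendsto_mult tendsto_const)
  then have l0: "(\<lambda>k. norm (d (r k) - v) + C * norm (w (r k))) \<longlonglongrightarrow> 0" by simp
  have "eventually (\<lambda>k. norm (d (r k) - v) + C * norm (w (r k)) < 1 \<and> norm (w (r k)) < 1) sequentially"
   using order_tendstoD(2)[OF wr, of 1] order_tendstoD(2)[OF l0, of 1] by (intro eventually_conj) auto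
  then obtain k where k: "norm (d (r k) - v) + C * norm (w (r k)) < 1" "norm (w (r k)) < 1"
   using eventually_happens'[OF sequentially_bot] by blast
  \<comment> \<open>\<open>?X\<close> belongs to \<open>U\<close> and nearly cancels
    \<open>?w\<close>: what remains is the deviation of direction and the second order error,
    together shorter than \<open>?w\<close>.\<close>
  let ?w = "w (r k)" let ?X = "- (norm ?w *\<^sub>R v)"
  have "?X \<in> U" using \<open>v \<in> U\<close> sub by (intro subspace_neg subspace_scale)
  then have "norm ?w <= norm (m ?X ?w)" using w(1)[of "r k"] by (auto simp: W_def)
  also have "m ?X ?w = (m ?X ?w - ?X - ?w) + norm ?w *\<^sub>R (d (r k) - v)"
   using w0[of "r k"] by (simp add: d_def scaleR_right_diff_distrib)
  also have "norm \<dots> <= C * norm ?X * norm ?w + norm ?w * norm (d (r k) - v)"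
   using near[of ?X ?w] k(2) v(1) by (intro norm_triangle_le add_mono) auto
  also have "\<dots> = norm ?w * (norm (d (r k) - v) + C * norm ?w)"
   using v(1) by (simp add: algebra_simps)
  also have "\<dots> < norm ?w * 1" using k(1) w0 by (intro mult_strict_left_mono) auto
  finally show False by simp
 qed
 then obtain \<epsilon> where \<epsilon>: "\<epsilon> > 0" "\<And>z. z \<in> L ==> norm z < \<epsilon> ==> z \<in> U" by blast
 \<comment> \<open>A neighbourhood of 0 in \<open>L\<close> lies in \<open>U\<close>, and
   translation by elements of \<open>U\<close> carries this to every point of \<open>U\<close>.
   Being also closed, \<open>U\<close> exhausts the connected set \<open>L\<close>.\<close>
 have "openin (top_of_set L) U"
  unfolding openin_contains_ball
 proof (intro conjI ballI)
  show "U \<subseteq> L" by (rule UL)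
  fix X assume X: "X \<in> U"
  have "m (- X) X = 0" using m0(1)[of "- X"] by simp
  then have "(m (- X) \<longlongrightarrow> 0) (at X)"
   using cont(2)[of "- X"] unfolding continuous_on_def by (metis UNIV_I)
  then obtain de where de: "de > 0" "\<And>z. z ~= X ==> dist z X < de ==> norm (m (- X) z) < \<epsilon>"
   using \<epsilon>(1) unfolding Lim_at by (metis dist_0_norm dist_commute zero_less_dist_iff)
  have "ball X de \<inter> L \<subseteq> U"
  proof
   fix z assume z: "z \<in> ball X de \<inter> L"
   show "z \<in> U"
   proof (cases "z = X")
    case False
    then have "norm (m (- X) z) < \<epsilon>" using de(2) z by (auto simp: dist_commute)
    moreover have "m (- X) z \<in> L" using L X UL z by blast
    ultimately have "m (- X) z \<in> U" using \<epsilon>(2) by blast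
    then have "m X (m (- X) z) \<in> U" using Um X by blast
    then show ?thesis using inv[of "- X" z] L(3) X UL z by auto
   qed (use X in simp)
  qed
  then show "\<exists>e>0. ball X e \<inter> L \<subseteq> U" using de(1) by blast
 qed
 moreover have "closedin (top_of_set L) U" using cU UL by (simp add: closed_subset)
 ultimately have "U = {} \<or> U = L" using \<open>connected L\<close> unfolding connected_clopen by blast
 then have "U = L" using subspace_0[OF sub] by blast
 then show "subspace L" using sub by simp
qed (rule L)

context levels
begin

text \<open>Conjugation is the exponential of the adjoint action, whose series stops at the second
  power by nilpotency.\<close>

lemma bch_Ad: "bch (bch p q) (- p) = q + nbr p q + (1/2) *\<^sub>R nbr p (nbr p q)"
proof -
 define B where "B = nbr p q"
 define R where "R = bch p q"
 have R: "R = p + q + (1/2) *\<^sub>R B + (1/12) *\<^sub>R (nbr p B - nbr q B)"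
  unfolding R_def B_def by (rule bch_nbr)
 have "nbr R (- p) = nbr p R" using nbr_commute[of R p] by (simp add: nbr_minus)
 moreover have pR: "nbr p R = B + (1/2) *\<^sub>R nbr p B"
  unfolding R by (simp add: nbr_add nbr_diff nbr_scale B_def nbr_nilpotent)
 moreover have "nbr R (nbr p R) = nbr p B + nbr q B" "nbr p (nbr p R) = nbr p B"
  unfolding pR unfolding R by (simp_all add: nbr_add nbr_diff nbr_scale B_def nbr_nilpotent)
 ultimately have "bch R (- p) = R + - p + (1/2) *\<^sub>R (B + (1/2) *\<^sub>R nbr p B)
    + (1/12) *\<^sub>R (nbr p B + nbr q B + nbr p B)"
  unfolding bch_nbr by (simp add: nbr_minus)
 also have "\<dots> = q + B + (1/2) *\<^sub>R nbr p B"
  unfolding R by (simp add: prod_eq_iff vec_eq_iff field_simps)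
 finally show ?thesis by (simp add: R_def B_def)
qed

lemma bch_near: "norm p <= 1 ==> norm q <= 1 ==> norm (bch p q - p - q) <= 3 * norm p * norm q"
proof -
 assume n: "norm p <= 1" "norm q <= 1"
 obtain pp x y et where p: "p = (pp, x, y, et)" by (cases p) auto
 obtain pp' x' y' et' where q: "q = (pp', x', y', et')" by (cases q) auto
 have c: "\<bar>pp\<bar> <= norm p" "norm x <= norm p" "norm y <= norm p"
  "\<bar>pp'\<bar> <= norm q" "norm x' <= norm q" "norm y' <= norm q"
  unfolding p q real_norm_def[symmetric]
  by (meson norm_fst_le norm_snd_le order_trans)+
 let ?c = "pp *\<^sub>R y' - pp' *\<^sub>R y" and ?e = "x' \<bullet> y - x \<bullet> y'" and ?P = "norm p * norm q"
 have nc: "norm ?c <= 2 * ?P"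
 proof -
  have "norm ?c <= \<bar>pp\<bar> * norm y' + \<bar>pp'\<bar> * norm y" by (rule order_trans[OF norm_triangle_ineq4]) simp
  also have "\<dots> <= norm p * norm q + norm q * norm p" by (intro add_mono mult_mono c) auto
  finally show ?thesis by simp
 qed
 have ne: "\<bar>?e\<bar> <= 2 * ?P"
 proof -
  have "\<bar>?e\<bar> <= norm x' * norm y + norm x * norm y'"
   using Cauchy_Schwarz_ineq2[of x' y] Cauchy_Schwarz_ineq2[of x y'] by linarith
  also have "\<dots> <= norm q * norm p + norm p * norm q" by (intro add_mono mult_mono c) auto
  finally show ?thesis by simp
 qed
 have nd: "\<bar>?c \<bullet> (y - y')\<bar> <= 4 * ?P"
 proof -
  have "norm (y - y') <= 2" using norm_triangle_ineq4[of y y'] c n by linarith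
  then have "norm ?c * norm (y - y') <= (2 * ?P) * 2" using nc by (intro mult_mono) auto
  then show ?thesis using Cauchy_Schwarz_ineq2[of ?c "y - y'"] by linarith
 qed
 have "bch p q - p - q = (0, (1/2) *\<^sub>R ?c, 0, ?e / 2 + (?c \<bullet> (y - y')) / 12)"
  by (simp add: p q)
 then have "norm (bch p q - p - q) = norm (0::real, (1/2) *\<^sub>R ?c, 0::'m vc, ?e / 2 + (?c \<bullet> (y - y')) / 12)" by simp
 also have "\<dots> = norm ((1/2) *\<^sub>R ?c, 0::'m vc, ?e / 2 + (?c \<bullet> (y - y')) / 12)" by (simp add: norm_Pair)
 also have "\<dots> <= norm ((1/2) *\<^sub>R ?c) + norm (0::'m vc, ?e / 2 + (?c \<bullet> (y - y')) / 12)" by (rule norm_Pair_le)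
 also have "norm (0::'m vc, ?e / 2 + (?c \<bullet> (y - y')) / 12) = \<bar>?e / 2 + (?c \<bullet> (y - y')) / 12\<bar>" by (simp add: norm_Pair)
 also have "norm ((1/2) *\<^sub>R ?c) + \<bar>?e / 2 + (?c \<bullet> (y - y')) / 12\<bar> <= 3 * ?P"
 proof -
  have gen: "c / 2 + \<bar>e / 2 + d / 12\<bar> <= 3 * P" if "c <= 2 * P" "\<bar>e\<bar> <= 2 * P" "\<bar>d\<bar> <= 4 * P" "0 <= P" for c d e P :: real
   using that by linarith
  have "norm ((1/2) *\<^sub>R ?c) = norm ?c / 2" by simp
  moreover have "0 <= ?P" by simp
  ultimately show ?thesis using gen[OF nc ne nd] by (simp only:)
 qed
 finally show ?thesis by simp
qed

lemma bch_alt: "bch p q = (fst p + fst q,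
  fst (snd p) + fst (snd q) + (1/2) *\<^sub>R (fst p *\<^sub>R fst (snd (snd q)) - fst q *\<^sub>R fst (snd (snd p))),
  fst (snd (snd p)) + fst (snd (snd q)),
  snd (snd (snd p)) + snd (snd (snd q)) + (fst (snd q) \<bullet> fst (snd (snd p)) - fst (snd p) \<bullet> fst (snd (snd q))) / 2
  + ((fst p *\<^sub>R fst (snd (snd q)) - fst q *\<^sub>R fst (snd (snd p))) \<bullet> (fst (snd (snd p)) - fst (snd (snd q)))) / 12)"
 by (cases p; cases q) simp

lemma continuous_on_bch: "continuous_on UNIV (\<lambda>p. bch p q)" "continuous_on UNIV (bch p)"
 unfolding bch_alt by (intro continuous_intros; simp)+

lemma bch_assoc: "p \<in> ncar ==> q \<in> ncar ==> r \<in> ncar ==> bch (bch p q) r = bch p (bch q r)"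
 by (rule nexp_inj) (simp_all add: bch_ncar nexp_mult[symmetric] matrix_mul_assoc)

text \<open>Closedness and connectedness pass to logarithmic coordinates, where the general result
  on subspaces applies as soon as the one-parameter directions are closed under brackets and hence
  under \<open>bch\<close>.\<close>

lemma unipotent_subgroup:
 assumes K: "closed K" "connected K" "K \<subseteq> nexp ` ncar" "mat 1 \<in> K" "\<And>g h. g \<in> K ==> h \<in> K ==> g ** h \<in> K"
  "\<And>g. g \<in> K ==> jinv g \<in> K"
 obtains U where "subspace U" "U \<subseteq> ncar" "K = nexp ` U" "\<And>p q. p \<in> U ==> q \<in> U ==> nbr p q \<in> U"
proof -
 define L where "L = {p \<in> ncar. nexp p \<in> K}"
 have "L = ncar \<inter> (nexp -` K)" by (auto simp: L_def)
 moreover have "closed (nexp -` K)" using K(1) continuous_on_nexp'[of UNIV] by (simp add: closed_vimage continuous_on_eq_continuous_within continuous_at_imp_continuous_on)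
 ultimately have clL: "closed L" using closed_subspace[OF subspace_ncar] by auto
 have "L = nlog ` K"
 proof
  show "L \<subseteq> nlog ` K"
  proof
   fix p assume "p \<in> L"
   then show "p \<in> nlog ` K" using nlog_nexp[of p] by (intro image_eqI[of _ _ "nexp p"]) (auto simp: L_def)
  qed
  show "nlog ` K \<subseteq> L"
  proof
   fix p assume "p \<in> nlog ` K"
   then obtain g q where "g \<in> K" "g = nexp q" "q \<in> ncar" "p = nlog g" using K(3) by blast
   then show "p \<in> L" by (simp add: L_def nlog_nexp)
  qed
 qed
 then have conL: "connected L" using K(2) continuous_on_nlog connected_continuous_image by metis
 have KL: "K = nexp ` L" using K(3) by (auto simp: L_def)
 have L0: "0 \<in> L" using K(4) by (simp add: L_def zero_prod_def[symmetric] subspace_0[OF subspace_ncar])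
 have Lm: "bch p q \<in> L" if "p \<in> L" "q \<in> L" for p q
  using that K(5) by (auto simp: L_def bch_ncar nexp_mult[symmetric])
 have Ln: "- p \<in> L" if "p \<in> L" for p
 proof -
  have p: "p \<in> ncar" "- p \<in> ncar" using that subspace_neg[OF subspace_ncar] by (auto simp: L_def)
  have "nexp (- p) = jinv (nexp p)"
  proof -
   have "nexp (- p) ** nexp p = mat 1" using p by (simp add: nexp_mult bch_neg)
   moreover have "nexp p ** jinv (nexp p) = mat 1" using nexp_SOJ[OF p(1)] by (intro jinv_right) (simp add: SOJ_def)
   ultimately show ?thesis by (metis matrix_mul_assoc matrix_mul_lid matrix_mul_rid)
  qed
  then show ?thesis using that K(6) p by (auto simp: L_def)
 qed
 define U where "U = {p. \<forall>t. t *\<^sub>R p \<in> L}"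
 have sub: "subspace U" unfolding U_def
  by (rule one_parameter_subspace[OF clL L0 Lm bch_line bch_near])
 have Ubr: "nbr p q \<in> U" if "p \<in> U" "q \<in> U" for p q
 proof -
  have Ad: "q + nbr p q + (1/2) *\<^sub>R nbr p (nbr p q) \<in> U" if "p \<in> U" for p
   unfolding U_def
  proof (intro CollectI allI)
   fix t
   have "p \<in> L" "t *\<^sub>R q \<in> L" using that \<open>q \<in> U\<close> unfolding U_def by (auto dest: spec[of _ 1])
   then have "bch (bch p (t *\<^sub>R q)) (- p) \<in> L" by (intro Lm Ln)
   then show "t *\<^sub>R (q + nbr p q + (1/2) *\<^sub>R nbr p (nbr p q)) \<in> L"
    unfolding bch_Ad nbr_scale by (simp add: algebra_simps)
  qed
  \<comment> \<open>The terms that are even in \<open>p\<close> cancel between \<open>p\<close> and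
    \<open>- p\<close>, leaving twice the bracket.\<close>
  have "(q + nbr p q + (1/2) *\<^sub>R nbr p (nbr p q)) - (q + nbr (- p) q + (1/2) *\<^sub>R nbr (- p) (nbr (- p) q)) \<in> U"
   by (intro subspace_diff sub Ad subspace_neg that)
  then have "2 *\<^sub>R nbr p q \<in> U" by (simp add: nbr_minus scaleR_2)
  from subspace_scale[OF sub this, of "1/2"] show ?thesis by simp
 qed
 have "subspace L"
 proof (rule subspace_of_closed_connected(1)[OF clL conL L0 Lm Ln bch_line bch_near bch_neg(3) _ _ continuous_on_bch])
  show "bch (- p) (bch p q) = q" if "p \<in> L" "q \<in> L" for p q
   using that by (intro bch_inverse) (auto simp: L_def)
  show "bch (bch p q) r = bch p (bch q r)" if "p \<in> L" "q \<in> L" "r \<in> L" for p q r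
   using that by (intro bch_assoc) (auto simp: L_def)
  show "\<forall>t. t *\<^sub>R bch p q \<in> L" if "\<And>t. t *\<^sub>R p \<in> L" "\<And>t. t *\<^sub>R q \<in> L" for p q
  proof -
   have pq: "p \<in> U" "q \<in> U" using that by (auto simp: U_def)
   have "bch p q \<in> U" unfolding bch_nbr by (intro subspace_add subspace_diff subspace_scale sub Ubr pq)
   then show ?thesis by (simp add: U_def)
  qed
 qed
 note sL = this
 have UL: "U = L" unfolding U_def using subspace_scale[OF sL] by (auto dest: spec[of _ 1])
 show ?thesis
 proof (rule that[OF sL _ KL])
  show "L \<subseteq> ncar" by (auto simp: L_def)
  show "nbr p q \<in> L" if "p \<in> L" "q \<in> L" for p q using Ubr[of p q] that unfolding UL .
 qed
qed

text \<open>In the coordinates \<open>(s, t)\<close> the torus is a vector group, so this is the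
  general result with addition as product and error constant 0.\<close>

lemma diagonal_subgroup:
 assumes K: "closed K" "connected K" "K \<subseteq> range (\<lambda>p. dE (fst p) (snd p))" "mat 1 \<in> K"
  "\<And>g h. g \<in> K ==> h \<in> K ==> g ** h \<in> K" "\<And>g. g \<in> K ==> jinv g \<in> K"
 obtains V where "subspace V" "K = (\<lambda>p. dE (fst p) (snd p)) ` V"
proof -
 let ?d = "\<lambda>p. dE (fst p) (snd p)" and ?l = "\<lambda>g :: 'm sqmat. (ln (g $ e1 $ e1), ln (g $ e2 $ e2))"
 define L where "L = {p. ?d p \<in> K}"
 have cd: "continuous_on UNIV ?d" unfolding dE_def dA_def adiag_exp wt_def
  by (intro continuous_intros continuous_on_if_const)
 have ld: "?l (?d p) = p" for p by (simp add: dE_entry)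
 have "closed L" unfolding L_def using continuous_closed_preimage[OF cd closed_UNIV K(1)] by (simp add: vimage_def)
 moreover have LK: "L = ?l ` K"
 proof
  show "L \<subseteq> ?l ` K"
  proof
   fix p assume "p \<in> L"
   then show "p \<in> ?l ` K" using ld[of p] by (intro image_eqI[of _ _ "?d p"]) (auto simp: L_def)
  qed
  show "?l ` K \<subseteq> L"
  proof
   fix p assume "p \<in> ?l ` K"
   then obtain g where g: "g \<in> K" "p = ?l g" by blast
   then obtain q where "g = ?d q" using K(3) by blast
   then show "p \<in> L" using g ld[of q] by (simp add: L_def)
  qed
 qed
 moreover have "continuous_on K ?l"
 proof (intro continuous_intros ballI)
  fix g assume "g \<in> K"
  then obtain p where "g = ?d p" using K(3) by blast
  then show "g $ e1 $ e1 ~= 0" "g $ e2 $ e2 ~= 0" by (simp_all add: dE_entry)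
 qed
 ultimately have conL: "connected L" "closed L" using K(2) by (simp_all only: connected_continuous_image)
 have "jinv (?d p) = ?d (- p)" for p
  by (auto simp: vec_eq_iff jinv_entry dE_entry opp_eq_iff) (metis level5 opp_simps wt_simps minus_minus neg_equal_zero minus_zero)
 then have Ln: "- p \<in> L" if "p \<in> L" for p using that K(6)[of "?d p"] by (simp add: L_def)
 have "subspace L"
 proof (rule subspace_of_closed_connected(1)[OF conL(2,1), of "(+)" 0])
  show "0 \<in> L" using K(4) by (simp add: L_def)
  show "p + q \<in> L" if "p \<in> L" "q \<in> L" for p q
   using that K(5)[of "?d p" "?d q"] by (simp add: L_def dE_dE)
  show "\<forall>t. t *\<^sub>R (p + q) \<in> L" if "\<And>t. t *\<^sub>R p \<in> L" "\<And>t. t *\<^sub>R q \<in> L" for p q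
   using that K(5)[of "?d (_ *\<^sub>R p)" "?d (_ *\<^sub>R q)"] by (simp add: L_def dE_dE distrib_left)
 qed (auto simp: Ln scaleR_left_distrib intro!: continuous_intros)
 moreover have "K = ?d ` L" using K(3) by (auto simp: L_def)
 ultimately show ?thesis using that by blast
qed

end

section \<open>The matrix exponential\<close>

definition mpow :: "'n::finite sqmat => nat => 'n sqmat" where "mpow X k = ((**) X ^^ k) (mat 1)"

lemma mpow_0 [simp]: "mpow X 0 = mat 1" and mpow_Suc: "mpow X (Suc k) = X ** mpow X k"
 by (simp_all add: mpow_def)

lemma matrix_mult_scaleR: "(c *\<^sub>R A) ** B = c *\<^sub>R (A ** B)" "A ** (c *\<^sub>R B) = c *\<^sub>R (A ** B)"
 for A B :: "'n::finite sqmat"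
 by (simp_all add: vec_eq_iff matrix_matrix_mult_def sum_distrib_left mult_ac)

lemma matrix_mult_minus: "(- A) ** B = - (A ** B)" "A ** (- B) = - (A ** B)"
 for A B :: "'n::finite sqmat"
 using matrix_mult_scaleR(1)[of "-1" A B] matrix_mult_scaleR(2)[of A "-1" B] by simp_all

lemma matrix_mult_add_left: "(A + B) ** C = A ** C + B ** C" and matrix_mult_diff_left: "(A - B) ** C = A ** C - B ** C"
 for A B C :: "'n::finite sqmat"
 by (simp_all add: matrix_matrix_mult_def vec_eq_iff sum.distrib sum_subtractf algebra_simps)

lemma mpow_scale: "mpow (t *\<^sub>R X) k = t ^ k *\<^sub>R mpow X k"
 by (induction k) (simp_all add: mpow_Suc matrix_mult_scaleR mult_ac)

lemma mpow_entry_le: "\<bar>mpow X k $ i $ j\<bar> <= (real CARD('n) * norm X) ^ k" for X :: "'n::finite sqmat"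
proof (induction k arbitrary: i j)
 case 0 then show ?case by (simp add: mat_def)
next
 case (Suc k)
 have "\<bar>mpow X (Suc k) $ i $ j\<bar> <= (\<Sum>l\<in>(UNIV::'n set). \<bar>X $ i $ l\<bar> * \<bar>mpow X k $ l $ j\<bar>)"
  unfolding mpow_Suc matrix_matrix_mult_def by (simp add: order_trans[OF sum_abs] abs_mult)
 also have "\<dots> <= (\<Sum>l\<in>(UNIV::'n set). norm X * (real CARD('n) * norm X) ^ k)"
  by (intro sum_mono mult_mono abs_entry_le_norm Suc.IH) auto
 finally show ?case by simp
qed

lemma mexp_sums: "(\<lambda>k. (1 / fact k) *\<^sub>R mpow X k) sums mexp X" for X :: "'n::finite sqmat"
proof -
 have "summable (\<lambda>k. (1 / fact k) *\<^sub>R mpow X k)"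
 proof (rule summable_comparison_test')
  show "summable (\<lambda>k. (real CARD('n))\<^sup>2 * (inverse (fact k) * (real CARD('n) * norm X) ^ k))"
   by (intro summable_mult summable_exp)
  fix k
  have "norm (mpow X k) <= (real CARD('n))\<^sup>2 * (real CARD('n) * norm X) ^ k"
   by (rule norm_le_entries[OF mpow_entry_le])
  then have "inverse (fact k) * norm (mpow X k) <= inverse (fact k) * ((real CARD('n))\<^sup>2 * (real CARD('n) * norm X) ^ k)"
   by (intro mult_left_mono) auto
  then show "norm ((1 / fact k) *\<^sub>R mpow X k) <= (real CARD('n))\<^sup>2 * (inverse (fact k) * (real CARD('n) * norm X) ^ k)"
   by (simp add: inverse_eq_divide mult_ac)
 qed
 then show ?thesis unfolding mexp_def mpow_def[symmetric] by (rule summable_sums)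
qed

lemma mexp_entry_sums: "(\<lambda>k. mpow X k $ i $ j / fact k * t ^ k) sums (mexp (t *\<^sub>R X) $ i $ j)"
proof -
 have bl: "bounded_linear (\<lambda>Y :: 'a sqmat. Y $ i $ j)"
  by (intro bounded_linear_compose[OF bounded_linear_vec_nth] bounded_linear_vec_nth)
 show ?thesis using bounded_linear.sums[OF bl mexp_sums[of "t *\<^sub>R X"]] by (simp add: mpow_scale mult_ac)
qed

lemma sums_mult_entry:
 fixes A :: "nat => 'n::finite sqmat"
 assumes "\<And>i j. (\<lambda>k. A k $ i $ j * c k) sums (S $ i $ j)"
 shows "(\<lambda>k. (X ** A k) $ i $ j * c k) sums ((X ** S) $ i $ j)" "(\<lambda>k. (A k ** X) $ i $ j * c k) sums ((S ** X) $ i $ j)"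
proof -
 have 1: "(\<lambda>k. \<Sum>l\<in>UNIV. X $ i $ l * (A k $ l $ j * c k)) sums (\<Sum>l\<in>UNIV. X $ i $ l * S $ l $ j)"
  by (intro sums_sum sums_mult assms)
 have "(\<Sum>l\<in>UNIV. X $ i $ l * (A k $ l $ j * c k)) = (X ** A k) $ i $ j * c k" for k
  by (simp add: matrix_matrix_mult_def sum_distrib_right mult.assoc)
 moreover have "(\<Sum>l\<in>UNIV. X $ i $ l * S $ l $ j) = (X ** S) $ i $ j" by (simp add: matrix_matrix_mult_def)
 ultimately show "(\<lambda>k. (X ** A k) $ i $ j * c k) sums ((X ** S) $ i $ j)" using 1 by (simp only:)
 have 2: "(\<lambda>k. \<Sum>l\<in>UNIV. (A k $ i $ l * c k) * X $ l $ j) sums (\<Sum>l\<in>UNIV. S $ i $ l * X $ l $ j)"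
  by (intro sums_sum sums_mult2 assms)
 have "(\<Sum>l\<in>UNIV. (A k $ i $ l * c k) * X $ l $ j) = (A k ** X) $ i $ j * c k" for k
  by (simp add: matrix_matrix_mult_def sum_distrib_left mult_ac)
 moreover have "(\<Sum>l\<in>UNIV. S $ i $ l * X $ l $ j) = (S ** X) $ i $ j" by (simp add: matrix_matrix_mult_def)
 ultimately show "(\<lambda>k. (A k ** X) $ i $ j * c k) sums ((S ** X) $ i $ j)" using 2 by (simp only:)
qed

lemma mexp_sums': "(\<lambda>k. mpow X k $ i $ j * (1 / fact k)) sums (mexp X $ i $ j)"
 using mexp_entry_sums[of X i j 1] by simp

lemma mpow_commute: "Y ** X = X ** Y ==> Y ** mpow X k = mpow X k ** Y"
 by (induction k) (simp_all add: mpow_Suc, metis matrix_mul_assoc)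

lemma mexp_commute: "Y ** X = X ** Y ==> Y ** mexp X = mexp X ** Y"
proof -
 assume c: "Y ** X = X ** Y"
 have "(Y ** mexp X) $ i $ j = (mexp X ** Y) $ i $ j" for i j
  using sums_unique2[OF sums_mult_entry(1)[OF mexp_sums', of Y X i j] ] sums_mult_entry(2)[OF mexp_sums', of X Y i j]
  by (simp add: mpow_commute[OF c])
 then show ?thesis by (simp add: vec_eq_iff)
qed

lemma mexp_0 [simp]: "mexp 0 = mat 1"
proof -
 have "mpow 0 k = 0" if "k > 0" for k using that by (cases k) (simp_all add: mpow_Suc)
 then have "(\<lambda>k. (1 / fact k) *\<^sub>R mpow (0::'a sqmat) k) sums (\<Sum>k\<in>{0}. (1 / fact k) *\<^sub>R mpow 0 k)"
  by (intro sums_finite) auto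
 then show ?thesis using sums_unique2[OF mexp_sums] by fastforce
qed

definition mderiv :: "(real => 'n::finite sqmat) => 'n sqmat => real => bool" where
 "mderiv F F' t \<longleftrightarrow> (\<forall>i j. ((\<lambda>t. F t $ i $ j) has_real_derivative F' $ i $ j) (at t))"

lemma mderiv_mexp: "mderiv (\<lambda>t. mexp (t *\<^sub>R X)) (X ** mexp (t *\<^sub>R X)) t"
 unfolding mderiv_def
proof (intro allI)
 fix i j
 define c where "c k = mpow X k $ i $ j / fact k" for k
 have eq: "mexp (t *\<^sub>R X) $ i $ j = (\<Sum>k. c k * t ^ k)" for t
  unfolding c_def by (rule sums_unique[OF mexp_entry_sums])
 have "diffs c k = (X ** mpow X k) $ i $ j / fact k" for k
  by (simp add: diffs_def c_def mpow_Suc fact_Suc del: of_nat_Suc)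
 then have "(\<lambda>k. diffs c k * t ^ k) sums ((X ** mexp (t *\<^sub>R X)) $ i $ j)"
  using sums_mult_entry(1)[of "mpow X" "\<lambda>k. t ^ k / fact k" "mexp (t *\<^sub>R X)" X i j] mexp_entry_sums[of X _ _ t]
  by (simp add: mult_ac)
 then have "(X ** mexp (t *\<^sub>R X)) $ i $ j = (\<Sum>k. diffs c k * t ^ k)" by (rule sums_unique)
 moreover have "((\<lambda>x. \<Sum>k. c k * x ^ k) has_field_derivative (\<Sum>k. diffs c k * t ^ k)) (at t)"
  using mexp_entry_sums[of X i j] by (intro termdiffs_strong_converges_everywhere) (auto simp: c_def sums_iff)
 ultimately show "((\<lambda>t. mexp (t *\<^sub>R X) $ i $ j) has_real_derivative (X ** mexp (t *\<^sub>R X)) $ i $ j) (at t)"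
  unfolding eq by simp
qed

lemma mderiv_mult: "mderiv F F' t ==> mderiv G G' t ==> mderiv (\<lambda>t. F t ** G t) (F' ** G t + F t ** G') t"
 unfolding mderiv_def matrix_matrix_mult_def
 by (auto intro!: derivative_eq_intros sum.cong simp: sum.distrib[symmetric])

lemma mderiv_transpose: "mderiv F F' t ==> mderiv (\<lambda>t. transpose (F t)) (transpose F') t"
 unfolding mderiv_def transpose_def by simp

lemma mderiv_const: "mderiv (\<lambda>t. A) 0 t"
 unfolding mderiv_def by simp

lemma mderiv_unique: "mderiv F A t ==> mderiv F B t ==> A = B"
 unfolding mderiv_def vec_eq_iff using DERIV_unique by blast

lemma mderiv_zero_const: "(\<And>t. mderiv F 0 t) ==> F s = F t"
 unfolding mderiv_def vec_eq_iff by (auto intro: DERIV_isconst_all)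

lemma mderiv_continuous: "(\<And>t. mderiv F (F' t) t) ==> continuous_on S F"
proof -
 assume d: "\<And>t. mderiv F (F' t) t"
 have "continuous_on S (\<lambda>t. \<chi> i j. F t $ i $ j)"
 proof (intro continuous_on_vec_lambda continuous_at_imp_continuous_on ballI)
  fix i j t
  show "isCont (\<lambda>t. F t $ i $ j) t" using d[of t] unfolding mderiv_def by (blast intro: DERIV_isCont)
 qed
 then show ?thesis by simp
qed

lemma mderiv_shift: "mderiv F F' (t + c) ==> mderiv (\<lambda>t. F (t + c)) F' t"
 unfolding mderiv_def by (auto simp: DERIV_shift)

lemma mderiv_mexp_minus: "mderiv (\<lambda>t. mexp (- t *\<^sub>R X)) (- (mexp (- t *\<^sub>R X) ** X)) t"
proof -
 have "mderiv (\<lambda>t. mexp (t *\<^sub>R (- X))) (- X ** mexp (t *\<^sub>R (- X))) t" by (rule mderiv_mexp)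
 moreover have "X ** mexp (- t *\<^sub>R X) = mexp (- t *\<^sub>R X) ** X"
  by (rule mexp_commute) (simp add: matrix_mult_scaleR matrix_mult_minus)
 ultimately show ?thesis by (simp add: matrix_mult_minus)
qed

lemma mexp_add_commuting:
 assumes "X ** Y = Y ** X"
 shows "mexp (- (X + Y)) ** (mexp X ** mexp Y) = mat 1"
proof -
 let ?F = "\<lambda>t. mexp (- t *\<^sub>R (X + Y)) ** (mexp (t *\<^sub>R X) ** mexp (t *\<^sub>R Y))"
 have zero: "mderiv ?F 0 t" for t
 proof -
  let ?E = "mexp (- t *\<^sub>R (X + Y))" and ?P = "mexp (t *\<^sub>R X)" and ?Q = "mexp (t *\<^sub>R Y)"
  have d: "mderiv ?F (- (?E ** (X + Y)) ** (?P ** ?Q) + ?E ** ((X ** ?P) ** ?Q + ?P ** (Y ** ?Q))) t"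
   by (intro mderiv_mult mderiv_mexp mderiv_mexp_minus)
  have "Y ** ?P = ?P ** Y" using assms by (intro mexp_commute) (simp add: matrix_mult_scaleR)
  then have "?P ** (Y ** ?Q) = Y ** (?P ** ?Q)" by (metis matrix_mul_assoc)
  then show ?thesis using d
   by (simp add: matrix_add_ldistrib matrix_mul_assoc[symmetric] matrix_mult_minus matrix_mult_add_left matrix_mult_diff_left)
 qed
 have "?F 1 = ?F 0" by (rule mderiv_zero_const[OF zero])
 then show ?thesis by simp
qed

lemma mexp_inverse: "mexp (- X) ** mexp X = mat 1" "mexp X ** mexp (- X) = mat 1"
 using mexp_add_commuting[of X 0] mexp_add_commuting[of "- X" 0] by simp_all

text \<open>The product \<open>mexp (- t *\<^sub>R X) ** F t\<close> has derivative zero. Explicit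
  formulas for exponentials are verified through this differential equation rather than through the
  series.\<close>

lemma mexp_unique:
 assumes "\<And>t. mderiv F (X ** F t) t" "F 0 = mat 1"
 shows "mexp (t *\<^sub>R X) = F t"
proof -
 let ?G = "\<lambda>t. mexp (- t *\<^sub>R X) ** F t"
 have "mderiv ?G 0 t" for t
  using mderiv_mult[OF mderiv_mexp_minus[of X t] assms(1)[of t]] by (simp add: matrix_mult_minus matrix_mul_assoc)
 from mderiv_zero_const[OF this] have "?G t = ?G 0" .
 then have "mexp (- (t *\<^sub>R X)) ** F t = mat 1" using assms(2) by simp
 then show ?thesis using mexp_inverse(2)[of "t *\<^sub>R X"] by (metis matrix_mul_assoc matrix_mul_lid matrix_mul_rid)
qed

context levels
begin

section \<open>Lie algebras of the groups\<close>

definition dmat :: "real => real => 'm sqmat" where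
 "dmat s t = (\<chi> i j. if i = j then wt s t i else 0)"

lemma dmat_mult: "(dmat s t ** g) $ i $ j = wt s t i * g $ i $ j"
 and mult_dmat: "(g ** dmat s t) $ i $ j = g $ i $ j * wt s t j"
 by (simp_all add: dmat_def matrix_matrix_mult_def if_distrib[of "\<lambda>x. x * _"] if_distrib[of "\<lambda>x. _ * x"] cong: if_cong)

lemma dmat_linear: "dmat (a + c) (b + d) = dmat a b + dmat c d" "dmat (r * a) (r * b) = r *\<^sub>R dmat a b"
 "dmat 0 0 = 0" "dmat (- a) (- b) = - dmat a b"
 by (auto simp: dmat_def vec_eq_iff wt_def)

lemma mexp_dmat: "mexp (dmat s t) = dE s t"
proof -
 have w: "wt (u * s) (u * t) i = u * wt s t i" for u i by (simp add: wt_def)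
 have "mexp (1 *\<^sub>R dmat s t) = dE (1 * s) (1 * t)"
  by (rule mexp_unique)
    (auto simp: mderiv_def dmat_mult dE_entry w intro!: derivative_eq_intros)
 then show ?thesis by simp
qed

lemma nmat_mult_0: "mderiv (\<lambda>s. nexp (s *\<^sub>R p)) (nmat p) 0"
 unfolding mderiv_def
proof (intro allI)
 fix i j
 obtain pp x y et where p: "p = (pp, x, y, et)" by (cases p) auto
 show "((\<lambda>s. nexp (s *\<^sub>R p) $ i $ j) has_real_derivative nmat p $ i $ j) (at 0)"
  by (cases rule: level5[of i]; cases rule: level5[of j])
   (auto simp: nexp_def nmat_def p power2_eq_square intro!: derivative_eq_intros)
qed

text \<open>The map \<open>t\<close> to \<open>nexp (t *\<^sub>R p)\<close> is a one-parameter
  group, so its derivative at any point follows from the derivative at 0.\<close>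

lemma mexp_nmat: assumes "p \<in> ncar" shows "mexp (nmat p) = nexp p"
proof -
 have tp: "t *\<^sub>R p \<in> ncar" for t using assms by (rule subspace_scale[OF subspace_ncar])
 have "mexp (1 *\<^sub>R nmat p) = nexp (1 *\<^sub>R p)"
 proof (rule mexp_unique)
  fix t
  have "mderiv (\<lambda>s. nexp ((s + (- t)) *\<^sub>R p)) (nmat p) t"
   by (rule mderiv_shift) (use nmat_mult_0 in simp)
  from mderiv_mult[OF this mderiv_const[of "nexp (t *\<^sub>R p)"]]
  have "mderiv (\<lambda>s. nexp ((s + (- t)) *\<^sub>R p) ** nexp (t *\<^sub>R p)) (nmat p ** nexp (t *\<^sub>R p)) t" by simp
  moreover have "nexp ((s + (- t)) *\<^sub>R p) ** nexp (t *\<^sub>R p) = nexp (s *\<^sub>R p)" for s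
   by (simp only: nexp_mult[OF tp tp] bch_line) simp
  ultimately show "mderiv (\<lambda>t. nexp (t *\<^sub>R p)) (nmat p ** nexp (t *\<^sub>R p)) t" by simp
 qed simp
 then show ?thesis by simp
qed

lemma nmat_scale: "nmat (c *\<^sub>R p) = c *\<^sub>R nmat p"
proof -
 obtain pp x y et where p: "p = (pp, x, y, et)" by (cases p) auto
 have "nmat (c *\<^sub>R p) $ i $ j = (c *\<^sub>R nmat p) $ i $ j" for i j by (simp add: nmat_def p)
 then show ?thesis by (simp add: vec_eq_iff)
qed

lemma nmat_add: "nmat (p + q) = nmat p + nmat q"
proof -
 obtain pp x y et where p: "p = (pp, x, y, et)" by (cases p) auto
 obtain pp' x' y' et' where q: "q = (pp', x', y', et')" by (cases q) auto
 have "nmat (p + q) $ i $ j = (nmat p + nmat q) $ i $ j" for i j by (simp add: nmat_def p q)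
 then show ?thesis by (simp add: vec_eq_iff)
qed

lemma nmat_inj: "p \<in> ncar ==> q \<in> ncar ==> nmat p = nmat q ==> p = q"
 by (metis mexp_nmat nexp_inj)

definition soJ :: "'m sqmat set" where "soJ = {X. transpose X ** J + J ** X = 0}"

lemma soJ_entry: "X \<in> soJ \<longleftrightarrow> (\<forall>i j. X $ opp i $ j = - X $ opp j $ i)"
 unfolding soJ_def by (auto simp: vec_eq_iff mult_J J_mult transpose_def add_eq_0_iff)

lemma mderiv_form:
 "mderiv F F' t ==> mderiv (\<lambda>t. transpose (F t) ** J ** F t) (transpose F' ** J ** F t + transpose (F t) ** J ** F') t"
 using mderiv_mult[OF mderiv_mult[OF mderiv_transpose mderiv_const[of J]]] by fastforce

text \<open>Differentiating the invariance of the form at 0 gives one inclusion. For the other, the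
  form is constant along the exponential because its derivative vanishes, and continuity settles the
  determinant.\<close>

lemma lie_SOJ: "lie SOJ = soJ"
proof
 show "lie SOJ \<subseteq> soJ"
 proof
  fix X assume "X \<in> lie SOJ"
  then have "transpose (mexp (t *\<^sub>R X)) ** J ** mexp (t *\<^sub>R X) = J" for t by (auto simp: lie_def SOJ_def)
  then have "mderiv (\<lambda>t. transpose (mexp (t *\<^sub>R X)) ** J ** mexp (t *\<^sub>R X)) 0 0" by (simp add: mderiv_const)
  moreover have "mderiv (\<lambda>t. transpose (mexp (t *\<^sub>R X)) ** J ** mexp (t *\<^sub>R X)) (transpose X ** J + J ** X) 0"
   using mderiv_form[OF mderiv_mexp[of X 0]] by (simp add: transpose_mat)
  ultimately show "X \<in> soJ" unfolding soJ_def using mderiv_unique by blast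
 qed
 show "soJ \<subseteq> lie SOJ"
 proof
  fix X assume X: "X \<in> soJ"
  let ?F = "\<lambda>t. transpose (mexp (t *\<^sub>R X)) ** J ** mexp (t *\<^sub>R X)"
  have X0: "transpose X ** J = - (J ** X)" using X by (simp add: soJ_def eq_neg_iff_add_eq_0)
  have "mderiv ?F 0 t" for t
  proof -
   have "transpose (X ** mexp (t *\<^sub>R X)) ** J ** mexp (t *\<^sub>R X) =
     transpose (mexp (t *\<^sub>R X)) ** (transpose X ** J) ** mexp (t *\<^sub>R X)"
    by (simp add: matrix_transpose_mul matrix_mul_assoc)
   also have "\<dots> = - (transpose (mexp (t *\<^sub>R X)) ** J ** (X ** mexp (t *\<^sub>R X)))"
    unfolding X0 by (simp add: matrix_mult_minus matrix_mul_assoc)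
   finally show ?thesis using mderiv_form[OF mderiv_mexp[of X t]] by simp
  qed
  from mderiv_zero_const[OF this] have form: "?F t = J" for t by (metis (no_types, lifting) matrix_mul_lid matrix_mul_rid mexp_0 scale_zero_left transpose_mat)
  have "mexp (t *\<^sub>R X) \<in> SOJ" for t
   using SOJ_by_path[OF mderiv_continuous[OF mderiv_mexp[of "t *\<^sub>R X"]]] form by simp
  then show "X \<in> lie SOJ" by (simp add: lie_def)
 qed
qed

lemma subspace_soJ: "subspace soJ"
 proof -
 have tr: "transpose (A + B) = transpose A + transpose B" "transpose (c *\<^sub>R A) = c *\<^sub>R transpose A"
  "transpose 0 = (0 :: 'm sqmat)" for A B :: "'m sqmat" and c
  by (simp_all add: transpose_def vec_eq_iff)
 have "transpose (A + B) ** J + J ** (A + B) = (transpose A ** J + J ** A) + (transpose B ** J + J ** B)" for A B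
  by (simp add: tr matrix_mult_add_left matrix_add_ldistrib)
 moreover have "transpose (c *\<^sub>R A) ** J + J ** (c *\<^sub>R A) = c *\<^sub>R (transpose A ** J + J ** A)" for A c
  by (simp add: tr matrix_mult_scaleR scaleR_right_distrib)
 ultimately show ?thesis unfolding subspace_def soJ_def by (simp add: tr)
qed

section \<open>The groups A, N and AN described by matrix entries\<close>

definition Agrp :: "'m sqmat set" where "Agrp = range (\<lambda>p. dE (fst p) (snd p))"
definition Ngrp :: "'m sqmat set" where "Ngrp = nexp ` ncar"

lemma level_order [simp]:
 "e1 < e2" "e2 < f2" "f2 < f1" "e1 < f2" "e1 < f1" "e2 < f1"
 "m \<in> mid ==> e1 < m" "m \<in> mid ==> e2 < m" "m \<in> mid ==> m < f2" "m \<in> mid ==> m < f1"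
 using e1_less_e2 f2_less_f1 e2_less_f2 by (auto simp: mid_def)

lemma level_not_less [simp]:
 "\<not> e2 < e1" "\<not> f2 < e2" "\<not> f1 < f2" "\<not> f2 < e1" "\<not> f1 < e1" "\<not> f1 < e2"
 "m \<in> mid ==> \<not> m < e1" "m \<in> mid ==> \<not> m < e2" "m \<in> mid ==> \<not> f2 < m" "m \<in> mid ==> \<not> f1 < m"
 by (simp_all add: not_less less_imp_le)

definition upper :: "'m sqmat => bool" where "upper g \<longleftrightarrow> (\<forall>i j. j < i \<longrightarrow> g $ i $ j = 0)"

lemma nexp_upper: "upper (nexp p)" and nexp_diag: "nexp p $ i $ i = 1"
proof -
 obtain pp x y et where p: "p = (pp, x, y, et)" by (cases p) auto
 have "nexp p $ i $ j = 0" if "j < i" for i j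
  using that by (cases rule: level5[of i]; cases rule: level5[of j]) (auto simp: nexp_def p)
 then show "upper (nexp p)" by (simp add: upper_def)
 show "nexp p $ i $ i = 1"
  by (cases rule: level5[of i]) (auto simp: nexp_def p)
qed

lemma form_entry: "transpose g ** J ** g = J ==>
  g $ e1 $ i * g $ f1 $ j + g $ e2 $ i * g $ f2 $ j + (\<Sum>k\<in>mid. g $ k $ i * g $ k $ j)
   + g $ f2 $ i * g $ e2 $ j + g $ f1 $ i * g $ e1 $ j = (if j = opp i then 1 else 0)"
proof -
 assume "transpose g ** J ** g = J"
 then have "((transpose g ** J) ** g) $ i $ j = J $ i $ j" by simp
 moreover have "((transpose g ** J) ** g) $ i $ j = (\<Sum>k\<in>UNIV. g $ opp k $ i * g $ k $ j)"
  by (subst matrix_matrix_mult_def) (simp add: mult_J transpose_def)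
 ultimately show ?thesis by (simp add: J_def sum_levels mult_ac add_ac cong: sum.cong)
qed

text \<open>A triangular orthogonal block with nonnegative diagonal is the identity. By induction,
  once the earlier rows are known, column \<open>i\<close> reduces to its diagonal entry, and its
  products with the other columns determine row \<open>i\<close>.\<close>

lemma upper_mid_block:
 assumes g: "transpose g ** J ** g = J" "upper g" "\<And>i. g $ i $ i >= 0" and "i \<in> mid" "j \<in> mid"
 shows "g $ i $ j = (if i = j then 1 else 0)"
proof -
 have u: "g $ i $ j = 0" if "j < i" for i j using g(2) that by (simp add: upper_def)
 have orth: "(\<Sum>k\<in>mid. g $ k $ i * g $ k $ j) = (if i = j then 1 else 0)" if "i \<in> mid" "j \<in> mid" for i j
  using form_entry[OF g(1), of i j] that u by auto
 have "i \<in> mid ==> \<forall>j\<in>mid. g $ i $ j = (if i = j then 1 else 0)" for i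
 proof (induction "card {k. k < i}" arbitrary: i rule: less_induct)
  case less
  have IH: "g $ k $ j = 0" if "k \<in> mid" "j \<in> mid" "k < i" "k ~= j" for k j
  proof -
   have "card {l. l < k} < card {k. k < i}" using that(3) by (intro psubset_card_mono) auto
   from less(1)[OF this that(1)] that show ?thesis by auto
  qed
  have one: "(\<Sum>k\<in>mid. g $ k $ i * g $ k $ j) = g $ i $ i * g $ i $ j" if "j \<in> mid" for j
  proof -
   have "(\<Sum>k\<in>mid. g $ k $ i * g $ k $ j) = (\<Sum>k\<in>mid. if k = i then g $ i $ i * g $ i $ j else 0)"
   proof (intro sum.cong refl)
    fix k assume "k \<in> mid"
    then show "g $ k $ i * g $ k $ j = (if k = i then g $ i $ i * g $ i $ j else 0)"
     using IH[of k i] less(2) u[of i k] by (cases k i rule: linorder_cases) auto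
   qed
   then show ?thesis using less(2) by simp
  qed
  have "g $ i $ i * g $ i $ i = 1" using orth[OF less(2) less(2)] one[OF less(2)] by simp
  then have d: "g $ i $ i = 1" using g(3)[of i] by (metis abs_of_nonneg abs_square_eq_1 power2_eq_square)
  show ?case
  proof
   fix j assume j: "j \<in> mid"
   show "g $ i $ j = (if i = j then 1 else 0)" using orth[OF less(2) j] one[OF j] d by auto
  qed
 qed
 then show ?thesis using assms by blast
qed

text \<open>The equations of the form express every remaining entry by entries of the first two
  rows, and those are read off as coordinates.\<close>

lemma Ngrp_char: assumes "g \<in> SOJ" "upper g" "\<And>i. g $ i $ i = 1" shows "g \<in> Ngrp"
proof -
 have g: "transpose g ** J ** g = J" using assms by (simp add: SOJ_def)
 have u: "g $ i $ j = 0" if "j < i" for i j using assms(2) that by (simp add: upper_def)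
 have z: "g $ e2 $ e1 = 0" "g $ f2 $ e1 = 0" "g $ f2 $ e2 = 0" "g $ f1 $ e1 = 0" "g $ f1 $ e2 = 0" "g $ f1 $ f2 = 0"
  "m \<in> mid ==> g $ m $ e1 = 0" "m \<in> mid ==> g $ m $ e2 = 0" "m \<in> mid ==> g $ f2 $ m = 0" "m \<in> mid ==> g $ f1 $ m = 0" for m
  by (auto intro: u)
 have md: "g $ i $ j = (if i = j then 1 else 0)" if "i \<in> mid" "j \<in> mid" for i j
  using upper_mid_block[OF g assms(2) _ that] assms(3) by simp
 define pp y a where "pp = g $ e1 $ e2" and "y = (\<chi> j. if j \<in> mid then g $ e2 $ j else 0)"
  and "a = (\<chi> j. if j \<in> mid then g $ e1 $ j else 0)"
 define x where "x = a - (pp / 2) *\<^sub>R y"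
 define et where "et = g $ e1 $ f2 + x \<bullet> y / 2 + pp * (y \<bullet> y) / 6"
 have s: "supp y" "supp a" "supp x" by (simp_all add: supp_def y_def a_def x_def)
 have ym: "g $ e2 $ m = y $ m" "g $ e1 $ m = a $ m" if "m \<in> mid" for m using that by (simp_all add: y_def a_def)
 have um: "g $ m $ f2 = - y $ m" if "m \<in> mid" for m
  using form_entry[OF g, of m f2] that by (simp add: z assms(3) md ym cong: sum.cong)
 have w: "g $ f2 $ f1 = - pp"
  using form_entry[OF g, of e2 f1] by (simp add: z assms(3) pp_def cong: sum.cong)
 have vm: "g $ m $ f1 = - a $ m + pp * y $ m" if "m \<in> mid" for m
  using form_entry[OF g, of m f1] that by (simp add: z assms(3) md ym w algebra_simps cong: sum.cong)
 have yy: "(\<Sum>k\<in>mid. y $ k * z $ k) = y \<bullet> z" "(\<Sum>k\<in>mid. a $ k * z $ k) = a \<bullet> z" for z using s by (simp_all add: sum_mid_inner)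
 have d: "g $ e2 $ f2 = - (y \<bullet> y) / 2"
  using form_entry[OF g, of f2 f2] by (simp add: z assms(3) um yy cong: sum.cong)
 have uv: "(\<Sum>k\<in>mid. g $ k $ f2 * g $ k $ f1) = y \<bullet> a - pp * (y \<bullet> y)"
 proof -
  have "(\<Sum>k\<in>mid. g $ k $ f2 * g $ k $ f1) = (\<Sum>k\<in>mid. y $ k * a $ k - pp * (y $ k * y $ k))"
   by (intro sum.cong refl) (simp add: um vm algebra_simps)
  then show ?thesis by (simp add: sum_subtractf sum_distrib_left[symmetric] yy)
 qed
 have vv: "(\<Sum>k\<in>mid. g $ k $ f1 * g $ k $ f1) = a \<bullet> a - 2 * pp * (y \<bullet> a) + pp\<^sup>2 * (y \<bullet> y)"
 proof -
  have "(\<Sum>k\<in>mid. g $ k $ f1 * g $ k $ f1) = (\<Sum>k\<in>mid. a $ k * a $ k - 2 * pp * (y $ k * a $ k) + pp\<^sup>2 * (y $ k * y $ k))"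
   by (intro sum.cong refl) (simp add: vm algebra_simps power2_eq_square)
  then show ?thesis by (simp add: sum_subtractf sum.distrib sum_distrib_left[symmetric] yy)
 qed
 have e: "g $ e2 $ f1 = - g $ e1 $ f2 + pp * (y \<bullet> y) / 2 - y \<bullet> a"
  using form_entry[OF g, of f2 f1] uv by (simp add: z assms(3) w d)
 have c: "2 * g $ e1 $ f1 = 2 * pp * g $ e2 $ f1 - a \<bullet> a + 2 * pp * (y \<bullet> a) - pp\<^sup>2 * (y \<bullet> y)"
  using form_entry[OF g, of f1 f1] vv by (simp add: z assms(3) w)
 have ax: "a = x + (pp / 2) *\<^sub>R y" by (simp add: x_def)
 have b: "g $ e1 $ f2 = et - x \<bullet> y / 2 - pp * (y \<bullet> y) / 6" by (simp add: et_def)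
 have ya: "y \<bullet> a = x \<bullet> y + pp * (y \<bullet> y) / 2" "a \<bullet> a = x \<bullet> x + pp * (x \<bullet> y) + pp\<^sup>2 * (y \<bullet> y) / 4"
  unfolding ax by (simp_all add: inner_add_left inner_add_right inner_commute[of y x] power2_eq_square field_simps)
 have E: "g $ e1 $ f1 = - pp * et - x \<bullet> x / 2 + pp\<^sup>2 * (y \<bullet> y) / 24" "g $ e2 $ f1 = - et - x \<bullet> y / 2 + pp * (y \<bullet> y) / 6"
  using c unfolding e b ya by (simp_all add: field_simps power2_eq_square)
 have E3: "g $ e1 $ e2 = pp" by (simp add: pp_def)
 have E4: "g $ e1 $ m = x $ m + pp * y $ m / 2" "g $ m $ f1 = - x $ m + pp * y $ m / 2" if "m \<in> mid" for m
  using ym[OF that] vm[OF that] by (simp_all add: ax)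
 have "g $ i $ j = nexp (pp, x, y, et) $ i $ j" for i j
  by (cases rule: level5[of i]; cases rule: level5[of j])
    (simp_all add: nexp_def z assms(3) md ym(1) um w d b E E3 E4)
 then have "g = nexp (pp, x, y, et)" by (simp add: vec_eq_iff)
 then show ?thesis using s by (auto simp: Ngrp_def)
qed

definition ANgrp :: "'m sqmat set" where "ANgrp = {a ** h | a h. a \<in> Agrp \<and> h \<in> Ngrp}"

text \<open>Nonnegativity of the diagonal suffices: opposite diagonal entries are inverse to each
  other and the middle block is the identity. As a weak inequality it is a closed condition, which
  makes AN closed.\<close>

lemma ANgrp_iff: "g \<in> ANgrp \<longleftrightarrow> g \<in> SOJ \<and> upper g \<and> (\<forall>i. g $ i $ i >= 0)"
proof
 assume "g \<in> ANgrp"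
 then obtain s t p where g: "g = dE s t ** nexp p" "p \<in> ncar" by (auto simp: ANgrp_def Agrp_def Ngrp_def)
 have "g \<in> SOJ" unfolding g by (intro SOJ_mult dE_SOJ nexp_SOJ g)
 then show "g \<in> SOJ \<and> upper g \<and> (\<forall>i. g $ i $ i >= 0)"
  using nexp_upper[of p] by (auto simp: g(1) upper_def dE_mult nexp_diag)
next
 assume g: "g \<in> SOJ \<and> upper g \<and> (\<forall>i. g $ i $ i >= 0)"
 then have form: "transpose g ** J ** g = J" by (simp add: SOJ_def)
 have u: "g $ i $ j = 0" if "j < i" for i j using g that by (simp add: upper_def)
 have z: "g $ e2 $ e1 = 0" "g $ f2 $ e1 = 0" "g $ f2 $ e2 = 0" "g $ f1 $ e1 = 0" "g $ f1 $ e2 = 0" "g $ f1 $ f2 = 0"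
  "m \<in> mid ==> g $ m $ e1 = 0" "m \<in> mid ==> g $ m $ e2 = 0" for m
  by (auto intro: u)
 have 1: "g $ e1 $ e1 * g $ f1 $ f1 = 1" "g $ e2 $ e2 * g $ f2 $ f2 = 1"
  using form_entry[OF form, of e1 f1] form_entry[OF form, of e2 f2] by (simp_all add: z)
 have pos: "g $ e1 $ e1 > 0" "g $ e2 $ e2 > 0" using 1 g by (metis less_le mult_zero_left zero_neq_one)+
 define s t where "s = ln (g $ e1 $ e1)" and "t = ln (g $ e2 $ e2)"
 have st: "exp s = g $ e1 $ e1" "exp t = g $ e2 $ e2" using pos by (simp_all add: s_def t_def)
 have inv: "g $ f1 $ f1 = exp (- s)" "g $ f2 $ f2 = exp (- t)"
  using 1 pos by (simp_all add: exp_minus st inverse_eq_divide eq_divide_eq mult_ac)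
 define h where "h = dE (- s) (- t) ** g"
 have "h \<in> Ngrp"
 proof (rule Ngrp_char)
  show "h \<in> SOJ" unfolding h_def using g by (intro SOJ_mult dE_SOJ) auto
  show "upper h" using g by (simp add: upper_def h_def dE_mult)
  have "g $ m $ m = 1" if "m \<in> mid" for m using upper_mid_block[OF form _ _ that that] g by simp
  then show "h $ i $ i = 1" for i
   by (cases rule: level5[of i]) (simp_all add: h_def dE_mult inv st[symmetric] exp_add[symmetric])
 qed
 moreover have "g = dE s t ** h" unfolding h_def by (simp add: matrix_mul_assoc dE_dE)
 moreover have "dE s t \<in> Agrp" unfolding Agrp_def by (intro image_eqI[of _ _ "(s, t)"]) auto
 ultimately show "g \<in> ANgrp" unfolding ANgrp_def by blast
qed

lemma closed_ANgrp: "closed ANgrp"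
proof -
 have "ANgrp = SOJ \<inter> (\<Inter>i. \<Inter>j\<in>{j. j < i}. {g. g $ i $ j = 0}) \<inter> (\<Inter>i. {g. g $ i $ i >= 0})"
  by (auto simp: ANgrp_iff upper_def)
 then show ?thesis
  by (auto intro!: closed_Int closed_SOJ closed_INT closed_Collect_eq closed_Collect_le continuous_intros)
qed

lemma AN_unique: "p \<in> ncar ==> q \<in> ncar ==> dE s t ** nexp p = dE s' t' ** nexp q ==> s = s' \<and> t = t' \<and> p = q"
proof -
 assume pq: "p \<in> ncar" "q \<in> ncar" and eq: "dE s t ** nexp p = dE s' t' ** nexp q"
 have "(dE s t ** nexp p) $ i $ i = (dE s' t' ** nexp q) $ i $ i" for i using eq by simp
 then have "exp (wt s t i) = exp (wt s' t' i)" for i by (simp add: dE_mult nexp_diag)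
 from this[of e1] this[of e2] have "s = s'" "t = t'" by simp_all
 moreover from this have "nexp p = nexp q"
  using arg_cong[OF eq, of "\<lambda>g. dE (- s) (- t) ** g"] by (simp add: matrix_mul_assoc dE_dE)
 ultimately show ?thesis using nexp_inj[OF pq] by simp
qed

end

section \<open>Families that fill the Weyl chamber\<close>

context levels
begin

lemma continuous_on_dE:
 "continuous_on S f ==> continuous_on S g ==> continuous_on S (\<lambda>t. dE (f t) (g t))"
 unfolding dE_def dA_def adiag_exp wt_def by (intro continuous_intros continuous_on_if_const)

lemma norm_le_sum_mid:
 assumes "supp x" "\<And>k. k \<in> mid ==> \<bar>x $ k\<bar> <= B" "0 <= B" shows "norm x <= real CARD('m) * B"
proof -
 have "\<bar>x $ k\<bar> <= B" for k using assms by (cases "k \<in> mid") (auto simp: supp_def)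
 then have "norm x <= (\<Sum>k\<in>(UNIV :: 'm set). B)" by (intro order_trans[OF norm_le_l1_cart] sum_mono) auto
 then show ?thesis by simp
qed

lemma L2_scale: "L2 (nexp (nad s t p)) <= (real CARD('m))^8 * exp (2 * (\<bar>s\<bar> + \<bar>t\<bar>)) * L2 (nexp p)"
proof -
 have "L2 (nexp (nad s t p)) <= ((real CARD('m))^4 * exp (\<bar>s\<bar> + \<bar>t\<bar>)) * ((real CARD('m))^4 * exp (\<bar>- s\<bar> + \<bar>- t\<bar>)) * L2 (nexp p)"
  unfolding nexp_conj[symmetric] by (rule L2_conj_le[OF L2_dE_le L2_dE_le])
 also have "\<dots> = (real CARD('m))^8 * exp (2 * (\<bar>s\<bar> + \<bar>t\<bar>)) * L2 (nexp p)"
 proof -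
  have "exp (2 * (\<bar>s\<bar> + \<bar>t\<bar>)) = exp (\<bar>s\<bar> + \<bar>t\<bar>) * exp (\<bar>s\<bar> + \<bar>t\<bar>)" by (simp only: mult_2 exp_add)
  then show ?thesis by (simp add: power_numeral_reduce mult_ac)
 qed
 finally show ?thesis .
qed

section \<open>Growth along rays and filling subgroups with phi = 0\<close>

lemma L2_ray_aux:
 assumes "\<And>r. r >= 1 ==> L2 (nexp (r *\<^sub>R p)) <= C * r\<^sup>2"
 shows "\<exists>C\<ge>1. \<forall>r\<ge>0. L2 (nexp (r *\<^sub>R p)) <= C * (1 + r\<^sup>2)"
proof -
 have "continuous_on {0..1::real} (\<lambda>r. L2 (nexp (r *\<^sub>R p)))"
  by (intro continuous_on_L2 continuous_on_compose2[OF continuous_on_nexp'[of UNIV]] continuous_intros) auto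
 from continuous_attains_sup[OF _ _ this] obtain r0 where
  r0: "\<forall>r\<in>{0..1}. L2 (nexp (r *\<^sub>R p)) <= L2 (nexp (r0 *\<^sub>R p))" by auto
 let ?C = "max 1 (max C (L2 (nexp (r0 *\<^sub>R p))))"
 have "L2 (nexp (r *\<^sub>R p)) <= ?C * (1 + r\<^sup>2)" if "r >= 0" for r
 proof (cases "r >= 1")
  case True
  have "C * r\<^sup>2 <= ?C * r\<^sup>2" by (intro mult_right_mono) auto
  also have "\<dots> <= ?C * (1 + r\<^sup>2)" by (intro mult_left_mono) auto
  finally show ?thesis using assms[OF True] by linarith
 next
  case False
  then have "L2 (nexp (r *\<^sub>R p)) <= L2 (nexp (r0 *\<^sub>R p))" using r0 that by auto
  then have "L2 (nexp (r *\<^sub>R p)) <= ?C" by (simp add: le_max_iff_disj)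
  also have "\<dots> <= ?C * (1 + r\<^sup>2)" using mult_left_mono[of 1 "1 + r\<^sup>2" ?C] by simp
  finally show ?thesis .
 qed
 then show ?thesis by (intro exI[of _ ?C]) auto
qed

text \<open>When \<open>y = 0\<close>, the remaining coordinates all have weight 1 for the torus
  direction (1, 0), so multiplication by \<open>r\<close> is conjugation by
  \<open>dE (ln r) 0\<close>.\<close>

lemma L2_ray_y0: "\<exists>C\<ge>1. \<forall>r\<ge>0. L2 (nexp (r *\<^sub>R (pp, x, 0, et))) <= C * (1 + r\<^sup>2)"
proof (rule L2_ray_aux)
 fix r :: real assume r: "r >= 1"
 have "r *\<^sub>R (pp, x, 0, et) = nad (ln r) 0 (pp, x, 0, et)" using r by simp
 then have "L2 (nexp (r *\<^sub>R (pp, x, 0, et))) <= (real CARD('m))^8 * exp (2 * (\<bar>ln r\<bar> + \<bar>0\<bar>)) * L2 (nexp (pp, x, 0, et))"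
  using L2_scale[of "ln r" 0 "(pp, x, 0, et)"] by (simp only:)
 also have "exp (2 * (\<bar>ln r\<bar> + \<bar>0\<bar>)) = r\<^sup>2" using r by (simp add: exp_double)
 finally show "L2 (nexp (r *\<^sub>R (pp, x, 0, et))) <= ((real CARD('m))^8 * L2 (nexp (pp, x, 0, et))) * r\<^sup>2"
  by (simp add: mult_ac)
qed

definition gram :: "'m vc => 'm vc => real" where "gram x y = (x \<bullet> x) * (y \<bullet> y) - (x \<bullet> y)\<^sup>2"

lemma gram_nonneg: "gram x y >= 0"
 using Cauchy_Schwarz_ineq[of x y] by (simp add: gram_def)

lemma gram_scale: "gram (r *\<^sub>R x) (r *\<^sub>R y) = r^4 * gram x y"
 by (simp add: gram_def algebra_simps power2_eq_square power4_eq_xxxx)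

lemma gram_0: assumes "gram x y = 0" "y ~= 0" obtains l where "x = l *\<^sub>R y"
proof -
 let ?l = "(x \<bullet> y) / (y \<bullet> y)"
 have yy: "y \<bullet> y ~= 0" using assms by simp
 have "(x - ?l *\<^sub>R y) \<bullet> (x - ?l *\<^sub>R y) = x \<bullet> x - 2 * ?l * (x \<bullet> y) + ?l * ?l * (y \<bullet> y)"
  by (simp only: inner_diff_left inner_diff_right inner_scaleR_left inner_scaleR_right inner_commute[of y x]) (simp add: algebra_simps)
 also have "\<dots> = gram x y / (y \<bullet> y)" using yy by (simp add: gram_def field_simps power2_eq_square)
 finally have "x = ?l *\<^sub>R y" using assms by simp
 then show ?thesis by (rule that)
qed

text \<open>Conjugation by the phi-axis adds multiples of \<open>y\<close> to \<open>x\<close>, so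
  \<open>x = l *\<^sub>R y\<close> can be conjugated away; then multiplication by \<open>r\<close>
  is conjugation by \<open>dE 0 (ln r)\<close>.\<close>

lemma L2_ray_parallel:
 assumes "supp x" "supp y" "gram x y = 0"
 shows "\<exists>C\<ge>1. \<forall>r\<ge>0. L2 (nexp (r *\<^sub>R (0, x, y, et))) <= C * (1 + r\<^sup>2)"
proof (cases "y = 0")
 case True then show ?thesis using L2_ray_y0[of 0 x et] by simp
next
 case False
 then obtain l where l: "x = l *\<^sub>R y" using gram_0 assms by metis
 let ?c = "nexp (l, 0, 0, 0)" and ?d = "nexp (- l, 0, 0, 0)"
 show ?thesis
 proof (rule L2_ray_aux)
  fix r :: real assume r: "r >= 1"
  have "bch (bch (l, 0, 0, 0) (0, 0, r *\<^sub>R y, r * et)) (- (l, 0, 0, 0)) = r *\<^sub>R (0, x, y, et)"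
   unfolding bch_Ad by (simp add: l)
  then have eq: "nexp (r *\<^sub>R (0, x, y, et)) = ?c ** nexp (nad 0 (ln r) (0, 0, y, et)) ** ?d"
   using r assms(2) by (simp add: nexp_mult del: bch.simps) (simp add: bch_Ad nexp_mult)
  have "L2 (nexp (r *\<^sub>R (0, x, y, et))) <= (L2 ?c * L2 ?d) * L2 (nexp (nad 0 (ln r) (0, 0, y, et)))"
   unfolding eq by (rule L2_conj_le) auto
  also have "\<dots> <= (L2 ?c * L2 ?d) * ((real CARD('m))^8 * exp (2 * (\<bar>0\<bar> + \<bar>ln r\<bar>)) * L2 (nexp (0, 0, y, et)))"
   by (intro mult_left_mono L2_scale mult_nonneg_nonneg L2_nonneg)
  also have "exp (2 * (\<bar>0\<bar> + \<bar>ln r\<bar>)) = r\<^sup>2" using r by (simp add: exp_double)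
  finally show "L2 (nexp (r *\<^sub>R (0, x, y, et))) <=
    ((L2 ?c * L2 ?d) * (real CARD('m))^8 * L2 (nexp (0, 0, y, et))) * r\<^sup>2" by (simp add: mult_ac)
 qed
qed

text \<open>Up to sign the left side is the determinant of the upper right two by two block, the
  minor that witnesses the upper boundary curve when phi vanishes.\<close>

lemma L2_phi0_ge: "et\<^sup>2 + gram x y / 4 <= L2 (nexp (0, x, y, et))"
proof -
 have "minor2 (nexp (0, x, y, et)) e1 e2 f2 f1 = - (et\<^sup>2 + gram x y / 4)"
  by (simp add: minor2_def nexp_def gram_def power2_eq_square field_simps)
 moreover have "0 <= et\<^sup>2 + gram x y / 4" using gram_nonneg[of x y] by simp
 ultimately show ?thesis using minor2_le_L2[of "nexp (0, x, y, et)" e1 e2 f2 f1] by simp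
qed

lemma norm_phi0:
 assumes "supp x" "supp y"
 shows "norm (nexp (0, x, y, et)) <= (real CARD('m))\<^sup>2 * (2 * (1 + (norm x)\<^sup>2 + (norm y)\<^sup>2 + \<bar>et\<bar>))"
  "(norm x)\<^sup>2 + (norm y)\<^sup>2 + \<bar>et\<bar> <= 5 * norm (nexp (0, x, y, et))"
proof -
 let ?B = "2 * (1 + (norm x)\<^sup>2 + (norm y)\<^sup>2 + \<bar>et\<bar>)" and ?g = "nexp (0, x, y, et)"
 have a: "a <= 1 + a\<^sup>2" for a :: real
 proof -
  have "2 * a <= 1 + a\<^sup>2" using zero_le_power2[of "a - 1"] by (simp add: power2_diff)
  then show ?thesis using zero_le_power2[of a] by linarith
 qed
 have xy: "\<bar>x \<bullet> y\<bar> <= (norm x)\<^sup>2 + (norm y)\<^sup>2"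
 proof -
  have "\<bar>x \<bullet> y\<bar> <= norm x * norm y" by (rule Cauchy_Schwarz_ineq2)
  also have "\<dots> <= (norm x)\<^sup>2 + (norm y)\<^sup>2"
   using sum_squares_bound[of "norm x" "norm y"] mult_nonneg_nonneg[OF norm_ge_zero[of x] norm_ge_zero[of y]] by linarith
  finally show ?thesis .
 qed
 show "norm ?g <= (real CARD('m))\<^sup>2 * ?B"
 proof (rule nexp_norm_le[OF assms])
  have n: "0 <= (norm x)\<^sup>2" "0 <= (norm y)\<^sup>2" by auto
  have gen: "1 <= 2 * (1 + p + q + \<bar>r\<bar>)" "q <= 2 * (1 + p + q + \<bar>r\<bar>)" "u <= 1 + p ==> u <= 2 * (1 + p + q + \<bar>r\<bar>)"
   "u <= 1 + q ==> u <= 2 * (1 + p + q + \<bar>r\<bar>)"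
   "\<bar>u\<bar> <= p + q ==> \<bar>r - u / 2\<bar> <= 2 * (1 + p + q + \<bar>r\<bar>)" "\<bar>u\<bar> <= p + q ==> \<bar>- r - u / 2\<bar> <= 2 * (1 + p + q + \<bar>r\<bar>)"
   if "0 <= p" "0 <= q" for p q r u :: real using that unfolding distrib_left by linarith+
  show "1 <= ?B" "(norm y)\<^sup>2 <= ?B" by (rule gen[OF n])+
  show "\<bar>0\<bar> <= ?B" using n by (simp add: add_nonneg_nonneg)
  show "norm x + \<bar>0\<bar> * norm y <= ?B" "norm y <= ?B" using gen(3,4)[OF n a] by simp_all
  show "\<bar>et - x \<bullet> y / 2 - 0 * (y \<bullet> y) / 6\<bar> <= ?B" "\<bar>- et - x \<bullet> y / 2 + 0 * (y \<bullet> y) / 6\<bar> <= ?B"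
   using gen(5,6)[OF n xy] by simp_all
  show "\<bar>- 0 * et - x \<bullet> x / 2 + 0\<^sup>2 * (y \<bullet> y) / 24\<bar> <= ?B" using n by (simp add: power2_norm_eq_inner)
 qed
 have e: "?g $ e1 $ f1 = - (norm x)\<^sup>2 / 2" "?g $ e2 $ f2 = - (norm y)\<^sup>2 / 2" "?g $ e1 $ f2 = et - x \<bullet> y / 2"
   "?g $ e2 $ f1 = - et - x \<bullet> y / 2"
  by (simp_all add: nexp_def power2_norm_eq_inner)
 have "(norm x)\<^sup>2 / 2 <= norm ?g" using abs_entry_le_norm[of ?g e1 f1] by (simp add: e)
 moreover have "(norm y)\<^sup>2 / 2 <= norm ?g" using abs_entry_le_norm[of ?g e2 f2] by (simp add: e)
 moreover have "\<bar>et\<bar> <= norm ?g" using abs_entry_le_norm[of ?g e1 f2] abs_entry_le_norm[of ?g e2 f1] unfolding e by linarith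
 ultimately show "(norm x)\<^sup>2 + (norm y)\<^sup>2 + \<bar>et\<bar> <= 5 * norm ?g" by linarith
qed

text \<open>By \<open>norm_phi0\<close> the norm is of order
  \<open>(norm x)^2 + (norm y)^2 + \<bar>et\<bar>\<close> up to an additive constant, so paths can
  be prescribed in coordinates.\<close>

lemma fills_phi0:
 assumes C: "C >= 1" and f: "\<And>N. N >= 1 ==> \<exists>x y et. continuous_on {0..1::real} x \<and> continuous_on {0..1} y \<and> continuous_on {0..1} et \<and>
   (\<forall>ta\<in>{0..1}. (0, x ta, y ta, et ta) \<in> U \<and> N <= C * ((norm (x ta))\<^sup>2 + (norm (y ta))\<^sup>2 + \<bar>et ta\<bar>) \<and>
    (norm (x ta))\<^sup>2 + (norm (y ta))\<^sup>2 + \<bar>et ta\<bar> <= C * N) \<and>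
   L2 (nexp (0, x 0, y 0, et 0)) <= C * N \<and> N\<^sup>2 <= C * ((et 1)\<^sup>2 + gram (x 1) (y 1) / 4)"
  and U: "U \<subseteq> ncar"
 shows "fills (nexp ` U)"
proof (rule fills_by_paths)
 let ?D = "(real CARD('m))\<^sup>2"
 let ?K = "5 * C + 4 * ?D * C"
 show K: "?K >= 1" using C DM_ge_1 by (simp add: add_increasing2)
 have CK: "C <= ?K" using C by (simp add: add_increasing2)
 fix N :: real assume N: "N >= 1"
 obtain x y et where h: "continuous_on {0..1::real} x" "continuous_on {0..1} y" "continuous_on {0..1} et"
  "\<And>ta. ta \<in> {0..1} ==> (0, x ta, y ta, et ta) \<in> U"
  "\<And>ta. ta \<in> {0..1} ==> N <= C * ((norm (x ta))\<^sup>2 + (norm (y ta))\<^sup>2 + \<bar>et ta\<bar>)"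
  "\<And>ta. ta \<in> {0..1} ==> (norm (x ta))\<^sup>2 + (norm (y ta))\<^sup>2 + \<bar>et ta\<bar> <= C * N"
  "L2 (nexp (0, x 0, y 0, et 0)) <= C * N" "N\<^sup>2 <= C * ((et 1)\<^sup>2 + gram (x 1) (y 1) / 4)"
  using f[OF N] by metis
 let ?ga = "\<lambda>ta. nexp (0, x ta, y ta, et ta)"
 show "\<exists>ga. continuous_on {0..1::real} ga \<and> (\<forall>ta\<in>{0..1}. ga ta \<in> nexp ` U \<and>
   N <= ?K * norm (ga ta) \<and> norm (ga ta) <= ?K * N) \<and> L2 (ga 0) <= ?K * N \<and> N\<^sup>2 <= ?K * L2 (ga 1)"
 proof (intro exI[of _ ?ga] conjI ballI)
  show "continuous_on {0..1} ?ga" by (intro continuous_on_nexp h(1-3) continuous_intros)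
  fix ta :: real assume t: "ta \<in> {0..1}"
  show "?ga ta \<in> nexp ` U" using h(4)[OF t] by blast
  have s: "supp (x ta)" "supp (y ta)" using h(4)[OF t] U by auto
  have "N <= C * (5 * norm (?ga ta))" using h(5)[OF t] mult_left_mono[OF norm_phi0(2)[OF s, of "et ta"], of C] C by linarith
  also have "\<dots> = (5 * C) * norm (?ga ta)" by simp
  also have "\<dots> <= ?K * norm (?ga ta)" using C by (intro mult_right_mono) auto
  finally show "N <= ?K * norm (?ga ta)" .
  have CN: "1 <= C * N" using mult_mono[of 1 C 1 N] C N by simp
  have "norm (?ga ta) <= ?D * (2 * (1 + ((norm (x ta))\<^sup>2 + (norm (y ta))\<^sup>2 + \<bar>et ta\<bar>)))"
   using norm_phi0(1)[OF s, of "et ta"] by (simp add: add.assoc)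
  also have "\<dots> <= ?D * (2 * (C * N + C * N))" using h(6)[OF t] CN by (intro mult_left_mono add_mono) auto
  also have "\<dots> = (4 * ?D * C) * N" by simp
  also have "\<dots> <= ?K * N" using C N by (intro mult_right_mono) auto
  finally show "norm (?ga ta) <= ?K * N" .
 next
  show "L2 (?ga 0) <= ?K * N" using h(7) mult_right_mono[OF CK, of N] N by linarith
  have "N\<^sup>2 <= C * L2 (?ga 1)" using h(8) mult_left_mono[OF L2_phi0_ge[of "et 1" "x 1" "y 1"], of C] C by linarith
  also have "\<dots> <= ?K * L2 (?ga 1)" by (intro mult_right_mono CK L2_nonneg)
  finally show "N\<^sup>2 <= ?K * L2 (?ga 1)" .
 qed
qed

lemma pos_on_interval:
 fixes f :: "real => real"
 assumes "continuous_on {0..1} f" "\<And>t. t \<in> {0..1} ==> f t > 0"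
 obtains c where "c > 0" "\<And>t. t \<in> {0..1} ==> c <= f t"
proof -
 obtain t0 where "t0 \<in> {0..1}" "\<And>t. t \<in> {0..1} ==> f t0 <= f t"
  using continuous_attains_inf[of "{0..1::real}" f] assms(1) by auto
 then show ?thesis using that[of "f t0"] assms(2) by blast
qed

lemma norm_mix_le: "ta \<in> {0..1} ==> norm ((1 - ta) *\<^sub>R a + ta *\<^sub>R b) <= norm a + norm b" for a b :: "'z::real_normed_vector"
proof -
 assume "ta \<in> {0..1}"
 then have "norm ((1 - ta) *\<^sub>R a + ta *\<^sub>R b) <= (1 - ta) * norm a + ta * norm b"
  by (intro order_trans[OF norm_triangle_ineq]) auto
 also have "\<dots> <= 1 * norm a + 1 * norm b" using \<open>ta \<in> _\<close> by (intro add_mono mult_right_mono) auto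
 finally show ?thesis by simp
qed

text \<open>The segment from the dependent to the independent pair is multiplied by
  \<open>sqrt N\<close>. Its norm stays of order \<open>N\<close>, the eta coordinate being only of
  order \<open>sqrt N\<close>, while \<open>L2\<close> passes from order \<open>N\<close> to order
  \<open>N^2\<close>.\<close>

lemma fills_parallel_independent:
 assumes U: "subspace U" "U \<subseteq> ncar" and X1: "(0, x1, y1, et1) \<in> U" "x1 ~= 0 \<or> y1 ~= 0" "gram x1 y1 = 0"
  and X2: "(0, x2, y2, et2) \<in> U" "gram x2 y2 ~= 0"
 shows "fills (nexp ` U)"
proof -
 define x y et where "x ta = (1 - ta) *\<^sub>R x1 + ta *\<^sub>R x2" and "y ta = (1 - ta) *\<^sub>R y1 + ta *\<^sub>R y2"
  and "et ta = (1 - ta) *\<^sub>R et1 + ta *\<^sub>R et2" for ta :: real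
 have cont: "continuous_on {0..1} x" "continuous_on {0..1} y" "continuous_on {0..1} et"
  unfolding x_def y_def et_def by (intro continuous_intros)+
 have mem: "r *\<^sub>R (0, x ta, y ta, et ta) \<in> U" for r ta
 proof -
  have "(0, x ta, y ta, et ta) = (1 - ta) *\<^sub>R (0, x1, y1, et1) + ta *\<^sub>R (0, x2, y2, et2)"
   by (simp add: x_def y_def et_def)
  then show ?thesis using U(1) X1(1) X2(1) by (metis subspace_scale subspace_add)
 qed
 \<comment> \<open>If the segment met the origin, the independent pair would be a multiple of the
   dependent one.\<close>
 have nz: "x ta ~= 0 \<or> y ta ~= 0" if "ta \<in> {0..1}" for ta
 proof (rule ccontr)
  assume "\<not> ?thesis"
  then have z: "ta *\<^sub>R x2 = - ((1 - ta) *\<^sub>R x1)" "ta *\<^sub>R y2 = - ((1 - ta) *\<^sub>R y1)"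
   by (simp_all add: x_def y_def eq_neg_iff_add_eq_0 add.commute)
  have "ta^4 * gram x2 y2 = (1 - ta)^4 * gram x1 y1"
   unfolding gram_scale[symmetric] z by (simp add: gram_def)
  then have "ta = 0" using X1(3) X2(2) by simp
  then show False using z X1(2) by simp
 qed
 have "continuous_on {0..1} (\<lambda>ta. (norm (x ta))\<^sup>2 + (norm (y ta))\<^sup>2)" by (intro continuous_intros cont)
 from pos_on_interval[OF this] nz obtain c where c: "c > 0" "\<And>ta. ta \<in> {0..1} ==> c <= (norm (x ta))\<^sup>2 + (norm (y ta))\<^sup>2"
  by (metis add_pos_nonneg add_nonneg_pos zero_le_power2 zero_less_norm_iff zero_less_power)
 have s1: "supp x1" "supp y1" using X1(1) U(2) by auto
 obtain C1 where C1: "C1 >= 1" "\<And>r. r >= 0 ==> L2 (nexp (r *\<^sub>R (0, x1, y1, et1))) <= C1 * (1 + r\<^sup>2)"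
  using L2_ray_parallel[OF s1 X1(3)] by blast
 define M where "M = (norm x1 + norm x2)\<^sup>2 + (norm y1 + norm y2)\<^sup>2 + (\<bar>et1\<bar> + \<bar>et2\<bar>)"
 have g2: "gram x2 y2 > 0" using gram_nonneg[of x2 y2] X2(2) by simp
 define C where "C = 1 + 1 / c + M + 2 * C1 + 4 / gram x2 y2"
 have M0: "M >= 0" unfolding M_def by simp
 have C: "C >= 1" "1 / c <= C" "M <= C" "2 * C1 <= C" "4 / gram x2 y2 <= C"
  unfolding C_def using c(1) M0 C1 g2 by (simp_all add: field_simps add_nonneg_nonneg add_pos_pos)
 show ?thesis
 proof (rule fills_phi0[OF C(1) _ U(2)])
  fix N :: real assume N: "N >= 1"
  define r where "r = sqrt N"
  have r: "r >= 1" "r\<^sup>2 = N" "r <= N" using N by (auto simp: r_def) (metis N abs_of_nonneg less_eq_real_def mult_left_mono order_trans real_sqrt_ge_one real_sqrt_mult_self zero_le_one mult.right_neutral)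
  show "\<exists>x y et. continuous_on {0..1::real} x \<and> continuous_on {0..1} y \<and> continuous_on {0..1} et \<and>
   (\<forall>ta\<in>{0..1}. (0, x ta, y ta, et ta) \<in> U \<and> N <= C * ((norm (x ta))\<^sup>2 + (norm (y ta))\<^sup>2 + \<bar>et ta\<bar>) \<and>
    (norm (x ta))\<^sup>2 + (norm (y ta))\<^sup>2 + \<bar>et ta\<bar> <= C * N) \<and>
   L2 (nexp (0, x 0, y 0, et 0)) <= C * N \<and> N\<^sup>2 <= C * ((et 1)\<^sup>2 + gram (x 1) (y 1) / 4)"
  proof (rule exI[of _ "\<lambda>ta. r *\<^sub>R x ta"], rule exI[of _ "\<lambda>ta. r *\<^sub>R y ta"],
    rule exI[of _ "\<lambda>ta. r * et ta"], intro conjI ballI)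
   show "continuous_on {0..1} (\<lambda>ta. r *\<^sub>R x ta)" "continuous_on {0..1} (\<lambda>ta. r *\<^sub>R y ta)" "continuous_on {0..1} (\<lambda>ta. r * et ta)"
    by (intro continuous_intros cont)+
   fix ta :: real assume t: "ta \<in> {0..1}"
   show "(0, r *\<^sub>R x ta, r *\<^sub>R y ta, r * et ta) \<in> U" using mem[of r ta] by simp
   have sq: "(norm (r *\<^sub>R x ta))\<^sup>2 + (norm (r *\<^sub>R y ta))\<^sup>2 = N * ((norm (x ta))\<^sup>2 + (norm (y ta))\<^sup>2)"
    using r by (simp add: power_mult_distrib algebra_simps)
   have "N = (1 / c) * (N * c)" using c(1) by simp
   also have "\<dots> <= C * (N * ((norm (x ta))\<^sup>2 + (norm (y ta))\<^sup>2))"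
    using C c(1) c(2)[OF t] N by (intro mult_mono) auto
   also have "\<dots> <= C * ((norm (r *\<^sub>R x ta))\<^sup>2 + (norm (r *\<^sub>R y ta))\<^sup>2 + \<bar>r * et ta\<bar>)"
    unfolding sq[symmetric] using C by (intro mult_left_mono) auto
   finally show "N <= C * ((norm (r *\<^sub>R x ta))\<^sup>2 + (norm (r *\<^sub>R y ta))\<^sup>2 + \<bar>r * et ta\<bar>)" .
   have "\<bar>r * et ta\<bar> <= N * (\<bar>et1\<bar> + \<bar>et2\<bar>)"
    using norm_mix_le[OF t, of et1 et2] r N unfolding abs_mult by (intro mult_mono) (auto simp: et_def)
   moreover have "(norm (x ta))\<^sup>2 <= (norm x1 + norm x2)\<^sup>2" "(norm (y ta))\<^sup>2 <= (norm y1 + norm y2)\<^sup>2"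
    unfolding x_def y_def by (intro power_mono norm_mix_le t norm_ge_zero)+
   then have "N * ((norm (x ta))\<^sup>2 + (norm (y ta))\<^sup>2) <= N * ((norm x1 + norm x2)\<^sup>2 + (norm y1 + norm y2)\<^sup>2)"
    using N by (intro mult_left_mono add_mono) auto
   ultimately have "(norm (r *\<^sub>R x ta))\<^sup>2 + (norm (r *\<^sub>R y ta))\<^sup>2 + \<bar>r * et ta\<bar> <= N * M"
    unfolding sq M_def by (simp add: distrib_left)
   also have "\<dots> <= C * N" using C N by (simp add: mult.commute mult_right_mono)
   finally show "(norm (r *\<^sub>R x ta))\<^sup>2 + (norm (r *\<^sub>R y ta))\<^sup>2 + \<bar>r * et ta\<bar> <= C * N" .
  next
   have "L2 (nexp (0, r *\<^sub>R x 0, r *\<^sub>R y 0, r * et 0)) <= C1 * (1 + r\<^sup>2)"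
    using C1(2)[of r] r by (simp add: x_def y_def et_def)
   also have "\<dots> <= (2 * C1) * N" using C1(1) N r by (simp add: algebra_simps)
   also have "\<dots> <= C * N" using C N by (intro mult_right_mono) auto
   finally show "L2 (nexp (0, r *\<^sub>R x 0, r *\<^sub>R y 0, r * et 0)) <= C * N" .
   have "r^4 = N\<^sup>2" using r(2) by (metis power2_eq_square power4_eq_xxxx mult.assoc)
   then have "N\<^sup>2 = (4 / gram x2 y2) * (gram (r *\<^sub>R x 1) (r *\<^sub>R y 1) / 4)"
    using g2 by (simp add: x_def y_def gram_scale)
   also have "\<dots> <= C * ((r * et 1)\<^sup>2 + gram (r *\<^sub>R x 1) (r *\<^sub>R y 1) / 4)"
    using C gram_nonneg g2 by (intro mult_mono) auto
   finally show "N\<^sup>2 <= C * ((r * et 1)\<^sup>2 + gram (r *\<^sub>R x 1) (r *\<^sub>R y 1) / 4)" .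
  qed
 qed
qed

text \<open>A dependent pair of size \<open>sqrt N\<close> and an eta coordinate of size
  \<open>N\<close> have the same order of norm, but \<open>L2\<close> of orders \<open>N\<close> and
  \<open>N^2\<close>.\<close>

lemma fills_parallel_eta:
 assumes U: "subspace U" "U \<subseteq> ncar" and X1: "(0, x1, y1, et1) \<in> U" "x1 ~= 0 \<or> y1 ~= 0" "gram x1 y1 = 0"
  and X2: "(0, 0, 0, et2) \<in> U" "et2 ~= 0"
 shows "fills (nexp ` U)"
proof -
 have ax: "(0, 0, 0, e) \<in> U" for e using subspace_scale[OF U(1) X2(1), of "e / et2"] X2(2) by simp
 have mem: "(0, a *\<^sub>R x1, a *\<^sub>R y1, e) \<in> U" for a e
  using subspace_add[OF U(1) subspace_scale[OF U(1) X1(1), of a] ax[of "e - a * et1"]] by simp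
 have s1: "supp x1" "supp y1" using X1(1) U(2) by auto
 obtain C1 where C1: "C1 >= 1" "\<And>r. r >= 0 ==> L2 (nexp (r *\<^sub>R (0, x1, y1, 0))) <= C1 * (1 + r\<^sup>2)"
  using L2_ray_parallel[OF s1 X1(3)] by blast
 define k where "k = (norm x1)\<^sup>2 + (norm y1)\<^sup>2"
 have k: "k > 0" using X1(2) by (auto simp: k_def add_pos_nonneg add_nonneg_pos)
 define C where "C = 2 + 4 / k + k + 2 * C1"
 have C: "C >= 2" "4 / k <= C" "k + 1 <= C" "2 * C1 <= C" unfolding C_def using k C1 by (simp_all add: field_simps)
 show ?thesis
 proof (rule fills_phi0[of C, OF _ _ U(2)])
  show "C >= 1" using C by simp
  fix N :: real assume N: "N >= 1"
  define r where "r = sqrt N"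
  have r: "r >= 0" "r\<^sup>2 = N" using N by (auto simp: r_def)
  show "\<exists>x y et. continuous_on {0..1::real} x \<and> continuous_on {0..1} y \<and> continuous_on {0..1} et \<and>
   (\<forall>ta\<in>{0..1}. (0, x ta, y ta, et ta) \<in> U \<and> N <= C * ((norm (x ta))\<^sup>2 + (norm (y ta))\<^sup>2 + \<bar>et ta\<bar>) \<and>
    (norm (x ta))\<^sup>2 + (norm (y ta))\<^sup>2 + \<bar>et ta\<bar> <= C * N) \<and>
   L2 (nexp (0, x 0, y 0, et 0)) <= C * N \<and> N\<^sup>2 <= C * ((et 1)\<^sup>2 + gram (x 1) (y 1) / 4)"
  proof (rule exI[of _ "\<lambda>ta. ((1 - ta) * r) *\<^sub>R x1"], rule exI[of _ "\<lambda>ta. ((1 - ta) * r) *\<^sub>R y1"],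
    rule exI[of _ "\<lambda>ta. ta * N"], intro conjI ballI)
   show "continuous_on {0..1} (\<lambda>ta. ((1 - ta) * r) *\<^sub>R x1)" "continuous_on {0..1} (\<lambda>ta. ((1 - ta) * r) *\<^sub>R y1)"
    "continuous_on {0..1} (\<lambda>ta. ta * N)" by (intro continuous_intros)+
   fix ta :: real assume t: "ta \<in> {0..1}"
   show "(0, ((1 - ta) * r) *\<^sub>R x1, ((1 - ta) * r) *\<^sub>R y1, ta * N) \<in> U" by (rule mem)
   have sq: "(norm (((1 - ta) * r) *\<^sub>R x1))\<^sup>2 + (norm (((1 - ta) * r) *\<^sub>R y1))\<^sup>2 + \<bar>ta * N\<bar> = N * ((1 - ta)\<^sup>2 * k + ta)"
    using t N r(2) by (simp add: power_mult_distrib k_def) (simp add: algebra_simps)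
   have "1 <= C * ((1 - ta)\<^sup>2 * k + ta)"
   proof (cases "ta >= 1/2")
    case True
    have "1 <= 2 * ta" using True by simp
    also have "\<dots> <= C * ((1 - ta)\<^sup>2 * k + ta)" using C k True by (intro mult_mono) auto
    finally show ?thesis .
   next
    case False
    then have "1/4 <= (1 - ta)\<^sup>2" using power_mono[of "1/2" "1 - ta" 2] by (simp add: power2_eq_square)
    then have "1 <= (4 / k) * ((1 - ta)\<^sup>2 * k)" using k by simp
    also have "\<dots> <= C * ((1 - ta)\<^sup>2 * k + ta)" using C k t by (intro mult_mono) auto
    finally show ?thesis .
   qed
   from mult_left_mono[OF this, of N] show "N <= C * ((norm (((1 - ta) * r) *\<^sub>R x1))\<^sup>2 + (norm (((1 - ta) * r) *\<^sub>R y1))\<^sup>2 + \<bar>ta * N\<bar>)"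
    unfolding sq using N by (simp add: mult_ac)
   have "(1 - ta)\<^sup>2 <= 1" using t by (simp add: power_le_one)
   then have "(1 - ta)\<^sup>2 * k + ta <= 1 * k + 1" using t k by (intro add_mono mult_right_mono) auto
   then have "(1 - ta)\<^sup>2 * k + ta <= C" using C by linarith
   from mult_left_mono[OF this, of N] show "(norm (((1 - ta) * r) *\<^sub>R x1))\<^sup>2 + (norm (((1 - ta) * r) *\<^sub>R y1))\<^sup>2 + \<bar>ta * N\<bar> <= C * N"
    unfolding sq using N by (simp add: mult_ac)
  next
   have "L2 (nexp (0, ((1 - 0) * r) *\<^sub>R x1, ((1 - 0) * r) *\<^sub>R y1, 0 * N)) <= C1 * (1 + r\<^sup>2)"
    using C1(2)[of r] r by simp
   also have "\<dots> <= (2 * C1) * N" using C1(1) N r by (simp add: algebra_simps)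
   also have "\<dots> <= C * N" using C N by (intro mult_right_mono) auto
   finally show "L2 (nexp (0, ((1 - 0) * r) *\<^sub>R x1, ((1 - 0) * r) *\<^sub>R y1, 0 * N)) <= C * N" .
   show "N\<^sup>2 <= C * ((1 * N)\<^sup>2 + gram (((1 - 1) * r) *\<^sub>R x1) (((1 - 1) * r) *\<^sub>R y1) / 4)"
    using mult_right_mono[of 1 C "N\<^sup>2"] C by (simp add: gram_def)
  qed
 qed
qed

section \<open>The case y = 0, where the upper right entry is - Qf / 2 for a quadratic form
  Qf\<close>

definition Qf :: "real => 'm vc => real => real" where "Qf pp x et = 2 * pp * et + x \<bullet> x"

lemma norm_y0:
 assumes "supp x"
 shows "norm (nexp (pp, x, 0, et)) <= (real CARD('m))\<^sup>2 * (1 + (\<bar>pp\<bar> + norm x + \<bar>et\<bar>) + \<bar>Qf pp x et\<bar>)"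
  "\<bar>pp\<bar> + norm x + \<bar>et\<bar> <= (2 + real CARD('m)) * norm (nexp (pp, x, 0, et))"
  "\<bar>Qf pp x et\<bar> <= 2 * norm (nexp (pp, x, 0, et))"
proof -
 let ?g = "nexp (pp, x, 0, et)"
 have n: "0 <= norm x" by simp
 have q: "- pp * et - x \<bullet> x / 2 = - Qf pp x et / 2" by (simp add: Qf_def field_simps)
 show "norm ?g <= (real CARD('m))\<^sup>2 * (1 + (\<bar>pp\<bar> + norm x + \<bar>et\<bar>) + \<bar>Qf pp x et\<bar>)"
  by (rule nexp_norm_le) (use n q assms in \<open>auto\<close>)
 have e: "?g $ e1 $ e2 = pp" "?g $ e1 $ f2 = et" "?g $ e1 $ f1 = - Qf pp x et / 2" "m \<in> mid ==> ?g $ e1 $ m = x $ m" for m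
  using q by (simp_all add: nexp_def)
 have "norm x <= real CARD('m) * norm ?g"
  using abs_entry_le_norm[of ?g e1] e by (intro norm_le_sum_mid assms) (metis, simp)
 moreover have "\<bar>pp\<bar> <= norm ?g" "\<bar>et\<bar> <= norm ?g" using abs_entry_le_norm[of ?g e1 e2] abs_entry_le_norm[of ?g e1 f2] e by simp_all
 ultimately show "\<bar>pp\<bar> + norm x + \<bar>et\<bar> <= (2 + real CARD('m)) * norm ?g" by (simp add: distrib_right)
 show "\<bar>Qf pp x et\<bar> <= 2 * norm ?g" using abs_entry_le_norm[of ?g e1 f1] by (simp add: e)
qed

text \<open>Since the upper right entry vanishes, the squares of \<open>pp\<close>, of
  \<open>et\<close> and of the coordinates of \<open>x\<close> are minors up to sign.\<close>

lemma L2_isotropic_ge: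
 assumes "supp x" "Qf pp x et = 0"
 shows "(\<bar>pp\<bar> + norm x + \<bar>et\<bar>)\<^sup>2 <= (2 + real CARD('m))\<^sup>2 * L2 (nexp (pp, x, 0, et))"
proof -
 let ?g = "nexp (pp, x, 0, et)" let ?s = "sqrt (L2 ?g)"
 have q: "- pp * et - x \<bullet> x / 2 = 0" using assms(2) by (simp add: Qf_def field_simps)
 have "minor2 ?g e1 f2 e2 f1 = - pp\<^sup>2" "minor2 ?g e1 e2 f2 f1 = - et\<^sup>2"
  using q by (simp_all add: minor2_def nexp_def power2_eq_square)
 then have "pp\<^sup>2 <= L2 ?g" "et\<^sup>2 <= L2 ?g"
  using minor2_le_L2[of ?g e1 f2 e2 f1] minor2_le_L2[of ?g e1 e2 f2 f1] by simp_all
 then have 1: "\<bar>pp\<bar> <= ?s" "\<bar>et\<bar> <= ?s" by (simp_all add: real_le_rsqrt)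
 have "\<bar>x $ m\<bar> <= ?s" if "m \<in> mid" for m
 proof -
  have "minor2 ?g e1 m m f1 = - (x $ m)\<^sup>2" using q that by (simp add: minor2_def nexp_def power2_eq_square)
  then have "(x $ m)\<^sup>2 <= L2 ?g" using minor2_le_L2[of ?g e1 m m f1] by simp
  then show ?thesis by (simp add: real_le_rsqrt)
 qed
 then have "norm x <= real CARD('m) * ?s" using assms(1) by (intro norm_le_sum_mid) (auto simp: L2_nonneg)
 with 1 have "\<bar>pp\<bar> + norm x + \<bar>et\<bar> <= (2 + real CARD('m)) * ?s" by (simp add: distrib_right)
 then have "(\<bar>pp\<bar> + norm x + \<bar>et\<bar>)\<^sup>2 <= ((2 + real CARD('m)) * ?s)\<^sup>2" by (intro power_mono) auto
 then show ?thesis by (simp add: power_mult_distrib L2_nonneg)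
qed

lemma Qf_scale: "Qf (r * pp) (r *\<^sub>R x) (r * et) = r\<^sup>2 * Qf pp x et"
 by (simp add: Qf_def power2_eq_square algebra_simps)

text \<open>The scaling factor \<open>r\<close> along the segment from \<open>v1\<close> to \<open>v2\<close> is the positive root of \<open>\<bar>Q\<bar> r\<^sup>2 + r = N\<close>.\<close>

lemma fills_isotropic:
 assumes U: "subspace U" "U \<subseteq> ncar" and v1: "(pp1, x1, 0, et1) \<in> U" "Qf pp1 x1 et1 ~= 0"
  and v2: "(pp2, x2, 0, et2) \<in> U" "Qf pp2 x2 et2 = 0" "(pp2, x2, et2) ~= (0, 0, 0)"
 shows "fills (nexp ` U)"
proof -
 let ?d = "real CARD('m)"
 define pp x et where "pp ta = (1 - ta) *\<^sub>R pp1 + ta *\<^sub>R pp2" and "x ta = (1 - ta) *\<^sub>R x1 + ta *\<^sub>R x2"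
  and "et ta = (1 - ta) *\<^sub>R et1 + ta *\<^sub>R et2" for ta :: real
 have cont: "continuous_on {0..1} pp" "continuous_on {0..1} x" "continuous_on {0..1} et"
  unfolding x_def pp_def et_def by (intro continuous_intros)+
 have mem: "(r * pp ta, r *\<^sub>R x ta, 0, r * et ta) \<in> U" for r ta
 proof -
  have eq: "(r * pp ta, r *\<^sub>R x ta, 0, r * et ta) = r *\<^sub>R ((1 - ta) *\<^sub>R (pp1, x1, 0, et1) + ta *\<^sub>R (pp2, x2, 0, et2))"
   by (simp add: x_def pp_def et_def)
  show ?thesis unfolding eq using U(1) v1(1) v2(1) by (metis subspace_scale subspace_add)
 qed
 define m where "m ta = \<bar>pp ta\<bar> + norm (x ta) + \<bar>et ta\<bar>" for ta
 define q where "q ta = \<bar>Qf (pp ta) (x ta) (et ta)\<bar>" for ta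
 \<comment> \<open>A zero on the segment would make the endpoints proportional, although
   \<open>Qf\<close> vanishes at only one of them.\<close>
 have mpos: "m ta > 0" if "ta \<in> {0..1}" for ta
 proof (rule ccontr)
  assume "\<not> m ta > 0"
  then have z: "pp ta = 0" "x ta = 0" "et ta = 0" unfolding m_def by (smt (verit) norm_ge_zero norm_eq_zero abs_ge_zero abs_eq_0)+
  then have e: "ta * pp2 = - ((1 - ta) * pp1)" "ta *\<^sub>R x2 = - ((1 - ta) *\<^sub>R x1)" "ta * et2 = - ((1 - ta) * et1)"
   by (simp_all add: x_def pp_def et_def eq_neg_iff_add_eq_0 add.commute)
  have "(1 - ta)\<^sup>2 * Qf pp1 x1 et1 = ta\<^sup>2 * Qf pp2 x2 et2"
   unfolding Qf_scale[symmetric] e by (simp add: Qf_def)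
  then have "ta = 1" using v1(2) v2(2) by simp
  then show False using e v2(3) by simp
 qed
 have "continuous_on {0..1} m" unfolding m_def by (intro continuous_intros cont)
 from pos_on_interval[OF this mpos] obtain c where c: "c > 0" "\<And>ta. ta \<in> {0..1} ==> c <= m ta" by metis
 define M where "M = (\<bar>pp1\<bar> + \<bar>pp2\<bar>) + (norm x1 + norm x2) + (\<bar>et1\<bar> + \<bar>et2\<bar>)"
 have mM: "m ta <= M" if "ta \<in> {0..1}" for ta
  using norm_mix_le[OF that, of pp1 pp2] norm_mix_le[OF that, of x1 x2] norm_mix_le[OF that, of et1 et2]
  unfolding m_def M_def x_def pp_def et_def real_norm_def by linarith
 have M0: "M >= 0" unfolding M_def by simp
 obtain C1 where C1: "C1 >= 1" "\<And>r. r >= 0 ==> L2 (nexp (r *\<^sub>R (pp1, x1, 0, et1))) <= C1 * (1 + r\<^sup>2)"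
  using L2_ray_y0 by metis
 define q1 where "q1 = \<bar>Qf pp1 x1 et1\<bar>"
 have q1: "q1 > 0" using v1(2) by (simp add: q1_def)
 define C where "C = 2 + ?d\<^sup>2 * (2 + M) + ((2 + ?d) / c + 2) + C1 * (1 + 1 / q1) + ((2 + ?d) / c)\<^sup>2"
 have nn: "0 <= ?d\<^sup>2 * (2 + M)" "0 <= (2 + ?d) / c" "0 <= C1 * (1 + 1 / q1)" "0 <= ((2 + ?d) / c)\<^sup>2"
  using M0 c(1) C1(1) q1 by auto
 then have C: "C >= 1" "?d\<^sup>2 * (2 + M) <= C" "(2 + ?d) / c + 2 <= C" "C1 * (1 + 1 / q1) <= C" "((2 + ?d) / c)\<^sup>2 <= C"
  unfolding C_def by linarith+
 show ?thesis
 proof (rule fills_by_paths[OF C(1)])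
  fix N :: real assume N: "N >= 1"
  define S where "S ta = sqrt (1 + 4 * q ta * N)" for ta
  \<comment> \<open>The rationalized quadratic formula: it remains valid and continuous where the
    leading coefficient \<open>q ta\<close> is 0.\<close>
  define r where "r ta = 2 * N / (1 + S ta)" for ta
  have q0: "q ta >= 0" for ta by (simp add: q_def)
  have S: "S ta >= 0" "(S ta)\<^sup>2 = 1 + 4 * q ta * N" for ta using q0[of ta] N by (simp_all add: S_def)
  have r0: "r ta >= 0" for ta using S(1)[of ta] N by (simp add: r_def)
  have root: "q ta * (r ta)\<^sup>2 + r ta = N" for ta
  proof -
   have s: "1 + S ta > 0" using S(1)[of ta] by simp
   have rP: "r ta * (1 + S ta) = 2 * N" using s by (simp add: r_def)
   have "(q ta * (r ta)\<^sup>2 + r ta) * (1 + S ta)\<^sup>2 = q ta * (r ta * (1 + S ta))\<^sup>2 + (r ta * (1 + S ta)) * (1 + S ta)"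
    by (simp add: power2_eq_square algebra_simps)
   also have "\<dots> = N * (4 * q ta * N + 2 + 2 * S ta)"
    unfolding rP by (simp add: power2_eq_square algebra_simps)
   also have "\<dots> = N * (1 + S ta)\<^sup>2" using S(2)[of ta] by (simp add: power2_eq_square algebra_simps)
   finally show ?thesis using s by simp
  qed
  have rN: "r ta <= N" "q ta * (r ta)\<^sup>2 <= N" for ta
   using root[of ta] r0[of ta] mult_nonneg_nonneg[OF q0[of ta] zero_le_power2[of "r ta"]] by linarith+
  have contr: "continuous_on {0..1} r"
   unfolding r_def S_def q_def Qf_def
  proof (intro continuous_intros cont ballI)
   fix ta :: real assume "ta \<in> {0..1}"
   show "1 + sqrt (1 + 4 * \<bar>2 * pp ta * et ta + x ta \<bullet> x ta\<bar> * N) ~= 0"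
    using S(1)[of ta] unfolding S_def q_def Qf_def by linarith
  qed
  let ?ga = "\<lambda>ta. nexp (r ta * pp ta, r ta *\<^sub>R x ta, 0, r ta * et ta)"
  have s: "supp (r ta *\<^sub>R x ta)" for ta using mem[of "r ta" ta] U(2) by auto
  have abs: "\<bar>r ta * pp ta\<bar> + norm (r ta *\<^sub>R x ta) + \<bar>r ta * et ta\<bar> = r ta * m ta" for ta
   using r0[of ta] by (simp add: abs_mult m_def distrib_left)
  have absQ: "\<bar>Qf (r ta * pp ta) (r ta *\<^sub>R x ta) (r ta * et ta)\<bar> = q ta * (r ta)\<^sup>2" for ta
   unfolding Qf_scale q_def by (simp add: abs_mult)
  show "\<exists>ga. continuous_on {0..1::real} ga \<and> (\<forall>ta\<in>{0..1}. ga ta \<in> nexp ` U \<and>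
   N <= C * norm (ga ta) \<and> norm (ga ta) <= C * N) \<and> L2 (ga 0) <= C * N \<and> N\<^sup>2 <= C * L2 (ga 1)"
  proof (rule exI[of _ ?ga], intro conjI ballI)
   show "continuous_on {0..1} ?ga" by (intro continuous_on_nexp continuous_intros cont contr)
   fix ta :: real assume t: "ta \<in> {0..1}"
   show "?ga ta \<in> nexp ` U" using mem by blast
   have "r ta * c <= (2 + ?d) * norm (?ga ta)"
    using norm_y0(2)[OF s, of "r ta * pp ta" ta "r ta * et ta"] mult_left_mono[OF c(2)[OF t] r0[of ta]] unfolding abs by linarith
   then have "r ta <= (2 + ?d) / c * norm (?ga ta)" using c(1) by (simp add: pos_le_divide_eq)
   then have "N <= ((2 + ?d) / c + 2) * norm (?ga ta)"
    using root[of ta] norm_y0(3)[OF s, of "r ta * pp ta" ta "r ta * et ta"] unfolding absQ distrib_right by linarith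
   also have "\<dots> <= C * norm (?ga ta)" by (intro mult_right_mono C) simp
   finally show "N <= C * norm (?ga ta)" .
   have "r ta * m ta <= N * M" using rN(1) mM[OF t] N mpos[OF t] by (intro mult_mono) auto
   then have "1 + r ta * m ta + q ta * (r ta)\<^sup>2 <= N * (2 + M)" using rN(2)[of ta] N unfolding distrib_left by linarith
   then have "?d\<^sup>2 * (1 + r ta * m ta + q ta * (r ta)\<^sup>2) <= ?d\<^sup>2 * (N * (2 + M))" by (intro mult_left_mono) auto
   also have "\<dots> = (?d\<^sup>2 * (2 + M)) * N" by simp
   also have "\<dots> <= C * N" using C N by (intro mult_right_mono) auto
   finally show "norm (?ga ta) <= C * N"
    using norm_y0(1)[OF s, of "r ta * pp ta" ta "r ta * et ta"] unfolding abs absQ by linarith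
  next
   have "q 0 = q1" by (simp add: q_def q1_def pp_def x_def et_def)
   then have "(r 0)\<^sup>2 <= N / q1" using rN(2)[of 0] q1 by (simp add: pos_le_divide_eq mult.commute)
   have "L2 (?ga 0) <= C1 * (1 + (r 0)\<^sup>2)" using C1(2)[OF r0[of 0]] by (simp add: pp_def x_def et_def)
   also have "\<dots> <= C1 * (N + N / q1)" using \<open>(r 0)\<^sup>2 <= _\<close> C1(1) N by (intro mult_left_mono add_mono) auto
   also have "\<dots> = (C1 * (1 + 1 / q1)) * N" by (simp add: algebra_simps)
   also have "\<dots> <= C * N" using C N by (intro mult_right_mono) auto
   finally show "L2 (?ga 0) <= C * N" .
   have Q2: "Qf (r 1 * pp 1) (r 1 *\<^sub>R x 1) (r 1 * et 1) = 0" unfolding Qf_scale using v2(2) by (simp add: pp_def x_def et_def)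
   then have "q 1 * (r 1)\<^sup>2 = 0" using absQ[of 1] by simp
   then have r1: "r 1 = N" using root[of 1] by linarith
   have "(N * c)\<^sup>2 <= (r 1 * m 1)\<^sup>2" unfolding r1 using c(2)[of 1] c(1) N by (intro power_mono mult_left_mono) auto
   also have "\<dots> <= (2 + ?d)\<^sup>2 * L2 (?ga 1)" using L2_isotropic_ge[OF s Q2] unfolding abs .
   finally have "N\<^sup>2 <= ((2 + ?d) / c)\<^sup>2 * L2 (?ga 1)"
    using c(1) by (simp add: power_mult_distrib power_divide pos_le_divide_eq)
   also have "\<dots> <= C * L2 (?ga 1)" by (intro mult_right_mono C L2_nonneg)
   finally show "N\<^sup>2 <= C * L2 (?ga 1)" .
  qed
 qed
qed

section \<open>Unipotent elements with phi and y both nonzero\<close>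

lemma powers_le_of_root:
 fixes r N :: real assumes "0 <= r" "1 <= N" "r ^ k <= N" "j <= k" "j > 0" shows "r ^ j <= N"
proof (cases "r <= 1")
 case True then show ?thesis using power_le_one[OF assms(1) True, of j] assms(2) by linarith
next
 case False
 then have "r ^ j <= r ^ k" using assms by (intro power_increasing) auto
 then show ?thesis using assms by linarith
qed

text \<open>Along this path the upper right entry is constantly \<open>- N\<close>.\<close>

lemma fills_principal_x:
 assumes U: "subspace U" "U \<subseteq> ncar" and w: "(pp, 0, y, 0) \<in> U" "pp ~= 0" "y ~= 0" and x: "(0, x, 0, 0) \<in> U" "x ~= 0" "x \<bullet> y = 0"
 shows "fills (nexp ` U)"
proof -
 let ?d = "real CARD('m)"
 have s: "supp x" "supp y" using w x U by auto
 have mem: "(r * pp, rh *\<^sub>R x, r *\<^sub>R y, 0) \<in> U" for r rh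
  using subspace_add[OF U(1) subspace_scale[OF U(1) w(1), of r] subspace_scale[OF U(1) x(1), of rh]] by simp
 define k where "k = pp\<^sup>2 * (y \<bullet> y)"
 have k: "k > 0" using w by (simp add: k_def)
 have xx: "x \<bullet> x > 0" and yy: "y \<bullet> y > 0" using x w by simp_all
 obtain C1 where C1: "C1 >= 1" "\<And>r. r >= 0 ==> L2 (nexp (r *\<^sub>R (0, x, 0, 0))) <= C1 * (1 + r\<^sup>2)"
  using L2_ray_y0 by metis
 define a where "a = \<bar>pp\<bar> * norm y"
 define B where "B = 1 + \<bar>pp\<bar> + norm y + y \<bullet> y + (2 * a + 2) + \<bar>pp * (y \<bullet> y)\<bar>"
 have a0: "a >= 0" by (simp add: a_def)
 have B: "B >= 1" "\<bar>pp\<bar> <= B" "norm y <= B" "y \<bullet> y <= B" "2 * a + 2 <= B" "\<bar>pp * (y \<bullet> y)\<bar> <= B"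
  unfolding B_def using a0 yy norm_ge_zero[of y] by linarith+
 define E where "E = 36 / (pp * (y \<bullet> y))\<^sup>2"
 have E: "E > 0" unfolding E_def using w yy by simp
 define C where "C = 1 + ?d\<^sup>2 * B + C1 * (1 + 2 / (x \<bullet> x)) + E"
 have "0 <= ?d\<^sup>2 * B" "0 <= C1 * (1 + 2 / (x \<bullet> x))" using B C1 xx by auto
 then have C: "C >= 1" "?d\<^sup>2 * B <= C" "C1 * (1 + 2 / (x \<bullet> x)) <= C" "E <= C" unfolding C_def using E by linarith+
 show ?thesis
 proof (rule fills_by_paths[OF C(1)])
  fix N :: real assume N: "N >= 1"
  \<comment> \<open>The entries cubic in \<open>r\<close> must reach order \<open>N\<close> at the
    end of the path, because their product is the minor of order \<open>N^2\<close>.\<close>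
  define R where "R = root 3 N"
  have R: "R >= 0" "R ^ 3 = N" using N by (simp_all add: R_def)
  define r where "r ta = ta * R" for ta
  \<comment> \<open>Solves for the \<open>x\<close> component that makes the upper right entry equal
    to \<open>- N\<close>.\<close>
  define rh where "rh ta = sqrt (((r ta)^4 * k / 12 + 2 * N) / (x \<bullet> x))" for ta
  have rh2: "rh ta >= 0" "(rh ta)\<^sup>2 * (x \<bullet> x) = (r ta)^4 * k / 12 + 2 * N" for ta
   using N k xx by (simp_all add: rh_def)
  let ?ga = "\<lambda>ta. nexp (r ta * pp, rh ta *\<^sub>R x, r ta *\<^sub>R y, 0)"
  have xy: "x \<bullet> y = 0" "y \<bullet> x = 0" using x(3) by (simp_all add: inner_commute)
  have corner: "- (r ta * pp) * 0 - (rh ta *\<^sub>R x) \<bullet> (rh ta *\<^sub>R x) / 2 + (r ta * pp)\<^sup>2 * ((r ta *\<^sub>R y) \<bullet> (r ta *\<^sub>R y)) / 24 = - N" for ta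
   using rh2(2)[of ta] by (simp add: k_def power2_eq_square power4_eq_xxxx algebra_simps)
  have e: "?ga ta $ e1 $ f1 = - N" "?ga ta $ e1 $ f2 = - ((r ta)^3 * (pp * (y \<bullet> y)) / 6)"
   "?ga ta $ e2 $ f1 = (r ta)^3 * (pp * (y \<bullet> y)) / 6" "?ga ta $ e2 $ f2 = - ((r ta)\<^sup>2 * (y \<bullet> y) / 2)" for ta
   using corner[of ta] by (simp_all add: nexp_def xy power2_eq_square power3_eq_cube)
  show "\<exists>ga. continuous_on {0..1::real} ga \<and> (\<forall>ta\<in>{0..1}. ga ta \<in> nexp ` U \<and>
   N <= C * norm (ga ta) \<and> norm (ga ta) <= C * N) \<and> L2 (ga 0) <= C * N \<and> N\<^sup>2 <= C * L2 (ga 1)"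
  proof (rule exI[of _ ?ga], intro conjI ballI)
   show "continuous_on {0..1} ?ga" unfolding r_def rh_def
    by (intro continuous_on_nexp continuous_intros) (use xx in auto)
   fix ta :: real assume t: "ta \<in> {0..1}"
   show "?ga ta \<in> nexp ` U" using mem by blast
   have "N <= norm (?ga ta)" using abs_entry_le_norm[of "?ga ta" e1 f1] e N by simp
   also have "\<dots> <= C * norm (?ga ta)" using mult_right_mono[OF C(1), of "norm (?ga ta)"] by simp
   finally show "N <= C * norm (?ga ta)" .
   have r0: "r ta >= 0" and "r ta <= R" using t R mult_right_mono[of ta 1 R] by (auto simp: r_def)
   then have "r ta ^ 3 <= N" using R power_mono[of "r ta" R 3] by simp
   then have rN: "r ta <= N" "(r ta)\<^sup>2 <= N" "(r ta)^3 <= N"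
    using powers_le_of_root[OF r0 N, of 3 1] powers_le_of_root[OF r0 N, of 3 2] by simp_all
   have rhx: "norm (rh ta *\<^sub>R x) <= (r ta)\<^sup>2 * a + 2 * N"
   proof (rule power2_le_imp_le)
    have "(norm (rh ta *\<^sub>R x))\<^sup>2 = (r ta)^4 * k / 12 + 2 * N"
     using rh2(2)[of ta] by (simp add: power_mult_distrib power2_norm_eq_inner)
    also have "\<dots> <= (r ta)^4 * k + 2 * N * (2 * N)"
    proof -
     have "0 <= (r ta)^4 * k" using k by simp
     moreover have "2 * N <= 2 * N * (2 * N)" using N mult_left_mono[of 1 "2 * N" "2 * N"] by simp
     ultimately show ?thesis by linarith
    qed
    also have "\<dots> <= ((r ta)\<^sup>2 * a + 2 * N)\<^sup>2"
    proof -
     have "((r ta)\<^sup>2 * a)\<^sup>2 = (r ta)^4 * k" by (simp add: a_def k_def power_mult_distrib power2_norm_eq_inner)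
     moreover have "0 <= 2 * ((r ta)\<^sup>2 * a) * (2 * N)" using a0 N by simp
     moreover have "(2 * N)\<^sup>2 = 2 * N * (2 * N)" by (rule power2_eq_square)
     ultimately show ?thesis unfolding power2_sum[of "(r ta)\<^sup>2 * a" "2 * N"] by linarith
    qed
    finally show "(norm (rh ta *\<^sub>R x))\<^sup>2 <= ((r ta)\<^sup>2 * a + 2 * N)\<^sup>2" .
    show "0 <= (r ta)\<^sup>2 * a + 2 * N" using a0 N by simp
   qed
   have BN: "u * c <= B * N" if "0 <= u" "u <= N" "0 <= c" "c <= B" for u c
   proof -
    have "u * c <= N * B" using that N by (intro mult_mono) auto
    then show ?thesis by (simp add: mult.commute)
   qed
   have "norm (?ga ta) <= ?d\<^sup>2 * (B * N)"
   proof (rule nexp_norm_le)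
    show "supp (rh ta *\<^sub>R x)" "supp (r ta *\<^sub>R y)" using s by simp_all
    show "1 <= B * N" using mult_mono[of 1 B 1 N] B N by simp
    show "\<bar>r ta * pp\<bar> <= B * N" using BN[OF r0 rN(1) _ B(2)] r0 by (simp add: abs_mult)
    have "norm (rh ta *\<^sub>R x) + \<bar>r ta * pp\<bar> * norm (r ta *\<^sub>R y) <= (r ta)\<^sup>2 * (2 * a) + 2 * N"
     using rhx r0 by (simp add: abs_mult a_def power2_eq_square algebra_simps)
    also have "\<dots> <= N * (2 * a) + 2 * N" using rN a0 N by (intro add_mono mult_right_mono) auto
    also have "\<dots> = (2 * a + 2) * N" by (simp add: algebra_simps)
    also have "\<dots> <= B * N" using B N by (intro mult_right_mono) auto
    finally show "norm (rh ta *\<^sub>R x) + \<bar>r ta * pp\<bar> * norm (r ta *\<^sub>R y) <= B * N" .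
    show "norm (r ta *\<^sub>R y) <= B * N" using BN[OF r0 rN(1) norm_ge_zero B(3)] r0 by simp
    show "(norm (r ta *\<^sub>R y))\<^sup>2 <= B * N" using BN[OF zero_le_power2 rN(2) _ B(4)] yy
     by (simp add: power_mult_distrib power2_norm_eq_inner)
    have m6: "\<bar>(r ta)^3 * (pp * (y \<bullet> y)) / 6\<bar> <= B * N"
     using BN[OF _ rN(3) abs_ge_zero B(6)] r0 mult_nonneg_nonneg[of B N] B(1) N by (simp add: abs_mult, linarith)
    show "\<bar>0 - (rh ta *\<^sub>R x) \<bullet> (r ta *\<^sub>R y) / 2 - r ta * pp * (r ta *\<^sub>R y \<bullet> r ta *\<^sub>R y) / 6\<bar> <= B * N"
     "\<bar>- 0 - (rh ta *\<^sub>R x) \<bullet> (r ta *\<^sub>R y) / 2 + r ta * pp * (r ta *\<^sub>R y \<bullet> r ta *\<^sub>R y) / 6\<bar> <= B * N"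
     using m6 by (simp_all add: xy power3_eq_cube mult_ac)
    have "N <= B * N" using mult_right_mono[OF B(1), of N] N by simp
    then show "\<bar>- (r ta * pp) * 0 - (rh ta *\<^sub>R x) \<bullet> (rh ta *\<^sub>R x) / 2 + (r ta * pp)\<^sup>2 * ((r ta *\<^sub>R y) \<bullet> (r ta *\<^sub>R y)) / 24\<bar> <= B * N"
     unfolding corner using N by simp
   qed
   also have "\<dots> = (?d\<^sup>2 * B) * N" by simp
   also have "\<dots> <= C * N" using C N by (intro mult_right_mono) auto
   finally show "norm (?ga ta) <= C * N" .
  next
   have "(rh 0)\<^sup>2 = 2 * N / (x \<bullet> x)" using rh2(2)[of 0] xx by (simp add: r_def field_simps)
   then have "L2 (?ga 0) <= C1 * (1 + 2 * N / (x \<bullet> x))" using C1(2)[OF rh2(1)[of 0]] by (simp add: r_def)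
   also have "\<dots> <= C1 * (N + 2 * N / (x \<bullet> x))" using C1(1) N by (intro mult_left_mono) auto
   also have "\<dots> = (C1 * (1 + 2 / (x \<bullet> x))) * N" by (simp add: algebra_simps)
   also have "\<dots> <= C * N" using C N by (intro mult_right_mono) auto
   finally show "L2 (?ga 0) <= C * N" .
   let ?A = "R^3 * (pp * (y \<bullet> y)) / 6"
   have "minor2 (?ga 1) e1 e2 f2 f1 = - (?A\<^sup>2 + N * (R\<^sup>2 * (y \<bullet> y) / 2))"
    unfolding minor2_def e by (simp add: r_def power2_eq_square)
   moreover have "0 <= N * (R\<^sup>2 * (y \<bullet> y) / 2)" using N yy by simp
   ultimately have "?A\<^sup>2 <= L2 (?ga 1)"
    using minor2_le_L2[of "?ga 1" e1 e2 f2 f1] zero_le_power2[of ?A] by linarith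
   then have "E * ?A\<^sup>2 <= C * L2 (?ga 1)" using C E by (intro mult_mono) auto
   moreover have "E * ?A\<^sup>2 = N\<^sup>2" using w yy unfolding E_def R(2) by (simp add: power_divide power_mult_distrib)
   ultimately show "N\<^sup>2 <= C * L2 (?ga 1)" by simp
  qed
 qed
qed

text \<open>For \<open>et = - R\<^sup>3 (y \<bullet> y) / 12\<close> the matrix differs from a matrix of rank one by a bounded matrix.\<close>

lemma L2_principal_eta:
 assumes "supp y" "y ~= 0"
 shows "\<exists>C\<ge>1. \<forall>R\<ge>1. L2 (nexp (R, 0, R *\<^sub>R y, - (R^3 * (y \<bullet> y)) / 12)) <= C * R^4"
proof -
 let ?d = "real CARD('m)"
 define k where "k = y \<bullet> y"
 have k: "k > 0" using assms by (simp add: k_def)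
 define a where "a = norm y"
 have a: "a >= 0" "a * a = k" "\<And>m. \<bar>y $ m\<bar> <= a"
  using component_le_norm_cart[of y] by (simp_all add: a_def k_def power2_norm_eq_inner[symmetric] power2_eq_square[symmetric])
 define B where "B = 4 + 8 / k + 8 * a / k"
 have "0 <= 8 / k" "0 <= 4 * a / k" "8 * a / k = 2 * (4 * a / k)" using k a by simp_all
 then have B: "B >= 4" "8 / k <= B" "4 * a / k <= B" unfolding B_def by linarith+
 define M where "M = 2 + a + k"
 have M: "M >= 2" "a + a <= 2 * M" "k <= M" "a <= M" "1 <= M" using k a by (simp_all add: M_def)
 define C where "C = ?d^4 * (4 * M * B + 2 * B\<^sup>2) + 1"
 have "L2 (nexp (R, 0, R *\<^sub>R y, - (R^3 * (y \<bullet> y)) / 12)) <= C * R^4" if R: "R >= 1" for R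
 proof -
  define g where "g = nexp (R, 0, R *\<^sub>R y, - (R^3 * (y \<bullet> y)) / 12)"
  \<comment> \<open>\<open>v\<close> is the first row, and \<open>u\<close> is the last column
    divided by the upper right entry \<open>R^4 * k / 8\<close>. The constant 12 in the eta
    coordinate is the one for which the minor of rows \<open>e1\<close>, \<open>e2\<close> and
    columns \<open>f2\<close>, \<open>f1\<close> vanishes.\<close>
  define u where "u i = (if i = e1 then 1 else if i = e2 then 2 / R else if i = f2 then - 8 / (R^3 * k)
   else if i = f1 then 8 / (R^4 * k) else 4 * y $ i / (R\<^sup>2 * k))" for i
  define v where "v j = (if j = e1 then 1 else if j = e2 then R else if j = f2 then - (R^3 * k) / 4
   else if j = f1 then R^4 * k / 8 else R\<^sup>2 * y $ j / 2)" for j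
  have R0: "R > 0" using R by simp
  have row1: "g $ e1 $ j = v j" for j
   by (cases rule: level5[of j]) (simp_all add: g_def nexp_def v_def k_def[symmetric] power_numeral_reduce field_simps)
  have g2: "g $ e2 $ e1 = 0" "g $ e2 $ e2 = 1" "m \<in> mid ==> g $ e2 $ m = R * y $ m" "g $ e2 $ f2 = - (R\<^sup>2 * k) / 2"
   "g $ e2 $ f1 = R^3 * k / 4" for m
   by (simp_all add: g_def nexp_def k_def[symmetric] power_numeral_reduce field_simps)
  have gm: "m \<in> mid ==> g $ m $ e1 = 0" "m \<in> mid ==> g $ m $ e2 = 0" "m \<in> mid ==> m' \<in> mid ==> g $ m $ m' = (if m' = m then 1 else 0)"
   "m \<in> mid ==> g $ m $ f2 = - (R * y $ m)" "m \<in> mid ==> g $ m $ f1 = R\<^sup>2 * y $ m / 2" for m m'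
   by (simp_all add: g_def nexp_def power2_eq_square)
  have gf: "g $ f2 $ e1 = 0" "g $ f2 $ e2 = 0" "m \<in> mid ==> g $ f2 $ m = 0" "g $ f2 $ f2 = 1" "g $ f2 $ f1 = - R"
   "g $ f1 $ e1 = 0" "g $ f1 $ e2 = 0" "m \<in> mid ==> g $ f1 $ m = 0" "g $ f1 $ f2 = 0" "g $ f1 $ f1 = 1" for m
   by (simp_all add: g_def nexp_def)
  have Rp: "R <= R^4" "R\<^sup>2 <= R^4" "R^3 <= R^4" "1 <= R^4" using R power_increasing[of _ 4 R] by (auto simp: power_increasing[of 1, simplified])
  have R40: "0 < R^4" using R0 by simp
  have inv: "c / R^j <= c" if "c >= 0" for c j
  proof -
   have "1 <= R^j" using R by simp
   then show ?thesis using that R0 by (simp add: pos_divide_le_eq mult_left_mono[of 1 "R^j" c, simplified])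
  qed
  have vb: "\<bar>v j\<bar> <= M * R^4" for j
  proof -
   have n: "\<bar>R\<^sup>2 * y $ m / 2\<bar> <= M * R^4" for m
   proof -
    have "\<bar>R\<^sup>2 * y $ m\<bar> <= R^4 * M" unfolding abs_mult using Rp a(3)[of m] M by (intro mult_mono) auto
    then show ?thesis using mult_nonneg_nonneg[of "R^4" M] R40 M by (simp add: mult.commute)
   qed
   have "R^3 * k <= R^4 * M" "R^4 * k <= R^4 * M" using Rp M k R0 by (intro mult_mono; simp)+
   moreover have "1 * 1 <= M * R^4" "1 * R <= M * R^4" using Rp M R0 by (intro mult_mono; simp)+
   ultimately show ?thesis using n[of j] k R0
    by (cases rule: level5[of j]) (simp_all add: v_def mult.commute[of M])
  qed
  have gb: "\<bar>g $ i $ j\<bar> <= M * R^4" for i j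
  proof -
   have m1: "1 <= M * R^4" "0 <= M * R^4" using vb[of e1] by (simp_all add: v_def)
   have R1: "R <= M * R^4" using vb[of e2] R0 by (simp add: v_def)
   have y1: "\<bar>R * y $ m\<bar> <= M * R^4" "\<bar>R\<^sup>2 * y $ m\<bar> <= M * R^4" for m
    unfolding abs_mult mult.commute[of M] using Rp a(3)[of m] M R0 by (intro mult_mono; simp)+
   have y2: "\<bar>R\<^sup>2 * y $ m / 2\<bar> <= M * R^4" for m
   proof -
    have "\<bar>R\<^sup>2 * y $ m / 2\<bar> = \<bar>R\<^sup>2 * y $ m\<bar> / 2" by simp
    then show ?thesis using y1(2)[of m] abs_ge_zero[of "R\<^sup>2 * y $ m"] by linarith
   qed
   have k3: "R\<^sup>2 * k <= M * R^4" "R^3 * k <= M * R^4"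
    unfolding mult.commute[of M] using Rp M k R0 by (intro mult_mono; simp)+
   have "0 <= R\<^sup>2 * k" "0 <= R^3 * k" using k R0 by simp_all
   note k3 this
   then have *: "\<bar>- (R\<^sup>2 * k) / 2\<bar> <= M * R^4" "\<bar>R^3 * k / 4\<bar> <= M * R^4" unfolding abs_le_iff using m1 by auto
   show ?thesis
    using R0 vb[of j]
    by (cases rule: level5[of i]; cases rule: level5[of j]) (simp_all only: row1 g2 gm gf * m1 y1 y2 R1 abs_minus_cancel abs_zero abs_one abs_of_pos if_split, simp_all add: m1)
  qed
  have Eb: "\<bar>g $ i $ j - u i * v j\<bar> <= B" for i j
  proof -
   have y1: "\<bar>4 * y $ m / (R^j * k)\<bar> <= B" for m j
   proof -
    have "\<bar>4 * y $ m / (R^j * k)\<bar> = (4 * \<bar>y $ m\<bar> / k) / R^j" using k R0 by (simp add: abs_mult field_simps)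
    also have "\<dots> <= 4 * \<bar>y $ m\<bar> / k" using k by (intro inv) auto
    also have "\<dots> <= 4 * a / k" using a(3) k by (intro divide_right_mono) auto
    finally show ?thesis using B by simp
   qed
   have k1: "\<bar>8 / (R^j * k)\<bar> <= B" for j
   proof -
    have "\<bar>8 / (R^j * k)\<bar> = (8 / k) / R^j" using k R0 by (simp add: field_simps)
    also have "\<dots> <= 8 / k" using k by (intro inv) auto
    finally show ?thesis using B by simp
   qed
   have yy: "\<bar>(if m = m' then 1 else 0) - 2 * (y $ m * y $ m') / k\<bar> <= B" for m m'
   proof -
    have "\<bar>y $ m * y $ m'\<bar> <= a * a" unfolding abs_mult by (intro mult_mono a abs_ge_zero)
    then have "\<bar>2 * (y $ m * y $ m') / k\<bar> <= 2" using k a by (simp add: abs_mult pos_divide_le_eq)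
    moreover have "\<bar>(if m = m' then 1 else 0) - s\<bar> <= B" if "\<bar>s\<bar> <= 2" for s :: real
     using that B(1) by auto
    ultimately show ?thesis by blast
   qed
   have r2: "\<bar>2 / R\<bar> <= B" using inv[of 2 1] B(1) R0 by simp
   show ?thesis
   proof (cases rule: level5[of i])
    case 1 then show ?thesis using B(1) by (simp add: row1) (simp add: u_def)
   next
    case 2
    show ?thesis using r2 B(1) R0 k unfolding 2
     by (cases rule: level5[of j]) (simp_all add: g2 u_def v_def power_numeral_reduce)
   next
    case 3
    have "g $ i $ j - u i * v j = (if j = e1 then - (4 * y $ i / (R^2 * k)) else if j = e2 then - (4 * y $ i / (R^1 * k))
     else if j \<in> mid then (if i = j then 1 else 0) - 2 * (y $ i * y $ j) / k else 0)"
     using 3 R0 k by (cases rule: level5[of j]) (auto simp: gm u_def v_def power_numeral_reduce field_simps)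
    then show ?thesis using y1[of i 2] y1[of i 1] yy[of i j] B(1) by simp
   next
    case 4
    have "g $ i $ j - u i * v j = (if j = e1 then 8 / (R^3 * k) else if j = e2 then 8 / (R^2 * k)
     else if j \<in> mid then 4 * y $ j / (R^1 * k) else if j = f2 then -1 else 0)"
     using 4 R0 k by (cases rule: level5[of j]) (auto simp: gf u_def v_def power_numeral_reduce field_simps)
    then show ?thesis using y1[of j 1] k1[of 3] k1[of 2] B(1) by simp
   next
    case 5
    have "g $ i $ j - u i * v j = (if j = e1 then - (8 / (R^4 * k)) else if j = e2 then - (8 / (R^3 * k))
     else if j \<in> mid then - (4 * y $ j / (R^2 * k)) else if j = f2 then 2 / R else 0)"
     using 5 R0 k by (cases rule: level5[of j]) (auto simp: gf u_def v_def power_numeral_reduce field_simps)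
    then show ?thesis using y1[of j 2] k1[of 3] k1[of 4] B(1) r2 by simp
   qed
  qed
  have "L2 g <= ?d^4 * (4 * (M * R^4) * B + 2 * B\<^sup>2)" by (rule L2_rank_one[OF gb Eb])
  also have "\<dots> <= ?d^4 * (4 * (M * R^4) * B + 2 * B\<^sup>2 * R^4)"
   using mult_left_mono[OF Rp(4), of "2 * B\<^sup>2"] by (intro mult_left_mono add_left_mono) auto
  also have "\<dots> = (?d^4 * (4 * M * B + 2 * B\<^sup>2)) * R^4" by (simp add: algebra_simps)
  also have "\<dots> <= C * R^4" using R40 by (intro mult_right_mono) (auto simp: C_def)
  finally show ?thesis unfolding g_def .
 qed
 moreover have "C >= 1" unfolding C_def using M B by simp
 ultimately show ?thesis by blast
qed

text \<open>The path starts on the curve of nearly rank one matrices of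
  \<open>L2_principal_eta\<close> and ends on the eta-axis.\<close>

lemma fills_principal_eta:
 assumes U: "subspace U" "U \<subseteq> ncar" and w: "(pp, 0, y, 0) \<in> U" "pp ~= 0" "y ~= 0" and et: "(0, 0, 0, et) \<in> U" "et ~= 0"
 shows "fills (nexp ` U)"
proof -
 let ?d = "real CARD('m)"
 define z where "z = (1 / pp) *\<^sub>R y"
 have z: "z ~= 0" "supp z" using w U by (auto simp: z_def)
 have mem: "(r, 0, r *\<^sub>R z, e) \<in> U" for r e
  using subspace_add[OF U(1) subspace_scale[OF U(1) w(1), of "r / pp"] subspace_scale[OF U(1) et(1), of "e / et"]]
  using w(2) et(2) by (simp add: z_def)
 define k where "k = z \<bullet> z"
 have k: "k > 0" using z by (simp add: k_def)
 obtain C1 where C1: "C1 >= 1" "\<And>R. R >= 1 ==> L2 (nexp (R, 0, R *\<^sub>R z, - (R^3 * (z \<bullet> z)) / 12)) <= C1 * R^4"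
  using L2_principal_eta[OF z(2,1)] by blast
 define B where "B = 2 + norm z + k"
 have B: "B >= 1" "norm z <= B" "k <= B" "k + 1 <= B" using k norm_ge_zero[of z] by (simp_all add: B_def)
 define C where "C = 4 + 128 / k + ?d\<^sup>2 * B + C1"
 have C: "C >= 4" "C >= 1" "128 / k <= C" "?d\<^sup>2 * B <= C" "C1 <= C"
  unfolding C_def using k C1 B by (simp_all add: add_nonneg_nonneg)
 show ?thesis
 proof (rule fills_by_paths[OF C(2)])
  fix N :: real assume N: "N >= 1"
  \<comment> \<open>On the starting curve the upper right entry is of fourth order in
    \<open>R\<close>.\<close>
  define R where "R = root 4 N"
  have R: "R >= 1" "R^4 = N" using N by (simp_all add: R_def)
  have R0: "R > 0" using R by simp
  define r where "r ta = (1 - ta) * R" for ta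
  \<comment> \<open>Subtracting \<open>f\<close> from eta adds \<open>f\<close> to the entry at
    \<open>(e2, f1)\<close> and \<open>r * f\<close> to the one at \<open>(e1, f1)\<close>. Dividing
    by \<open>1 + r ta\<close> makes the two contributions sum to \<open>N * ta\<close>.\<close>
  define f where "f ta = N * ta / (1 + r ta)" for ta
  let ?ga = "\<lambda>ta. nexp (r ta, 0, r ta *\<^sub>R z, - ((r ta)^3 * k) / 12 - f ta)"
  have e: "?ga ta $ e1 $ f1 = (r ta)^4 * k / 8 + r ta * f ta" "?ga ta $ e2 $ f1 = (r ta)^3 * k / 4 + f ta" for ta
   by (simp_all add: nexp_def k_def[symmetric] power_numeral_reduce field_simps)
  show "\<exists>ga. continuous_on {0..1::real} ga \<and> (\<forall>ta\<in>{0..1}. ga ta \<in> nexp ` U \<and>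
   N <= C * norm (ga ta) \<and> norm (ga ta) <= C * N) \<and> L2 (ga 0) <= C * N \<and> N\<^sup>2 <= C * L2 (ga 1)"
  proof (rule exI[of _ ?ga], intro conjI ballI)
   show "continuous_on {0..1} ?ga" unfolding f_def r_def
   proof (intro continuous_on_nexp continuous_intros ballI)
    fix x :: real assume "x \<in> {0..1}"
    then have "0 <= (1 - x) * R" using R0 by simp
    then show "1 + (1 - x) * R ~= 0" by linarith
   qed simp_all
   fix ta :: real assume t: "ta \<in> {0..1}"
   show "?ga ta \<in> nexp ` U" using mem by blast
   have r0: "r ta >= 0" and rR: "r ta <= R" using t R0 mult_right_mono[of "1 - ta" 1 R] by (auto simp: r_def)
   have f0: "f ta >= 0" using t N r0 by (simp add: f_def)
   have fr: "f ta + r ta * f ta = N * ta"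
   proof -
    have "f ta + r ta * f ta = f ta * (1 + r ta)" by (simp add: algebra_simps)
    also have "\<dots> = N * ta" using r0 by (simp add: f_def)
    finally show ?thesis .
   qed
   have Nt: "N * ta <= N" using t N mult_left_mono[of ta 1 N] by simp
   have rf0: "0 <= r ta * f ta" using r0 f0 by simp
   have fN: "f ta <= N" "r ta * f ta <= N" using fr Nt f0 rf0 by linarith+
   have r40: "0 <= (r ta)^4 * k" and r30: "0 <= (r ta)^3 * k" using r0 k by simp_all
   have lower: "(r ta)^4 * k / 8 + r ta * f ta <= norm (?ga ta)" "(r ta)^3 * k / 4 + f ta <= norm (?ga ta)"
    using abs_entry_le_norm[of "?ga ta" e1 f1] abs_entry_le_norm[of "?ga ta" e2 f1] unfolding e by linarith+
   show "N <= C * norm (?ga ta)"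
   proof (cases "ta >= 1/2")
    case True
    then have "N / 2 <= N * ta" using N mult_left_mono[of "1/2" ta N] by simp
    then have "N <= 4 * norm (?ga ta)" using lower fr r40 r30 by linarith
    also have "\<dots> <= C * norm (?ga ta)" by (intro mult_right_mono C) simp
    finally show ?thesis .
   next
    case False
    then have "R / 2 <= r ta" using R0 mult_right_mono[of "1/2" "1 - ta" R] by (simp add: r_def)
    then have "(R / 2)^4 <= (r ta)^4" using R0 by (intro power_mono) auto
    then have "N / 16 <= (r ta)^4" by (simp add: power_divide R)
    then have "(N / 16) * k <= (r ta)^4 * k" using k by (intro mult_right_mono) auto
    then have "N * k <= 128 * norm (?ga ta)" using lower(1) rf0 by linarith
    then have "N <= 128 / k * norm (?ga ta)" using k by (simp add: pos_le_divide_eq)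
    also have "\<dots> <= C * norm (?ga ta)" by (intro mult_right_mono C) simp
    finally show ?thesis .
   qed
   have "(r ta)^4 <= N" using power_mono[OF rR r0, of 4] R by simp
   then have rN: "r ta <= N" "(r ta)\<^sup>2 <= N" "(r ta)^3 <= N" "(r ta)^4 <= N"
    using powers_le_of_root[OF r0 N, of 4 1] powers_le_of_root[OF r0 N, of 4 2] powers_le_of_root[OF r0 N, of 4 3] by simp_all
   have BN: "u * c <= B * N" if "0 <= u" "u <= N" "0 <= c" "c <= B" for u c
   proof -
    have "u * c <= N * B" using that N by (intro mult_mono) auto
    then show ?thesis by (simp add: mult.commute)
   qed
   have k3: "(r ta)^3 * k <= N * k" "(r ta)^4 * k <= N * k" using rN k by (intro mult_right_mono; simp)+
   have kN: "N * k + N <= B * N" using mult_right_mono[OF B(4), of N] N by (simp add: algebra_simps)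
   have NB: "N <= B * N" "1 <= B * N" using mult_right_mono[OF B(1), of N] mult_mono[of 1 B 1 N] B(1) N by simp_all
   have "norm (?ga ta) <= ?d\<^sup>2 * (B * N)"
   proof (rule nexp_norm_le)
    show "supp 0" "supp (r ta *\<^sub>R z)" "1 <= B * N" using z NB by simp_all
    show "\<bar>r ta\<bar> <= B * N" using r0 rN NB by simp
    have "r ta * (r ta * norm z) <= B * N" using BN[OF zero_le_power2 rN(2) norm_ge_zero B(2)] by (simp add: power2_eq_square mult_ac)
    then show "norm 0 + \<bar>r ta\<bar> * norm (r ta *\<^sub>R z) <= B * N" using r0 by simp
    show "norm (r ta *\<^sub>R z) <= B * N" using BN[OF r0 rN(1) norm_ge_zero B(2)] r0 by simp
    show "(norm (r ta *\<^sub>R z))\<^sup>2 <= B * N" using BN[OF zero_le_power2 rN(2) _ B(3)] k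
     by (simp add: power_mult_distrib power2_norm_eq_inner k_def)
    have k4: "r ta * (r ta *\<^sub>R z \<bullet> r ta *\<^sub>R z) = (r ta)^3 * k" by (simp add: k_def power_numeral_reduce mult_ac)
    have "(r ta)^3 * k / 4 + f ta <= B * N" using k3 kN fN r30 by linarith
    moreover have "\<bar>- a / 12 - g - 0 / 2 - a / 6\<bar> <= c \<and> \<bar>- (- a / 12 - g) - 0 / 2 + a / 6\<bar> <= c"
     if "a / 4 + g <= c" "0 <= a" "0 <= g" for a c g :: real using that by (auto simp: abs_le_iff)
    ultimately show "\<bar>- ((r ta)^3 * k) / 12 - f ta - 0 \<bullet> r ta *\<^sub>R z / 2 - r ta * (r ta *\<^sub>R z \<bullet> r ta *\<^sub>R z) / 6\<bar> <= B * N"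
      "\<bar>- (- ((r ta)^3 * k) / 12 - f ta) - 0 \<bullet> r ta *\<^sub>R z / 2 + r ta * (r ta *\<^sub>R z \<bullet> r ta *\<^sub>R z) / 6\<bar> <= B * N"
     unfolding k4 inner_zero_left using r30 f0 by blast+
    have "- r ta * (- ((r ta)^3 * k) / 12 - f ta) - 0 \<bullet> (0::'m vc) / 2 + (r ta)\<^sup>2 * (r ta *\<^sub>R z \<bullet> r ta *\<^sub>R z) / 24 = (r ta)^4 * k / 8 + r ta * f ta"
     by (simp add: k_def[symmetric] power_numeral_reduce field_simps)
    then show "\<bar>- r ta * (- ((r ta)^3 * k) / 12 - f ta) - 0 \<bullet> (0::'m vc) / 2 + (r ta)\<^sup>2 * (r ta *\<^sub>R z \<bullet> r ta *\<^sub>R z) / 24\<bar> <= B * N"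
     using k3 kN fN r40 rf0 by (simp only: abs_le_iff) linarith
   qed
   also have "\<dots> = (?d\<^sup>2 * B) * N" by simp
   also have "\<dots> <= C * N" using C N by (intro mult_right_mono) auto
   finally show "norm (?ga ta) <= C * N" .
  next
   have "L2 (?ga 0) <= C1 * N" using C1(2)[OF R(1)] by (simp add: r_def f_def k_def R)
   also have "\<dots> <= C * N" using C N by (intro mult_right_mono) auto
   finally show "L2 (?ga 0) <= C * N" .
   have "?ga 1 = nexp (0, 0, 0, - N)" by (simp add: r_def f_def)
   then have "N\<^sup>2 <= L2 (?ga 1)" using L2_phi0_ge[of "- N" 0 0] by (simp add: gram_def)
   also have "\<dots> <= C * L2 (?ga 1)" using mult_right_mono[OF C(2) L2_nonneg[of "?ga 1"]] by simp
   finally show "N\<^sup>2 <= C * L2 (?ga 1)" .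
  qed
 qed
qed

section \<open>Filling by a one-dimensional torus and one unipotent direction\<close>

lemma norm_dE_nexp_le: "norm (dE s t ** nexp p) <= (real CARD('m))^5 * exp (max \<bar>s\<bar> \<bar>t\<bar>) * norm (nexp p)"
proof -
 have "norm (dE s t ** nexp p) <= (real CARD('m))^3 * norm (dE s t) * norm (nexp p)" by (rule norm_matrix_mult_le)
 also have "\<dots> <= (real CARD('m))^3 * ((real CARD('m))\<^sup>2 * exp (max \<bar>s\<bar> \<bar>t\<bar>)) * norm (nexp p)"
  by (intro mult_right_mono mult_left_mono norm_dE_le) auto
 finally show ?thesis by (simp add: power_numeral_reduce mult_ac)
qed

text \<open>Keeping \<open>exp u * r^2 = N\<close> fixes the order of the norm. The path moves from
  a unipotent element, whose \<open>L2\<close> has order \<open>N\<close>, to \<open>dE L L\<close>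
  times a fixed element, where the first two diagonal entries alone give a minor
  \<open>N^2\<close>.\<close>

lemma fills_alpha_kernel:
 assumes s: "supp x" "supp y" and xy: "gram x y = 0" "x ~= 0 \<or> y ~= 0"
  and S: "\<And>s r. r > 0 ==> dE s s ** nexp (r *\<^sub>R (0, x, y, 0)) \<in> S"
 shows "fills S"
proof -
 let ?d = "real CARD('m)"
 define k where "k = (norm x)\<^sup>2 + (norm y)\<^sup>2"
 have k: "k > 0" using xy(2) by (auto simp: k_def add_pos_nonneg add_nonneg_pos)
 obtain C1 where C1: "C1 >= 1" "\<And>r. r >= 0 ==> L2 (nexp (r *\<^sub>R (0, x, y, 0))) <= C1 * (1 + r\<^sup>2)"
  using L2_ray_parallel[OF s xy(1)] by blast
 define C where "C = 1 + 4 / k + ?d^7 * (2 + 2 * k) + 2 * C1"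
 have "0 <= 4 / k" "0 <= ?d^7 * (2 + 2 * k)" using k by auto
 then have C: "C >= 1" "4 / k <= C" "?d^7 * (2 + 2 * k) <= C" "2 * C1 <= C" unfolding C_def using C1(1) by linarith+
 show ?thesis
 proof (rule fills_by_paths[OF C(1)])
  fix N :: real assume N: "N >= 1"
  define L where "L = ln N"
  have L: "L >= 0" "exp L = N" using N by (simp_all add: L_def)
  define u where "u ta = ta * L" for ta
  define r where "r ta = exp ((L - u ta) / 2)" for ta
  have r0: "r ta > 0" for ta by (simp add: r_def)
  have r2: "exp (u ta) * (r ta)\<^sup>2 = N" for ta
   unfolding r_def exp_double[symmetric] L(2)[symmetric] exp_add[symmetric] by (simp add: field_simps)
  let ?g = "\<lambda>ta. nexp (r ta *\<^sub>R (0, x, y, 0))"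
  let ?ga = "\<lambda>ta. dE (u ta) (u ta) ** ?g ta"
  show "\<exists>ga. continuous_on {0..1::real} ga \<and> (\<forall>ta\<in>{0..1}. ga ta \<in> S \<and>
   N <= C * norm (ga ta) \<and> norm (ga ta) <= C * N) \<and> L2 (ga 0) <= C * N \<and> N\<^sup>2 <= C * L2 (ga 1)"
  proof (rule exI[of _ ?ga], intro conjI ballI)
   show "continuous_on {0..1} ?ga" unfolding u_def r_def
    by (intro continuous_on_dE continuous_intros continuous_on_compose2[OF continuous_on_nexp'[of UNIV]]) auto
   fix ta :: real assume t: "ta \<in> {0..1}"
   show "?ga ta \<in> S" using S r0 by blast
   have uL: "0 <= u ta" "u ta <= L" using t L mult_right_mono[of ta 1 L] by (auto simp: u_def)
   have r1: "1 <= (r ta)\<^sup>2" using uL by (simp add: r_def exp_double[symmetric])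
   have "?ga ta $ e1 $ f1 = - (exp (u ta) * (r ta)\<^sup>2) * (norm x)\<^sup>2 / 2" "?ga ta $ e2 $ f2 = - (exp (u ta) * (r ta)\<^sup>2) * (norm y)\<^sup>2 / 2"
    by (simp_all add: dE_mult nexp_def dot_square_norm power2_eq_square mult_ac)
   then have "?ga ta $ e1 $ f1 = - (N * (norm x)\<^sup>2 / 2)" "?ga ta $ e2 $ f2 = - (N * (norm y)\<^sup>2 / 2)" unfolding r2 by simp_all
   then have "N * (norm x)\<^sup>2 / 2 <= norm (?ga ta)" "N * (norm y)\<^sup>2 / 2 <= norm (?ga ta)"
    using abs_entry_le_norm[of "?ga ta" e1 f1] abs_entry_le_norm[of "?ga ta" e2 f2] by linarith+
   then have "N * k <= 4 * norm (?ga ta)" unfolding k_def distrib_left using norm_ge_zero[of "?ga ta"] by linarith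
   then have "N <= 4 / k * norm (?ga ta)" using k by (simp add: pos_le_divide_eq)
   also have "\<dots> <= C * norm (?ga ta)" by (intro mult_right_mono C) simp
   finally show "N <= C * norm (?ga ta)" .
   have "norm (?g ta) <= ?d\<^sup>2 * (2 * (1 + (norm (r ta *\<^sub>R x))\<^sup>2 + (norm (r ta *\<^sub>R y))\<^sup>2 + \<bar>0\<bar>))"
    using norm_phi0(1)[of "r ta *\<^sub>R x" "r ta *\<^sub>R y" 0] s by simp
   also have "\<dots> = ?d\<^sup>2 * (2 * (1 + (r ta)\<^sup>2 * k))" by (simp add: power_mult_distrib k_def distrib_left)
   also have "\<dots> <= ?d\<^sup>2 * (2 * ((r ta)\<^sup>2 + (r ta)\<^sup>2 * k))" using r1 by (intro mult_left_mono add_mono) auto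
   finally have ng: "norm (?g ta) <= ?d\<^sup>2 * (2 + 2 * k) * (r ta)\<^sup>2" by (simp add: algebra_simps)
   have "norm (?ga ta) <= ?d^5 * exp (u ta) * norm (?g ta)" using norm_dE_nexp_le[of "u ta" "u ta"] uL by simp
   also have "\<dots> <= ?d^5 * exp (u ta) * (?d\<^sup>2 * (2 + 2 * k) * (r ta)\<^sup>2)" by (intro mult_left_mono ng) auto
   also have "\<dots> = ?d^7 * (2 + 2 * k) * (exp (u ta) * (r ta)\<^sup>2)" by (simp add: power_numeral_reduce mult_ac)
   also have "\<dots> <= C * N" unfolding r2 using C N by (intro mult_right_mono) auto
   finally show "norm (?ga ta) <= C * N" .
  next
   have "(r 0)\<^sup>2 = N" using r2[of 0] by (simp add: u_def)
   then have "L2 (?ga 0) <= C1 * (1 + N)" using C1(2)[of "r 0"] r0[of 0] by (simp add: u_def)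
   also have "\<dots> <= (2 * C1) * N" using C1(1) N by (simp add: algebra_simps)
   also have "\<dots> <= C * N" using C N by (intro mult_right_mono) auto
   finally show "L2 (?ga 0) <= C * N" .
   have "minor2 (?ga 1) e1 e2 e1 e2 = N\<^sup>2" using L by (simp add: minor2_def dE_mult nexp_def u_def power2_eq_square)
   then have "N\<^sup>2 <= L2 (?ga 1)" using minor2_le_L2[of "?ga 1" e1 e2 e1 e2] by simp
   also have "\<dots> <= C * L2 (?ga 1)" using mult_right_mono[OF C(1) L2_nonneg[of "?ga 1"]] by simp
   finally show "N\<^sup>2 <= C * L2 (?ga 1)" .
  qed
 qed
qed

text \<open>Keeping \<open>exp u * r = N\<close>, the path leads from \<open>dE L 0\<close> times a
  fixed element, with \<open>L2\<close> of order \<open>N\<close>, to an isotropic unipotent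
  element, with \<open>L2\<close> of order \<open>N^2\<close>.\<close>

lemma fills_beta_kernel:
 assumes s: "supp x" and q: "Qf pp x et = 0" "(pp, x, et) ~= (0, 0, 0)"
  and S: "\<And>s r. r > 0 ==> dE s 0 ** nexp (r *\<^sub>R (pp, x, 0, et)) \<in> S"
 shows "fills S"
proof -
 let ?d = "real CARD('m)"
 define m where "m = \<bar>pp\<bar> + norm x + \<bar>et\<bar>"
 have m: "m > 0" using q(2) norm_ge_zero[of x] unfolding m_def
  by (smt (verit) norm_eq_zero Pair_inject abs_eq_0 abs_ge_zero)
 define C2 where "C2 = ?d^4 * L2 (nexp (pp, x, 0, et))"
 define C where "C = 1 + (2 + ?d) / m + ?d^7 * (1 + m) + C2 + ((2 + ?d) / m)\<^sup>2"
 have "0 <= (2 + ?d) / m" "0 <= ?d^7 * (1 + m)" "0 <= C2" "0 <= ((2 + ?d) / m)\<^sup>2" using m by (auto simp: C2_def L2_nonneg)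
 then have C: "C >= 1" "(2 + ?d) / m <= C" "?d^7 * (1 + m) <= C" "C2 <= C" "((2 + ?d) / m)\<^sup>2 <= C" unfolding C_def by linarith+
 show ?thesis
 proof (rule fills_by_paths[OF C(1)])
  fix N :: real assume N: "N >= 1"
  define L where "L = ln N"
  have L: "L >= 0" "exp L = N" using N by (simp_all add: L_def)
  define u where "u ta = (1 - ta) * L" for ta
  define r where "r ta = exp (L - u ta)" for ta
  have r0: "r ta > 0" for ta by (simp add: r_def)
  have r2: "exp (u ta) * r ta = N" for ta unfolding r_def exp_add[symmetric] using L by simp
  let ?g = "\<lambda>ta. nexp (r ta *\<^sub>R (pp, x, 0, et))"
  let ?ga = "\<lambda>ta. dE (u ta) 0 ** ?g ta"
  have Q: "Qf (r ta * pp) (r ta *\<^sub>R x) (r ta * et) = 0" for ta unfolding Qf_scale q by simp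
  have ab: "\<bar>r ta * pp\<bar> + norm (r ta *\<^sub>R x) + \<bar>r ta * et\<bar> = r ta * m" for ta
   using r0[of ta] by (simp add: abs_mult m_def distrib_left)
  show "\<exists>ga. continuous_on {0..1::real} ga \<and> (\<forall>ta\<in>{0..1}. ga ta \<in> S \<and>
   N <= C * norm (ga ta) \<and> norm (ga ta) <= C * N) \<and> L2 (ga 0) <= C * N \<and> N\<^sup>2 <= C * L2 (ga 1)"
  proof (rule exI[of _ ?ga], intro conjI ballI)
   show "continuous_on {0..1} ?ga" unfolding u_def r_def
    by (intro continuous_on_dE continuous_intros continuous_on_compose2[OF continuous_on_nexp'[of UNIV]]) auto
   fix ta :: real assume t: "ta \<in> {0..1}"
   show "?ga ta \<in> S" using S r0 by blast
   have uL: "0 <= u ta" "u ta <= L" using t L mult_right_mono[of "1 - ta" 1 L] by (auto simp: u_def)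
   have r1: "1 <= r ta" using uL by (simp add: r_def)
   have g: "?ga ta $ e1 $ e2 = N * pp" "?ga ta $ e1 $ f2 = N * et" "i \<in> mid ==> ?ga ta $ e1 $ i = N * x $ i" for i
    unfolding r2[of ta, symmetric] by (simp_all add: dE_mult nexp_def)
   have "\<bar>N * pp\<bar> <= norm (?ga ta)" "\<bar>N * et\<bar> <= norm (?ga ta)" "i \<in> mid ==> \<bar>N * x $ i\<bar> <= norm (?ga ta)" for i
    using abs_entry_le_norm[of "?ga ta" e1] g by metis+
   moreover from this(3) have "norm (N *\<^sub>R x) <= ?d * norm (?ga ta)" using s by (intro norm_le_sum_mid) auto
   ultimately have "N * m <= (2 + ?d) * norm (?ga ta)" using N unfolding m_def by (simp add: abs_mult distrib_left distrib_right)
   then have "N <= (2 + ?d) / m * norm (?ga ta)" using m by (simp add: pos_le_divide_eq)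
   also have "\<dots> <= C * norm (?ga ta)" by (intro mult_right_mono C) simp
   finally show "N <= C * norm (?ga ta)" .
   have "norm (?g ta) <= ?d\<^sup>2 * (1 + r ta * m)"
    using norm_y0(1)[of "r ta *\<^sub>R x" "r ta * pp" "r ta * et"] s unfolding ab Q by simp
   also have "\<dots> <= ?d\<^sup>2 * (r ta + r ta * m)" using r1 by (intro mult_left_mono add_mono) auto
   finally have ng: "norm (?g ta) <= ?d\<^sup>2 * (1 + m) * r ta" by (simp add: algebra_simps)
   have "norm (?ga ta) <= ?d^5 * exp (u ta) * norm (?g ta)" using norm_dE_nexp_le[of "u ta" 0] uL by simp
   also have "\<dots> <= ?d^5 * exp (u ta) * (?d\<^sup>2 * (1 + m) * r ta)" by (intro mult_left_mono ng) auto
   also have "\<dots> = ?d^7 * (1 + m) * (exp (u ta) * r ta)" by (simp add: power_numeral_reduce mult_ac)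
   also have "\<dots> <= C * N" unfolding r2 using C N by (intro mult_right_mono) auto
   finally show "norm (?ga ta) <= C * N" .
  next
   have "L2 (?ga 0) <= L2 (dE L 0) * L2 (nexp (pp, x, 0, et))" using L2_mult[of "dE L 0" "nexp (pp, x, 0, et)"] by (simp add: u_def r_def)
   also have "\<dots> <= (?d^4 * N) * L2 (nexp (pp, x, 0, et))" using L2_dE_le[of L 0] L by (intro mult_right_mono L2_nonneg) simp
   also have "\<dots> = C2 * N" by (simp add: C2_def)
   also have "\<dots> <= C * N" using C N by (intro mult_right_mono) auto
   finally show "L2 (?ga 0) <= C * N" .
   have r1: "r 1 = N" using L by (simp add: r_def u_def)
   have "(N * m)\<^sup>2 <= (2 + ?d)\<^sup>2 * L2 (?g 1)"
    using L2_isotropic_ge[of "r 1 *\<^sub>R x" "r 1 * pp" "r 1 * et"] s Q[of 1] unfolding ab by (simp add: r1)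
   then have "(N * m)\<^sup>2 <= (2 + ?d)\<^sup>2 * L2 (?ga 1)" by (simp add: u_def)
   then have "N\<^sup>2 <= ((2 + ?d) / m)\<^sup>2 * L2 (?ga 1)" using m by (simp add: power_mult_distrib power_divide pos_le_divide_eq)
   also have "\<dots> <= C * L2 (?ga 1)" by (intro mult_right_mono C L2_nonneg)
   finally show "N\<^sup>2 <= C * L2 (?ga 1)" .
  qed
 qed
qed

text \<open>The hypothesis says that \<open>t1\<close> and \<open>t2\<close> do not have opposite
  signs, so both torus exponents stay in \<open>[0, L]\<close>, while the entry at
  \<open>(e1, e2)\<close> is constantly \<open>N\<close>. At the start the torus reduces the entry
  at \<open>(f2, f1)\<close> to size 1 and the matrix is nearly of rank one; at the end both blocks
  carry an entry of size \<open>N\<close>.\<close>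

lemma fills_alpha_line:
 assumes t: "\<bar>t1 - t2\<bar> <= \<bar>t1 + t2\<bar>" "t1 + t2 ~= 0" and S: "\<And>u r. dE (u * t1) (u * t2) ** nexp (r, 0, 0, 0) \<in> S"
 shows "fills S"
proof -
 let ?d = "real CARD('m)"
 define C where "C = 6 * ?d^4"
 have C: "C >= 1" "?d\<^sup>2 <= C" "6 * ?d^4 <= C" unfolding C_def using DM_ge_1 power_increasing[of 2 4 ?d] one_le_power[of ?d 4]
  by (simp_all, linarith+)
 show ?thesis
 proof (rule fills_by_paths[OF C(1)])
  fix N :: real assume N: "N >= 1"
  define L where "L = ln N"
  have L: "L >= 0" "exp L = N" using N by (simp_all add: L_def)
  define p where "p ta = ((1 - ta) * L / (t1 + t2)) * t1" for ta
  define q where "q ta = ((1 - ta) * L / (t1 + t2)) * t2" for ta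
  have pq: "p ta + q ta = (1 - ta) * L" for ta using t(2) unfolding p_def q_def distrib_left[symmetric] by simp
  let ?g = "\<lambda>ta. nexp (exp (L - p ta), 0, 0, 0)"
  let ?ga = "\<lambda>ta. dE (p ta) (q ta) ** ?g ta"
  have g: "?ga ta $ e1 $ e1 = exp (p ta)" "?ga ta $ e1 $ e2 = N" "?ga ta $ e2 $ e1 = 0" "?ga ta $ e2 $ e2 = exp (q ta)"
    "?ga ta $ f2 $ f2 = exp (- q ta)" "?ga ta $ f2 $ f1 = - exp (L - (p ta + q ta))" "?ga ta $ f1 $ f1 = exp (- p ta)"
    "?ga ta $ f1 $ f2 = 0" "?ga ta $ e1 $ f2 = 0" "?ga ta $ e1 $ f1 = 0" "?ga ta $ e2 $ f2 = 0" "?ga ta $ e2 $ f1 = 0"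
    "?ga ta $ f2 $ e1 = 0" "?ga ta $ f2 $ e2 = 0" "?ga ta $ f1 $ e1 = 0" "?ga ta $ f1 $ e2 = 0" for ta
   using L by (simp_all add: dE_mult nexp_def exp_add[symmetric] algebra_simps)
  have gm: "m \<in> mid ==> ?ga ta $ m $ j = (if j = m then 1 else 0)" "m \<in> mid ==> ?ga ta $ i $ m = (if i = m then 1 else 0)" for ta m i j
   by ((cases rule: level5[of j]; simp add: dE_mult nexp_def; fail), (cases rule: level5[of i]; simp add: dE_mult nexp_def))
  show "\<exists>ga. continuous_on {0..1::real} ga \<and> (\<forall>ta\<in>{0..1}. ga ta \<in> S \<and>
   N <= C * norm (ga ta) \<and> norm (ga ta) <= C * N) \<and> L2 (ga 0) <= C * N \<and> N\<^sup>2 <= C * L2 (ga 1)"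
  proof (rule exI[of _ ?ga], intro conjI ballI)
   show "continuous_on {0..1} ?ga" unfolding p_def q_def
    by (intro continuous_on_dE continuous_intros continuous_on_nexp) (use t in auto)
   fix ta :: real assume th: "ta \<in> {0..1}"
   show "?ga ta \<in> S" unfolding p_def q_def by (rule S)
   have "N <= norm (?ga ta)" using abs_entry_le_norm[of "?ga ta" e1 e2] g N by simp
   also have "\<dots> <= C * norm (?ga ta)" using mult_right_mono[OF C(1), of "norm (?ga ta)"] by simp
   finally show "N <= C * norm (?ga ta)" .
   have d0: "0 <= (1 - ta) * L" "(1 - ta) * L <= L" using th L mult_right_mono[of "1 - ta" 1 L] by auto
   have "\<bar>p ta - q ta\<bar> = \<bar>(1 - ta) * L / (t1 + t2)\<bar> * \<bar>t1 - t2\<bar>" unfolding p_def q_def right_diff_distrib[symmetric] by (rule abs_mult)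
   also have "\<dots> <= \<bar>(1 - ta) * L / (t1 + t2)\<bar> * \<bar>t1 + t2\<bar>" by (intro mult_left_mono t) auto
   also have "\<dots> = (1 - ta) * L" using t(2) d0 by (simp add: abs_mult[symmetric])
   finally have b: "0 <= p ta" "p ta <= L" "0 <= q ta" "q ta <= L" "p ta + q ta <= L" "0 <= p ta + q ta" using pq[of ta] d0 by linarith+
   then have "exp (p ta) <= N" "exp (q ta) <= N" "exp (L - (p ta + q ta)) <= N" "exp (- p ta) <= N" "exp (- q ta) <= N"
    unfolding L(2)[symmetric] using L(1) by simp_all
   then have "\<bar>?ga ta $ i $ j\<bar> <= N" for i j
    using N by (cases rule: level5[of i]; cases rule: level5[of j]) (simp_all add: g gm)
   from norm_le_entries[OF this] have "norm (?ga ta) <= ?d\<^sup>2 * N" .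
   also have "\<dots> <= C * N" using C N by (intro mult_right_mono) auto
   finally show "norm (?ga ta) <= C * N" .
  next
   \<comment> \<open>Because \<open>p 0 + q 0 = L\<close>, this product agrees with the block of
     \<open>e1\<close>, \<open>e2\<close> except at \<open>(e2, e1)\<close>, where it differs by
     1.\<close>
   let ?u = "\<lambda>i. if i = e1 then N else if i = e2 then exp (q 0) else 0"
   let ?v = "\<lambda>j. if j = e1 then exp (p 0 - L) else if j = e2 then 1 else 0"
   have pq0: "p 0 + q 0 = L" using pq[of 0] by simp
   have "\<bar>p 0 - q 0\<bar> = \<bar>L / (t1 + t2)\<bar> * \<bar>t1 - t2\<bar>" unfolding p_def q_def right_diff_distrib[symmetric] abs_mult by simp
   also have "\<dots> <= \<bar>L / (t1 + t2)\<bar> * \<bar>t1 + t2\<bar>" by (intro mult_left_mono t) auto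
   also have "\<dots> = L" using t(2) L by (simp add: abs_mult[symmetric])
   finally have b: "0 <= p 0" "p 0 <= L" "0 <= q 0" "q 0 <= L" using pq0 by linarith+
   have Np: "N * exp (p 0 - L) = exp (p 0)" "exp (q 0) * exp (p 0 - L) = 1"
    unfolding L(2)[symmetric] exp_add[symmetric] using pq0 by simp_all
   have eb: "exp (p 0) <= N" "exp (q 0) <= N" "exp (- p 0) <= 1" "exp (- q 0) <= 1" "exp (- p 0) <= N" "exp (- q 0) <= N"
    unfolding L(2)[symmetric] using b by simp_all
   have 1: "\<bar>?ga 0 $ i $ j\<bar> <= N" for i j
    using N eb by (cases rule: level5[of i]; cases rule: level5[of j]) (simp_all add: g gm pq0)
   have 2: "\<bar>?ga 0 $ i $ j - ?u i * ?v j\<bar> <= 1" for i j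
    using eb by (cases rule: level5[of i]; cases rule: level5[of j]) (simp_all add: g gm pq0 Np)
   have "L2 (?ga 0) <= ?d^4 * (4 * N * 1 + 2 * 1\<^sup>2)" by (rule L2_rank_one[OF 1 2])
   also have "\<dots> <= ?d^4 * (6 * N)" using N by (intro mult_left_mono) auto
   also have "\<dots> = (6 * ?d^4) * N" by simp
   also have "\<dots> <= C * N" using C N by (intro mult_right_mono) auto
   finally show "L2 (?ga 0) <= C * N" .
   have "p 1 = 0" "q 1 = 0" by (simp_all add: p_def q_def)
   then have "minor2 (?ga 1) e1 f2 e2 f1 = - N\<^sup>2" unfolding minor2_def g using L by (simp add: power2_eq_square)
   then have "N\<^sup>2 <= L2 (?ga 1)" using minor2_le_L2[of "?ga 1" e1 f2 e2 f1] by simp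
   also have "\<dots> <= C * L2 (?ga 1)" using mult_right_mono[OF C(1) L2_nonneg[of "?ga 1"]] by simp
   finally show "N\<^sup>2 <= C * L2 (?ga 1)" .
  qed
 qed
qed

section \<open>Reflections of the Weyl group as permutations of indices\<close>

lemma fills_reindex:
 assumes S: "fills S" and sg: "bij sg" and S': "\<And>g. g \<in> S ==> (\<chi> i j. g $ sg i $ sg j) \<in> S'"
 shows "fills S'"
proof -
 have n: "norm (\<chi> i j. g $ sg i $ sg j :: 'm sqmat) = norm g" for g :: "'m sqmat"
  by (simp add: norm_vec_def L2_set_def sum.reindex_bij_betw[OF sg, of "\<lambda>j. (g $ _ $ j)\<^sup>2"]
   sum.reindex_bij_betw[OF sg, of "\<lambda>i. \<Sum>j\<in>UNIV. (g $ i $ j)\<^sup>2"] sum_nonneg)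
 have l: "L2 (\<chi> i j. g $ sg i $ sg j :: 'm sqmat) = L2 g" for g :: "'m sqmat"
 proof -
  have "L2 (\<chi> i j. g $ sg i $ sg j :: 'm sqmat) = (\<Sum>i\<in>UNIV. \<Sum>j\<in>UNIV. \<Sum>k\<in>UNIV. \<Sum>l\<in>UNIV. \<bar>minor2 g (sg i) (sg j) (sg k) (sg l)\<bar>)"
   by (simp add: L2_def minor2_def)
  then show ?thesis unfolding L2_def
   using sum.reindex_bij_betw[OF sg, of "\<lambda>i. \<Sum>j\<in>UNIV. \<Sum>k\<in>UNIV. \<Sum>l\<in>UNIV. \<bar>minor2 g i j k l\<bar>"]
   by (simp add: sum.reindex_bij_betw[OF sg, of "\<lambda>j. \<Sum>k\<in>UNIV. \<Sum>l\<in>UNIV. \<bar>minor2 g _ j k l\<bar>"]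
    sum.reindex_bij_betw[OF sg, of "\<lambda>k. \<Sum>l\<in>UNIV. \<bar>minor2 g _ _ k l\<bar>"] sum.reindex_bij_betw[OF sg, of "\<lambda>l. \<bar>minor2 g _ _ _ l\<bar>"])
 qed
 show ?thesis using S S' unfolding fills_def by (metis n l)
qed

text \<open>\<open>swap12\<close> acts on the torus as the reflection in \<alpha>,
  \<open>swap2\<close> as the reflection in \<beta>; both are compatible with
  \<open>opp\<close>.\<close>

definition swap12 :: "'m => 'm" where
 "swap12 = (\<lambda>i. if i = e1 then e2 else if i = e2 then e1 else if i = f1 then f2 else if i = f2 then f1 else i)"

definition swap2 :: "'m => 'm" where
 "swap2 = (\<lambda>i. if i = e2 then f2 else if i = f2 then e2 else i)"

lemma swap12_swap12: "swap12 (swap12 i) = i"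
 by (cases rule: level5[of i]) (simp_all add: swap12_def)

lemma swap2_swap2: "swap2 (swap2 i) = i"
 by (cases rule: level5[of i]) (simp_all add: swap2_def)

lemma bij_swap12: "bij swap12" and bij_swap2: "bij swap2"
 using swap12_swap12 swap2_swap2 by (metis bij_def injI surjI)+

lemma reindex_phi_eta:
 "(\<chi> i j. (dE s t ** nexp (pp, 0, 0, et)) $ swap2 i $ swap2 j) = dE s (- t) ** nexp (et, 0, 0, pp)"
proof (unfold vec_eq_iff, intro allI)
 fix i j show "(\<chi> i j. (dE s t ** nexp (pp, 0, 0, et)) $ swap2 i $ swap2 j) $ i $ j = (dE s (- t) ** nexp (et, 0, 0, pp)) $ i $ j"
  by (cases rule: level5[of i]; cases rule: level5[of j]) (simp_all add: swap2_def dE_mult nexp_def)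
qed

lemma reindex_x_y:
 "(\<chi> i j. (dE s t ** nexp (0, x, 0, 0)) $ swap12 i $ swap12 j) = dE t s ** nexp (0, 0, x, 0)"
proof (unfold vec_eq_iff, intro allI)
 fix i j show "(\<chi> i j. (dE s t ** nexp (0, x, 0, 0)) $ swap12 i $ swap12 j) $ i $ j = (dE t s ** nexp (0, 0, x, 0)) $ i $ j"
  by (cases rule: level5[of i]; cases rule: level5[of j]) (simp_all add: swap12_def dE_mult nexp_def)
qed

lemma fills_eta_line:
 assumes t: "\<bar>t1 + t2\<bar> <= \<bar>t1 - t2\<bar>" "t1 ~= t2" and S: "\<And>u r. dE (u * t1) (u * t2) ** nexp (0, 0, 0, r) \<in> S"
 shows "fills S"
proof (rule fills_reindex[OF fills_alpha_line bij_swap2])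
 let ?S = "{dE (u * t1) (- (u * t2)) ** nexp (r, 0, 0, 0) |u r. True}"
 show "dE (u * t1) (u * - t2) ** nexp (r, 0, 0, 0) \<in> ?S" for u r by (simp, blast)
 fix g assume "g \<in> ?S"
 then obtain u r where g: "g = dE (u * t1) (- (u * t2)) ** nexp (r, 0, 0, 0)" by blast
 show "(\<chi> i j. g $ swap2 i $ swap2 j) \<in> S" unfolding g reindex_phi_eta using S[of u r] by simp
qed (use t in simp_all)

text \<open>The relation \<open>exp p * r^2 = N\<close> fixes the upper right entry. Since
  \<open>t2\<close> dominates, \<open>q\<close> can reach size \<open>L\<close> while
  \<open>p\<close> stays in \<open>[0, L]\<close>; then a diagonal entry of size \<open>N\<close>
  combines with the upper right entry to a minor of order \<open>N^2\<close>.\<close>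

lemma fills_x_line:
 assumes t: "\<bar>t1\<bar> <= \<bar>t2\<bar>" "t2 ~= 0" and x: "supp x" "x ~= 0" and S: "\<And>u r. dE (u * t1) (u * t2) ** nexp (0, r *\<^sub>R x, 0, 0) \<in> S"
 shows "fills S"
proof -
 let ?d = "real CARD('m)"
 define k where "k = x \<bullet> x"
 have k: "k > 0" using x by (simp add: k_def)
 obtain C1 where C1: "C1 >= 1" "\<And>r. r >= 0 ==> L2 (nexp (r *\<^sub>R (0, x, 0, 0))) <= C1 * (1 + r\<^sup>2)"
  using L2_ray_y0[of 0 x 0] by blast
 define a where "a = norm x"
 define C where "C = 1 + 2 / k + ?d\<^sup>2 * (1 + k + a) + 2 * C1"
 have "0 <= 2 / k" "0 <= ?d\<^sup>2 * (1 + k + a)" "0 <= a" using k by (auto simp: a_def)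
 then have C: "C >= 1" "2 / k <= C" "?d\<^sup>2 * (1 + k + a) <= C" "2 * C1 <= C" unfolding C_def using C1(1) by linarith+
 have a: "\<bar>x $ m\<bar> <= a" "0 <= a" for m by (auto simp: a_def component_le_norm_cart)
 \<comment> \<open>Orients the torus so that \<open>p\<close> is nonnegative; the sign of
   \<open>q\<close> does not matter.\<close>
 define sg where "sg = (if t1 < 0 then - 1 else 1 :: real)"
 show ?thesis
 proof (rule fills_by_paths[OF C(1)])
  fix N :: real assume N: "N >= 1"
  define L where "L = ln N"
  have L: "L >= 0" "exp L = N" using N by (simp_all add: L_def)
  define p where "p ta = (sg * ta * L / \<bar>t2\<bar>) * t1" for ta
  define q where "q ta = (sg * ta * L / \<bar>t2\<bar>) * t2" for ta
  define r where "r ta = exp ((L - p ta) / 2)" for ta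
  have r0: "r ta > 0" for ta by (simp add: r_def)
  have r2: "exp (p ta) * (r ta)\<^sup>2 = N" for ta
   unfolding r_def exp_double[symmetric] L(2)[symmetric] exp_add[symmetric] by (simp add: field_simps)
  let ?g = "\<lambda>ta. nexp (0, r ta *\<^sub>R x, 0, 0)"
  let ?ga = "\<lambda>ta. dE (p ta) (q ta) ** ?g ta"
  have g: "?ga ta $ e1 $ f1 = - (N * k / 2)" "?ga ta $ e1 $ e1 = exp (p ta)" "?ga ta $ e2 $ e2 = exp (q ta)" "?ga ta $ f2 $ f2 = exp (- q ta)"
   "?ga ta $ f1 $ f1 = exp (- p ta)" "?ga ta $ e2 $ f1 = 0" "?ga ta $ e1 $ e2 = 0" "?ga ta $ e1 $ f2 = 0" "?ga ta $ f2 $ f1 = 0"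
   "?ga ta $ e2 $ e1 = 0" "?ga ta $ e2 $ f2 = 0" "?ga ta $ f2 $ e1 = 0" "?ga ta $ f2 $ e2 = 0" "?ga ta $ f1 $ e1 = 0"
   "?ga ta $ f1 $ e2 = 0" "?ga ta $ f1 $ f2 = 0" for ta
   unfolding r2[of ta, symmetric] by (simp_all add: dE_mult nexp_def k_def power2_eq_square)
  have gm: "m \<in> mid ==> ?ga ta $ e2 $ m = 0" "m \<in> mid ==> ?ga ta $ f2 $ m = 0" "m \<in> mid ==> ?ga ta $ f1 $ m = 0"
   "m \<in> mid ==> ?ga ta $ m $ e1 = 0" "m \<in> mid ==> ?ga ta $ m $ e2 = 0" "m \<in> mid ==> ?ga ta $ m $ f2 = 0"
   "m \<in> mid ==> m' \<in> mid ==> ?ga ta $ m $ m' = (if m' = m then 1 else 0)" for ta m m'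
   by (simp_all add: dE_mult nexp_def)
  show "\<exists>ga. continuous_on {0..1::real} ga \<and> (\<forall>ta\<in>{0..1}. ga ta \<in> S \<and>
   N <= C * norm (ga ta) \<and> norm (ga ta) <= C * N) \<and> L2 (ga 0) <= C * N \<and> N\<^sup>2 <= C * L2 (ga 1)"
  proof (rule exI[of _ ?ga], intro conjI ballI)
   show "continuous_on {0..1} ?ga" unfolding p_def q_def r_def
    by (intro continuous_on_dE continuous_intros continuous_on_nexp) (use t in auto)
   fix ta :: real assume th: "ta \<in> {0..1}"
   show "?ga ta \<in> S" unfolding p_def q_def by (rule S)
   have "N * k / 2 <= norm (?ga ta)" using abs_entry_le_norm[of "?ga ta" e1 f1] unfolding g by simp
   then have "N <= 2 / k * norm (?ga ta)" using k by (simp add: field_simps)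
   also have "\<dots> <= C * norm (?ga ta)" by (intro mult_right_mono C) simp
   finally show "N <= C * norm (?ga ta)" .
   have tL: "0 <= ta * L" "ta * L <= L" using th L mult_right_mono[of ta 1 L] by auto
   have p: "p ta = (ta * L) * (\<bar>t1\<bar> / \<bar>t2\<bar>)" by (simp add: p_def sg_def)
   have "\<bar>q ta\<bar> = ta * L" using t tL th L by (simp add: q_def sg_def abs_mult)
   moreover have "\<bar>t1\<bar> / \<bar>t2\<bar> <= 1" using t by simp
   then have "p ta <= (ta * L) * 1" unfolding p using tL by (intro mult_left_mono) auto
   moreover have "0 <= p ta" unfolding p by (rule mult_nonneg_nonneg[OF tL(1)]) simp
   ultimately have b: "0 <= p ta" "p ta <= L" "\<bar>q ta\<bar> <= L" using tL by linarith+
   have e: "exp (p ta) <= N" "exp (q ta) <= N" "exp (- q ta) <= N" "exp (- p ta) <= 1" "r ta <= N"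
    unfolding r_def L(2)[symmetric] using b by simp_all
   have "exp (p ta) * r ta = exp ((L + p ta) / 2)" unfolding r_def exp_add[symmetric] by (simp add: field_simps)
   also have "\<dots> <= N" unfolding L(2)[symmetric] using b by simp
   finally have er: "exp (p ta) * r ta <= N" .
   define M where "M = N * (1 + k + a)"
   have M: "N <= M" "1 <= M" "0 <= M" "N * k / 2 <= M" "N * a <= M"
    using N k a mult_nonneg_nonneg[of N k] mult_nonneg_nonneg[of N a] unfolding M_def distrib_left by (simp_all, linarith+)
   have eM: "exp (p ta) <= M" "exp (q ta) <= M" "exp (- q ta) <= M" "exp (- p ta) <= M" using e M by linarith+
   have M2: "exp (p ta) * (r ta * \<bar>x $ m\<bar>) <= M" "r ta * \<bar>x $ m\<bar> <= M" for m
    using order_trans[OF mult_mono[OF er a(1)[of m]] M(5)] order_trans[OF mult_mono[OF e(5) a(1)[of m]] M(5)] N by (simp_all add: mult.assoc)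
   have g': "m \<in> mid ==> \<bar>?ga ta $ e1 $ m\<bar> <= M" "m \<in> mid ==> \<bar>?ga ta $ m $ f1\<bar> <= M" for m
    using M2[of m] r0[of ta] by (simp_all add: dE_mult nexp_def abs_mult)
   have "\<bar>?ga ta $ i $ j\<bar> <= M" for i j
    using M N k eM g' by (cases rule: level5[of i]; cases rule: level5[of j]) (simp_all add: g gm)
   from norm_le_entries[OF this] have "norm (?ga ta) <= ?d\<^sup>2 * (1 + k + a) * N" by (simp add: M_def mult_ac)
   also have "\<dots> <= C * N" using C N by (intro mult_right_mono) auto
   finally show "norm (?ga ta) <= C * N" .
  next
   have "(r 0)\<^sup>2 = N" using r2[of 0] by (simp add: p_def)
   then have "L2 (?ga 0) <= C1 * (1 + N)" using C1(2)[of "r 0"] r0[of 0] by (simp add: p_def q_def)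
   also have "\<dots> <= (2 * C1) * N" using C1(1) N by (simp add: algebra_simps)
   also have "\<dots> <= C * N" using C N by (intro mult_right_mono) auto
   finally show "L2 (?ga 0) <= C * N" .
   have "\<bar>q 1\<bar> = L" using t L by (simp add: q_def sg_def abs_mult)
   then have "exp (q 1) = N \<or> exp (- q 1) = N" using L by (auto simp: abs_if split: if_splits)
   then have "N\<^sup>2 * (k / 2) <= L2 (?ga 1)"
   proof
    assume "exp (q 1) = N"
    then have "minor2 (?ga 1) e1 e2 f1 e2 = - (N\<^sup>2 * (k / 2))" unfolding minor2_def g by (simp add: power2_eq_square)
    then show ?thesis using minor2_le_L2[of "?ga 1" e1 e2 f1 e2] k by simp
   next
    assume "exp (- q 1) = N"
    then have "minor2 (?ga 1) e1 f2 f1 f2 = - (N\<^sup>2 * (k / 2))" unfolding minor2_def g by (simp add: power2_eq_square)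
    then show ?thesis using minor2_le_L2[of "?ga 1" e1 f2 f1 f2] k by simp
   qed
   then have "N\<^sup>2 <= 2 / k * L2 (?ga 1)" using k by (simp add: field_simps)
   also have "\<dots> <= C * L2 (?ga 1)" by (intro mult_right_mono C L2_nonneg)
   finally show "N\<^sup>2 <= C * L2 (?ga 1)" .
  qed
 qed
qed

lemma fills_y_line:
 assumes t: "\<bar>t2\<bar> <= \<bar>t1\<bar>" "t1 ~= 0" and y: "supp y" "y ~= 0" and S: "\<And>u r. dE (u * t1) (u * t2) ** nexp (0, 0, r *\<^sub>R y, 0) \<in> S"
 shows "fills S"
proof (rule fills_reindex[OF fills_x_line[OF t y] bij_swap12])
 let ?S = "{dE (u * t2) (u * t1) ** nexp (0, r *\<^sub>R y, 0, 0) |u r. True}"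
 show "dE (u * t2) (u * t1) ** nexp (0, r *\<^sub>R y, 0, 0) \<in> ?S" for u r by blast
 fix g assume "g \<in> ?S"
 then obtain u r where g: "g = dE (u * t2) (u * t1) ** nexp (0, r *\<^sub>R y, 0, 0)" by blast
 show "(\<chi> i j. g $ swap12 i $ swap12 j) \<in> S" unfolding g reindex_x_y by (rule S)
qed

end

section \<open>Families that do not fill the Weyl chamber\<close>

context levels
begin

definition family :: "(real \<times> real) set => 'm nco set => 'm sqmat set" where
 "family V U = {dE s t ** nexp p |s t p. (s, t) \<in> V \<and> p \<in> U}"

lemma exp_shrink: "c = 0 \<or> w > 0 ==> ((\<lambda>l. exp (- l * w) *\<^sub>R c) \<longlongrightarrow> 0) at_top" for c :: "'z::real_normed_vector"
proof (cases "c = 0")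
 case False
 assume "c = 0 \<or> w > 0"
 then have w: "w > 0" using False by simp
 have "((\<lambda>l. exp (- l * w)) \<longlongrightarrow> 0) at_top"
  by (rule filterlim_compose[OF exp_at_bot])
    (use filterlim_at_top_mult_tendsto_pos[OF tendsto_const w filterlim_ident] in \<open>simp add: filterlim_uminus_at_top\<close>)
 from tendsto_scaleR[OF this tendsto_const[of c]] show ?thesis by simp
qed simp

text \<open>Every coordinate that occurs in \<open>p\<close> is contracted by the negative direction
  of the torus, so \<open>p\<close> can be shrunk to norm 1.\<close>

definition positive_weights :: "real => real => 'm nco => bool" where
 "positive_weights tu1 tu2 p = (case p of (pp, x, y, et) =>
   (pp = 0 \<or> tu1 > tu2) \<and> (x = 0 \<or> tu1 > 0) \<and> (y = 0 \<or> tu2 > 0) \<and> (et = 0 \<or> tu1 + tu2 > 0))"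

lemma normalize:
 assumes "positive_weights tu1 tu2 p" and "norm p > 1"
 shows "\<exists>l\<ge>0. norm (nad (- l * tu1) (- l * tu2) p) = 1"
proof -
 obtain pp x y et where p: "p = (pp, x, y, et)" by (cases p) blast
 let ?f = "\<lambda>l. nad (- l * tu1) (- l * tu2) p"
 have "?f = (\<lambda>l. (exp (- l * (tu1 - tu2)) *\<^sub>R pp, exp (- l * tu1) *\<^sub>R x, exp (- l * tu2) *\<^sub>R y, exp (- l * (tu1 + tu2)) *\<^sub>R et))"
  by (simp add: p algebra_simps)
 moreover have "(\<dots> \<longlongrightarrow> (0, 0, 0, 0)) at_top"
  by (intro tendsto_Pair exp_shrink) (use assms(1) in \<open>auto simp: positive_weights_def p\<close>)
 ultimately have "(?f \<longlongrightarrow> 0) at_top" by (simp only: zero_prod_def)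
 from tendsto_norm[OF this] have "((\<lambda>l. norm (?f l)) \<longlongrightarrow> 0) at_top" by simp
 then have "\<forall>\<^sub>F l in at_top. norm (?f l) < 1" by (rule order_tendstoD) simp
 then obtain b where b: "\<And>l. l >= b ==> norm (?f l) < 1" by (auto simp: eventually_at_top_linorder)
 have "\<exists>l\<ge>0. l <= max 0 b \<and> norm (?f l) = 1"
 proof (rule IVT2')
  show "norm (?f (max 0 b)) <= 1" by (rule less_imp_le[OF b]) simp
  show "1 <= norm (?f 0)" using assms(2) by (simp add: p)
  show "continuous_on {0..max 0 b} (\<lambda>l. norm (?f l))" unfolding p nad_simp by (intro continuous_intros)
 qed simp
 then show ?thesis by blast
qed

text \<open>Writing \<open>p\<close> as the torus image of a unit vector \<open>X\<close> after time
  \<open>l\<close> turns \<open>dE s nexp p\<close> into a torus element of time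
  \<open>s + l\<close>, the bounded matrix \<open>nexp X\<close>, and a torus element of time
  \<open>- l\<close>. \<open>G\<close> is the leading coefficient of the entry or minor used; it is
  bounded below on the compact unit sphere of \<open>U\<close>. The function \<open>f\<close> is the
  norm or \<open>L2\<close>.\<close>

lemma scaled_family:
 assumes U: "closed U" "U \<subseteq> ncar" "\<And>p. p \<in> U ==> positive_weights tu1 tu2 p"
   "\<And>l p. p \<in> U ==> nad (- l * tu1) (- l * tu2) p \<in> U"
  and G: "continuous_on U G" "\<And>p. p \<in> U ==> p ~= 0 ==> G p > 0"
  and f: "\<And>s p. p \<in> U ==> exp (- mu * s) <= f (dE (s * tu1) (s * tu2) ** nexp p)"
   "\<And>s p. p \<in> U ==> exp (mu * s) <= f (dE (s * tu1) (s * tu2) ** nexp p)"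
   "\<And>s l p. p \<in> U ==> G p * exp (mu * (s + 2 * l)) <= f (dE (s * tu1) (s * tu2) ** nexp (nad (l * tu1) (l * tu2) p))"
 shows "\<exists>c>0. \<exists>B>0. \<forall>h \<in> family (span {(tu1, tu2)}) U. \<exists>s l Y. l >= 0 \<and> norm Y <= B \<and>
   h = dE ((s + l) * tu1) ((s + l) * tu2) ** Y ** dE (- l * tu1) (- l * tu2) \<and>
   c * exp (- mu * s) <= f h \<and> c * exp (mu * (s + 2 * l)) <= f h"
proof -
 have "compact (nexp ` cball (0 :: 'm nco) 1)" by (intro compact_continuous_image continuous_on_nexp') simp
 from bounded_pos[THEN iffD1, OF compact_imp_bounded[OF this]]
 obtain B where B: "B > 0" "\<And>p. norm p <= 1 ==> norm (nexp p) <= B" by auto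
 have K: "compact (U \<inter> sphere 0 1)" using U(1) by (intro closed_Int_compact) auto
 obtain c where c: "c > 0" "\<And>p. p \<in> U ==> norm p = 1 ==> c <= G p"
 proof (cases "U \<inter> sphere 0 1 = {}")
  case False
  obtain q where q: "q \<in> U \<inter> sphere 0 1" "\<forall>p\<in>U \<inter> sphere 0 1. G q <= G p"
   using continuous_attains_inf[OF K False continuous_on_subset[OF G(1)]] by blast
  then have "q ~= 0" by auto
  then show ?thesis using G(2)[of q] q by (intro that[of "G q"]) auto
 next
  case True then show ?thesis by (intro that[of 1]) auto
 qed
 have "\<exists>s l Y. l >= 0 \<and> norm Y <= B \<and>
   h = dE ((s + l) * tu1) ((s + l) * tu2) ** Y ** dE (- l * tu1) (- l * tu2) \<and>
   min 1 c * exp (- mu * s) <= f h \<and> min 1 c * exp (mu * (s + 2 * l)) <= f h" if hh: "h \<in> family (span {(tu1, tu2)}) U" for h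
 proof -
  obtain s p where h: "h = dE (s * tu1) (s * tu2) ** nexp p" "p \<in> U"
   using hh by (auto simp: family_def span_singleton)
  have m: "min 1 c * exp r <= exp r" "min 1 c * exp r <= c * exp r" for r
   using mult_right_mono[of "min 1 c" 1 "exp r"] by (auto intro: mult_right_mono)
  have 1: "min 1 c * exp (- mu * s) <= f h" using f(1)[OF h(2), of s] m(1) unfolding h(1) by (rule order_trans[rotated])
  show ?thesis
  proof (cases "norm p <= 1")
   case True
   have "min 1 c * exp (mu * s) <= f h" using f(2)[OF h(2), of s] m(1) unfolding h(1) by (rule order_trans[rotated])
   then show ?thesis using 1 B(2)[OF True] h(1) by (intro exI[of _ s] exI[of _ 0] exI[of _ "nexp p"]) simp
  next
   case False
   then obtain l where l: "l >= 0" "norm (nad (- l * tu1) (- l * tu2) p) = 1" using normalize[OF U(3)[OF h(2)]] by auto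
   define X where "X = nad (- l * tu1) (- l * tu2) p"
   have X: "X \<in> U" "norm X = 1" "p = nad (l * tu1) (l * tu2) X"
    using U(4)[OF h(2)] l(2) by (auto simp: X_def) (cases p; simp add: mult_exp_exp mult.assoc[symmetric])
   have "dE ((s + l) * tu1) ((s + l) * tu2) ** nexp X ** dE (- l * tu1) (- l * tu2)
    = dE (s * tu1) (s * tu2) ** (dE (l * tu1) (l * tu2) ** nexp X ** dE (- (l * tu1)) (- (l * tu2)))"
    by (simp add: matrix_mul_assoc dE_dE distrib_right)
   also have "\<dots> = h" unfolding nexp_conj X(3)[symmetric] h(1) ..
   finally have 2: "h = dE ((s + l) * tu1) ((s + l) * tu2) ** nexp X ** dE (- l * tu1) (- l * tu2)" ..
   have "min 1 c * exp (mu * (s + 2 * l)) <= c * exp (mu * (s + 2 * l))" by (rule m)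
   also have "\<dots> <= G X * exp (mu * (s + 2 * l))" using c(2)[OF X(1,2)] by (intro mult_right_mono) auto
   also have "\<dots> <= f h" using f(3)[OF X(1), of s l] unfolding h(1) X(3) .
   finally show ?thesis using 1 2 l(1) B(2)[of X] X(2) by (intro exI[of _ s] exI[of _ l] exI[of _ "nexp X"]) simp
  qed
 qed
 moreover have "min 1 c > 0" using c(1) by simp
 ultimately show ?thesis using B(1) by blast
qed

lemma not_fills_family_upper:
 assumes "closed U" "U \<subseteq> ncar" "\<And>p. p \<in> U ==> positive_weights tu1 tu2 p"
   "\<And>l p. p \<in> U ==> nad (- l * tu1) (- l * tu2) p \<in> U"
  and "continuous_on U G" "\<And>p. p \<in> U ==> p ~= 0 ==> G p > 0"
  and f: "\<And>s p. p \<in> U ==> exp (- mu * s) <= norm (dE (s * tu1) (s * tu2) ** nexp p)"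
   "\<And>s p. p \<in> U ==> exp (mu * s) <= norm (dE (s * tu1) (s * tu2) ** nexp p)"
   "\<And>s l p. p \<in> U ==> G p * exp (mu * (s + 2 * l)) <= norm (dE (s * tu1) (s * tu2) ** nexp (nad (l * tu1) (l * tu2) p))"
  and mu: "0 < \<bar>tu1\<bar> + \<bar>tu2\<bar>" "\<bar>tu1\<bar> + \<bar>tu2\<bar> < 2 * mu"
 shows "\<not> fills (family (span {(tu1, tu2)}) U)"
proof -
 obtain c B where "c > 0" "B > 0" "\<forall>h \<in> family (span {(tu1, tu2)}) U. \<exists>s l Y. l >= 0 \<and> norm Y <= B \<and>
   h = dE ((s + l) * tu1) ((s + l) * tu2) ** Y ** dE (- l * tu1) (- l * tu2) \<and>
   c * exp (- mu * s) <= norm h \<and> c * exp (mu * (s + 2 * l)) <= norm h"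
  using scaled_family[where f = norm, OF assms(1-9)] by metis
 then show ?thesis using mu by (intro not_fills_scaled_upper[of c B mu tu1 tu2]) auto
qed

lemma not_fills_family_lower:
 assumes "closed U" "U \<subseteq> ncar" "\<And>p. p \<in> U ==> positive_weights tu1 tu2 p"
   "\<And>l p. p \<in> U ==> nad (- l * tu1) (- l * tu2) p \<in> U"
  and "continuous_on U G" "\<And>p. p \<in> U ==> p ~= 0 ==> G p > 0"
  and f: "\<And>s p. p \<in> U ==> exp (- mu * s) <= L2 (dE (s * tu1) (s * tu2) ** nexp p)"
   "\<And>s p. p \<in> U ==> exp (mu * s) <= L2 (dE (s * tu1) (s * tu2) ** nexp p)"
   "\<And>s l p. p \<in> U ==> G p * exp (mu * (s + 2 * l)) <= L2 (dE (s * tu1) (s * tu2) ** nexp (nad (l * tu1) (l * tu2) p))"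
  and mu: "max \<bar>tu1\<bar> \<bar>tu2\<bar> > 0" "max \<bar>tu1\<bar> \<bar>tu2\<bar> < mu"
 shows "\<not> fills (family (span {(tu1, tu2)}) U)"
proof -
 obtain c B where "c > 0" "B > 0" "\<forall>h \<in> family (span {(tu1, tu2)}) U. \<exists>s l Y. l >= 0 \<and> norm Y <= B \<and>
   h = dE ((s + l) * tu1) ((s + l) * tu2) ** Y ** dE (- l * tu1) (- l * tu2) \<and>
   c * exp (- mu * s) <= L2 h \<and> c * exp (mu * (s + 2 * l)) <= L2 h"
  using scaled_family[where f = L2, OF assms(1-9)] by metis
 then show ?thesis using mu by (intro not_fills_scaled_lower[of c B tu1 tu2 mu]) auto
qed

lemma norm_ge_entry: "g $ i $ j = e ==> c <= \<bar>e\<bar> ==> c <= norm g" for g :: "'m sqmat"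
 using abs_entry_le_norm[of g i j] by simp

lemma L2_ge_minor: "minor2 g i j k l = e ==> c <= \<bar>e\<bar> ==> c <= L2 g" for g :: "'m sqmat"
 using minor2_le_L2[of g i j k l] by simp

lemma exp_quad: "exp (s::real) * (exp l * exp l) = exp (s + 2 * l)"
 by (simp add: mult_exp_exp)

text \<open>The entry at \<open>(e1, f1)\<close> and the diagonal force exponent 1 for the norm,
  while \<open>L2\<close> has exponent at most \<open>1 + \<bar>kp\<bar>\<close>, which is below
  2.\<close>

lemma not_fills_x:
 assumes kp: "\<bar>kp\<bar> < 1" and U: "subspace U" "\<And>pp x y et. (pp, x, y, et) \<in> U ==> pp = 0 \<and> supp x \<and> y = 0 \<and> et = 0"
 shows "\<not> fills (family (span {(1, kp)}) U)"
proof (rule not_fills_family_upper[where mu = 1 and G = "\<lambda>(pp, x, y, et). x \<bullet> x / 2"])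
 have U': "\<exists>x. p = (0, x, 0, 0) \<and> supp x" if "p \<in> U" for p using U(2) that by (cases p) auto
 show "closed U" by (rule closed_subspace[OF U(1)])
 show "U \<subseteq> ncar" using U' by fastforce
 fix p assume p: "p \<in> U"
 obtain x where x: "p = (0, x, 0, 0)" using U'[OF p] by blast
 show "positive_weights 1 kp p" by (simp add: positive_weights_def x)
 show "nad (- l * 1) (- l * kp) p \<in> U" for l using subspace_scale[OF U(1) p, of "exp (- l)"] by (simp add: x)
 show "p ~= 0 ==> 0 < (case p of (pp, x, y, et) => x \<bullet> x / 2)" by (simp add: x zero_prod_def)
 fix s l :: real
 show "exp (- 1 * s) <= norm (dE (s * 1) (s * kp) ** nexp p)"
  by (rule norm_ge_entry[where i = f1 and j = f1, OF refl]) (simp add: dE_mult x nexp_def mult.commute)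
 show "exp (1 * s) <= norm (dE (s * 1) (s * kp) ** nexp p)"
  by (rule norm_ge_entry[where i = e1 and j = e1, OF refl]) (simp add: dE_mult x nexp_def mult.commute)
 show "(case p of (pp, x, y, et) => x \<bullet> x / 2) * exp (1 * (s + 2 * l)) <= norm (dE (s * 1) (s * kp) ** nexp (nad (l * 1) (l * kp) p))"
  by (rule norm_ge_entry[where i = e1 and j = f1, OF refl]) (simp add: dE_mult x nexp_def abs_mult exp_quad[symmetric])
qed (use kp in \<open>auto intro!: continuous_intros simp: case_prod_beta\<close>)

text \<open>The entry at \<open>(e2, f2)\<close> takes the place of the upper right one. For
  \<open>kp = 0\<close> the eta-axis has the same weight as the y-space, so \<open>U\<close> may be
  a graph of eta over y; the last hypothesis allows exactly this.\<close>

lemma not_fills_y: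
 assumes kp: "\<bar>kp\<bar> < 1" and U: "subspace U" "\<And>pp x y et. (pp, x, y, et) \<in> U ==> pp = 0 \<and> x = 0 \<and> supp y"
  "\<And>pp x y et. (pp, x, y, et) \<in> U ==> y = 0 \<or> kp ~= 0 ==> et = 0"
 shows "\<not> fills (family (span {(kp, 1)}) U)"
proof (rule not_fills_family_upper[where mu = 1 and G = "\<lambda>(pp, x, y, et). y \<bullet> y / 2"])
 have U': "\<exists>y et. p = (0, 0, y, et) \<and> supp y" if "p \<in> U" for p using U(2) that by (cases p) blast
 show "closed U" by (rule closed_subspace[OF U(1)])
 show "U \<subseteq> ncar" using U' by fastforce
 fix p assume p: "p \<in> U"
 obtain y et where y: "p = (0, 0, y, et)" using U'[OF p] by blast
 have et: "et = 0" if "y = 0 \<or> kp ~= 0" using U(3) p that unfolding y by blast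
 show "positive_weights kp 1 p" using kp by (auto simp: positive_weights_def y)
 show "nad (- l * kp) (- l * 1) p \<in> U" for l
  using subspace_scale[OF U(1) p, of "exp (- l)"] et by (cases "kp = 0") (simp_all add: y)
 show "p ~= 0 ==> 0 < (case p of (pp, x, y, et) => y \<bullet> y / 2)" using et by (auto simp: y zero_prod_def)
 fix s l :: real
 show "exp (- 1 * s) <= norm (dE (s * kp) (s * 1) ** nexp p)"
  by (rule norm_ge_entry[where i = f2 and j = f2, OF refl]) (simp add: dE_mult y nexp_def mult.commute)
 show "exp (1 * s) <= norm (dE (s * kp) (s * 1) ** nexp p)"
  by (rule norm_ge_entry[where i = e2 and j = e2, OF refl]) (simp add: dE_mult y nexp_def mult.commute)
 show "(case p of (pp, x, y, et) => y \<bullet> y / 2) * exp (1 * (s + 2 * l)) <= norm (dE (s * kp) (s * 1) ** nexp (nad (l * kp) (l * 1) p))"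
  by (rule norm_ge_entry[where i = e2 and j = f2, OF refl]) (simp add: dE_mult y nexp_def abs_mult exp_quad[symmetric])
qed (use kp in \<open>auto intro!: continuous_intros simp: case_prod_beta\<close>)

text \<open>The upper right minor forces exponent \<open>tu1 + tu2 = 1\<close> for
  \<open>L2\<close>. The hypotheses place both weights strictly between 0 and 1, so the norm has a
  smaller exponent.\<close>

lemma not_fills_eta:
 assumes tu: "tu1 + tu2 = 1" "\<bar>tu1 - tu2\<bar> < 1" and U: "subspace U" "\<And>pp x y et. (pp, x, y, et) \<in> U ==> pp = 0 \<and> x = 0 \<and> y = 0"
 shows "\<not> fills (family (span {(tu1, tu2)}) U)"
proof (rule not_fills_family_lower[where mu = 1 and G = "\<lambda>(pp, x, y, et). et * et"])
 have U': "\<exists>et. p = (0, 0, 0, et)" if "p \<in> U" for p using U(2) that by (cases p) auto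
 show "closed U" by (rule closed_subspace[OF U(1)])
 show "U \<subseteq> ncar" using U' by fastforce
 fix p assume p: "p \<in> U"
 obtain et where et: "p = (0, 0, 0, et)" using U'[OF p] by blast
 show "positive_weights tu1 tu2 p" using tu by (simp add: positive_weights_def et)
 have w: "s * tu1 + s * tu2 = s" for s using tu by (simp add: distrib_left[symmetric])
 show "nad (- l * tu1) (- l * tu2) p \<in> U" for l using subspace_scale[OF U(1) p, of "exp (- l)"] w[of "- l"] by (simp add: et)
 show "p ~= 0 ==> 0 < (case p of (pp, x, y, et) => et * et)" by (auto simp: et zero_prod_def zero_less_mult_iff)
 fix s l :: real
 show "exp (- 1 * s) <= L2 (dE (s * tu1) (s * tu2) ** nexp p)"
  by (rule L2_ge_minor[where i = f2 and j = f1 and k = f2 and l = f1, OF refl])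
    (use w[of "- s"] in \<open>simp add: minor2_def dE_mult et nexp_def mult_exp_exp add.commute\<close>)
 show "exp (1 * s) <= L2 (dE (s * tu1) (s * tu2) ** nexp p)"
  by (rule L2_ge_minor[where i = e1 and j = e2 and k = e1 and l = e2, OF refl])
    (use w[of s] in \<open>simp add: minor2_def dE_mult et nexp_def mult_exp_exp\<close>)
 have es: "exp s = exp (s * tu1) * exp (s * tu2)" using w[of s] by (simp add: mult_exp_exp)
 have "minor2 (dE (s * tu1) (s * tu2) ** nexp (nad (l * tu1) (l * tu2) p)) e1 e2 f2 f1 = - (et * et * exp (s + 2 * l))"
  unfolding et nad_simp w[of l] exp_quad[symmetric] es by (simp add: minor2_def dE_mult nexp_def)
 then show "(case p of (pp, x, y, et) => et * et) * exp (1 * (s + 2 * l)) <= L2 (dE (s * tu1) (s * tu2) ** nexp (nad (l * tu1) (l * tu2) p))"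
  by (rule L2_ge_minor) (simp add: et abs_mult)
qed (use tu in \<open>auto intro!: continuous_intros simp: case_prod_beta max_def\<close>)

text \<open>The case of eta, transported by the reflection in \<beta>, which exchanges phi and eta
  and changes the sign of the second torus coordinate.\<close>

lemma not_fills_phi:
 assumes tu: "tu1 - tu2 = 1" "\<bar>tu1 + tu2\<bar> < 1" and U: "subspace U" "\<And>pp x y et. (pp, x, y, et) \<in> U ==> x = 0 \<and> y = 0 \<and> et = 0"
 shows "\<not> fills (family (span {(tu1, tu2)}) U)"
proof
 let ?U = "(\<lambda>(pp, x, y, et). (et, x, y, pp)) ` U"
 have s: "subspace ?U" by (rule linear_subspace_image[OF _ U(1)]) (auto intro!: linearI)
 have e: "(pp, x, y, et) \<in> ?U ==> pp = 0 \<and> x = 0 \<and> y = 0" for pp x y et using U(2) by force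
 assume "fills (family (span {(tu1, tu2)}) U)"
 then have "fills (family (span {(tu1, - tu2)}) ?U)"
 proof (rule fills_reindex[OF _ bij_swap2])
  fix g assume "g \<in> family (span {(tu1, tu2)}) U"
  then obtain s p where g: "g = dE (s * tu1) (s * tu2) ** nexp p" "p \<in> U" by (auto simp: family_def span_singleton)
  obtain pp where p: "p = (pp, 0, 0, 0)" using U(2) g(2) by (cases p) auto
  then have "(0, 0, 0, pp) \<in> ?U" using g(2) by force
  then show "(\<chi> i j. g $ swap2 i $ swap2 j) \<in> family (span {(tu1, - tu2)}) ?U"
   unfolding g(1) p reindex_phi_eta family_def span_singleton by force
 qed
 moreover have "\<not> fills (family (span {(tu1, - tu2)}) ?U)" using tu by (intro not_fills_eta s) (use e in auto)
 ultimately show False by simp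
qed

text \<open>For the direction (1, 1) the norm has exponent 1 and the upper right minor exponent 2.
  The last hypothesis says that the leading coefficient of this minor vanishes only at 0.\<close>

lemma not_fills_nonparallel:
 assumes U: "subspace U" "U \<subseteq> ncar" "\<And>pp x y et. (pp, x, y, et) \<in> U ==> pp = 0" "\<And>l p. p \<in> U ==> nad l l p \<in> U"
  and a: "\<And>x y et. (0, x, y, et) \<in> U ==> (x, y, et) ~= (0, 0, 0) ==> et ~= 0 \<or> gram x y ~= 0"
 shows "\<not> fills (family (span {(1, 1)}) U)"
proof (rule not_fills_family_lower[where mu = 2 and G = "\<lambda>(pp, x, y, et). et\<^sup>2 + gram x y / 4"])
 show "closed U" by (rule closed_subspace[OF U(1)])
 fix p assume p: "p \<in> U"
 obtain x y et where x: "p = (0, x, y, et)" using U(3) p by (cases p) auto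
 show "positive_weights 1 1 p" by (simp add: positive_weights_def x)
 show "nad (- l * 1) (- l * 1) p \<in> U" for l using U(4)[OF p] by simp
 show "p ~= 0 ==> 0 < (case p of (pp, x, y, et) => et\<^sup>2 + gram x y / 4)"
 proof -
  assume "p ~= 0"
  then have "et ~= 0 \<or> gram x y ~= 0" using a[of x y et] p by (auto simp: x zero_prod_def)
  then show ?thesis using gram_nonneg[of x y] by (cases "et = 0") (simp_all add: x add_pos_nonneg)
 qed
 fix s l :: real
 show "exp (- 2 * s) <= L2 (dE (s * 1) (s * 1) ** nexp p)"
  by (rule L2_ge_minor[where i = f2 and j = f1 and k = f2 and l = f1, OF refl])
    (simp add: minor2_def dE_mult x nexp_def mult_exp_exp)
 show "exp (2 * s) <= L2 (dE (s * 1) (s * 1) ** nexp p)"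
  by (rule L2_ge_minor[where i = e1 and j = e2 and k = e1 and l = e2, OF refl])
    (simp add: minor2_def dE_mult x nexp_def mult_exp_exp)
 have e2: "exp (l + l) = (exp l)\<^sup>2" "exp (2 * l) = (exp l)\<^sup>2" "exp (l * 2) = (exp l)\<^sup>2"
  by (simp_all add: exp_add[symmetric] power2_eq_square)
 have "minor2 (dE (s * 1) (s * 1) ** nexp (nad (l * 1) (l * 1) p)) e1 e2 f2 f1 = - ((et\<^sup>2 + gram x y / 4) * ((exp s)\<^sup>2 * (exp l)^4))"
  by (simp add: minor2_def dE_mult x nexp_def gram_def e2 power_numeral_reduce field_simps)
 also have "(exp s)\<^sup>2 * (exp l)^4 = exp (2 * (s + 2 * l))"
  by (simp only: exp_of_nat_mult[symmetric] exp_add[symmetric]) simp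
 finally show "(case p of (pp, x, y, et) => et\<^sup>2 + gram x y / 4) * exp (2 * (s + 2 * l)) <= L2 (dE (s * 1) (s * 1) ** nexp (nad (l * 1) (l * 1) p))"
  by (rule L2_ge_minor) (simp add: x gram_nonneg abs_mult)
qed (use U in \<open>auto intro!: continuous_intros simp: case_prod_beta max_def gram_def\<close>)

text \<open>For the direction (1, 0) both \<open>L2\<close> and the upper right entry have exponent
  1, the latter with leading coefficient \<open>\<bar>Qf pp x et\<bar> / 2\<close>, which anisotropy
  keeps positive.\<close>

lemma not_fills_anisotropic:
 assumes U: "subspace U" "U \<subseteq> ncar" "\<And>pp x y et. (pp, x, y, et) \<in> U ==> y = 0"
  and a: "\<And>pp x et. (pp, x, 0, et) \<in> U ==> (pp, x, et) ~= (0, 0, 0) ==> Qf pp x et ~= 0"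
 shows "\<not> fills (family (span {(1, 0)}) U)"
proof (rule not_fills_family_upper[where mu = 1 and G = "\<lambda>(pp, x, y, et). \<bar>Qf pp x et\<bar> / 2"])
 show "closed U" by (rule closed_subspace[OF U(1)])
 fix p assume p: "p \<in> U"
 obtain pp x et where x: "p = (pp, x, 0, et)" using U(3) p by (cases p) auto
 show "positive_weights 1 0 p" by (simp add: positive_weights_def x)
 show "nad (- l * 1) (- l * 0) p \<in> U" for l using subspace_scale[OF U(1) p, of "exp (- l)"] by (simp add: x)
 show "p ~= 0 ==> 0 < (case p of (pp, x, y, et) => \<bar>Qf pp x et\<bar> / 2)" using a[of pp x et] p by (auto simp: x zero_prod_def)
 fix s l :: real
 show "exp (- 1 * s) <= norm (dE (s * 1) (s * 0) ** nexp p)"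
  by (rule norm_ge_entry[where i = f1 and j = f1, OF refl]) (simp add: dE_mult x nexp_def mult.commute)
 show "exp (1 * s) <= norm (dE (s * 1) (s * 0) ** nexp p)"
  by (rule norm_ge_entry[where i = e1 and j = e1, OF refl]) (simp add: dE_mult x nexp_def mult.commute)
 have "(dE (s * 1) (s * 0) ** nexp (nad (l * 1) (l * 0) p)) $ e1 $ f1 = - (Qf pp x et / 2 * (exp s * (exp l * exp l)))"
  by (simp add: dE_mult x nexp_def Qf_def field_simps)
 then show "(case p of (pp, x, y, et) => \<bar>Qf pp x et\<bar> / 2) * exp (1 * (s + 2 * l)) <= norm (dE (s * 1) (s * 0) ** nexp (nad (l * 1) (l * 0) p))"
  by (rule norm_ge_entry) (simp add: x abs_mult exp_quad)
qed (use U in \<open>auto intro!: continuous_intros simp: case_prod_beta Qf_def\<close>)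

text \<open>The direction (2, 1) gives phi and y the same weight. The upper right entry has exponent
  2 and \<open>L2\<close> at most 3, so \<open>L2\<close> is at most of the order of the norm to the
  power 3/2.\<close>

lemma not_fills_principal:
 assumes q: "supp y" "pp ~= 0" "y ~= 0"
 shows "\<not> fills (family (span {(2, 1)}) (span {(pp, 0, y, 0)}))"
proof (rule not_fills_family_upper[where mu = 2 and G = "\<lambda>(pp, x, y, et). pp\<^sup>2 * (y \<bullet> y) / 24"])
 let ?U = "span {(pp, 0, y, 0)} :: 'm nco set"
 show "closed ?U" by (rule closed_subspace) simp
 show "?U \<subseteq> ncar" using q by (auto simp: span_singleton)
 fix p assume p: "p \<in> ?U"
 then obtain r where x: "p = (r * pp, 0, r *\<^sub>R y, 0)" by (auto simp: span_singleton)
 show "positive_weights 2 1 p" by (simp add: positive_weights_def x)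
 show "nad (- l * 2) (- l * 1) p \<in> ?U" for l using span_scale[OF p, of "exp (- l)"] by (simp add: x)
 show "0 < (case p of (pp, x, y, et) => pp\<^sup>2 * (y \<bullet> y) / 24)" if "p ~= 0"
 proof -
  have "r ~= 0" using that by (auto simp: x zero_prod_def)
  then have "0 < (r * pp)\<^sup>2" "0 < norm (r *\<^sub>R y)" using q by auto
  then show ?thesis unfolding x prod.case by (intro divide_pos_pos mult_pos_pos) (auto simp: dot_square_norm)
 qed
 fix s l :: real
 show "exp (- 2 * s) <= norm (dE (s * 2) (s * 1) ** nexp p)"
  by (rule norm_ge_entry[where i = f1 and j = f1, OF refl]) (simp add: dE_mult x nexp_def mult.commute)
 show "exp (2 * s) <= norm (dE (s * 2) (s * 1) ** nexp p)"
  by (rule norm_ge_entry[where i = e1 and j = e1, OF refl]) (simp add: dE_mult x nexp_def mult.commute)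
 have "(dE (s * 2) (s * 1) ** nexp (nad (l * 2) (l * 1) p)) $ e1 $ f1 = (r * pp)\<^sup>2 * ((r *\<^sub>R y) \<bullet> (r *\<^sub>R y)) / 24 * (exp (s * 2) * (exp l)^4)"
  by (simp add: dE_mult x nexp_def power_numeral_reduce field_simps)
 also have "exp (s * 2) * (exp l)^4 = exp (2 * (s + 2 * l))"
  by (simp only: exp_of_nat_mult[symmetric] exp_add[symmetric]) (simp add: algebra_simps)
 finally show "(case p of (pp, x, y, et) => pp\<^sup>2 * (y \<bullet> y) / 24) * exp (2 * (s + 2 * l)) <= norm (dE (s * 2) (s * 1) ** nexp (nad (l * 2) (l * 1) p))"
  by (rule norm_ge_entry) (simp add: x abs_mult)
qed (auto intro!: continuous_intros simp: case_prod_beta)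

end

section \<open>One-dimensional tori: case analysis\<close>

context levels
begin

lemma span_pair_scale: "c ~= 0 ==> span {(c * a, c * b)} = span {(a, b)}" for a b c :: real
proof -
 assume c: "c ~= 0"
 have "(\<lambda>k. k *\<^sub>R (c * a, c * b)) = (\<lambda>k. k *\<^sub>R (a, b)) \<circ> (\<lambda>k. k * c)" by auto
 moreover have "range (\<lambda>k::real. k * c) = UNIV" using c by (intro surjI[of _ "\<lambda>k. k / c"]) auto
 ultimately show ?thesis unfolding span_singleton by (metis image_comp)
qed

lemma family_scale: "c ~= 0 ==> family (span {(c * a, c * b)}) U = family (span {(a, b)}) U"
 by (simp add: span_pair_scale)

text \<open>In this order \<alpha>, \<beta>, \<alpha> + \<beta>, \<alpha> + 2 \<beta>, as linear
  forms in the logarithmic coordinates \<open>(s, t)\<close> of the torus.\<close>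

definition root_vectors :: "(real \<times> real) set" where
 "root_vectors = {(1, -1), (0, 1), (1, 0), (1, 1)}"

definition root_coords :: "real \<times> real => 'm nco set" where
 "root_coords v = {(pp, x, y, et). supp x \<and> supp y \<and> (v ~= (1, -1) \<longrightarrow> pp = 0) \<and> (v ~= (0, 1) \<longrightarrow> y = 0) \<and>
   (v ~= (1, 0) \<longrightarrow> x = 0) \<and> (v ~= (1, 1) \<longrightarrow> et = 0)}"

lemma root_coords_simps [simp]:
 "(pp, x, y, et) \<in> root_coords (1, -1) \<longleftrightarrow> x = 0 \<and> y = 0 \<and> et = 0"
 "(pp, x, y, et) \<in> root_coords (0, 1) \<longleftrightarrow> supp y \<and> pp = 0 \<and> x = 0 \<and> et = 0"
 "(pp, x, y, et) \<in> root_coords (1, 0) \<longleftrightarrow> supp x \<and> pp = 0 \<and> y = 0 \<and> et = 0"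
 "(pp, x, y, et) \<in> root_coords (1, 1) \<longleftrightarrow> pp = 0 \<and> x = 0 \<and> y = 0"
 by (auto simp: root_coords_def)

end

locale invariant_family = levels e1 e2 f2 f1 for e1 e2 f2 f1 :: "'m::{finite, linorder}" +
 fixes U :: "'m nco set" and t1 t2 :: real
 assumes subspace_U: "subspace U" and U_ncar: "U \<subseteq> ncar" and nbr_U: "\<And>p q. p \<in> U ==> q \<in> U ==> nbr p q \<in> U"
  and nad_U: "\<And>l p. p \<in> U ==> nad (l * t1) (l * t2) p \<in> U" and t_nonzero: "(t1, t2) ~= (0, 0)"
begin

text \<open>The derivative of the torus action at \<open>l = 0\<close>; difference quotients stay in
  the closed subspace \<open>U\<close>.\<close>

lemma weights_U: assumes "(pp, x, y, et) \<in> U" shows "((t1 - t2) * pp, t1 *\<^sub>R x, t2 *\<^sub>R y, (t1 + t2) * et) \<in> U"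
proof (rule Lim_in_closed_set)
 show "closed U" by (rule closed_subspace[OF subspace_U])
 let ?e = "\<lambda>w l :: real. (exp (l * w) - 1) / l"
 have "((\<lambda>l. exp (l * w)) has_real_derivative w) (at 0)" for w by (auto intro!: derivative_eq_intros)
 then have e: "(?e w \<longlongrightarrow> w) (at 0)" for w unfolding DERIV_def by simp
 let ?g = "\<lambda>l. (?e (t1 - t2) l * pp, ?e t1 l *\<^sub>R x, ?e t2 l *\<^sub>R y, ?e (t1 + t2) l * et)"
 show "(?g \<longlongrightarrow> ((t1 - t2) * pp, t1 *\<^sub>R x, t2 *\<^sub>R y, (t1 + t2) * et)) (at 0)"
  by (intro tendsto_intros e)
 have "(1 / l) *\<^sub>R (nad (l * t1) (l * t2) (pp, x, y, et) - (pp, x, y, et)) \<in> U" for l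
  using assms by (intro subspace_scale[OF subspace_U] subspace_diff[OF subspace_U] nad_U)
 moreover have "(1 / l) *\<^sub>R (nad (l * t1) (l * t2) (pp, x, y, et) - (pp, x, y, et)) = ?g l" for l
 proof -
  have "(1 / l) *\<^sub>R (e *\<^sub>R z - z) = ((e - 1) / l) *\<^sub>R z" for e and z :: "'m vc"
   by (simp add: scaleR_diff_right scaleR_diff_left diff_divide_distrib)
  then show ?thesis by (simp add: left_diff_distrib right_diff_distrib[symmetric] distrib_left[symmetric])
 qed
 ultimately have "?g l \<in> U" for l by (simp only:)
 then show "\<forall>\<^sub>F l in at 0. ?g l \<in> U" by (intro always_eventually allI)
qed simp

lemma isolate:
 assumes "(pp, x, y, et) \<in> U"
 shows "(if t1 - t2 = w then pp else 0, if t1 = w then x else 0, if t2 = w then y else 0, if t1 + t2 = w then et else 0) \<in> U"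
proof -
 \<comment> \<open>Lagrange interpolation in the torus action: the product over all other weights
   annihilates their components, and dividing by its nonzero value at \<open>w\<close> gives the
   projection.\<close>
 let ?P = "\<lambda>S w. \<Prod>a\<in>S. w - a"
 have P: "finite S ==> (?P S (t1 - t2) * pp, ?P S t1 *\<^sub>R x, ?P S t2 *\<^sub>R y, ?P S (t1 + t2) * et) \<in> U" for S
 proof (induction S rule: finite_induct)
  case empty then show ?case using assms by simp
 next
  case (insert a S)
  from subspace_diff[OF subspace_U weights_U[OF insert.IH] subspace_scale[OF subspace_U insert.IH, of a]]
  show ?case using insert by (simp add: algebra_simps)
 qed
 let ?S = "{t1 - t2, t1, t2, t1 + t2} - {w}"
 have "?P ?S w ~= 0" by auto
 moreover have "v \<in> {t1 - t2, t1, t2, t1 + t2} ==> ?P ?S v = (if v = w then ?P ?S w else 0)" for v by auto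
 ultimately have "v \<in> {t1 - t2, t1, t2, t1 + t2} ==> (1 / ?P ?S w) * ?P ?S v = (if v = w then 1 else 0)" for v by auto
 then have k: "(1 / ?P ?S w) * ?P ?S (t1 - t2) = (if t1 - t2 = w then 1 else 0)" "(1 / ?P ?S w) * ?P ?S t1 = (if t1 = w then 1 else 0)"
  "(1 / ?P ?S w) * ?P ?S t2 = (if t2 = w then 1 else 0)" "(1 / ?P ?S w) * ?P ?S (t1 + t2) = (if t1 + t2 = w then 1 else 0)" by blast+
 have "(1 / ?P ?S w) *\<^sub>R (?P ?S (t1 - t2) * pp, ?P ?S t1 *\<^sub>R x, ?P ?S t2 *\<^sub>R y, ?P ?S (t1 + t2) * et) \<in> U"
  by (rule subspace_scale[OF subspace_U P]) simp
 then show ?thesis unfolding scaleR_Pair scaleR_scaleR real_scaleR_def mult.assoc[symmetric] k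
  by (simp only: if_distribR if_distrib[of "\<lambda>c. c *\<^sub>R _"] if_distrib[of "\<lambda>c. c * _"] mult_1 mult_zero_left scaleR_one scaleR_zero_left)
qed

lemma supp_U: "(pp, x, y, et) \<in> U ==> supp x" "(pp, x, y, et) \<in> U ==> supp y"
 using U_ncar by auto

text \<open>Two root components that coexist produce, together with their brackets, one of the
  filling configurations already found.\<close>

lemma fills_pairs:
 assumes "\<not> fills (nexp ` U)"
 shows phi_x: "(pp, 0, 0, 0) \<in> U ==> pp ~= 0 ==> (0, x, 0, 0) \<in> U ==> x = 0"
  and phi_eta: "(pp, 0, 0, 0) \<in> U ==> pp ~= 0 ==> (0, 0, 0, et) \<in> U ==> et = 0"
  and phi_y: "(pp, 0, 0, 0) \<in> U ==> pp ~= 0 ==> (0, x, y, et) \<in> U ==> y = 0"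
  and eta_par: "(0, 0, 0, et) \<in> U ==> et ~= 0 ==> (0, x, y, et') \<in> U ==> gram x y = 0 ==> x = 0 \<and> y = 0"
  and x_y: "(0, x, 0, et) \<in> U ==> (0, 0, y, et') \<in> U ==> x = 0 \<or> y = 0"
proof -
 show 1: "x = 0" if "(pp, 0, 0, 0) \<in> U" "pp ~= 0" "(0, x, 0, 0) \<in> U" for pp x
  using assms fills_isotropic[OF subspace_U U_ncar that(3) _ that(1)] that(2) by (auto simp: Qf_def)
 show "et = 0" if "(pp, 0, 0, 0) \<in> U" "pp ~= 0" "(0, 0, 0, et) \<in> U" for pp et
  using assms fills_isotropic[OF subspace_U U_ncar, of pp 0 et pp 0 0] subspace_add[OF subspace_U that(1,3)] that by (auto simp: Qf_def)
 \<comment> \<open>The bracket with phi turns \<open>y\<close> into the x-vector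
   \<open>pp *\<^sub>R y\<close>, which the first claim excludes.\<close>
 show "y = 0" if "(pp, 0, 0, 0) \<in> U" "pp ~= 0" "(0, x, y, et) \<in> U" for pp x y et
  using nbr_U[OF that(1,3)] 1[OF that(1,2)] that(2) by fastforce
 show 2: "x = 0 \<and> y = 0" if "(0, 0, 0, et) \<in> U" "et ~= 0" "(0, x, y, et') \<in> U" "gram x y = 0" for et x y et'
  using assms fills_parallel_eta[OF subspace_U U_ncar that(3) _ that(4,1,2)] by blast
 show "x = 0 \<or> y = 0" if xy: "(0, x, 0, et) \<in> U" "(0, 0, y, et') \<in> U" for x y et et'
 proof (rule ccontr)
  assume n: "\<not> ?thesis"
  \<comment> \<open>The bracket lies on the eta-axis, which is excluded next to a nonzero
    \<open>x\<close>. So \<open>x\<close> and \<open>y\<close> are orthogonal, hence independent,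
    and the segment from one to their sum fills.\<close>
  have "(0, 0, 0, - (x \<bullet> y)) \<in> U" using nbr_U[OF xy] by simp
  then have "x \<bullet> y = 0" using 2[of "- (x \<bullet> y)", OF _ _ xy(1)] n by (auto simp: gram_def)
  then have "gram x y ~= 0" using n by (simp add: gram_def)
  moreover have "(0, x, y, et + et') \<in> U" using subspace_add[OF subspace_U xy] by simp
  ultimately show False using assms fills_parallel_independent[OF subspace_U U_ncar xy(1)] n by (auto simp: gram_def)
 qed
qed

definition single_root :: bool where "single_root \<longleftrightarrow> (\<exists>v\<in>root_vectors. U \<subseteq> root_coords v)"

lemma single_rootI:
 "(\<And>pp x y et. (pp, x, y, et) \<in> U ==> x = 0 \<and> y = 0 \<and> et = 0) ==> single_root"
 "(\<And>pp x y et. (pp, x, y, et) \<in> U ==> pp = 0 \<and> x = 0 \<and> et = 0) ==> single_root"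
 "(\<And>pp x y et. (pp, x, y, et) \<in> U ==> pp = 0 \<and> y = 0 \<and> et = 0) ==> single_root"
 "(\<And>pp x y et. (pp, x, y, et) \<in> U ==> pp = 0 \<and> x = 0 \<and> y = 0) ==> single_root"
proof -
 have *: "(\<And>pp x y et. (pp, x, y, et) \<in> U ==> (pp, x, y, et) \<in> root_coords v) ==> v \<in> root_vectors ==> single_root" for v
  unfolding single_root_def by (auto intro!: bexI[of _ v])
 show "(\<And>pp x y et. (pp, x, y, et) \<in> U ==> x = 0 \<and> y = 0 \<and> et = 0) ==> single_root" by (rule *[of "(1, -1)"]) (simp_all add: root_vectors_def)
 show "(\<And>pp x y et. (pp, x, y, et) \<in> U ==> pp = 0 \<and> x = 0 \<and> et = 0) ==> single_root" by (rule *[of "(0, 1)"]) (auto simp: root_vectors_def supp_U)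
 show "(\<And>pp x y et. (pp, x, y, et) \<in> U ==> pp = 0 \<and> y = 0 \<and> et = 0) ==> single_root" by (rule *[of "(1, 0)"]) (auto simp: root_vectors_def supp_U)
 show "(\<And>pp x y et. (pp, x, y, et) \<in> U ==> pp = 0 \<and> x = 0 \<and> y = 0) ==> single_root" by (rule *[of "(1, 1)"]) (simp_all add: root_vectors_def)
qed

text \<open>By \<open>fills_pairs\<close>, any nonzero root component that is present excludes the
  components in the other three root spaces.\<close>

lemma single_root_if_isolated:
 assumes n: "\<not> fills (nexp ` U)"
  and iso: "\<And>pp x y et. (pp, x, y, et) \<in> U ==> (pp, 0, 0, 0) \<in> U \<and> (0, x, 0, 0) \<in> U \<and> (0, 0, y, 0) \<in> U \<and> (0, 0, 0, et) \<in> U"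
 shows single_root
proof -
 note pairs = fills_pairs[OF n]
 have g: "gram 0 y = 0" "gram y 0 = 0" for y by (simp_all add: gram_def)
 consider (a) pp where "(pp, 0, 0, 0) \<in> U" "pp ~= 0" | (b) et where "(0, 0, 0, et) \<in> U" "et ~= 0" | (c) x where "(0, x, 0, 0) \<in> U" "x ~= 0"
  | (d) "\<And>pp x y et. (pp, x, y, et) \<in> U ==> pp = 0 \<and> x = 0 \<and> et = 0" using iso by blast
 then show ?thesis
 proof cases
  case a
  show ?thesis by (rule single_rootI(1)) (use pairs(1-3)[OF a] iso in blast)
 next
  case b
  show ?thesis by (rule single_rootI(4)) (use pairs(2)[OF _ _ b(1)] pairs(4)[OF b _ g(1)] pairs(4)[OF b _ g(2)] b iso in blast)
 next
  case c
  show ?thesis by (rule single_rootI(3)) (use pairs(1)[OF _ _ c(1)] pairs(4)[OF _ _ c(1) g(2)] pairs(5)[OF c(1)] c iso in blast)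
 next
  case d then show ?thesis by (rule single_rootI(2))
 qed
qed

text \<open>The vector \<open>(b, - a)\<close> is \<open>(a, b)\<close> turned by a right angle, so
  the negated inequality says that the torus line makes an angle of less than 45 degrees with the
  root. Rescaling the torus so that the root takes the value 1 gives the normal forms treated
  above.\<close>

lemma single_root_not_fills:
 assumes U: "U \<subseteq> root_coords (a, b)" "(a, b) \<in> root_vectors" and t: "\<not> \<bar>a * t1 + b * t2\<bar> <= \<bar>b * t1 - a * t2\<bar>"
 shows "\<not> fills (family (span {(t1, t2)}) U)"
proof -
 have c: "c ~= 0 ==> family (span {(t1, t2)}) U = family (span {(t1 / c, t2 / c)}) U" for c
  using family_scale[of c "t1 / c" "t2 / c" U] by simp
 consider "(a, b) = (1, -1)" | "(a, b) = (0, 1)" | "(a, b) = (1, 0)" | "(a, b) = (1, 1)" using U(2) unfolding root_vectors_def by blast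
 then show ?thesis
 proof cases
  case 1
  have nz: "t1 - t2 ~= 0" using t 1 by auto
  show ?thesis unfolding c[OF nz]
  proof (rule not_fills_phi[OF _ _ subspace_U])
   show "t1 / (t1 - t2) - t2 / (t1 - t2) = 1" using nz by (simp add: diff_divide_distrib[symmetric])
   show "\<bar>t1 / (t1 - t2) + t2 / (t1 - t2)\<bar> < 1" using t nz 1 by (auto simp: add_divide_distrib[symmetric] abs_divide divide_less_eq_1)
  qed (use U 1 in auto)
 next
  case 2
  have nz: "t2 ~= 0" using t 2 by auto
  have "\<not> fills (family (span {(t1 / t2, 1)}) U)"
   by (rule not_fills_y[OF _ subspace_U]) (use U(1) t nz 2 in \<open>auto simp: abs_divide divide_less_eq_1\<close>)
  then show ?thesis using c[OF nz] nz by simp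
 next
  case 3
  have nz: "t1 ~= 0" using t 3 by auto
  have "\<not> fills (family (span {(1, t2 / t1)}) U)"
   by (rule not_fills_x[OF _ subspace_U]) (use U(1) t nz 3 in \<open>auto simp: abs_divide divide_less_eq_1\<close>)
  then show ?thesis using c[OF nz] nz by simp
 next
  case 4
  have nz: "t1 + t2 ~= 0" using t 4 by auto
  show ?thesis unfolding c[OF nz]
  proof (rule not_fills_eta[OF _ _ subspace_U])
   show "t1 / (t1 + t2) + t2 / (t1 + t2) = 1" using nz by (simp add: add_divide_distrib[symmetric])
   show "\<bar>t1 / (t1 + t2) - t2 / (t1 + t2)\<bar> < 1" using t nz 4 by (auto simp: diff_divide_distrib[symmetric] abs_divide divide_less_eq_1)
  qed (use U 4 in auto)
 qed
qed

text \<open>The trivial \<open>U\<close> lies in every root space, and the root lines are 45 degrees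
  apart, so one of them is close enough to the torus line.\<close>

lemma trivial_not_fills: assumes "U = {0}" shows "\<not> fills (family (span {(t1, t2)}) U)"
proof -
 have U: "U \<subseteq> root_coords v" for v using assms by (auto simp: root_coords_def zero_prod_def)
 have "\<exists>(a, b) \<in> root_vectors. \<not> \<bar>a * t1 + b * t2\<bar> <= \<bar>b * t1 - a * t2\<bar>"
  using t_nonzero by (cases "\<bar>t1\<bar> = \<bar>t2\<bar>"; cases "t1 = t2") (auto simp: root_vectors_def)
 then show ?thesis using single_root_not_fills[OF U] by blast
qed

lemma single_root_fills:
 assumes U: "U \<subseteq> root_coords (a, b)" "(a, b) \<in> root_vectors" "U ~= {0}" and t: "\<bar>a * t1 + b * t2\<bar> <= \<bar>b * t1 - a * t2\<bar>"
 shows "fills (family (span {(t1, t2)}) U)"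
proof -
 obtain p where p: "p \<in> U" "p ~= 0" using U(3) subspace_0[OF subspace_U] by blast
 have mem: "dE (u * t1) (u * t2) ** nexp (r *\<^sub>R p) \<in> family (span {(t1, t2)}) U" for u r
 proof -
  have "(u * t1, u * t2) \<in> span {(t1, t2)}" by (auto simp: span_singleton)
  then show ?thesis using subspace_scale[OF subspace_U p(1), of r] unfolding family_def by blast
 qed
 obtain pp x y et where p': "p = (pp, x, y, et)" by (cases p) blast
 consider "(a, b) = (1, -1)" | "(a, b) = (0, 1)" | "(a, b) = (1, 0)" | "(a, b) = (1, 1)" using U(2) unfolding root_vectors_def by blast
 then show ?thesis
 proof cases
  case 1
  then have "p = (pp, 0, 0, 0)" "pp ~= 0" using U(1) p p' by (auto simp: zero_prod_def)
  then show ?thesis using 1 t t_nonzero mem[of _ "_ / pp"] by (intro fills_alpha_line[of t1 t2]) auto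
 next
  case 2
  then have "p = (0, 0, y, 0)" "y ~= 0" "supp y" using U(1) p p' by (auto simp: zero_prod_def)
  then show ?thesis using 2 t t_nonzero mem by (intro fills_y_line[of t2 t1 y]) auto
 next
  case 3
  then have "p = (0, x, 0, 0)" "x ~= 0" "supp x" using U(1) p p' by (auto simp: zero_prod_def)
  then show ?thesis using 3 t t_nonzero mem by (intro fills_x_line[of t1 t2 x]) auto
 next
  case 4
  then have "p = (0, 0, 0, et)" "et ~= 0" using U(1) p p' by (auto simp: zero_prod_def)
  then show ?thesis using 4 t t_nonzero mem[of _ "_ / et"] by (intro fills_eta_line[of t1 t2]) auto
 qed
qed

text \<open>Condition (3) in coordinates: the span of \<open>x\<close> and \<open>y\<close> has
  dimension 1 when not both vanish and the Gram determinant is 0.\<close>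

definition alpha_exception :: bool where
 "alpha_exception \<longleftrightarrow> t1 = t2 \<and> U ~= {0} \<and>
   (\<forall>(pp, x, y, et) \<in> U. (pp, x, y, et) ~= 0 \<longrightarrow> pp = 0 \<and> et = 0 \<and> (x ~= 0 \<or> y ~= 0) \<and> gram x y = 0)"

definition beta_exception :: bool where
 "beta_exception \<longleftrightarrow> t2 = 0 \<and> U ~= {0} \<and> (\<forall>(pp, x, y, et) \<in> U. y = 0 \<and> Qf pp x et = 0)"

lemma alpha_exception_fills: assumes alpha_exception shows "fills (family (span {(t1, t2)}) U)"
proof -
 obtain p where p: "p \<in> U" "p ~= 0" using assms subspace_0[OF subspace_U] unfolding alpha_exception_def by blast
 obtain pp x y et where p': "p = (pp, x, y, et)" by (cases p) blast
 then have p0: "p = (0, x, y, 0)" and xy: "x ~= 0 \<or> y ~= 0" "gram x y = 0" "t1 = t2"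
  using assms p unfolding alpha_exception_def by auto
 show ?thesis
 proof (rule fills_alpha_kernel[OF _ _ xy(2,1)])
  show "supp x" "supp y" using supp_U p(1) unfolding p' by blast+
  fix s r :: real
  have "(s, s) \<in> span {(t1, t2)}" using t_nonzero xy(3) by (auto simp: span_singleton intro!: image_eqI[of _ _ "s / t1"])
  then show "dE s s ** nexp (r *\<^sub>R (0, x, y, 0)) \<in> family (span {(t1, t2)}) U"
   using subspace_scale[OF subspace_U p(1), of r] unfolding family_def p0 by blast
 qed
qed

lemma beta_exception_fills: assumes beta_exception shows "fills (family (span {(t1, t2)}) U)"
proof -
 obtain p where p: "p \<in> U" "p ~= 0" using assms subspace_0[OF subspace_U] unfolding beta_exception_def by blast
 obtain pp x y et where p': "p = (pp, x, y, et)" by (cases p) blast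
 then have p0: "p = (pp, x, 0, et)" and q: "Qf pp x et = 0" "t2 = 0"
  using assms p unfolding beta_exception_def by auto
 show ?thesis
 proof (rule fills_beta_kernel[OF _ q(1)])
  show "supp x" using supp_U p(1) unfolding p' by blast
  show "(pp, x, et) ~= (0, 0, 0)" using p(2) by (auto simp: p0 zero_prod_def)
  fix s r :: real
  have "(s, 0) \<in> span {(t1, t2)}" using t_nonzero q(2) by (auto simp: span_singleton intro!: image_eqI[of _ _ "s / t1"])
  then show "dE s 0 ** nexp (r *\<^sub>R (pp, x, 0, et)) \<in> family (span {(t1, t2)}) U"
   using subspace_scale[OF subspace_U p(1), of r] unfolding family_def p0 by blast
 qed
qed

text \<open>The weights 0, t, t, 2 t split \<open>U\<close> into a phi-part, an xy-part and an
  eta-part. A phi-component would force a single root. Without it, one nonzero vector with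
  \<open>et = 0\<close> and dependent \<open>x\<close>, \<open>y\<close> would make all vectors of
  this kind, which is the exception.\<close>

lemma not_fills_alpha_kernel:
 assumes n: "\<not> fills (nexp ` U)" "\<not> single_root" "\<not> alpha_exception" "t1 = t2"
 shows "\<not> fills (family (span {(t1, t2)}) U)"
proof -
 note pairs = fills_pairs[OF n(1)]
 have t: "t1 ~= 0" using t_nonzero n(4) by simp
 have i: "(pp, 0, 0, 0) \<in> U" "(0, x, y, 0) \<in> U" "(0, 0, 0, et) \<in> U" if "(pp, x, y, et) \<in> U" for pp x y et
  using isolate[OF that, of 0] isolate[OF that, of t1] isolate[OF that, of "t1 + t1"] t n(4) by auto
 have ph: "pp = 0" if p: "(pp, x, y, et) \<in> U" for pp x y et
 proof (rule ccontr)
  assume ne: "pp ~= 0"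
  have "y' = 0 \<and> x' = 0 \<and> et' = 0" if q: "(pp', x', y', et') \<in> U" for pp' x' y' et'
  proof -
   have "y' = 0" by (rule pairs(3)[OF i(1)[OF p] ne i(2)[OF q]])
   then show ?thesis using pairs(1)[OF i(1)[OF p] ne, of x'] pairs(2)[OF i(1)[OF p] ne i(3)[OF q]] i(2)[OF q] by simp
  qed
  then show False using n(2) single_rootI(1) by blast
 qed
 have U0: "U ~= {0}"
 proof
  assume "U = {0}"
  then have "single_root" by (intro single_rootI(1)) (auto simp: zero_prod_def)
  then show False using n by simp
 qed
 have "\<not> fills (family (span {(1, 1)}) U)"
 proof (rule not_fills_nonparallel[OF subspace_U U_ncar])
  show "nad l l p \<in> U" if "p \<in> U" for l p using nad_U[OF that, of "l / t1"] t n(4) by simp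
  fix x y et assume p: "(0, x, y, et) \<in> U" and ne: "(x, y, et) ~= (0, 0, 0)"
  show "et ~= 0 \<or> gram x y ~= 0"
  proof (rule ccontr)
   assume a: "\<not> ?thesis"
   then have xy: "x ~= 0 \<or> y ~= 0" "gram x y = 0" using ne by auto
   have "et' = 0 \<and> gram x' y' = 0" if q: "(pp', x', y', et') \<in> U" for pp' x' y' et'
    using n(1) fills_parallel_independent[OF subspace_U U_ncar i(2)[OF p] xy i(2)[OF q]] pairs(4)[OF i(3)[OF q] _ i(2)[OF p] xy(2)] xy(1) by blast
   then have alpha_exception unfolding alpha_exception_def using n(4) U0 ph by (fastforce simp: zero_prod_def)
   then show False using n by simp
  qed
 qed (use ph in auto)
 then show ?thesis using family_scale[OF t, of 1 1] n(4) by simp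
qed

text \<open>Only y is separated, having weight 0. A y-component would force a single root, so
  \<open>y = 0\<close> throughout; since some vector is not isotropic, a nonzero isotropic one would
  make the unipotent part fill.\<close>

lemma not_fills_beta_kernel:
 assumes n: "\<not> fills (nexp ` U)" "\<not> single_root" "\<not> beta_exception" "t2 = 0"
 shows "\<not> fills (family (span {(t1, t2)}) U)"
proof -
 note pairs = fills_pairs[OF n(1)]
 have t: "t1 ~= 0" using t_nonzero n(4) by simp
 have i: "(pp, x, 0, et) \<in> U" "(0, 0, y, 0) \<in> U" if "(pp, x, y, et) \<in> U" for pp x y et
  using isolate[OF that, of t1] isolate[OF that, of 0] t n(4) by auto
 have y0: "y = 0" if p: "(pp, x, y, et) \<in> U" for pp x y et
 proof (rule ccontr)
  assume ne: "y ~= 0"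
  note y = i(2)[OF p]
  have "pp' = 0 \<and> x' = 0 \<and> et' = 0" if q: "(pp', x', y', et') \<in> U" for pp' x' y' et'
  proof -
   have e: "e = 0" if "(0, 0, 0, e) \<in> U" for e using pairs(4)[OF that _ y] ne by (auto simp: gram_def)
   \<comment> \<open>Bracketing twice with \<open>y\<close> carries the phi-component to the
     eta-axis, which a nonzero \<open>y\<close> excludes.\<close>
   have "(0, 0, 0, - (pp' * (y \<bullet> y))) \<in> U" using nbr_U[OF nbr_U[OF i(1)[OF q] y] y] by simp
   then have ph: "pp' = 0" using e ne by fastforce
   then have x: "x' = 0" using pairs(5)[of x' et' y 0] i(1)[OF q] y ne by simp
   then show ?thesis using e[of et'] i(1)[OF q] ph by simp
  qed
  then show False using n(2) single_rootI(2) by blast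
 qed
 have U0: "U ~= {0}"
 proof
  assume "U = {0}"
  then have "single_root" by (intro single_rootI(1)) (auto simp: zero_prod_def)
  then show False using n by simp
 qed
 then obtain pp x et where v: "(pp, x, 0, et) \<in> U" "Qf pp x et ~= 0" using n(3,4) y0 unfolding beta_exception_def by fast
 have "\<not> fills (family (span {(1, 0)}) U)"
  by (rule not_fills_anisotropic[OF subspace_U U_ncar]) (use y0 n(1) fills_isotropic[OF subspace_U U_ncar v] in blast)+
 then show ?thesis using family_scale[OF t, of 1 0] n(4) by simp
qed

lemma not_fills_gamma_kernel:
 assumes n: "\<not> fills (nexp ` U)" "\<not> single_root" "t1 = 0"
 shows "\<not> fills (family (span {(t1, t2)}) U)"
proof -
 note pairs = fills_pairs[OF n(1)]
 have t: "t2 ~= 0" using t_nonzero n(3) by simp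
 have i: "(pp, 0, 0, 0) \<in> U" "(0, x, 0, 0) \<in> U" "(0, 0, y, et) \<in> U" if "(pp, x, y, et) \<in> U" for pp x y et
  using isolate[OF that, of "- t2"] isolate[OF that, of 0] isolate[OF that, of t2] t n(3) by auto
 have ph: "pp = 0" if p: "(pp, x, y, et) \<in> U" for pp x y et
 proof (rule ccontr)
  assume ne: "pp ~= 0"
  have "y' = 0 \<and> x' = 0 \<and> et' = 0" if q: "(pp', x', y', et') \<in> U" for pp' x' y' et'
  proof -
   have "y' = 0" by (rule pairs(3)[OF i(1)[OF p] ne i(3)[OF q]])
   then show ?thesis using pairs(1)[OF i(1)[OF p] ne i(2)[OF q]] pairs(2)[OF i(1)[OF p] ne, of et'] i(3)[OF q] by simp
  qed
  then show False using n(2) single_rootI(1) by blast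
 qed
 have g: "gram 0 y = 0" "gram y 0 = 0" for y by (simp_all add: gram_def)
 have x0: "x = 0" if p: "(pp, x, y, et) \<in> U" for pp x y et
 proof (rule ccontr)
  assume ne: "x ~= 0"
  have "pp' = 0 \<and> y' = 0 \<and> et' = 0" if q: "(pp', x', y', et') \<in> U" for pp' x' y' et'
  proof -
   have "y' = 0" using pairs(5)[OF i(2)[OF p] i(3)[OF q]] ne by simp
   then show ?thesis using pairs(4)[of et', OF _ _ i(2)[OF p] g(2)] i(3)[OF q] ph[OF q] ne by auto
  qed
  then show False using n(2) single_rootI(3) by blast
 qed
 have e: "et = 0" if p: "(pp, x, 0, et) \<in> U" for pp x et
 proof (rule ccontr)
  assume ne: "et ~= 0"
  have "pp' = 0 \<and> x' = 0 \<and> y' = 0" if q: "(pp', x', y', et') \<in> U" for pp' x' y' et'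
   using pairs(4)[OF i(3)[OF p] ne i(3)[OF q] g(1)] ph[OF q] x0[OF q] by simp
  then show False using n(2) single_rootI(4) by blast
 qed
 have "\<not> fills (family (span {(0, 1)}) U)"
 proof (rule not_fills_y[OF _ subspace_U])
  show "pp = 0 \<and> x = 0 \<and> supp y" if "(pp, x, y, et) \<in> U" for pp x y et using that ph x0 supp_U(2) by blast
  show "et = 0" if "(pp, x, y, et) \<in> U" "y = 0 \<or> (0::real) ~= 0" for pp x y et using that e by blast
 qed simp
 then show ?thesis using family_scale[OF t, of 0 1] n(3) by simp
qed

text \<open>Here phi and y share a weight. Unless \<open>U\<close> lies in a single root space it
  contains a vector with both coordinates nonzero but meets neither axis; an x- or eta-component
  would then make the unipotent part fill, so \<open>U\<close> is the line of that vector.\<close>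

lemma not_fills_principal_torus:
 assumes n: "\<not> fills (nexp ` U)" "\<not> single_root" "t1 = 2 * t2"
 shows "\<not> fills (family (span {(t1, t2)}) U)"
proof -
 note pairs = fills_pairs[OF n(1)]
 have t: "t2 ~= 0" using t_nonzero n(3) by simp
 have i: "(pp, 0, y, 0) \<in> U" "(0, x, 0, 0) \<in> U" "(0, 0, 0, et) \<in> U" if "(pp, x, y, et) \<in> U" for pp x y et
  using isolate[OF that, of "t2"] isolate[OF that, of t1] isolate[OF that, of "t1 + t2"] t n(3) by auto
 have ph: "pp = 0" if p: "(pp, 0, 0, 0) \<in> U" for pp
 proof (rule ccontr)
  assume ne: "pp ~= 0"
  have "y = 0" if "(pp', 0, y, 0) \<in> U" for pp' y
   using pairs(3)[OF p ne, of 0 y 0] subspace_diff[OF subspace_U that subspace_scale[OF subspace_U p, of "pp' / pp"]] ne by simp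
  then have "x = 0 \<and> y = 0 \<and> et = 0" if "(pp', x, y, et) \<in> U" for pp' x y et
   using i[OF that] pairs(1,2)[OF p ne] by metis
  then have "single_root" by (rule single_rootI(1))
  then show False using n by simp
 qed
 have y0: "y = 0" if p: "(0, 0, y, 0) \<in> U" for y
 proof (rule ccontr)
  assume ne: "y ~= 0"
  have e: "e = 0" if "(0, 0, 0, e) \<in> U" for e using pairs(4)[OF that _ p] ne by (auto simp: gram_def)
  have x: "x = 0" if "(0, x, 0, 0) \<in> U" for x using pairs(5)[OF that p] ne by simp
  have "pp = 0" if "(pp, 0, y', 0) \<in> U" for pp y' using x[of "pp *\<^sub>R y"] nbr_U[OF that p] ne by simp
  then have "pp = 0 \<and> x = 0 \<and> et = 0" if "(pp, x, y', et) \<in> U" for pp x y' et using e x i[OF that] by metis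
  then have "single_root" by (rule single_rootI(2))
  then show False using n by simp
 qed
 have "\<exists>pp y. (pp, 0, y, 0) \<in> U \<and> pp ~= 0 \<and> y ~= 0"
 proof (rule ccontr)
  assume a: "\<not> ?thesis"
  have "pp = 0 \<and> y = 0" if "(pp, 0, y, 0) \<in> U" for pp y
   using that ph[of pp] y0[of y] a by (cases "pp = 0"; cases "y = 0") auto
  then have "(pp, 0, 0, 0) \<in> U \<and> (0, x, 0, 0) \<in> U \<and> (0, 0, y, 0) \<in> U \<and> (0, 0, 0, et) \<in> U" if "(pp, x, y, et) \<in> U" for pp x y et
   using i[OF that] by metis
  from single_root_if_isolated[OF n(1) this] n(2) show False by blast
 qed
 then obtain pp y where w: "(pp, 0, y, 0) \<in> U" "pp ~= 0" "y ~= 0" by blast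
 have e: "e = 0" if "(0, 0, 0, e) \<in> U" for e using fills_principal_eta[OF subspace_U U_ncar w that] n(1) by blast
 have x: "x = 0" if p: "(0, x, 0, 0) \<in> U" for x
  using fills_principal_x[OF subspace_U U_ncar w p] n(1) e[of "x \<bullet> y"] nbr_U[OF w(1) p] by auto
 have "U = span {(pp, 0, y, 0)}"
 proof
  show "span {(pp, 0, y, 0)} \<subseteq> U" using w(1) subspace_U by (intro span_minimal) auto
  show "U \<subseteq> span {(pp, 0, y, 0)}"
  proof
   fix p assume p: "p \<in> U"
   obtain pp' x' y' et' where p': "p = (pp', x', y', et')" by (cases p) blast
   note q = i[OF p[unfolded p']]
   have "x' = 0" "et' = 0" using x e q by blast+
   moreover have "y' - (pp' / pp) *\<^sub>R y = 0"
    by (rule y0) (use subspace_diff[OF subspace_U q(1) subspace_scale[OF subspace_U w(1), of "pp' / pp"]] w(2) in simp)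
   ultimately have "p = (pp' / pp) *\<^sub>R (pp, 0, y, 0)" using w(2) by (simp add: p')
   then show "p \<in> span {(pp, 0, y, 0)}" by (simp only: span_scale span_base singletonI)
  qed
 qed
 moreover have "\<not> fills (family (span {(2, 1)}) (span {(pp, 0, y, 0)}))"
  using w supp_U(2) by (intro not_fills_principal) auto
 ultimately show ?thesis using family_scale[OF t, of 2 1] n(3) by (simp add: mult.commute)
qed

theorem fills_family_iff:
 "fills (family (span {(t1, t2)}) U) \<longleftrightarrow>
   fills (nexp ` U) \<or> alpha_exception \<or> beta_exception \<or>
   (U ~= {0} \<and> (\<exists>(a, b) \<in> root_vectors. U \<subseteq> root_coords (a, b) \<and> \<bar>a * t1 + b * t2\<bar> <= \<bar>b * t1 - a * t2\<bar>))"
  (is "?F \<longleftrightarrow> ?U \<or> _ \<or> _ \<or> ?R")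
proof
 assume "?U \<or> alpha_exception \<or> beta_exception \<or> ?R"
 then show ?F
 proof (elim disjE)
  have "nexp ` U \<subseteq> family (span {(t1, t2)}) U"
  proof
   fix g assume "g \<in> nexp ` U"
   then obtain p where "g = dE 0 0 ** nexp p" "p \<in> U" by auto
   moreover have "(0, 0) \<in> span {(t1, t2)}" using span_zero[of "{(t1, t2)}"] by (simp add: zero_prod_def)
   ultimately show "g \<in> family (span {(t1, t2)}) U" unfolding family_def by blast
  qed
  then show "?U ==> ?F" by (rule fills_mono[rotated])
 qed (use alpha_exception_fills beta_exception_fills single_root_fills in blast)+
next
 assume F: ?F
 show "?U \<or> alpha_exception \<or> beta_exception \<or> ?R"
 proof (rule ccontr)
  assume a: "\<not> ?thesis"
  have s: "\<not> single_root"
  proof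
   assume single_root
   then obtain c d where v: "(c, d) \<in> root_vectors" "U \<subseteq> root_coords (c, d)" unfolding single_root_def by (metis surj_pair)
   then show False using a F single_root_not_fills[OF v(2,1)] trivial_not_fills by blast
  qed
  have "\<not> (t1 = t2)" "\<not> (t2 = 0)" "\<not> (t1 = 0)" "\<not> (t1 = 2 * t2)"
   using F a s not_fills_alpha_kernel not_fills_beta_kernel not_fills_gamma_kernel not_fills_principal_torus by blast+
  note t = this
  \<comment> \<open>Off the four exceptional lines the weights of phi, x, y and eta are pairwise
    distinct, so each component can be isolated.\<close>
  have "(pp, 0, 0, 0) \<in> U \<and> (0, x, 0, 0) \<in> U \<and> (0, 0, y, 0) \<in> U \<and> (0, 0, 0, et) \<in> U" if "(pp, x, y, et) \<in> U" for pp x y et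
   using isolate[OF that, of "t1 - t2"] isolate[OF that, of t1] isolate[OF that, of t2] isolate[OF that, of "t1 + t2"] t
   by (auto simp: algebra_simps split: if_splits)
  from single_root_if_isolated[OF _ this] a s show False by blast
 qed
qed

end

section \<open>Lie algebras of A and N, root spaces and coroots\<close>

context levels
begin

lemma lie_entry_const: "(\<And>t. mexp (t *\<^sub>R X) $ i $ j = c) ==> X $ i $ j = 0" for X :: "'m sqmat"
proof -
 assume c: "\<And>t. mexp (t *\<^sub>R X) $ i $ j = c"
 have "((\<lambda>t. mexp (t *\<^sub>R X) $ i $ j) has_real_derivative X $ i $ j) (at 0)"
  using mderiv_mexp[of X 0] by (simp add: mderiv_def)
 moreover have "((\<lambda>t. mexp (t *\<^sub>R X) $ i $ j) has_real_derivative 0) (at 0)" unfolding c by simp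
 ultimately show ?thesis by (rule DERIV_unique)
qed

lemma lie_mono: "H \<subseteq> K ==> lie H \<subseteq> lie K" for H :: "'m sqmat set"
 by (auto simp: lie_def)

lemma soJ_D:
 assumes "X \<in> soJ"
 shows "X $ f2 $ f1 = - X $ e1 $ e2" "X $ e2 $ f1 = - X $ e1 $ f2" "X $ e1 $ f1 = 0" "X $ e2 $ f2 = 0"
  "X $ f2 $ f2 = - X $ e2 $ e2" "X $ f1 $ f1 = - X $ e1 $ e1"
  "m \<in> mid ==> X $ m $ f1 = - X $ e1 $ m" "m \<in> mid ==> X $ m $ f2 = - X $ e2 $ m" "m \<in> mid ==> X $ m $ m = 0"
proof -
 have *: "X $ i $ j = - X $ opp j $ opp i" for i j using assms[unfolded soJ_entry] opp_opp by metis
 show "X $ f2 $ f1 = - X $ e1 $ e2" "X $ e2 $ f1 = - X $ e1 $ f2" "X $ e1 $ f1 = 0" "X $ e2 $ f2 = 0"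
  "X $ f2 $ f2 = - X $ e2 $ e2" "X $ f1 $ f1 = - X $ e1 $ e1"
  using *[of f2 f1] *[of e2 f1] *[of e1 f1] *[of e2 f2] *[of f2 f2] *[of f1 f1] unfolding opp_simps by linarith+
 assume "m \<in> mid"
 then have m: "opp m = m" by simp
 show "X $ m $ f1 = - X $ e1 $ m" "X $ m $ f2 = - X $ e2 $ m" "X $ m $ m = 0"
  using *[of m f1] *[of m f2] *[of m m] unfolding m opp_simps(1-4) by linarith+
qed

lemma Agrp_SOJ: "Agrp \<subseteq> SOJ" and Ngrp_SOJ: "Ngrp \<subseteq> SOJ"
 using dE_SOJ nexp_SOJ by (auto simp: Agrp_def Ngrp_def)

lemma dE_Agrp [simp]: "dE s t \<in> Agrp" unfolding Agrp_def by (intro image_eqI[of _ _ "(s, t)"]) auto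

lemma lie_Agrp: "lie Agrp = range (\<lambda>p. dmat (fst p) (snd p))"
proof
 show "range (\<lambda>p. dmat (fst p) (snd p)) \<subseteq> lie Agrp"
  by (auto simp: lie_def dmat_linear(2)[symmetric] mexp_dmat)
 show "lie Agrp \<subseteq> range (\<lambda>p. dmat (fst p) (snd p))"
 proof
  fix X assume X: "X \<in> lie Agrp"
  then have s: "X \<in> soJ" using lie_mono[OF Agrp_SOJ] lie_SOJ by blast
  have off: "X $ i $ j = 0" if "i ~= j" for i j
  proof (rule lie_entry_const)
   fix t show "mexp (t *\<^sub>R X) $ i $ j = 0" using X that by (auto simp: lie_def Agrp_def dE_entry dest!: spec[of _ t])
  qed
  have "X $ i $ j = dmat (X $ e1 $ e1) (X $ e2 $ e2) $ i $ j" for i j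
   by (cases "i = j"; cases rule: level5[of i]; cases rule: level5[of j]) (simp_all add: dmat_def off soJ_D[OF s])
  then have "X = dmat (X $ e1 $ e1) (X $ e2 $ e2)" unfolding vec_eq_iff by blast
  then have "X = dmat (fst (X $ e1 $ e1, X $ e2 $ e2)) (snd (X $ e1 $ e1, X $ e2 $ e2))" by (simp only: fst_conv snd_conv)
  then show "X \<in> range (\<lambda>p. dmat (fst p) (snd p))" by blast
 qed
qed

lemma eq_nmatI:
 assumes s: "X \<in> soJ" and z: "\<And>i j. j <= i ==> X $ i $ j = 0" "\<And>i j. i \<in> mid ==> j \<in> mid ==> X $ i $ j = 0"
 shows "X = nmat (X $ e1 $ e2, \<chi> k. if k \<in> mid then X $ e1 $ k else 0, \<chi> k. if k \<in> mid then X $ e2 $ k else 0, X $ e1 $ f2)" (is "?X")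
  and "(X $ e1 $ e2, \<chi> k. if k \<in> mid then X $ e1 $ k else 0, \<chi> k. if k \<in> mid then X $ e2 $ k else 0, X $ e1 $ f2) \<in> ncar" (is "?p \<in> _")
proof -
 have z': "j < i ==> X $ i $ j = 0" "X $ i $ i = 0" for i j using z(1) by auto
 have "X $ i $ j = nmat ?p $ i $ j" for i j
  by (cases rule: level5[of i]; cases rule: level5[of j]) (simp_all add: nmat_def soJ_D[OF s] z' z(2))
 then show ?X unfolding vec_eq_iff by blast
 show "?p \<in> ncar" by (simp add: supp_def)
qed

lemma lie_Ngrp: "lie Ngrp = nmat ` ncar"
proof
 show "nmat ` ncar \<subseteq> lie Ngrp"
  using subspace_scale[OF subspace_ncar] by (auto simp: lie_def Ngrp_def nmat_scale[symmetric] mexp_nmat)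
 show "lie Ngrp \<subseteq> nmat ` ncar"
 proof
  fix X assume X: "X \<in> lie Ngrp"
  then have s: "X \<in> soJ" using lie_mono[OF Ngrp_SOJ] lie_SOJ by blast
  have N: "\<exists>p. mexp (t *\<^sub>R X) = nexp p" for t using X unfolding lie_def Ngrp_def by blast
  have "X $ i $ j = 0" if "j <= i" for i j
  proof (rule lie_entry_const)
   show "mexp (t *\<^sub>R X) $ i $ j = (if i = j then 1 else 0)" for t
    using N[of t] that nexp_upper nexp_diag unfolding upper_def by (auto simp: order.order_iff_strict)
  qed
  moreover have "X $ i $ j = 0" if "i \<in> mid" "j \<in> mid" for i j
  proof (rule lie_entry_const)
   show "mexp (t *\<^sub>R X) $ i $ j = (if j = i then 1 else 0)" for t using N[of t] that by (auto simp: nexp_def)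
  qed
  ultimately show "X \<in> nmat ` ncar" using eq_nmatI[OF s] by blast
 qed
qed

lemma wt_linear: "wt s t i = s * wt 1 0 i + t * wt 0 1 i"
 by (cases rule: level5[of i]) simp_all

lemma wt_opp: "wt s t (opp i) = - wt s t i"
 by (cases rule: level5[of i]) simp_all

text \<open>A root space is recognized by the support of its matrices. Unlike
  \<open>root_coords\<close> this also covers the negative roots.\<close>

definition weight_space :: "real \<times> real => 'm sqmat set" where
 "weight_space v = {X \<in> soJ. \<forall>i j. X $ i $ j ~= 0 \<longrightarrow> wt 1 0 i - wt 1 0 j = fst v \<and> wt 0 1 i - wt 0 1 j = snd v}"

lemma weight_space_wt: "X \<in> weight_space v ==> X $ i $ j ~= 0 ==> wt s t i - wt s t j = s * fst v + t * snd v"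
 unfolding wt_linear[of s t] weight_space_def by (auto simp: algebra_simps)

lemma root_coords_ncar: "root_coords v \<subseteq> ncar"
 unfolding root_coords_def ncar_def by blast

lemma nmat_weight_space: assumes v: "v \<in> root_vectors" shows "weight_space v = nmat ` root_coords v"
proof
 have vs: "v = (1, -1) \<or> v = (0, 1) \<or> v = (1, 0) \<or> v = (1, 1)" using v by (simp add: root_vectors_def)
 show "nmat ` root_coords v \<subseteq> weight_space v"
 proof
  fix X assume "X \<in> nmat ` root_coords v"
  then obtain pp x y et where p: "(pp, x, y, et) \<in> root_coords v" and X: "X = nmat (pp, x, y, et)" by auto
  have "(pp, x, y, et) \<in> ncar" using p root_coords_ncar by blast
  then have "nmat (pp, x, y, et) \<in> lie Ngrp" unfolding lie_Ngrp by blast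
  then have "X \<in> soJ" using lie_mono[OF Ngrp_SOJ] unfolding lie_SOJ X by blast
  moreover have "wt 1 0 i - wt 1 0 j = fst v \<and> wt 0 1 i - wt 0 1 j = snd v" if "X $ i $ j ~= 0" for i j
   using vs that p unfolding X by (elim disjE; cases rule: level5[of i]; cases rule: level5[of j]) (simp_all add: nmat_def split: if_splits)
  ultimately show "X \<in> weight_space v" by (auto simp: weight_space_def)
 qed
 show "weight_space v \<subseteq> nmat ` root_coords v"
 proof
  fix X assume X: "X \<in> weight_space v"
  then have s: "X \<in> soJ" and w: "\<And>i j. \<not> (wt 1 0 i - wt 1 0 j = fst v \<and> wt 0 1 i - wt 0 1 j = snd v) ==> X $ i $ j = 0"
   by (auto simp: weight_space_def)
  have z: "X $ i $ j = 0" if "j <= i" for i j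
   using vs that unfolding not_less[symmetric] by (intro w) (cases rule: level5[of i]; cases rule: level5[of j]; auto)
  have z2: "X $ i $ j = 0" if "i \<in> mid" "j \<in> mid" for i j using vs that by (intro w) auto
  let ?p = "(X $ e1 $ e2, \<chi> k. if k \<in> mid then X $ e1 $ k else 0, \<chi> k. if k \<in> mid then X $ e2 $ k else 0, X $ e1 $ f2)"
  have "X $ e1 $ e2 = 0" if "v ~= (1, -1)" using vs that by (intro w) auto
  moreover have "X $ e2 $ k = 0" if "v ~= (0, 1)" "k \<in> mid" for k using vs that by (intro w) auto
  moreover have "X $ e1 $ k = 0" if "v ~= (1, 0)" "k \<in> mid" for k using vs that by (intro w) auto
  moreover have "X $ e1 $ f2 = 0" if "v ~= (1, 1)" using vs that by (intro w) auto
  ultimately have "?p \<in> root_coords v" by (auto simp: root_coords_def supp_def vec_eq_iff)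
  then show "X \<in> nmat ` root_coords v" using eq_nmatI(1)[OF s z z2] by blast
 qed
qed

lemma soJ_transpose: "X \<in> soJ ==> transpose X \<in> soJ"
 unfolding soJ_entry by (simp add: transpose_def) (metis opp_opp)

lemma dmat_soJ: "dmat s t \<in> soJ"
 by (auto simp: soJ_entry dmat_def wt_opp opp_eq_iff)

lemma transpose_weight_space: "X \<in> weight_space v ==> transpose X \<in> weight_space (- v)"
proof -
 assume X: "X \<in> weight_space v"
 have "wt 1 0 i - wt 1 0 j = fst (- v) \<and> wt 0 1 i - wt 0 1 j = snd (- v)" if "transpose X $ i $ j ~= 0" for i j
  using weight_space_wt[OF X, of j i 1 0] weight_space_wt[OF X, of j i 0 1] that by (simp add: transpose_def)
 moreover have "transpose X \<in> soJ" using X soJ_transpose by (simp add: weight_space_def)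
 ultimately show ?thesis unfolding weight_space_def by blast
qed

definition sdot :: "real \<times> real => 'm sqmat => real" where
 "sdot v X = fst v * X $ e1 $ e1 + snd v * X $ e2 $ e2"

lemma sdot_dmat [simp]: "sdot v (dmat s t) = fst v * s + snd v * t"
 by (simp add: sdot_def dmat_def)

text \<open>Transposition exchanges opposite root spaces, and a suitably normalized root vector and
  its transpose bracket to the torus element with the coordinates of the root. For x and y a unit
  vector in one middle coordinate is taken.\<close>

lemma bracket_transpose:
 assumes v: "v \<in> root_vectors"
 shows "\<exists>p \<in> root_coords v. bracket (nmat p) (transpose (nmat p)) = dmat (fst v) (snd v)"
proof -
 obtain m where m: "m \<in> mid" using ex_mid unfolding mid_def by blast
 define a :: "'m vc" where "a = axis m 1"
 have "a \<bullet> a = 1" unfolding a_def by (simp add: inner_axis_axis)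
 moreover have "supp a" using m by (auto simp: supp_def axis_def a_def)
 ultimately have a: "supp a" "a \<bullet> a = 1" by simp_all
 have sm: "(\<Sum>k\<in>mid. a $ k * a $ k) = 1" using sum_mid_inner[OF a(1)] a(2) by simp
 have 1: "bracket (nmat (1, 0, 0, 0)) (transpose (nmat (1, 0, 0, 0))) = dmat 1 (-1)" (is "?l = ?r")
 proof (unfold vec_eq_iff, intro allI)
  fix i j show "?l $ i $ j = ?r $ i $ j"
   by (cases rule: level5[of i]; cases rule: level5[of j]) (simp_all add: bracket_def mult_entry transpose_def nmat_def dmat_def)
 qed
 have 2: "bracket (nmat (0, 0, a, 0)) (transpose (nmat (0, 0, a, 0))) = dmat 0 1" (is "?l = ?r")
 proof (unfold vec_eq_iff, intro allI)
  fix i j show "?l $ i $ j = ?r $ i $ j"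
   by (cases rule: level5[of i]; cases rule: level5[of j]) (simp_all add: bracket_def mult_entry transpose_def nmat_def dmat_def sm)
 qed
 have 3: "bracket (nmat (0, a, 0, 0)) (transpose (nmat (0, a, 0, 0))) = dmat 1 0" (is "?l = ?r")
 proof (unfold vec_eq_iff, intro allI)
  fix i j show "?l $ i $ j = ?r $ i $ j"
   by (cases rule: level5[of i]; cases rule: level5[of j]) (simp_all add: bracket_def mult_entry transpose_def nmat_def dmat_def sm)
 qed
 have 4: "bracket (nmat (0, 0, 0, 1)) (transpose (nmat (0, 0, 0, 1))) = dmat 1 1" (is "?l = ?r")
 proof (unfold vec_eq_iff, intro allI)
  fix i j show "?l $ i $ j = ?r $ i $ j"
   by (cases rule: level5[of i]; cases rule: level5[of j]) (simp_all add: bracket_def mult_entry transpose_def nmat_def dmat_def)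
 qed
 have "v = (1, -1) \<or> v = (0, 1) \<or> v = (1, 0) \<or> v = (1, 1)" using v by (simp add: root_vectors_def)
 then show ?thesis
  using a 1 2 3 4 bexI[of _ "(1, 0, 0, 0)"] bexI[of _ "(0, 0, a, 0)"] bexI[of _ "(0, a, 0, 0)"] bexI[of _ "(0, 0, 0, 1)"]
  by (elim disjE) auto
qed

text \<open>The brackets are orthogonal, for the trace form, to the kernel of the root \<open>v\<close>.\<close>

lemma coroot_span:
 assumes v: "v \<in> root_vectors"
 shows "span {bracket X Y |X Y. X \<in> weight_space v \<and> Y \<in> weight_space (- v)} \<inter> range (\<lambda>p. dmat (fst p) (snd p))
  = range (\<lambda>r. dmat (r * fst v) (r * snd v))" (is "span ?B \<inter> ?L = ?R")
proof
 let ?tr = "\<lambda>Z. \<Sum>i\<in>UNIV. wt (snd v) (- fst v) i * Z $ i $ i"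
 have b: "?tr Z = 0" if Z: "Z \<in> ?B" for Z
 proof -
  obtain X Y where XY: "X \<in> weight_space v" and Z: "Z = bracket X Y" using Z by blast
  have c: "wt (snd v) (- fst v) i * X $ i $ j = wt (snd v) (- fst v) j * X $ i $ j" for i j
   using weight_space_wt[OF XY, of i j "snd v" "- fst v"] by (cases "X $ i $ j = 0") auto
  have "?tr Z = (\<Sum>i\<in>UNIV. \<Sum>j\<in>UNIV. wt (snd v) (- fst v) i * X $ i $ j * Y $ j $ i)
    - (\<Sum>i\<in>UNIV. \<Sum>j\<in>UNIV. wt (snd v) (- fst v) i * Y $ i $ j * X $ j $ i)"
   by (simp add: Z bracket_def matrix_matrix_mult_def sum_distrib_left sum_subtractf right_diff_distrib mult_ac)
  also have "(\<Sum>i\<in>UNIV. \<Sum>j\<in>UNIV. wt (snd v) (- fst v) i * Y $ i $ j * X $ j $ i)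
    = (\<Sum>i\<in>UNIV. \<Sum>j\<in>UNIV. wt (snd v) (- fst v) i * X $ i $ j * Y $ j $ i)"
  proof (subst sum.swap, intro sum.cong refl)
   fix i j
   have "wt (snd v) (- fst v) j * Y $ j $ i * X $ i $ j = (wt (snd v) (- fst v) j * X $ i $ j) * Y $ j $ i" by (simp only: mult_ac)
   then show "wt (snd v) (- fst v) j * Y $ j $ i * X $ i $ j = wt (snd v) (- fst v) i * X $ i $ j * Y $ j $ i" unfolding c[of i j, symmetric] .
  qed
  finally show ?thesis by simp
 qed
 have tr: "?tr Z = 0" if "Z \<in> span ?B" for Z
  using that
 proof (induction rule: span_induct_alt)
  case (step c x y)
  then show ?case using b[of x] by (simp add: distrib_left sum.distrib mult.left_commute[of _ c] sum_distrib_left[symmetric])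
 qed simp
 show "span ?B \<inter> ?L \<subseteq> ?R"
 proof
  fix Z assume Z: "Z \<in> span ?B \<inter> ?L"
  then obtain s t where st: "Z = dmat s t" by auto
  have "0 = ?tr Z" using tr Z by simp
  also have "\<dots> = 2 * (snd v * s - fst v * t)" by (simp add: st sum_levels dmat_def algebra_simps)
  finally have "snd v * s = fst v * t" by simp
  then have "\<exists>r. s = r * fst v \<and> t = r * snd v" using v by (auto simp: root_vectors_def)
  then show "Z \<in> ?R" by (auto simp: st)
 qed
 obtain p where p: "p \<in> root_coords v" "bracket (nmat p) (transpose (nmat p)) = dmat (fst v) (snd v)"
  using bracket_transpose[OF v] by blast
 have X: "nmat p \<in> weight_space v" using p(1) nmat_weight_space[OF v] by blast
 have "bracket (nmat p) (transpose (nmat p)) \<in> ?B" using X transpose_weight_space[OF X] by blast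
 then have "r *\<^sub>R dmat (fst v) (snd v) \<in> span ?B" for r unfolding p(2) by (intro span_scale span_base)
 then have "dmat (r * fst v) (r * snd v) \<in> span ?B" for r by (simp only: dmat_linear)
 moreover have "dmat s t \<in> ?L" for s t by (intro image_eqI[of _ _ "(s, t)"]) auto
 ultimately show "?R \<subseteq> span ?B \<inter> ?L" by auto
qed

end

text \<open>For any linear projection \<open>P\<close> onto \<open>V\<close>, the trace of
  \<open>f\<close> on \<open>V\<close> is the trace of \<open>f \<circ> P\<close> on the whole
  space. This removes the arbitrary basis from \<open>trace_on\<close>.\<close>

lemma trace_on_projection:
 fixes V :: "'v::euclidean_space set"
 assumes V: "subspace V" and f: "linear f" "\<And>v. v \<in> V ==> f v \<in> V" and P: "linear P" "\<And>z. P z \<in> V" "\<And>v. v \<in> V ==> P v = v"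
 shows "trace_on V f = (\<Sum>e\<in>Basis. f (P e) \<bullet> e)"
proof -
 define B where "B = (SOME B. independent B \<and> span B = V)"
 have "\<exists>B. independent B \<and> span B = V"
  using basis_exists[of V] V by (metis span_eq_iff span_subspace subset_antisym)
 then have "independent B \<and> span B = V" unfolding B_def by (rule someI_ex)
 then have B: "independent B" "span B = V" by auto
 have fin: "finite B" using B(1) by (rule independent_imp_finite)
 have BV: "b \<in> V" if "b \<in> B" for b using that B(2) span_base by blast
 have ex: "f (P e) \<bullet> e = (\<Sum>b\<in>B. representation B (P e) b * (f b \<bullet> e))" for e
 proof -
  have "P e = (\<Sum>b\<in>B. representation B (P e) b *\<^sub>R b)"
   using sum_representation_eq[OF B(1) _ fin subset_refl] P(2) B(2) by metis
  from arg_cong[OF this, of f] have "f (P e) = (\<Sum>b\<in>B. representation B (P e) b *\<^sub>R f b)"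
   unfolding linear_sum[OF f(1)] linear_scale[OF f(1)] .
  then show ?thesis by (simp add: inner_sum_left)
 qed
 have "representation B (f b) b = (\<Sum>e\<in>Basis. (f b \<bullet> e) * representation B (P e) b)" if b: "b \<in> B" for b
 proof -
  have "f b = P (\<Sum>e\<in>Basis. (f b \<bullet> e) *\<^sub>R e)" using P(3) f(2) BV[OF b] by (simp add: euclidean_representation)
  also have "\<dots> = (\<Sum>e\<in>Basis. (f b \<bullet> e) *\<^sub>R P e)" by (simp add: linear_sum[OF P(1)] linear_scale[OF P(1)])
  finally have "representation B (f b) b = representation B (\<Sum>e\<in>Basis. (f b \<bullet> e) *\<^sub>R P e) b" by simp
  also have "\<dots> = (\<Sum>e\<in>Basis. representation B ((f b \<bullet> e) *\<^sub>R P e) b)"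
   by (subst representation_sum[OF B(1)]) (use P(2) B(2) subspace_scale[OF V] in auto)
  also have "\<dots> = (\<Sum>e\<in>Basis. (f b \<bullet> e) * representation B (P e) b)"
   by (intro sum.cong refl) (use P(2) B in \<open>simp add: representation_scale\<close>)
  finally show ?thesis .
 qed
 then have "trace_on V f = (\<Sum>b\<in>B. \<Sum>e\<in>Basis. (f b \<bullet> e) * representation B (P e) b)"
  unfolding trace_on_def Let_def B_def[symmetric] by (rule sum.cong[OF refl])
 also have "\<dots> = (\<Sum>e\<in>Basis. f (P e) \<bullet> e)" by (subst sum.swap) (simp add: ex mult.commute)
 finally show ?thesis .
qed

lemma sum_Basis_matrix:
 "(\<Sum>e\<in>Basis. g e \<bullet> e) = (\<Sum>i\<in>UNIV. \<Sum>j\<in>UNIV. g (axis i (axis j 1)) $ i $ j)" for g :: "'m::finite sqmat => 'm sqmat"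
proof -
 have inj: "inj (\<lambda>(i, j). axis i (axis j 1) :: 'm sqmat)"
  by (auto simp: inj_def axis_eq_axis)
 have "(Basis :: 'm sqmat set) = (\<lambda>(i, j). axis i (axis j 1)) ` UNIV"
  by (auto simp: Basis_vec_def)
 then have "(\<Sum>e\<in>Basis. g e \<bullet> e) = (\<Sum>(i, j)\<in>UNIV. g (axis i (axis j 1)) \<bullet> axis i (axis j 1))"
  using sum.reindex[OF inj, of "\<lambda>e. g e \<bullet> e"] by (simp add: case_prod_beta)
 then show ?thesis by (simp add: UNIV_Times_UNIV[symmetric] sum.cartesian_product[symmetric] inner_axis del: UNIV_Times_UNIV)
qed

context levels
begin

text \<open>The double bracket acts diagonally on matrix units, and antisymmetrization under
  \<open>opp\<close> projects onto \<open>soJ\<close>. For n + 2 indices the factor is 2 n; only its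
  positivity is used later.\<close>

lemma killing_dmat: "killing soJ (dmat a b) (dmat c d) = (2 * real CARD('m) - 4) * (a * c + b * d)"
proof -
 let ?c = "\<lambda>i j. (wt a b i - wt a b j) * (wt c d i - wt c d j)"
 define f where "f Z = bracket (dmat a b) (bracket (dmat c d) Z)" for Z :: "'m sqmat"
 define P where "P Z = (\<chi> i j. (Z $ i $ j - Z $ opp j $ opp i) / 2)" for Z :: "'m sqmat"
 have fe: "f Z $ i $ j = ?c i j * Z $ i $ j" for Z i j
  by (simp add: f_def bracket_def dmat_mult mult_dmat algebra_simps)
 have "trace_on soJ f = (\<Sum>e\<in>Basis. f (P e) \<bullet> e)"
 proof (rule trace_on_projection[OF subspace_soJ])
  show "linear f" by (rule linearI) (simp_all add: vec_eq_iff fe algebra_simps)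
  show "linear P" by (rule linearI) (simp_all add: vec_eq_iff P_def field_simps)
  show "P Z \<in> soJ" for Z by (simp add: soJ_entry P_def field_simps)
  show "f Z \<in> soJ" if "Z \<in> soJ" for Z
  proof -
   have z: "Z $ opp i $ j = - Z $ opp j $ i" for i j using that unfolding soJ_entry by blast
   show ?thesis unfolding soJ_entry
   proof (intro allI)
    fix i j show "f Z $ opp i $ j = - f Z $ opp j $ i"
     unfolding fe wt_opp z[of i j] by (simp add: algebra_simps)
   qed
  qed
  show "P Z = Z" if "Z \<in> soJ" for Z
  proof -
   have "Z $ i $ j = - Z $ opp j $ opp i" for i j using that[unfolded soJ_entry] opp_opp by metis
   then have "(Z $ i $ j - Z $ opp j $ opp i) / 2 = Z $ i $ j" for i j by (metis diff_minus_eq_add field_sum_of_halves add_divide_distrib minus_minus)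
   then show ?thesis by (simp add: P_def vec_eq_iff)
  qed
 qed
 also have "\<dots> = (\<Sum>i\<in>UNIV. \<Sum>j\<in>UNIV. f (P (axis i (axis j 1))) $ i $ j)" by (rule sum_Basis_matrix)
 also have "\<dots> = (\<Sum>i\<in>UNIV. \<Sum>j\<in>UNIV. (?c i j - (if j = opp i then ?c i j else 0)) / 2)"
 proof (intro sum.cong refl)
  fix i j
  \<comment> \<open>A matrix unit keeps coefficient 1/2 under the projection, except that it is
    annihilated when \<open>j = opp i\<close>.\<close>
  have "opp j = i \<and> opp i = j \<longleftrightarrow> j = opp i" by (metis opp_opp)
  then have "P (axis i (axis j 1)) $ i $ j = (1 - (if j = opp i then 1 else 0)) / 2" by (auto simp: P_def axis_def)
  then show "f (P (axis i (axis j 1))) $ i $ j = (?c i j - (if j = opp i then ?c i j else 0)) / 2"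
   unfolding fe by (simp only:) (simp split: if_split)
 qed
 also have "\<dots> = ((\<Sum>i\<in>UNIV. \<Sum>j\<in>UNIV. ?c i j) - (\<Sum>i\<in>UNIV. ?c i (opp i))) / 2"
  by (simp add: sum_divide_distrib[symmetric] sum_subtractf)
 also have "(\<Sum>i\<in>UNIV. ?c i (opp i)) = 8 * (a * c + b * d)" by (simp add: wt_opp sum_levels)
 also have "(\<Sum>i\<in>UNIV. \<Sum>j\<in>UNIV. ?c i j) = 4 * real CARD('m) * (a * c + b * d)"
 proof -
  have s0: "(\<Sum>i\<in>UNIV. wt s t i) = 0" for s t by (simp add: sum_levels)
  have s2: "(\<Sum>i\<in>UNIV. wt a b i * wt c d i) = 2 * (a * c + b * d)" by (simp add: sum_levels)
  have "?c i j = wt a b i * wt c d i + wt a b j * wt c d j - wt a b i * wt c d j - wt a b j * wt c d i" for i j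
   by (simp add: algebra_simps)
  then show ?thesis
   by (simp add: sum_subtractf sum.distrib sum_distrib_left[symmetric] sum_distrib_right[symmetric] s0 s2)
 qed
 finally show ?thesis by (simp add: killing_def f_def[abs_def] algebra_simps)
qed

end

section \<open>The ordered index type with n + 2 elements\<close>

lemma ix_less: "1 <= i ==> i < j ==> j <= CARD('m) ==> (ix i :: 'm::{finite, linorder}) < ix j"
 unfolding ix_def by (rule sorted_wrt_nth_less[OF sorted_list_of_set.strict_sorted_key_list_of_set]) (auto simp: card_gt_0_iff)

lemma ix_cases: obtains k where "1 <= k" "k <= CARD('m)" "i = (ix k :: 'm::{finite, linorder})"
proof -
 have "i \<in> set (sorted_list_of_set UNIV)" by simp
 then obtain k where "k < CARD('m)" "sorted_list_of_set UNIV ! k = i" unfolding in_set_conv_nth by auto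
 then show thesis by (intro that[of "Suc k"]) (auto simp: ix_def)
qed

locale so2n = levels e1 e2 f2 f1 for e1 e2 f2 f1 :: "'m::{finite, linorder}" +
 fixes n :: nat
 assumes n: "n >= 3" and card_index: "CARD('m) = n + 2"
  and levels_ix: "e1 = ix 1" "e2 = ix 2" "f2 = ix (n + 1)" "f1 = ix (n + 2)"

lemma so2n_ix:
 assumes "n >= 3" "CARD('m::{finite, linorder}) = n + 2"
 shows "so2n (ix 1 :: 'm) (ix 2) (ix (n + 1)) (ix (n + 2)) n"
proof (unfold_locales; (rule assms refl)?)
 have l: "1 <= i ==> i < j ==> j <= n + 2 ==> (ix i :: 'm) < ix j" for i j
  using ix_less[where 'm = 'm] assms(2) by metis
 show "(ix 1 :: 'm) < ix 2" "(ix (n + 1) :: 'm) < ix (n + 2)" by (auto intro!: l)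
 show "\<exists>m. (ix 2 :: 'm) < m \<and> m < ix (n + 1)" by (rule exI[of _ "ix 3"]) (use assms in \<open>auto intro!: l\<close>)
 fix i :: 'm
 obtain k where k: "1 <= k" "k <= n + 2" "i = ix k" using ix_cases[of i] assms(2) by metis
 then consider "k = 1" | "k = 2" | "2 < k \<and> k < n + 1" | "k = n + 1" | "k = n + 2" by linarith
 then show "i = ix 1 \<or> i = ix 2 \<or> i = ix (n + 1) \<or> i = ix (n + 2) \<or> ix 2 < i \<and> i < ix (n + 1)"
  using k by cases (auto intro!: l)
qed

context so2n
begin

lemma ix_simps [simp]: "ix (Suc 0) = e1" "ix 1 = e1" "ix 2 = e2" "ix (n + 1) = f2" "ix (Suc n) = f2" "ix (n + 2) = f1" "ix (Suc (Suc n)) = f1"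
 using levels_ix by simp_all

lemma ix_less': "1 <= i ==> i < j ==> j <= n + 2 ==> (ix i :: 'm) < ix j"
 using ix_less[where 'm = 'm] card_index by metis

lemma mid_ix: "mid = ix ` {3..n}"
proof (intro equalityI subsetI)
 fix i assume i: "i \<in> mid"
 obtain k where k: "1 <= k" "k <= n + 2" "i = ix k" using ix_cases[of i] card_index by metis
 then consider "k = 1" | "k = 2" | "k \<in> {3..n}" | "k = n + 1" | "k = n + 2" by (auto, linarith)
 then show "i \<in> ix ` {3..n}" using i k by cases auto
next
 fix i :: 'm assume "i \<in> ix ` {3..n}"
 then obtain k where k: "i = ix k" "3 <= k" "k <= n" by auto
 have "(ix 2 :: 'm) < ix k" "(ix k :: 'm) < ix (n + 1)" by (rule ix_less'; use k in linarith)+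
 then have "e2 < i" "i < f2" unfolding k(1) by simp_all
 then show "i \<in> mid" unfolding mid_def by blast
qed

lemma qform_J: "qform n v = v \<bullet> (J *v v)" for v :: "'m vc"
proof -
 have "inj_on (ix :: nat => 'm) {3..n}"
 proof (rule linorder_inj_onI)
  show "(ix i :: 'm) ~= ix j" if "i < j" "i \<in> {3..n}" "j \<in> {3..n}" for i j using ix_less'[of i j] that by auto
 qed auto
 then have "(\<Sum>i\<in>mid. (v $ i)\<^sup>2) = (\<Sum>i = 3..n. (v $ ix i)\<^sup>2)" unfolding mid_ix by (simp add: sum.reindex)
 then show ?thesis by (simp add: qform_def inner_vec_def sum_levels J_vec power2_eq_square)
qed

text \<open>Polarization: the difference \<open>M\<close> of the two Gram matrices is symmetric, and
  a symmetric matrix whose quadratic form vanishes is 0.\<close>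

lemma SO2_eq: "SO2 n = SOJ"
proof -
 have "(\<forall>v. qform n (g *v v) = qform n v) \<longleftrightarrow> transpose g ** J ** g = J" for g :: "'m sqmat"
 proof -
  define M where "M = transpose g ** J ** g - J"
  have q: "qform n (g *v v) - qform n v = v \<bullet> (M *v v)" for v
  proof -
   have "(g *v v) \<bullet> (J *v (g *v v)) = v \<bullet> (transpose g *v (J *v (g *v v)))" by (metis dot_lmul_matrix vector_transpose_matrix)
   then show ?thesis by (simp only: qform_J M_def matrix_vector_mult_diff_rdistrib inner_diff_right matrix_vector_mul_assoc matrix_mul_assoc)
  qed
  have sM: "M $ i $ j = M $ j $ i" for i j
  proof -
   have "transpose (A - B) = transpose A - transpose B" for A B :: "'m sqmat" by (simp add: transpose_def vec_eq_iff)
   then have t: "transpose M = M" by (simp add: M_def matrix_transpose_mul matrix_mul_assoc)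
   show ?thesis using arg_cong[OF t, of "\<lambda>A. A $ j $ i"] by (simp add: transpose_def)
  qed
  have ax: "axis i 1 \<bullet> (M *v axis j 1) = M $ i $ j" for i j
   by (simp add: inner_axis' matrix_vector_mult_basis column_def)
  have "M = 0" if "\<forall>v. v \<bullet> (M *v v) = 0"
  proof -
   have 0: "M $ i $ i = 0" for i using that[rule_format, of "axis i 1"] ax by simp
   have "M $ i $ j = 0" for i j
    using that[rule_format, of "axis i 1 + axis j 1"] 0 sM[of i j]
    by (simp add: matrix_vector_right_distrib inner_add_left inner_add_right ax)
   then show ?thesis by (simp add: vec_eq_iff)
  qed
  then show ?thesis using q by (auto simp: M_def)
 qed
 then show ?thesis by (simp add: SO2_def SOJ_def)
qed

lemma grpA_eq: "grpA n = Agrp"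
proof
 show "Agrp \<subseteq> grpA n" using dE_SOJ by (auto simp: grpA_def SO2_eq Agrp_def dE_entry)
 show "grpA n \<subseteq> Agrp"
 proof
  fix a :: "'m sqmat" assume "a \<in> grpA n"
  then have a: "a \<in> SOJ" "\<And>i j. i ~= j ==> a $ i $ j = 0" "\<And>i. a $ i $ i > 0" by (auto simp: grpA_def SO2_eq)
  have f: "transpose a ** J ** a = J" using a(1) by (simp add: SOJ_def)
  have 1: "a $ e1 $ e1 * a $ f1 $ f1 = 1" "a $ e2 $ e2 * a $ f2 $ f2 = 1"
   using form_entry[OF f, of e1 f1] form_entry[OF f, of e2 f2] a(2) by simp_all
  have m: "a $ m $ m = 1" if "m \<in> mid" for m
  proof -
   have "(\<Sum>k\<in>mid. a $ k $ m * a $ k $ m) = (\<Sum>k\<in>mid. if k = m then a $ m $ m * a $ m $ m else 0)"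
    using a(2) by (intro sum.cong) auto
   also have "\<dots> = a $ m $ m * a $ m $ m" by (subst sum.delta) (use that in simp_all)
   finally have "a $ m $ m * a $ m $ m = 1" using form_entry[OF f, of m m] a(2) that by simp
   then show ?thesis using a(3)[of m] by (simp add: square_eq_1_iff)
  qed
  have inv: "a $ f1 $ f1 = inverse (a $ e1 $ e1)" "a $ f2 $ f2 = inverse (a $ e2 $ e2)"
   using 1 inverse_unique by metis+
  have "a $ i $ j = dE (ln (a $ e1 $ e1)) (ln (a $ e2 $ e2)) $ i $ j" for i j
   using a(3) by (cases "i = j"; cases rule: level5[of i]; cases rule: level5[of j])
    (simp_all add: dE_entry a(2) m inv exp_minus)
  then show "a \<in> Agrp" using dE_Agrp unfolding vec_eq_iff by (metis vec_eq_iff)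
 qed
qed

lemma grpN_eq: "grpN n = Ngrp"
proof
 show "Ngrp \<subseteq> grpN n" using Ngrp_SOJ nexp_upper nexp_diag by (auto simp: grpN_def SO2_eq Ngrp_def upper_def)
 show "grpN n \<subseteq> Ngrp" using Ngrp_char by (auto simp: grpN_def SO2_eq upper_def)
qed

lemma grpAN_eq: "grpAN n = ANgrp"
 by (simp add: grpAN_def ANgrp_def grpA_eq grpN_eq)

lemma lie_SO2: "lie (SO2 n) = soJ" and lie_grpA: "lie (grpA n) = range (\<lambda>p. dmat (fst p) (snd p))"
 and lie_grpN: "lie (grpN n) = nmat ` ncar"
 by (simp_all add: SO2_eq grpA_eq grpN_eq lie_SOJ lie_Agrp lie_Ngrp)

lemma logN_nexp: "p \<in> ncar ==> logN n (nexp p) = nmat p"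
proof -
 assume p: "p \<in> ncar"
 have "X = nmat p" if X: "X \<in> nmat ` ncar" "mexp X = nexp p" for X
 proof -
  obtain q where q: "q \<in> ncar" "X = nmat q" using X(1) by blast
  then have "nexp q = nexp p" using X(2) mexp_nmat by simp
  then show ?thesis using nexp_inj[OF q(1) p] q(2) by simp
 qed
 then have u: "X \<in> nmat ` ncar \<and> mexp X = nexp p ==> X = nmat p" for X by blast
 have "nmat p \<in> nmat ` ncar \<and> mexp (nmat p) = nexp p" using p mexp_nmat by blast
 then show ?thesis unfolding logN_def lie_grpN using u by (rule the_equality)
qed

lemma parameters:
 assumes "(pp, x, y, et) \<in> ncar"
 shows "par_phi n (nexp (pp, x, y, et)) = pp" "par_x n (nexp (pp, x, y, et)) = x" "par_y n (nexp (pp, x, y, et)) = y"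
  "par_eta n (nexp (pp, x, y, et)) = et"
 unfolding par_phi_def par_x_def par_y_def par_eta_def logN_nexp[OF assms]
 using assms by (auto simp: nmat_def mid_ix[symmetric] vec_eq_iff supp_def)

lemma dE_inverse: "matrix_inv (dE s t) = dE (- s) (- t)"
proof -
 have "\<exists>B. dE s t ** B = mat 1 \<and> B ** dE s t = mat 1" by (rule exI[of _ "dE (- s) (- t)"]) (simp add: dE_dE)
 then have "matrix_inv (dE s t) ** dE s t = mat 1" unfolding matrix_inv_def by (rule someI2_ex) simp
 then have "matrix_inv (dE s t) ** (dE s t ** dE (- s) (- t)) = dE (- s) (- t)"
  by (simp only: matrix_mul_assoc matrix_mul_lid)
 then show ?thesis by (simp add: dE_dE)
qed

text \<open>Conjugation by \<open>dE s t\<close> multiplies the entry at \<open>(i, j)\<close> by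
  the exponential of a weight difference, so an eigenmatrix is supported where this difference is
  the root.\<close>

lemma root_space_eq:
 assumes "\<And>s t. \<omega> (dE s t) = exp (fst v * s + snd v * t)"
 shows "root_space n \<omega> = weight_space v"
proof -
 have e: "(dE s t ** X ** dE (- s) (- t)) $ i $ j = exp (wt s t i - wt s t j) * X $ i $ j" for s t X i j
 proof -
  have "wt (- s) (- t) j = - wt s t j" by (cases rule: level5[of j]) simp_all
  then show ?thesis by (simp add: mult_dE dE_mult exp_diff exp_minus field_simps)
 qed
 have *: "X \<in> root_space n \<omega> \<longleftrightarrow> X \<in> soJ \<and> (\<forall>s t i j. exp (wt s t i - wt s t j) * X $ i $ j = exp (fst v * s + snd v * t) * X $ i $ j)" for X
  by (auto simp: root_space_def lie_SO2 grpA_eq Agrp_def dE_inverse assms vec_eq_iff e)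
 show ?thesis
 proof (intro equalityI subsetI)
  fix X assume X: "X \<in> root_space n \<omega>"
  then have "exp (wt s t i - wt s t j) = exp (fst v * s + snd v * t)" if "X $ i $ j ~= 0" for s t i j
   using that unfolding * by (metis mult_right_cancel)
  then have "wt s t i - wt s t j = fst v * s + snd v * t" if "X $ i $ j ~= 0" for s t i j using that exp_inj_iff by blast
  from this[of _ _ 1 0] this[of _ _ 0 1] show "X \<in> weight_space v" using X unfolding weight_space_def * by simp
 next
  fix X assume X: "X \<in> weight_space v"
  have "exp (wt s t i - wt s t j) * X $ i $ j = exp (fst v * s + snd v * t) * X $ i $ j" for s t i j
   using weight_space_wt[OF X, of i j s t] by (cases "X $ i $ j = 0") (simp_all add: mult.commute)
  then show "X \<in> root_space n \<omega>" unfolding * using X by (simp add: weight_space_def)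
 qed
qed

definition is_root :: "('m sqmat => real) => real \<times> real => bool" where
 "is_root \<omega> v \<longleftrightarrow> v \<in> root_vectors \<and> (\<forall>s t. \<omega> (dE s t) = exp (fst v * s + snd v * t))"

lemma pos_roots_vectors:
 shows "\<omega> \<in> pos_roots ==> \<exists>v. is_root \<omega> v" and "v \<in> root_vectors ==> \<exists>\<omega>\<in>pos_roots. is_root \<omega> v"
proof -
 have e: "root_alpha (dE s t) = exp (s - t)" "root_beta (dE s t) = exp t" for s t
  using dE_entry wt_simps(1,2) by (simp_all add: root_alpha_def root_beta_def exp_diff)
 have r: "is_root root_alpha (1, -1)" "is_root root_beta (0, 1)" "is_root (\<lambda>a. root_alpha a * root_beta a) (1, 0)"
  "is_root (\<lambda>a. root_alpha a * (root_beta a)\<^sup>2) (1, 1)"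
  by (auto simp: is_root_def root_vectors_def e exp_add[symmetric] exp_double[symmetric])
 show "\<omega> \<in> pos_roots ==> \<exists>v. is_root \<omega> v" using r unfolding pos_roots_def by blast
 show "v \<in> root_vectors ==> \<exists>\<omega>\<in>pos_roots. is_root \<omega> v"
  unfolding pos_roots_def root_vectors_def using r by blast
qed

lemma root_space_coords: "is_root \<omega> v ==> root_space n \<omega> = nmat ` root_coords v"
 using root_space_eq nmat_weight_space unfolding is_root_def by simp

lemma coroot_line_eq: "is_root \<omega> v ==> coroot_line n \<omega> = range (\<lambda>r. dmat (r * fst v) (r * snd v))"
proof -
 assume r: "is_root \<omega> v"
 then have "root_space n (\<lambda>a. inverse (\<omega> a)) = weight_space (- v)"
  by (intro root_space_eq) (simp add: is_root_def exp_minus[symmetric])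
 moreover have "root_space n \<omega> = weight_space v" using r root_space_eq by (simp add: is_root_def)
 ultimately show ?thesis using coroot_span r unfolding coroot_line_def lie_grpA by (simp add: is_root_def)
qed

end

section \<open>Weyl chambers\<close>

lemma open_scaleR: "open U ==> Y \<in> U ==> \<exists>e>0. Y + e *\<^sub>R Z \<in> U" for Y :: "'v::real_normed_vector"
proof -
 assume U: "open U" "Y \<in> U"
 obtain e where e: "e > 0" "ball Y e \<subseteq> U" using U open_contains_ball by blast
 define k where "k = 2 * norm Z + 2"
 have k: "norm Z < k" "k > 0" using norm_ge_zero[of Z] unfolding k_def by linarith+
 then have "norm ((e / k) *\<^sub>R Z) < e" using e(1) by (simp add: pos_divide_less_eq)
 then have "Y + (e / k) *\<^sub>R Z \<in> U" using e(2) by (auto simp: dist_norm)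
 moreover have "e / k > 0" using e(1) k(2) by simp
 ultimately show ?thesis by blast
qed

context so2n
begin

abbreviation torus :: "'m sqmat set" where "torus \<equiv> lie (grpA n)"

lemma torusE: "X \<in> torus ==> (\<And>s t. X = dmat s t ==> thesis) ==> thesis"
 unfolding lie_grpA by auto

lemma dmat_torus [simp]: "dmat s t \<in> torus"
 unfolding lie_grpA by (rule image_eqI[of _ _ "(s, t)"]) auto

lemma sdot_linear: "sdot u (X + Y) = sdot u X + sdot u Y" "sdot u (c *\<^sub>R X) = c * sdot u X"
 by (simp_all add: sdot_def algebra_simps)

lemma continuous_on_sdot [continuous_intros]: "continuous_on S f ==> continuous_on S (\<lambda>x. sdot u (f x))"
 unfolding sdot_def by (intro continuous_intros)

lemma dmat_add_scale: "dmat a b + c *\<^sub>R dmat d e = dmat (a + c * d) (b + c * e)"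
 by (simp add: dmat_linear)

lemma subspace_torus: "subspace torus"
 by (rule subspaceI) (auto elim!: torusE simp flip: dmat_linear)

definition regular :: "'m sqmat => bool" where
 "regular X \<longleftrightarrow> X \<in> torus \<and> (\<forall>u\<in>root_vectors. sdot u X ~= 0)"

definition chamber :: "'m sqmat => 'm sqmat set" where
 "chamber X = {Y \<in> torus. \<forall>u\<in>root_vectors. sdot u Y * sdot u X >= 0}"

text \<open>The sets with a fixed sign pattern of the roots are convex, hence connected, and no root
  changes sign on a connected set of regular elements; so they are the components. Weak inequalities
  give the closure, since moving a point towards \<open>X\<close> makes them strict.\<close>

lemma weyl_chambers_eq: "weyl_chambers n = chamber ` {X. regular X}"
proof -
 have "torus - (\<Union>\<omega>\<in>pos_roots. {X. \<omega> (mexp X) = 1}) = {X. regular X}"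
 proof (intro equalityI subsetI)
  fix X assume X: "X \<in> torus - (\<Union>\<omega>\<in>pos_roots. {X. \<omega> (mexp X) = 1})"
  then obtain s t where st: "X = dmat s t" by (auto elim: torusE)
  have "sdot u X ~= 0" if u: "u \<in> root_vectors" for u
  proof -
   obtain \<omega> where "\<omega> \<in> pos_roots" "is_root \<omega> u" using pos_roots_vectors(2)[OF u] by blast
   then show ?thesis using X by (auto simp: st mexp_dmat is_root_def)
  qed
  then show "X \<in> {X. regular X}" using X by (simp add: regular_def)
 next
  fix X assume X: "X \<in> {X. regular X}"
  then obtain s t where st: "X = dmat s t" by (auto simp: regular_def elim: torusE)
  have "\<omega> (mexp X) ~= 1" if "\<omega> \<in> pos_roots" for \<omega>
   using pos_roots_vectors(1)[OF that] X by (auto simp: st mexp_dmat is_root_def regular_def)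
  then show "X \<in> torus - (\<Union>\<omega>\<in>pos_roots. {X. \<omega> (mexp X) = 1})" using X by (auto simp: regular_def)
 qed
 moreover have "closure (connected_component_set {X. regular X} X) = chamber X" if X: "regular X" for X
 proof -
  let ?K = "{Y \<in> torus. \<forall>u\<in>root_vectors. sdot u Y * sdot u X > 0}"
  have Xt: "X \<in> torus" and X0: "\<And>u. u \<in> root_vectors ==> sdot u X * sdot u X > 0" using X by (auto simp: regular_def zero_less_mult_iff)
  have 1: "connected_component_set {X. regular X} X = ?K"
  proof
   have "convex ?K"
   proof (rule convexI)
    fix Y Z and a b :: real assume YZ: "Y \<in> ?K" "Z \<in> ?K" and ab: "0 <= a" "0 <= b" "a + b = 1"
    have "a *\<^sub>R Y + b *\<^sub>R Z \<in> torus" using YZ subspace_torus by (simp add: subspace_def)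
    moreover have "sdot u (a *\<^sub>R Y + b *\<^sub>R Z) * sdot u X > 0" if u: "u \<in> root_vectors" for u
    proof -
     have p: "sdot u Y * sdot u X > 0" "sdot u Z * sdot u X > 0" using YZ u by blast+
     have "sdot u (a *\<^sub>R Y + b *\<^sub>R Z) * sdot u X = a * (sdot u Y * sdot u X) + b * (sdot u Z * sdot u X)"
      by (simp add: sdot_linear algebra_simps)
     also have "\<dots> > 0" using p ab by (cases "a = 0") (simp_all add: add_pos_nonneg)
     finally show ?thesis .
    qed
    ultimately show "a *\<^sub>R Y + b *\<^sub>R Z \<in> ?K" by blast
   qed
   then show "?K \<subseteq> connected_component_set {X. regular X} X"
    using Xt X0 by (intro connected_component_maximal convex_connected) (auto simp: regular_def)
   show "connected_component_set {X. regular X} X \<subseteq> ?K"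
   proof
    fix Y assume "Y \<in> connected_component_set {X. regular X} X"
    then obtain S where S: "connected S" "S \<subseteq> {X. regular X}" "X \<in> S" "Y \<in> S"
     unfolding connected_component_def mem_Collect_eq by blast
    have "sdot u Y * sdot u X > 0" if u: "u \<in> root_vectors" for u
    proof (rule ccontr)
     assume "\<not> ?thesis"
     then have "sdot u X <= 0 \<and> 0 <= sdot u Y \<or> sdot u Y <= 0 \<and> 0 <= sdot u X" unfolding not_less mult_le_0_iff by blast
     moreover have c: "connected (sdot u ` S)" by (intro connected_continuous_image continuous_intros S)
     ultimately have "0 \<in> sdot u ` S"
      using connectedD_interval[OF c imageI[OF S(3)] imageI[OF S(4)], of 0] connectedD_interval[OF c imageI[OF S(4)] imageI[OF S(3)], of 0] by blast
     then show False using S(2) u by (auto simp: regular_def)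
    qed
    then show "Y \<in> ?K" using S by (auto simp: regular_def)
   qed
  qed
  have "closure ?K = chamber X"
  proof
   have "closed (chamber X)"
   proof -
    have "chamber X = torus \<inter> (\<Inter>u\<in>root_vectors. {Y. sdot u Y * sdot u X >= 0})" by (auto simp: chamber_def)
    then show ?thesis using closed_subspace[OF subspace_torus]
     by (auto intro!: closed_Int closed_INT closed_Collect_le continuous_intros)
   qed
   then show "closure ?K \<subseteq> chamber X" by (intro closure_minimal) (auto simp: chamber_def intro: less_imp_le)
   show "chamber X \<subseteq> closure ?K"
   proof
    fix Y assume Y: "Y \<in> chamber X"
    have "((\<lambda>e. Y + e *\<^sub>R X) \<longlongrightarrow> Y + 0 *\<^sub>R X) (at_right 0)" by (intro tendsto_intros)
    moreover have "\<forall>\<^sub>F e in at_right 0. Y + e *\<^sub>R X \<in> closure ?K"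
     unfolding eventually_at_right_field
    proof (rule exI[of _ 1], intro conjI allI impI)
     fix e :: real assume e: "0 < e"
     have "Y + e *\<^sub>R X \<in> torus" using Y Xt subspace_torus by (auto simp: chamber_def subspace_def)
     moreover have "sdot u (Y + e *\<^sub>R X) * sdot u X > 0" if "u \<in> root_vectors" for u
     proof -
      have "0 < e * (sdot u X * sdot u X)" using e X0[OF that] by simp
      moreover have "0 <= sdot u Y * sdot u X" using Y that by (simp add: chamber_def)
      ultimately show ?thesis by (simp add: sdot_linear distrib_right mult.assoc)
     qed
     ultimately have "Y + e *\<^sub>R X \<in> ?K" by simp
     then show "Y + e *\<^sub>R X \<in> closure ?K" by (rule closure_subset[THEN subsetD])
    qed simp
    ultimately have "Y + 0 *\<^sub>R X \<in> closure ?K" by (intro Lim_in_closed_set[OF closed_closure _ trivial_limit_at_right_real])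
    then show "Y \<in> closure ?K" by simp
   qed
  qed
  then show ?thesis unfolding 1 .
 qed
 ultimately show ?thesis unfolding weyl_chambers_def components_def by (auto simp: image_image)
qed

text \<open>In B2 every positive root is orthogonal to exactly one other positive root, and the wall
  through the coroot of \<open>v\<close> is the kernel of that root.\<close>

definition perp :: "real \<times> real => real \<times> real" where
 "perp v = (if v = (1, -1) then (1, 1) else if v = (0, 1) then (1, 0) else if v = (1, 0) then (0, 1) else (1, -1))"

lemma root_vectors_cases: "v \<in> root_vectors ==> v = (1, -1) \<or> v = (0, 1) \<or> v = (1, 0) \<or> v = (1, 1)"
 by (simp add: root_vectors_def)

lemma perp_props:
 assumes "v \<in> root_vectors"
 shows "perp v \<in> root_vectors" "fst (perp v) * fst v + snd (perp v) * snd v = 0"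
  "fst (perp v) * fst (perp v) + snd (perp v) * snd (perp v) > 0" "fst v * fst v + snd v * snd v > 0"
  "\<bar>fst (perp v) * s + snd (perp v) * t\<bar> = \<bar>snd v * s - fst v * t\<bar>"
  "u \<in> root_vectors ==> u ~= perp v ==> fst u * fst v + snd u * snd v ~= 0"
  "sg = 1 \<or> sg = -1 ==> de = 1 \<or> de = -1 ==> u \<in> root_vectors ==> u ~= perp v ==> sg * (fst u * fst v + snd u * snd v) *
   (fst u * (4 * sg * fst v + de * fst (perp v)) + snd u * (4 * sg * snd v + de * snd (perp v))) > 0"
proof -
 note v = root_vectors_cases[OF assms]
 show "perp v \<in> root_vectors" "fst (perp v) * fst v + snd (perp v) * snd v = 0"
  "fst (perp v) * fst (perp v) + snd (perp v) * snd (perp v) > 0" "fst v * fst v + snd v * snd v > 0"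
  using v by (elim disjE; simp add: perp_def root_vectors_def)+
 show "\<bar>fst (perp v) * s + snd (perp v) * t\<bar> = \<bar>snd v * s - fst v * t\<bar>" using v by (elim disjE; simp add: perp_def)
 show "u \<in> root_vectors ==> u ~= perp v ==> fst u * fst v + snd u * snd v ~= 0"
  using v by (drule_tac root_vectors_cases) (elim disjE; simp add: perp_def)
 show "sg = 1 \<or> sg = -1 ==> de = 1 \<or> de = -1 ==> u \<in> root_vectors ==> u ~= perp v ==> sg * (fst u * fst v + snd u * snd v) *
   (fst u * (4 * sg * fst v + de * fst (perp v)) + snd u * (4 * sg * snd v + de * snd (perp v))) > 0"
  using v by (drule_tac root_vectors_cases) (elim disjE; simp add: perp_def)
qed

text \<open>The right-angled cone around \<open>sg\<close> times the coroot, that is, the union of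
  the two chambers that meet along its ray.\<close>

definition half :: "real \<times> real => real => 'm sqmat set" where
 "half v sg = {Y \<in> torus. \<bar>sdot (perp v) Y\<bar> <= sg * sdot v Y}"

lemma half_iff:
 assumes "v \<in> root_vectors" "sg = 1 \<or> sg = -1" "Y \<in> torus"
 shows "(\<forall>u\<in>root_vectors - {perp v}. sg * (fst u * fst v + snd u * snd v) * sdot u Y >= 0) \<longleftrightarrow> Y \<in> half v sg"
proof -
 obtain s t where Y: "Y = dmat s t" using assms(3) torusE by blast
 show ?thesis using root_vectors_cases[OF assms(1)] assms(2)
  by (elim disjE) (auto simp: half_def Y root_vectors_def perp_def insert_Diff_if abs_le_iff)
qed

lemma chamber_eq:
 assumes v: "v \<in> root_vectors" "sg = 1 \<or> sg = -1" and de: "de * sdot (perp v) X > 0"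
  and X: "\<And>u. u \<in> root_vectors ==> u ~= perp v ==> sg * (fst u * fst v + snd u * snd v) * sdot u X > 0"
 shows "chamber X = {Y \<in> half v sg. de * sdot (perp v) Y >= 0}"
proof -
 have sgn: "0 <= b * a \<longleftrightarrow> 0 <= k * b" if "k * a > 0" for a b k :: real
  using that by (auto simp: zero_less_mult_iff zero_le_mult_iff)
 have "Y \<in> chamber X \<longleftrightarrow> Y \<in> half v sg \<and> de * sdot (perp v) Y >= 0" if Y: "Y \<in> torus" for Y
 proof -
  have "Y \<in> chamber X \<longleftrightarrow> (\<forall>u\<in>root_vectors - {perp v}. sdot u Y * sdot u X >= 0) \<and> sdot (perp v) Y * sdot (perp v) X >= 0"
   using Y perp_props(1)[OF v(1)] by (auto simp: chamber_def)
  also have "\<dots> \<longleftrightarrow> (\<forall>u\<in>root_vectors - {perp v}. sg * (fst u * fst v + snd u * snd v) * sdot u Y >= 0) \<and> de * sdot (perp v) Y >= 0"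
   using sgn[OF X] sgn[OF de] by auto
  finally show ?thesis using half_iff[OF v Y] by simp
 qed
 then show ?thesis by (auto simp: chamber_def half_def)
qed

lemma chamber_through:
 assumes v: "v \<in> root_vectors" "sg = 1 \<or> sg = -1" and W: "W \<in> weyl_chambers n" "dmat (sg * fst v) (sg * snd v) \<in> W"
 shows "\<exists>de. (de = 1 \<or> de = -1) \<and> W = {Y \<in> half v sg. de * sdot (perp v) Y >= 0}"
proof -
 obtain X where X: "regular X" "W = chamber X" using W(1) unfolding weyl_chambers_eq by blast
 let ?de = "if sdot (perp v) X > 0 then 1 else -1 :: real"
 have "chamber X = {Y \<in> half v sg. ?de * sdot (perp v) Y >= 0}"
 proof (rule chamber_eq[OF v])
  show "?de * sdot (perp v) X > 0" using X(1) perp_props(1)[OF v(1)] by (auto simp: regular_def)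
  fix u assume u: "u \<in> root_vectors" "u ~= perp v"
  have "0 <= (fst u * (sg * fst v) + snd u * (sg * snd v)) * sdot u X" using W(2) u(1) by (simp add: X(2) chamber_def)
  moreover have "(fst u * (sg * fst v) + snd u * (sg * snd v)) = sg * (fst u * fst v + snd u * snd v)" by (simp add: algebra_simps)
  moreover have "sg * (fst u * fst v + snd u * snd v) * sdot u X ~= 0"
   using perp_props(6)[OF v(1) u] v(2) X(1) u(1) by (auto simp: regular_def)
  ultimately show "sg * (fst u * fst v + snd u * snd v) * sdot u X > 0" by (metis less_le)
 qed
 then show ?thesis unfolding X(2) by (rule exI[of _ ?de, OF conjI, rotated]) simp
qed

lemma adjacent_chamber:
 assumes v: "v \<in> root_vectors" "sg = 1 \<or> sg = -1" and de: "de = 1 \<or> de = -1"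
 shows "{Y \<in> half v sg. de * sdot (perp v) Y >= 0} \<in> weyl_chambers n"
  "\<exists>Y \<in> half v sg. de * sdot (perp v) Y > 0"
proof -
 \<comment> \<open>A point slightly off the ray: the factor 4 lets the multiple of \<open>v\<close>
   decide the sign of every root except \<open>perp v\<close>, and the small tilt decides that of
   \<open>perp v\<close>.\<close>
 let ?X = "dmat (4 * sg * fst v + de * fst (perp v)) (4 * sg * snd v + de * snd (perp v))"
 have "sdot (perp v) ?X = 4 * sg * (fst (perp v) * fst v + snd (perp v) * snd v) + de * (fst (perp v) * fst (perp v) + snd (perp v) * snd (perp v))"
  by (simp add: algebra_simps)
 then have 1: "de * sdot (perp v) ?X > 0" using perp_props(2,3)[OF v(1)] de by auto
 have 2: "sg * (fst u * fst v + snd u * snd v) * sdot u ?X > 0" if "u \<in> root_vectors" "u ~= perp v" for u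
  using perp_props(7)[OF v de that] by simp
 have "sdot u ?X ~= 0" if "u \<in> root_vectors" for u using 1 2[OF that] by (cases "u = perp v") auto
 then have "regular ?X" by (simp add: regular_def)
 moreover have ch: "chamber ?X = {Y \<in> half v sg. de * sdot (perp v) Y >= 0}" by (rule chamber_eq[OF v 1 2])
 ultimately show "{Y \<in> half v sg. de * sdot (perp v) Y >= 0} \<in> weyl_chambers n" unfolding weyl_chambers_eq by blast
 have "?X \<in> chamber ?X" by (simp add: chamber_def)
 then have "?X \<in> half v sg" unfolding ch by blast
 then show "\<exists>Y \<in> half v sg. de * sdot (perp v) Y > 0" using 1 by blast
qed

lemma intA_iff: "Y \<in> intA n S \<longleftrightarrow> Y \<in> torus \<and> (\<exists>U. open U \<and> Y \<in> U \<and> U \<inter> torus \<subseteq> S)"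
proof -
 have "Y \<in> intA n S \<longleftrightarrow> (\<exists>U. open U \<and> Y \<in> torus \<inter> U \<and> torus \<inter> U \<subseteq> S)"
  unfolding intA_def interior_of_def openin_open by blast
 then show ?thesis by (simp only: Int_commute Int_iff) blast
qed

lemma intA_half:
 assumes v: "v \<in> root_vectors" "sg = 1 \<or> sg = -1"
 shows "intA n (half v sg) = {Y \<in> torus. \<bar>sdot (perp v) Y\<bar> < sg * sdot v Y}"
proof
 show "{Y \<in> torus. \<bar>sdot (perp v) Y\<bar> < sg * sdot v Y} \<subseteq> intA n (half v sg)"
 proof
  fix Y assume Y: "Y \<in> {Y \<in> torus. \<bar>sdot (perp v) Y\<bar> < sg * sdot v Y}"
  have "open {Y. \<bar>sdot (perp v) Y\<bar> < sg * sdot v Y}" by (intro open_Collect_less continuous_intros)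
  then show "Y \<in> intA n (half v sg)" unfolding intA_iff using Y
   by (auto simp: half_def intro!: exI[of _ "{Y. \<bar>sdot (perp v) Y\<bar> < sg * sdot v Y}"])
 qed
 show "intA n (half v sg) \<subseteq> {Y \<in> torus. \<bar>sdot (perp v) Y\<bar> < sg * sdot v Y}"
 proof
  fix Y assume "Y \<in> intA n (half v sg)"
  then obtain U where U: "Y \<in> torus" "open U" "Y \<in> U" "U \<inter> torus \<subseteq> half v sg" unfolding intA_iff by blast
  \<comment> \<open>A small step towards the opposite ray stays inside the cone, which forces strict
    inequality at \<open>Y\<close>.\<close>
  obtain e where e: "e > 0" "Y + e *\<^sub>R dmat (- sg * fst v) (- sg * snd v) \<in> U" using open_scaleR[OF U(2,3)] by blast
  have "Y + e *\<^sub>R dmat (- sg * fst v) (- sg * snd v) \<in> torus" using U(1) subspace_torus by (simp add: subspace_def)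
  then have "Y + e *\<^sub>R dmat (- sg * fst v) (- sg * snd v) \<in> half v sg" using e(2) U(4) by blast
  moreover have "sdot (perp v) (Y + e *\<^sub>R dmat (- sg * fst v) (- sg * snd v)) = sdot (perp v) Y - e * sg * (fst (perp v) * fst v + snd (perp v) * snd v)"
   by (simp add: sdot_linear algebra_simps)
  moreover have "sg * sdot v (Y + e *\<^sub>R dmat (- sg * fst v) (- sg * snd v)) = sg * sdot v Y - (sg * sg) * (e * (fst v * fst v + snd v * snd v))"
   by (simp add: sdot_linear algebra_simps)
  moreover have "sg * sg = 1" "e * (fst v * fst v + snd v * snd v) > 0" using v(2) e(1) perp_props(4)[OF v(1)] by auto
  ultimately show "Y \<in> {Y \<in> torus. \<bar>sdot (perp v) Y\<bar> < sg * sdot v Y}"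
   using U(1) perp_props(2)[OF v(1)] by (simp add: half_def)
 qed
qed

text \<open>The orthogonal root changes sign across the ray, so no single chamber is a neighbourhood
  of the point. This rules out the first case of \<open>region_of_ray\<close>.\<close>

lemma coroot_on_wall:
 assumes v: "v \<in> root_vectors" "sg = 1 \<or> sg = -1" and W: "W \<in> weyl_chambers n"
 shows "dmat (sg * fst v) (sg * snd v) \<notin> intA n W"
proof
 assume i: "dmat (sg * fst v) (sg * snd v) \<in> intA n W"
 then obtain U where U: "open U" "dmat (sg * fst v) (sg * snd v) \<in> U" "U \<inter> torus \<subseteq> W" unfolding intA_iff by blast
 then have "dmat (sg * fst v) (sg * snd v) \<in> W" by auto
 then obtain de where de: "de = 1 \<or> de = -1" "W = {Y \<in> half v sg. de * sdot (perp v) Y >= 0}" using chamber_through[OF v W] by blast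
 obtain e where e: "e > 0" "dmat (sg * fst v) (sg * snd v) + e *\<^sub>R dmat (- de * fst (perp v)) (- de * snd (perp v)) \<in> U"
  using open_scaleR[OF U(1,2)] by blast
 then have "dmat (sg * fst v) (sg * snd v) + e *\<^sub>R dmat (- de * fst (perp v)) (- de * snd (perp v)) \<in> W"
  using U(3) unfolding dmat_add_scale by auto
 then have "0 <= de * sdot (perp v) (dmat (sg * fst v) (sg * snd v) + e *\<^sub>R dmat (- de * fst (perp v)) (- de * snd (perp v)))"
  unfolding de(2) by blast
 also have "\<dots> = de * sg * (fst (perp v) * fst v + snd (perp v) * snd v) - (de * de) * (e * (fst (perp v) * fst (perp v) + snd (perp v) * snd (perp v)))"
  by (simp add: sdot_linear algebra_simps)
 finally show False using perp_props(2,3)[OF v(1)] de(1) e(1) by (auto simp: mult_le_0_iff)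
qed

lemma adjacent_chambers:
 assumes v: "v \<in> root_vectors" "sg = 1 \<or> sg = -1"
 shows "{Y \<in> half v sg. 1 * sdot (perp v) Y >= 0} \<inter> {Y \<in> half v sg. -1 * sdot (perp v) Y >= 0}
   = {s *\<^sub>R dmat (sg * fst v) (sg * snd v) |s. s >= 0}"
proof (intro equalityI subsetI)
 fix Y assume Y: "Y \<in> {Y \<in> half v sg. 1 * sdot (perp v) Y >= 0} \<inter> {Y \<in> half v sg. -1 * sdot (perp v) Y >= 0}"
 then obtain s t where st: "Y = dmat s t" by (auto simp: half_def elim: torusE)
 from Y have p: "fst (perp v) * s + snd (perp v) * t = 0" "0 <= sg * (fst v * s + snd v * t)" by (auto simp: half_def st)
 have "\<exists>r\<ge>0. s = r * (sg * fst v) \<and> t = r * (sg * snd v)"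
  using root_vectors_cases[OF v(1)] v(2) p
  by (intro exI[of _ "sg * (if fst v = 1 then s else t)"]) (elim disjE; simp add: perp_def)
 then show "Y \<in> {s *\<^sub>R dmat (sg * fst v) (sg * snd v) |s. s >= 0}" by (auto simp: st dmat_linear)
next
 fix Y assume "Y \<in> {s *\<^sub>R dmat (sg * fst v) (sg * snd v) |s. s >= 0}"
 then obtain r where r: "r >= 0" "Y = dmat (r * (sg * fst v)) (r * (sg * snd v))" by (auto simp: dmat_linear)
 have "sdot (perp v) Y = r * sg * (fst (perp v) * fst v + snd (perp v) * snd v)" by (simp add: r(2) algebra_simps)
 moreover have "sg * sdot v Y = (sg * sg) * (r * (fst v * fst v + snd v * snd v))" by (simp add: r(2) algebra_simps)
 moreover have "sg * sg = 1" using v(2) by auto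
 moreover have "Y \<in> torus" by (simp add: r(2))
 ultimately show "Y \<in> {Y \<in> half v sg. 1 * sdot (perp v) Y >= 0} \<inter> {Y \<in> half v sg. -1 * sdot (perp v) Y >= 0}"
  using perp_props(2,4)[OF v(1)] r(1) by (simp add: half_def)
qed

text \<open>Only two chambers contain the ray, one on each side of the wall, so two different
  chambers that meet along it must be these.\<close>

lemma region_of_coroot_ray:
 assumes v: "v \<in> root_vectors" "sg = 1 \<or> sg = -1"
 shows "region_of_ray n {s *\<^sub>R dmat (sg * fst v) (sg * snd v) |s. s >= 0} \<C> \<longleftrightarrow> \<C> = intA n (half v sg)"
proof
 let ?R = "{s *\<^sub>R dmat (sg * fst v) (sg * snd v) |s. s >= 0}" and ?Q = "\<lambda>de. {Y \<in> half v sg. de * sdot (perp v) Y >= 0}"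
 have PR: "dmat (sg * fst v) (sg * snd v) \<in> ?R" by (auto intro!: exI[of _ 1])
 have P0: "dmat (sg * fst v) (sg * snd v) ~= 0"
 proof
  assume "dmat (sg * fst v) (sg * snd v) = 0"
  then have "sdot v (dmat (sg * fst v) (sg * snd v)) = 0" by (simp only:) (simp add: sdot_def)
  then have "sg * (fst v * fst v + snd v * snd v) = 0" by (simp add: algebra_simps)
  then show False using v(2) perp_props(4)[OF v(1)] by auto
 qed
 have "half v sg = ?Q 1 \<union> ?Q (-1)" by auto
 moreover have R: "?R = ?Q 1 \<inter> ?Q (-1)" using adjacent_chambers[OF v] by simp
 ultimately have U: "?Q 1 \<union> ?R \<union> ?Q (-1) = half v sg" "?Q (-1) \<union> ?R \<union> ?Q 1 = half v sg" by blast+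
 {
  assume "region_of_ray n ?R \<C>"
  then obtain W1 W2 where W: "W1 \<in> weyl_chambers n" "W2 \<in> weyl_chambers n" "W1 ~= W2" "?R = W1 \<inter> W2" "\<C> = intA n (W1 \<union> ?R \<union> W2)"
   unfolding region_of_ray_def using PR P0 coroot_on_wall[OF v] by blast
  obtain d1 d2 where d: "d1 = 1 \<or> d1 = -1" "W1 = ?Q d1" "d2 = 1 \<or> d2 = -1" "W2 = ?Q d2"
   using chamber_through[OF v W(1)] chamber_through[OF v W(2)] PR W(4) by auto
  then have "W1 \<union> ?R \<union> W2 = half v sg" using W(3) U by auto
  then show "\<C> = intA n (half v sg)" using W(5) by simp
 }
 assume C: "\<C> = intA n (half v sg)"
 have "?Q 1 ~= ?Q (-1)" using adjacent_chamber(2)[OF v, of 1] by force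
 moreover have "\<C> = intA n (?Q 1 \<union> ?R \<union> ?Q (-1))" using U(1) C by simp
 ultimately show "region_of_ray n ?R \<C>" unfolding region_of_ray_def
  using adjacent_chamber(1)[OF v, of 1] adjacent_chamber(1)[OF v, of "-1"] R by blast
qed

text \<open>Reversing both rays reverses the region, so only the two lines matter: a chosen ray lies
  in the region exactly when the torus line makes an angle of less than 45 degrees with the coroot.
  The right side is the negation of that.\<close>

lemma region_condition:
 assumes \<omega>: "is_root \<omega> v" and t: "(t1, t2) ~= (0, 0)"
 shows "(\<exists>T \<C>. ray_and_region n \<omega> (range (\<lambda>r. dmat (r * t1) (r * t2))) T \<C> \<and> \<not> T - {0} \<subseteq> intA n \<C>) \<longleftrightarrow>
  \<bar>fst v * t1 + snd v * t2\<bar> <= \<bar>snd v * t1 - fst v * t2\<bar>" (is "?L \<longleftrightarrow> ?C")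
proof -
 have v: "v \<in> root_vectors" using \<omega> by (simp add: is_root_def)
 have D: "2 * real CARD('m) - 4 > 0" using n by (simp add: card_index)
 have k: "killing (lie (SO2 n)) (dmat a b) (dmat c d) >= 0 \<longleftrightarrow> a * c + b * d >= 0" for a b c d
  unfolding lie_SO2 killing_dmat using D by (simp add: zero_le_mult_iff)
 have d0: "dmat a b = 0 \<longleftrightarrow> a = 0 \<and> b = 0" for a b
 proof
  assume "dmat a b = 0"
  then have "dmat a b $ e1 $ e1 = 0" "dmat a b $ e2 $ e2 = 0" by simp_all
  then show "a = 0 \<and> b = 0" by (simp add: dmat_def)
 qed (simp add: dmat_linear)
 \<comment> \<open>The region is itself an interior, so taking the interior again changes
   nothing.\<close>
 have ii: "intA n (intA n S) = intA n S" for S :: "'m sqmat set" by (simp add: intA_def)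
 show ?thesis
 proof
  assume ?L
  then obtain T \<C> R where T: "ray T" "T \<subseteq> range (\<lambda>r. dmat (r * t1) (r * t2))" and R: "ray R" "R \<subseteq> coroot_line n \<omega>"
   and kil: "\<forall>X\<in>T. \<forall>Y\<in>R. killing (lie (SO2 n)) X Y >= 0" and C: "region_of_ray n R \<C>" and nC: "\<not> T - {0} \<subseteq> intA n \<C>"
   unfolding ray_and_region_def by blast
  obtain w where w: "w ~= 0" "R = {s *\<^sub>R w |s. s >= 0}" using R(1) by (auto simp: ray_def)
  have "w \<in> R" by (auto simp: w(2) intro!: exI[of _ 1])
  then obtain r where r: "w = dmat (r * fst v) (r * snd v)" using R(2) coroot_line_eq[OF \<omega>] by auto
  have r0: "r ~= 0" using w(1) r by (auto simp: d0)
  define sg where "sg = sgn r"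
  have sg: "sg = 1 \<or> sg = -1" using r0 by (auto simp: sg_def sgn_if)
  have rs: "r = \<bar>r\<bar> * sg" by (simp add: sg_def abs_mult_sgn mult.commute)
  have w': "w = \<bar>r\<bar> *\<^sub>R dmat (sg * fst v) (sg * snd v)"
   unfolding r by (simp only: dmat_linear(2)[symmetric] mult.assoc[symmetric] rs[symmetric])
  have R': "R = {s *\<^sub>R dmat (sg * fst v) (sg * snd v) |s. s >= 0}"
  proof (intro equalityI subsetI)
   fix Y assume "Y \<in> R"
   then obtain s where "s >= 0" "Y = (s * \<bar>r\<bar>) *\<^sub>R dmat (sg * fst v) (sg * snd v)" unfolding w(2) w' by auto
   then show "Y \<in> {s *\<^sub>R dmat (sg * fst v) (sg * snd v) |s. s >= 0}" by (auto intro!: exI[of _ "s * \<bar>r\<bar>"])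
  next
   fix Y assume "Y \<in> {s *\<^sub>R dmat (sg * fst v) (sg * snd v) |s. s >= 0}"
   then obtain s where "s >= 0" "Y = s *\<^sub>R dmat (sg * fst v) (sg * snd v)" by auto
   then have "Y = (s / \<bar>r\<bar>) *\<^sub>R w" "s / \<bar>r\<bar> >= 0" using r0 unfolding w' by auto
   then show "Y \<in> R" unfolding w(2) by blast
  qed
  have C': "\<C> = intA n (half v sg)" using C region_of_coroot_ray[OF v sg] unfolding R' by blast
  obtain X where X: "X \<in> T" "X ~= 0" "X \<notin> intA n (half v sg)" using nC unfolding C' ii by blast
  obtain c where c: "X = dmat (c * t1) (c * t2)" using T(2) X(1) by auto
  have c0: "c ~= 0" using X(2) by (auto simp: c d0)
  have "dmat (sg * fst v) (sg * snd v) \<in> R" unfolding R' by (auto intro!: exI[of _ 1])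
  then have "c * t1 * (sg * fst v) + c * t2 * (sg * snd v) >= 0" using kil X(1) k unfolding c by blast
  then have p: "0 <= sg * c * (fst v * t1 + snd v * t2)" by (simp add: algebra_simps)
  have "\<not> \<bar>sdot (perp v) X\<bar> < sg * sdot v X" using X(3) unfolding intA_half[OF v sg] by (simp add: c)
  moreover have "\<bar>sdot (perp v) X\<bar> = \<bar>c\<bar> * \<bar>snd v * t1 - fst v * t2\<bar>"
  proof -
   have "sdot (perp v) X = c * (fst (perp v) * t1 + snd (perp v) * t2)" by (simp add: c algebra_simps)
   then show ?thesis unfolding abs_mult perp_props(5)[OF v] by (simp add: abs_mult perp_props(5)[OF v])
  qed
  moreover have "sg * sdot v X = sg * c * (fst v * t1 + snd v * t2)" by (simp add: c algebra_simps)
  moreover have "sg * c * (fst v * t1 + snd v * t2) = \<bar>c\<bar> * \<bar>fst v * t1 + snd v * t2\<bar>"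
  proof -
   have "\<bar>sg * c * (fst v * t1 + snd v * t2)\<bar> = \<bar>c\<bar> * \<bar>fst v * t1 + snd v * t2\<bar>" using sg by (auto simp: abs_mult)
   then show ?thesis using p by simp
  qed
  ultimately have "\<bar>c\<bar> * \<bar>fst v * t1 + snd v * t2\<bar> <= \<bar>c\<bar> * \<bar>snd v * t1 - fst v * t2\<bar>" by simp
  then show ?C using c0 by simp
 next
  assume C: ?C
  \<comment> \<open>The orientation of the torus ray whose pairing with the positive coroot ray is
    nonnegative.\<close>
  define rh :: real where "rh = (if fst v * t1 + snd v * t2 >= 0 then 1 else -1)"
  have rh: "rh = 1 \<or> rh = -1" "rh * (fst v * t1 + snd v * t2) >= 0" by (auto simp: rh_def)
  let ?X = "dmat (rh * t1) (rh * t2)" and ?P = "dmat (1 * fst v) (1 * snd v)"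
  let ?T = "{s *\<^sub>R ?X |s. s >= 0}" and ?R = "{s *\<^sub>R ?P |s. s >= 0}"
  have X0: "?X ~= 0" using t rh(1) by (auto simp: d0)
  have P0: "?P ~= 0" using root_vectors_cases[OF v] by (auto simp: d0)
  have rr: "ray_and_region n \<omega> (range (\<lambda>r. dmat (r * t1) (r * t2))) ?T (intA n (half v 1))"
   unfolding ray_and_region_def
  proof (intro exI[of _ ?R] conjI ballI)
   show "ray ?T" "ray ?R" unfolding ray_def using X0 P0 by blast+
   show "?T \<subseteq> range (\<lambda>r. dmat (r * t1) (r * t2))" by (auto simp: dmat_linear(2)[symmetric] mult.assoc[symmetric])
   show "?R \<subseteq> coroot_line n \<omega>" unfolding coroot_line_eq[OF \<omega>] by (auto simp: dmat_linear(2)[symmetric])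
   show "region_of_ray n ?R (intA n (half v 1))" using region_of_coroot_ray[OF v, of 1] by simp
   fix X Y assume "X \<in> ?T" "Y \<in> ?R"
   then obtain a b where ab: "a >= 0" "b >= 0" "X = dmat (a * (rh * t1)) (a * (rh * t2))" "Y = dmat (b * fst v) (b * snd v)"
    by (auto simp: dmat_linear(2))
   have "a * (rh * t1) * (b * fst v) + a * (rh * t2) * (b * snd v) = a * b * (rh * (fst v * t1 + snd v * t2))"
    by (simp add: algebra_simps)
   then show "0 <= killing (lie (SO2 n)) X Y" unfolding ab k using ab(1,2) rh(2) by simp
  qed
  have "?X \<notin> intA n (half v 1)"
  proof
   assume "?X \<in> intA n (half v 1)"
   then have "\<bar>sdot (perp v) ?X\<bar> < 1 * sdot v ?X" unfolding intA_half[OF v, of 1, simplified] by simp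
   moreover have "sdot (perp v) ?X = rh * (fst (perp v) * t1 + snd (perp v) * t2)" by (simp add: algebra_simps)
   moreover have "sdot v ?X = rh * (fst v * t1 + snd v * t2)" by (simp add: algebra_simps)
   ultimately show False using C rh(1) perp_props(5)[OF v, of t1 t2] by (auto simp: abs_mult)
  qed
  moreover have "?X \<in> ?T - {0}" using X0 by (auto intro!: exI[of _ 1])
  ultimately have "\<not> ?T - {0} \<subseteq> intA n (intA n (half v 1))" unfolding ii by blast
  with rr show ?L by blast
 qed
qed

end

section \<open>Closed connected subgroups of \<open>A N\<close>\<close>

context levels
begin

definition matrix_subgroup :: "'m sqmat set => bool" where
 "matrix_subgroup H \<longleftrightarrow> mat 1 \<in> H \<and> (\<forall>g\<in>H. \<forall>h\<in>H. g ** h \<in> H) \<and> (\<forall>g\<in>H. jinv g \<in> H)"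

lemma jinv_unique: "g \<in> SOJ ==> h ** g = mat 1 ==> jinv g = h"
proof -
 assume g: "g \<in> SOJ" and h: "h ** g = mat 1"
 have "h = h ** (g ** jinv g)" using jinv_right[of g] g by (simp add: SOJ_def)
 also have "\<dots> = jinv g" unfolding matrix_mul_assoc h by simp
 finally show "jinv g = h" ..
qed

lemma subgroup_mat_group:
 assumes "S \<subseteq> SOJ" "\<And>g. g \<in> S ==> jinv g \<in> S"
 shows "subgroup H (mat_group S) \<longleftrightarrow> H \<subseteq> S \<and> matrix_subgroup H"
proof -
 have "inv\<^bsub>mat_group S\<^esub> g = jinv g" if g: "g \<in> S" for g
  unfolding m_inv_def
 proof (rule the_equality)
  show "jinv g \<in> carrier (mat_group S) \<and> g \<otimes>\<^bsub>mat_group S\<^esub> jinv g = \<one>\<^bsub>mat_group S\<^esub> \<and> jinv g \<otimes>\<^bsub>mat_group S\<^esub> g = \<one>\<^bsub>mat_group S\<^esub>"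
  proof -
   have "transpose g ** J ** g = J" using g assms(1) by (auto simp: SOJ_def)
   then show ?thesis using jinv_left jinv_right assms(2)[OF g] by (simp add: mat_group_def)
  qed
  show "y = jinv g" if "y \<in> carrier (mat_group S) \<and> g \<otimes>\<^bsub>mat_group S\<^esub> y = \<one>\<^bsub>mat_group S\<^esub> \<and> y \<otimes>\<^bsub>mat_group S\<^esub> g = \<one>\<^bsub>mat_group S\<^esub>" for y
  proof -
   have "y ** g = mat 1" using that by (simp add: mat_group_def)
   then show ?thesis using jinv_unique g assms(1) by blast
  qed
 qed
 then show ?thesis unfolding subgroup_def matrix_subgroup_def by (auto simp: mat_group_def subset_iff)
qed

lemma jinv_ANgrp: "g \<in> ANgrp ==> jinv g \<in> ANgrp"
proof -
 assume "g \<in> ANgrp"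
 then obtain s t p where g: "g = dE s t ** nexp p" "p \<in> ncar" by (auto simp: ANgrp_def Agrp_def Ngrp_def)
 have q: "nad s t p \<in> ncar" using g(2) by (cases p) simp
 note q = subspace_neg[OF subspace_ncar q] q
 have "(dE (- s) (- t) ** nexp (- nad s t p)) ** g = dE (- s) (- t) ** (nexp (- nad s t p) ** nexp (nad s t p)) ** dE s t"
  unfolding g(1) dE_nexp[of s t] by (simp only: matrix_mul_assoc)
 also have "\<dots> = mat 1" by (simp add: nexp_mult[OF q] bch_neg dE_dE)
 finally have "(dE (- s) (- t) ** nexp (- nad s t p)) ** g = mat 1" .
 moreover have "g \<in> SOJ" unfolding g(1) by (intro SOJ_mult dE_SOJ nexp_SOJ g)
 ultimately have "jinv g = dE (- s) (- t) ** nexp (- nad s t p)" using jinv_unique by blast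
 moreover have "nexp (- nad s t p) \<in> Ngrp" using q by (simp add: Ngrp_def)
 ultimately show ?thesis using dE_Agrp unfolding ANgrp_def by blast
qed

lemma ANgrp_SOJ: "ANgrp \<subseteq> SOJ" by (auto simp: ANgrp_iff)

lemma dE_inj: "dE s t = dE s' t' ==> s = s' \<and> t = t'"
 using AN_unique[of 0 0 s t s' t'] by (simp add: zero_prod_def)

lemma fills_Agrp: "fills Agrp"
 unfolding fills_def
proof (rule exI[of _ "(real CARD('m))^4"], intro conjI allI impI)
 let ?D = "real CARD('m)"
 show "0 < ?D^4" by simp
 fix a b :: real assume ab: "1 <= b" "b <= a"
 have D: "1 <= ?D^4" "?D\<^sup>2 <= ?D^4" using DM_ge_1 by (simp_all add: power_increasing)
 have "dA a b \<in> Agrp" using dA_as_dE[of a b] ab by simp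
 moreover have le: "x / ?D^4 <= x" if "0 <= x" for x using mult_left_mono[OF D(1) that] by (simp add: pos_divide_le_eq)
 have "a / ?D^4 <= norm (dA a b)" using le[of a] norm_dA_bounds(1)[OF ab] ab by linarith
 moreover have "norm (dA a b) <= ?D^4 * a" using norm_dA_bounds(2)[OF ab] mult_right_mono[OF D(2), of a] ab by linarith
 moreover have "a * b / ?D^4 <= L2 (dA a b)" using le[of "a * b"] L2_dA_bounds(1)[OF ab] ab by simp
 ultimately show "\<exists>h\<in>Agrp. a / ?D^4 <= norm h \<and> norm h <= ?D^4 * a \<and> a * b / ?D^4 <= L2 h \<and> L2 h <= ?D^4 * (a * b)"
  using L2_dA_bounds(2)[OF ab] by blast
qed

lemma bracket_root_coords:
 assumes "p \<in> root_coords v" "q \<in> root_coords v" "v \<in> root_vectors"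
 shows "bracket (nmat p) (nmat q) = 0"
proof -
 obtain pp x y et where p: "p = (pp, x, y, et)" by (cases p) blast
 obtain pp' x' y' et' where q: "q = (pp', x', y', et')" by (cases q) blast
 have "v = (1, -1) \<or> v = (0, 1) \<or> v = (1, 0) \<or> v = (1, 1)" using assms(3) by (simp add: root_vectors_def)
 then have "bracket (nmat p) (nmat q) $ i $ j = 0" for i j
  using assms(1,2) unfolding p q
  by (elim disjE; cases rule: level5[of i]; cases rule: level5[of j])
   (simp_all add: bracket_def mult_entry nmat_def sum_negf mult.commute)
 then show ?thesis by (simp add: vec_eq_iff)
qed

text \<open>Variation of constants: \<open>c\<close> is the value of the root on the torus
  direction, and the coefficient of \<open>p\<close> solves \<open>g' = exp (- c * r)\<close> with
  \<open>g 0 = 0\<close>.\<close>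

lemma mexp_torus_root:
 fixes s t :: real
 assumes v: "v \<in> root_vectors" and p: "p \<in> root_coords v"
 defines "c \<equiv> s * fst v + t * snd v"
 shows "mexp (r *\<^sub>R (dmat s t + nmat p)) = dE (r * s) (r * t) ** nexp ((if c = 0 then r else (1 - exp (- c * r)) / c) *\<^sub>R p)"
proof -
 define g where "g r = (if c = 0 then r else (1 - exp (- c * r)) / c)" for r
 have g': "(g has_real_derivative exp (- c * r)) (at r)" for r
 proof (cases "c = 0")
  case True then show ?thesis unfolding g_def by (auto intro!: derivative_eq_intros)
 next
  case False
  have "((\<lambda>r. (1 - exp (- c * r)) / c) has_real_derivative exp (- c * r)) (at r)"
   using False by (auto intro!: derivative_eq_intros)
  then show ?thesis using False unfolding g_def by simp
 qed
 have pn: "p \<in> ncar" using p root_coords_ncar by blast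
 have N: "nexp (u *\<^sub>R p) = mexp (u *\<^sub>R nmat p)" for u
  using mexp_nmat[OF subspace_scale[OF subspace_ncar pn]] by (simp add: nmat_scale)
 have X: "nmat p \<in> weight_space v" using p nmat_weight_space[OF v] by blast
 have DY: "dE (r * s) (r * t) ** nmat p = exp (c * r) *\<^sub>R (nmat p ** dE (r * s) (r * t))" for r
 proof -
  have "exp (wt (r * s) (r * t) i) * nmat p $ i $ j = exp (c * r) * (nmat p $ i $ j * exp (wt (r * s) (r * t) j))" for i j
  proof (cases "nmat p $ i $ j = 0")
   case False
   have "wt (r * s) (r * t) i = c * r + wt (r * s) (r * t) j"
    using weight_space_wt[OF X False, of "r * s" "r * t"] by (simp add: c_def algebra_simps)
   then show ?thesis by (simp add: exp_add)
  qed simp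
  then show ?thesis by (simp add: vec_eq_iff dE_mult mult_dE)
 qed
 have "mexp (r *\<^sub>R (dmat s t + nmat p)) = dE (r * s) (r * t) ** nexp (g r *\<^sub>R p)"
 proof (rule mexp_unique)
  fix r
  have 1: "mderiv (\<lambda>r. nexp (g r *\<^sub>R p)) (exp (- c * r) *\<^sub>R (nmat p ** nexp (g r *\<^sub>R p))) r"
   unfolding mderiv_def
  proof (intro allI)
   fix i j
   have "((\<lambda>u. mexp (u *\<^sub>R nmat p) $ i $ j) has_real_derivative (nmat p ** mexp (g r *\<^sub>R nmat p)) $ i $ j) (at (g r))"
    using mderiv_mexp[of "nmat p" "g r"] by (simp add: mderiv_def)
   from DERIV_chain2[OF this g'] show "((\<lambda>r. nexp (g r *\<^sub>R p) $ i $ j) has_real_derivative (exp (- c * r) *\<^sub>R (nmat p ** nexp (g r *\<^sub>R p))) $ i $ j) (at r)"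
    unfolding N by (simp add: mult.commute)
  qed
  have 2: "mderiv (\<lambda>r. dE (r * s) (r * t)) (dmat s t ** dE (r * s) (r * t)) r"
   using mderiv_mexp[of "dmat s t" r] by (simp add: dmat_linear(2)[symmetric] mexp_dmat)
  have "dE (r * s) (r * t) ** (exp (- c * r) *\<^sub>R (nmat p ** nexp (g r *\<^sub>R p))) = exp (- c * r) *\<^sub>R ((dE (r * s) (r * t) ** nmat p) ** nexp (g r *\<^sub>R p))"
   by (simp add: matrix_mult_scaleR matrix_mul_assoc)
  also have "\<dots> = nmat p ** dE (r * s) (r * t) ** nexp (g r *\<^sub>R p)"
   unfolding DY by (simp add: matrix_mult_scaleR mult_exp_exp)
  finally show "mderiv (\<lambda>r. dE (r * s) (r * t) ** nexp (g r *\<^sub>R p)) ((dmat s t + nmat p) ** (dE (r * s) (r * t) ** nexp (g r *\<^sub>R p))) r"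
   using mderiv_mult[OF 2 1] by (simp add: matrix_mult_add_left matrix_mul_assoc)
 qed (simp add: g_def)
 then show ?thesis by (simp add: g_def)
qed

text \<open>Inside one root space the explicit exponential shows that sums generate curves in the
  family. Conversely, the torus and unipotent coordinates of a one-parameter group are
  differentiated at 0, and the difference quotients stay in the closed subspaces \<open>V\<close>
  and \<open>U\<close>.\<close>

lemma lie_family:
 assumes V: "subspace V" and U: "subspace U" "U \<subseteq> root_coords v" and v: "v \<in> root_vectors"
 shows "lie (family V U) = {X + Y |X Y. X \<in> (\<lambda>w. dmat (fst w) (snd w)) ` V \<and> Y \<in> nmat ` U}"
proof
 show "{X + Y |X Y. X \<in> (\<lambda>w. dmat (fst w) (snd w)) ` V \<and> Y \<in> nmat ` U} \<subseteq> lie (family V U)"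
 proof
  fix Z assume "Z \<in> {X + Y |X Y. X \<in> (\<lambda>w. dmat (fst w) (snd w)) ` V \<and> Y \<in> nmat ` U}"
  then obtain s t p where Z: "Z = dmat s t + nmat p" "(s, t) \<in> V" "p \<in> U" by auto
  have "(r * s, r * t) \<in> V" for r using subspace_scale[OF V Z(2), of r] by simp
  then show "Z \<in> lie (family V U)"
   using mexp_torus_root[OF v, of p] U(2) subspace_scale[OF U(1) Z(3)] Z(3) unfolding lie_def family_def Z(1) by blast
 qed
 show "lie (family V U) \<subseteq> {X + Y |X Y. X \<in> (\<lambda>w. dmat (fst w) (snd w)) ` V \<and> Y \<in> nmat ` U}"
 proof
  fix X assume X: "X \<in> lie (family V U)"
  define F where "F r = mexp (r *\<^sub>R X)" for r
  have Uc: "U \<subseteq> ncar" using U(2) root_coords_ncar by blast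
  have "\<exists>s t p. F r = dE s t ** nexp p \<and> (s, t) \<in> V \<and> p \<in> U" for r using X by (auto simp: lie_def family_def F_def)
  then obtain s t p where F: "\<And>r. F r = dE (s r) (t r) ** nexp (p r)" "\<And>r. (s r, t r) \<in> V" "\<And>r. p r \<in> U" by metis
  have "family V U \<subseteq> SOJ" unfolding family_def using Uc by (auto intro!: SOJ_mult dE_SOJ nexp_SOJ)
  from lie_mono[OF this] X have Xs: "X \<in> soJ" unfolding lie_SOJ by blast
  have d: "((\<lambda>r. F r $ i $ j) has_real_derivative X $ i $ j) (at 0)" for i j
   using mderiv_mexp[of X 0] by (simp add: mderiv_def F_def)
  have F0: "F 0 $ i $ j = (if i = j then 1 else 0)" for i j by (simp add: F_def mat_def)
  have diag: "F r $ e1 $ e1 = exp (s r)" "F r $ e2 $ e2 = exp (t r)" for r by (simp_all add: F(1) dE_mult nexp_diag)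
  have lim: "((\<lambda>h. f h / h) \<longlongrightarrow> D) (at 0)" if "(f has_real_derivative D) (at 0)" "f 0 = 0" for f D
   using that by (simp add: DERIV_def)
  have ln': "((\<lambda>r. ln (F r $ i $ i)) has_real_derivative X $ i $ i) (at 0)" for i
   using d[of i i] F0[of i i] by (auto intro!: derivative_eq_intros)
  have "((\<lambda>h. (ln (F h $ e1 $ e1) / h, ln (F h $ e2 $ e2) / h)) \<longlongrightarrow> (X $ e1 $ e1, X $ e2 $ e2)) (at 0)"
   by (intro tendsto_Pair lim ln') (simp_all add: F0)
  moreover have "(ln (F h $ e1 $ e1) / h, ln (F h $ e2 $ e2) / h) \<in> V" for h
   using subspace_scale[OF V F(2), of "1 / h" h] by (simp add: diag)
  ultimately have XV: "(X $ e1 $ e1, X $ e2 $ e2) \<in> V"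
   by (intro Lim_in_closed_set[OF closed_subspace[OF V] always_eventually at_neq_bot]) auto
  define q where "q A = (A $ e1 $ e2, \<chi> k. if k \<in> mid then A $ e1 $ k else 0, \<chi> k. if k \<in> mid then A $ e2 $ k else 0, A $ e1 $ f2)" for A :: "'m sqmat"
  \<comment> \<open>Dividing each row by its diagonal entry removes the torus factor; within a
    single root space the coordinates appear linearly in the remaining unipotent matrix.\<close>
  define G where "G r = (\<chi> i j. F r $ i $ j / F r $ i $ i)" for r
  have vs: "v = (1, -1) \<or> v = (0, 1) \<or> v = (1, 0) \<or> v = (1, 1)" using v by (simp add: root_vectors_def)
  have qG: "q (G r) = p r" for r
  proof -
   obtain pp x y et where pr: "p r = (pp, x, y, et)" by (cases "p r") blast
   then have "(pp, x, y, et) \<in> root_coords v" using U(2) F(3)[of r] by auto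
   then have "(\<forall>k. pp * y $ k = 0) \<and> pp * (y \<bullet> y) = 0 \<and> x \<bullet> y = 0 \<and> supp x \<and> supp y" using vs by (elim disjE) simp_all
   then have z: "pp * y $ k = 0" "pp * (y \<bullet> y) = 0" "x \<bullet> y = 0" "k \<notin> mid ==> x $ k = 0" "k \<notin> mid ==> y $ k = 0" for k
    by (auto simp: supp_def)
   have "F r $ e1 $ e2 / F r $ e1 $ e1 = pp" "F r $ e1 $ f2 / F r $ e1 $ e1 = et" "k \<in> mid ==> F r $ e1 $ k / F r $ e1 $ e1 = x $ k"
    "k \<in> mid ==> F r $ e2 $ k / F r $ e2 $ e2 = y $ k" for k
    unfolding F(1) pr by (simp_all add: dE_mult nexp_def z)
   then show ?thesis unfolding q_def G_def pr by (simp add: vec_eq_iff z)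
  qed
  have Gd: "((\<lambda>r. G r $ i $ j) has_real_derivative X $ i $ j) (at 0)" if "i ~= j" for i j
   unfolding G_def using d[of i j] d[of i i] F0[of i i] F0[of i j] that by (auto intro!: derivative_eq_intros)
  have Gl: "((\<lambda>h. G h $ i $ j / h) \<longlongrightarrow> X $ i $ j) (at 0)" if "i ~= j" for i j
   using that by (intro lim Gd) (simp_all add: G_def F0)
  have Gk: "((\<lambda>h. (if k \<in> mid then G h $ e $ k else 0) / h) \<longlongrightarrow> (if k \<in> mid then X $ e $ k else 0)) (at 0)" if "e \<notin> mid" for e k
   using Gl[of e k] that by (cases "k \<in> mid") auto
  have "((\<lambda>h. (1 / h) *\<^sub>R q (G h)) \<longlongrightarrow> q X) (at 0)"
   unfolding q_def scaleR_Pair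
   by (intro tendsto_Pair vec_tendstoI) (simp_all add: Gl Gk)
  then have "q X \<in> U"
   unfolding qG using F(3) subspace_scale[OF U(1)]
   by (intro Lim_in_closed_set[OF closed_subspace[OF U(1)] always_eventually at_neq_bot]) auto
  moreover have "X - dmat (X $ e1 $ e1) (X $ e2 $ e2) = nmat (q X)"
  proof -
   let ?Z = "X - dmat (X $ e1 $ e1) (X $ e2 $ e2)"
   have Zs: "?Z \<in> soJ" by (intro subspace_diff[OF subspace_soJ] Xs dmat_soJ)
   have low: "X $ i $ j = 0" if "j < i" for i j
   proof (rule lie_entry_const)
    show "mexp (r *\<^sub>R X) $ i $ j = 0" for r
     using F(1)[of r] nexp_upper[of "p r"] that by (simp add: F_def dE_mult upper_def)
   qed
   have mm: "X $ i $ j = 0" if "i \<in> mid" "j \<in> mid" for i j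
   proof (rule lie_entry_const)
    show "mexp (r *\<^sub>R X) $ i $ j = (if j = i then 1 else 0)" for r
     using F(1)[of r] that by (cases "p r") (simp add: F_def dE_mult nexp_def)
   qed
   have dg: "?Z $ i $ i = 0" for i
    by (cases rule: level5[of i]) (simp_all add: dmat_def soJ_D[OF Xs])
   have z: "?Z $ i $ j = 0" if "j <= i" for i j
    using that low[of j i] dg[of i] by (cases "j = i") (auto simp: dmat_def)
   have z2: "?Z $ i $ j = 0" if "i \<in> mid" "j \<in> mid" for i j
    using mm[OF that] that by (simp add: dmat_def)
   have "?Z = nmat (q ?Z)" unfolding q_def by (rule eq_nmatI(1)[OF Zs z z2])
   moreover have "q ?Z = q X" unfolding q_def dmat_def by (auto simp: vec_eq_iff)
   ultimately show ?thesis by simp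
  qed
  then have "X = dmat (fst (X $ e1 $ e1, X $ e2 $ e2)) (snd (X $ e1 $ e1, X $ e2 $ e2)) + nmat (q X)" by (simp add: algebra_simps)
  ultimately show "X \<in> {X + Y |X Y. X \<in> (\<lambda>w. dmat (fst w) (snd w)) ` V \<and> Y \<in> nmat ` U}" using XV by blast
 qed
qed

lemma dim_span_pair: "dim (span {x, y}) = 1 \<longleftrightarrow> (x ~= 0 \<or> y ~= 0) \<and> gram x y = 0" for x y :: "'m vc"
proof (cases "y = 0")
 case True
 have "dim {x, 0} = dim (span {x})" by (metis dim_span insert_commute span_insert_0)
 then show ?thesis by (simp add: True gram_def dim_insert)
next
 case False
 show ?thesis
 proof
  assume d: "dim (span {x, y}) = 1"
  have "span {y} = span {x, y}"
   using d False by (intro subspace_dim_equal subspace_span span_mono) auto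
  then have "x \<in> span {y}" using span_base[of x "{x, y}"] by auto
  then obtain l where "x = l *\<^sub>R y" by (auto simp: span_singleton)
  then show "(x ~= 0 \<or> y ~= 0) \<and> gram x y = 0" using False by (simp add: gram_def power2_eq_square)
 next
  assume "(x ~= 0 \<or> y ~= 0) \<and> gram x y = 0"
  then obtain l where "x = l *\<^sub>R y" using gram_0 False by metis
  then have "span {x, y} = span {y}" by (simp add: span_redundant span_base span_scale)
  then show "dim (span {x, y}) = 1" using False by simp
 qed
qed

lemma subspace_plane_cases:
 fixes V :: "(real \<times> real) set"
 assumes "subspace V"
 obtains "V = {0}" | "V = UNIV" | a b where "(a, b) ~= (0, 0)" "V = span {(a, b)}"
proof -
 have "dim V <= 2" using dim_subset_UNIV[of V] by simp
 then consider "dim V = 0" | "dim V = 1" | "dim V = 2" by linarith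
 then show thesis
 proof cases
  case 1
  then have "V \<subseteq> {0}" by (simp only: dim_eq_0)
  then have "V = {0}" using subspace_0[OF assms] by blast
  then show ?thesis using that by blast
 next
  case 2
  then obtain w where w: "w \<in> V" "w ~= 0" using dim_eq_0[of V] by auto
  have "span {w} = V" using w 2 assms by (intro subspace_dim_equal span_minimal) auto
  then show ?thesis using that(3)[of "fst w" "snd w"] w(2) by (auto simp: zero_prod_def prod_eq_iff)
 next
  case 3
  then have "span V = UNIV" using dim_eq_full[of V] by simp
  then show ?thesis using that(2) assms by (metis span_eq_iff)
 qed
qed

end

context so2n
begin

lemma CDS_iff:
 assumes "closed K" "connected K" "K \<subseteq> SOJ" "matrix_subgroup K"
 shows "CDS (SO2 n) K \<longleftrightarrow> fills K"
proof -
 have "subgroup K (mat_group SOJ)" using assms(3,4) subgroup_mat_group[OF subset_refl SOJ_jinv] by blast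
 then have "closed_subgroup K SOJ" unfolding closed_subgroup_def using closed_subset[OF assms(3,1)] by blast
 then have "CDS (SO2 n) K \<longleftrightarrow> (\<exists>C\<subseteq>SOJ. compact C \<and> {c ** h ** d | c h d. c \<in> C \<and> h \<in> K \<and> d \<in> C} = SOJ)"
  using assms(2) by (simp add: CDS_def SO2_eq)
 also have "\<dots> \<longleftrightarrow> fills K"
 proof
  assume "\<exists>C\<subseteq>SOJ. compact C \<and> {c ** h ** d | c h d. c \<in> C \<and> h \<in> K \<and> d \<in> C} = SOJ"
  then obtain C where "compact C" "C \<subseteq> SOJ" "SOJ \<subseteq> {c ** h ** d | c h d. c \<in> C \<and> h \<in> K \<and> d \<in> C}" by blast
  then show "fills K" by (rule fills_if_dense)
 next
  assume "fills K"
  then obtain C where C: "compact C" "C \<subseteq> SOJ" "{c ** h ** d | c h d. c \<in> C \<and> h \<in> K \<and> d \<in> C} = SOJ"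
   by (rule dense_if_fills[OF assms(3)])
  show "\<exists>C\<subseteq>SOJ. compact C \<and> {c ** h ** d | c h d. c \<in> C \<and> h \<in> K \<and> d \<in> C} = SOJ"
   by (rule exI[of _ C]) (intro conjI C)
 qed
 finally show ?thesis .
qed

text \<open>
 The projection of \<open>A N\<close> to its diagonal part is continuous, so \<open>H \<inter> A\<close> and \<open>H \<inter> N\<close> are connected because
 they are continuous images of \<open>H\<close>.
\<close>

lemma semidirect_coordinates:
 assumes H: "closed_subgroup H (grpAN n)" "connected H" "inner_semidirect H (H \<inter> grpA n) (H \<inter> grpN n)"
 obtains V U where "subspace V" "subspace U" "U \<subseteq> ncar" "\<And>p q. p \<in> U ==> q \<in> U ==> nbr p q \<in> U"
  "\<And>s t p. (s, t) \<in> V ==> p \<in> U ==> nad s t p \<in> U" "H = family V U" "H \<inter> grpN n = nexp ` U"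
  "H \<inter> grpA n = (\<lambda>w. dE (fst w) (snd w)) ` V"
  "CDS (SO2 n) H \<longleftrightarrow> fills H" "CDS (SO2 n) (H \<inter> grpN n) \<longleftrightarrow> fills (nexp ` U)"
proof -
 have HS: "H \<subseteq> ANgrp" "matrix_subgroup H"
  using H(1) subgroup_mat_group[OF ANgrp_SOJ jinv_ANgrp] by (auto simp: closed_subgroup_def grpAN_eq)
 have mem: "mat 1 \<in> H" "\<And>g h. g \<in> H ==> h \<in> H ==> g ** h \<in> H" "\<And>g. g \<in> H ==> jinv g \<in> H"
  using HS(2) by (auto simp: matrix_subgroup_def)
 have clH: "closed H" using H(1) closed_ANgrp by (auto simp: closed_subgroup_def grpAN_eq closedin_closed_eq)
 have form: "\<exists>s t p. g = dE s t ** nexp p \<and> p \<in> ncar \<and> dE s t \<in> H \<and> nexp p \<in> H" if g: "g \<in> H" for g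
 proof -
  have "(H \<inter> grpA n) <#>\<^bsub>mat_group H\<^esub> (H \<inter> grpN n) = H" using H(3) by (simp add: inner_semidirect_def)
  then have "g \<in> (\<Union>a\<in>H \<inter> grpA n. \<Union>u\<in>H \<inter> grpN n. {a ** u})"
   using g by (simp add: set_mult_def mat_group_def)
  then obtain a u where au: "a \<in> H" "a \<in> Agrp" "u \<in> H" "u \<in> Ngrp" "g = a ** u" unfolding grpA_eq grpN_eq by blast
  then obtain s t p where "a = dE s t" "u = nexp p" "p \<in> ncar" unfolding Agrp_def Ngrp_def by blast
  then show ?thesis using au by blast
 qed
 \<comment> \<open>On AN this is the torus factor, since the unipotent factor has diagonal
   1.\<close>
 define de where "de g = (\<chi> i j. if i = j then g $ i $ i else 0)" for g :: "'m sqmat"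
 have de: "de (dE s t ** nexp p) = dE s t" for s t p
  by (auto simp: de_def vec_eq_iff dE_mult dE_entry nexp_diag)
 have jd: "jinv (dE s t) = dE (- s) (- t)" for s t by (rule jinv_unique) (simp_all add: dE_SOJ dE_dE)
 have HA: "H \<inter> Agrp = de ` H"
 proof (intro equalityI subsetI)
  fix a assume a: "a \<in> H \<inter> Agrp"
  then obtain s t where "a = dE s t ** nexp 0" by (auto simp: Agrp_def)
  then have "de a = a" by (simp only: de) simp
  then show "a \<in> de ` H" using a by (metis IntD1 imageI)
 next
  fix a assume "a \<in> de ` H"
  then obtain g where g: "g \<in> H" "a = de g" by blast
  then show "a \<in> H \<inter> Agrp" using form[OF g(1)] de by auto
 qed
 have HN: "H \<inter> Ngrp = (\<lambda>g. jinv (de g) ** g) ` H"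
 proof (intro equalityI subsetI)
  fix a assume a: "a \<in> H \<inter> Ngrp"
  then obtain p where "a = dE 0 0 ** nexp p" by (auto simp: Ngrp_def)
  then have "de a = dE 0 0" by (simp only: de)
  then have "jinv (de a) ** a = a" by (simp only: jd) simp
  then show "a \<in> (\<lambda>g. jinv (de g) ** g) ` H" using a by (metis (no_types, lifting) IntD1 imageI)
 next
  fix a assume "a \<in> (\<lambda>g. jinv (de g) ** g) ` H"
  then obtain g where g: "g \<in> H" "a = jinv (de g) ** g" by blast
  obtain s t p where p: "g = dE s t ** nexp p" "p \<in> ncar" "nexp p \<in> H" using form[OF g(1)] by blast
  have "a = nexp p" unfolding g(2) p(1) de jd by (simp add: matrix_mul_assoc dE_dE)
  then show "a \<in> H \<inter> Ngrp" using p by (simp add: Ngrp_def)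
 qed
 have cont: "continuous_on H de" unfolding de_def by (intro continuous_intros continuous_on_if_const)
 have clA: "closed (H \<inter> Agrp)"
 proof -
  have "H \<inter> Agrp = H \<inter> (\<Inter>i. \<Inter>j\<in>{j. i ~= j}. {g. g $ i $ j = 0})"
  proof (intro equalityI subsetI)
   fix g assume g: "g \<in> H \<inter> (\<Inter>i. \<Inter>j\<in>{j. i ~= j}. {g. g $ i $ j = 0})"
   then have "g \<in> H" by (rule IntD1)
   from form[OF this] obtain s t p where p: "g = dE s t ** nexp p" by (elim exE conjE)
   have "de g = g" using g by (auto simp: de_def vec_eq_iff)
   then show "g \<in> H \<inter> Agrp" using g de[of s t p] by (simp add: p)
  qed (auto simp: Agrp_def dE_entry)
  then show ?thesis by (auto intro!: closed_Int clH closed_INT closed_Collect_eq continuous_intros)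
 qed
 have clN: "closed (H \<inter> Ngrp)"
 proof -
  have "H \<inter> Ngrp = H \<inter> (\<Inter>i. {g. g $ i $ i = 1})"
  proof (intro equalityI subsetI)
   fix g assume g: "g \<in> H \<inter> (\<Inter>i. {g. g $ i $ i = 1})"
   then have "g \<in> ANgrp" using HS(1) by blast
   then show "g \<in> H \<inter> Ngrp" using g by (auto simp: ANgrp_iff intro: Ngrp_char)
  qed (auto simp: Ngrp_def nexp_diag)
  then show ?thesis by (auto intro!: closed_Int clH closed_INT closed_Collect_eq continuous_intros)
 qed
 have conA: "connected (H \<inter> Agrp)" unfolding HA by (rule connected_continuous_image[OF cont H(2)])
 have conN: "connected (H \<inter> Ngrp)" unfolding HN jinv_def
  by (intro connected_continuous_image H(2) continuous_on_matrix_mult continuous_on_transpose cont continuous_on_const continuous_on_id)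
 have sA: "matrix_subgroup Agrp" and sN: "matrix_subgroup Ngrp"
 proof -
  have "g ** h \<in> Agrp \<and> jinv g \<in> Agrp" if "g \<in> Agrp" "h \<in> Agrp" for g h
  proof -
   obtain s t s' t' where "g = dE s t" "h = dE s' t'" using \<open>g \<in> Agrp\<close> \<open>h \<in> Agrp\<close> unfolding Agrp_def by blast
   then show ?thesis by (simp only: dE_dE jd dE_Agrp simp_thms)
  qed
  then show "matrix_subgroup Agrp" unfolding matrix_subgroup_def using dE_Agrp[of 0 0] by simp
  have "jinv (nexp p) = nexp (- p)" if "p \<in> ncar" for p
   by (rule jinv_unique) (use that subspace_neg[OF subspace_ncar that] in \<open>simp_all add: nexp_SOJ nexp_mult bch_neg\<close>)
  moreover have "mat 1 \<in> Ngrp" using subspace_0[OF subspace_ncar] by (auto simp: Ngrp_def intro!: image_eqI[of _ _ 0])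
  moreover have "nexp p ** nexp q \<in> Ngrp" if "p \<in> ncar" "q \<in> ncar" for p q
   unfolding nexp_mult[OF that] Ngrp_def using bch_ncar[OF that] by blast
  ultimately show "matrix_subgroup Ngrp" unfolding matrix_subgroup_def
   using subspace_neg[OF subspace_ncar] by (auto simp: Ngrp_def)
 qed
 have mA: "mat 1 \<in> H \<inter> Agrp" "\<And>g h. g \<in> H \<inter> Agrp ==> h \<in> H \<inter> Agrp ==> g ** h \<in> H \<inter> Agrp" "\<And>g. g \<in> H \<inter> Agrp ==> jinv g \<in> H \<inter> Agrp"
  using mem sA unfolding matrix_subgroup_def by blast+
 have mN: "mat 1 \<in> H \<inter> Ngrp" "\<And>g h. g \<in> H \<inter> Ngrp ==> h \<in> H \<inter> Ngrp ==> g ** h \<in> H \<inter> Ngrp" "\<And>g. g \<in> H \<inter> Ngrp ==> jinv g \<in> H \<inter> Ngrp"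
  using mem sN unfolding matrix_subgroup_def by blast+
 obtain V where V: "subspace V" "H \<inter> Agrp = (\<lambda>w. dE (fst w) (snd w)) ` V"
  using diagonal_subgroup[OF clA conA _ mA] unfolding Agrp_def by blast
 obtain U where U: "subspace U" "U \<subseteq> ncar" "H \<inter> Ngrp = nexp ` U" "\<And>p q. p \<in> U ==> q \<in> U ==> nbr p q \<in> U"
  using unipotent_subgroup[OF clN conN _ mN] unfolding Ngrp_def by blast
 have inV: "(s, t) \<in> V" if "dE s t \<in> H" for s t
 proof -
  have "dE s t \<in> (\<lambda>w. dE (fst w) (snd w)) ` V" using that V(2) by auto
  then obtain w where "w \<in> V" "dE s t = dE (fst w) (snd w)" by blast
  then show ?thesis using dE_inj by (metis prod.collapse)
 qed
 have inU: "p \<in> U" if "p \<in> ncar" "nexp p \<in> H" for p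
 proof -
  have "nexp p \<in> nexp ` U" using that U(3) by (auto simp: Ngrp_def)
  then show ?thesis using nexp_inj[OF that(1)] U(2) by blast
 qed
 have VH: "dE s t \<in> H" if "(s, t) \<in> V" for s t using V(2) that by force
 have UH: "nexp p \<in> H" if "p \<in> U" for p using U(3) that by blast
 have nad: "nad s t p \<in> U" if "(s, t) \<in> V" "p \<in> U" for s t p
 proof (rule inU)
  show "nad s t p \<in> ncar" using that(2) U(2) by (cases p) auto
  show "nexp (nad s t p) \<in> H"
   unfolding nexp_conj[symmetric] jd[symmetric] by (intro mem VH UH that)
 qed
 have Hf: "H = family V U"
 proof
  show "H \<subseteq> family V U" unfolding family_def using form inV inU by blast
  show "family V U \<subseteq> H" unfolding family_def using VH UH mem(2) by blast
 qed
 have "CDS (SO2 n) H \<longleftrightarrow> fills H"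
  using HS ANgrp_SOJ by (intro CDS_iff clH H(2)) auto
 moreover have "CDS (SO2 n) (H \<inter> Ngrp) \<longleftrightarrow> fills (H \<inter> Ngrp)"
  using Ngrp_SOJ mN by (intro CDS_iff clN conN) (auto simp: matrix_subgroup_def)
 ultimately show thesis using that[OF V(1) U(1,2,4) nad Hf] U(3) V(2) by (simp add: grpA_eq grpN_eq)
qed

end

section \<open>The characterization of Cartan-decomposition subgroups\<close>

theorem theorem6p1:
  fixes n :: nat and H :: "'m::{finite, linorder} sqmat set"
  assumes "n \<ge> 3" and "CARD('m) = n + 2"
    and "closed_subgroup H (grpAN n)" and "connected H"
    and "inner_semidirect H (H \<inter> grpA n) (H \<inter> grpN n)"
  shows "CDS (SO2 n) H \<longleftrightarrow>
      grpA n \<subseteq> H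
    \<or> CDS (SO2 n) (H \<inter> grpN n)
    \<or> (H \<inter> grpA n = root_ker n root_alpha \<and> H \<inter> grpN n \<noteq> {mat 1} \<and>
        (\<forall>h \<in> H \<inter> grpN n. h \<noteq> mat 1 \<longrightarrow>
           par_phi n h = 0 \<and> par_eta n h = 0 \<and> dim (span {par_x n h, par_y n h}) = 1))
    \<or> (H \<inter> grpA n = root_ker n root_beta \<and> H \<inter> grpN n \<noteq> {mat 1} \<and>
        (\<forall>h \<in> H \<inter> grpN n.
           par_y n h = 0 \<and> (norm (par_x n h))\<^sup>2 = - 2 * par_phi n h * par_eta n h))
    \<or> (\<exists>\<omega> \<in> pos_roots. lie H \<inter> lie (grpN n) \<subseteq> root_space n \<omega> \<and>
        (\<exists>\<tt> \<uu>. subspace \<tt> \<and> dim \<tt> = 1 \<and> \<tt> \<subseteq> lie (grpA n) \<and>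
               subalgebra \<uu> \<and> \<uu> \<noteq> {0} \<and> \<uu> \<subseteq> root_space n \<omega> \<and>
               lie H = {X + Y | X Y. X \<in> \<tt> \<and> Y \<in> \<uu>} \<and>
               (\<exists>T \<C>. ray_and_region n \<omega> \<tt> T \<C> \<and> \<not> T - {0} \<subseteq> intA n \<C>)))"
    (is "_ \<longleftrightarrow> ?c1 \<or> ?c2 \<or> ?c3 \<or> ?c4 \<or> ?c5")
proof -
 obtain e1 e2 f2 f1 :: 'm where "so2n e1 e2 f2 f1 n" using so2n_ix[OF assms(1,2)] by blast
 then interpret so2n e1 e2 f2 f1 n .
 note H = assms(3-5)
 let ?D = "\<lambda>w. dE (fst w) (snd w)" and ?d = "\<lambda>w. dmat (fst w) (snd w)"
 obtain V U where V: "subspace V" and U: "subspace U" "U \<subseteq> ncar" "\<And>p q. p \<in> U ==> q \<in> U ==> nbr p q \<in> U"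
  and nad: "\<And>s t p. (s, t) \<in> V ==> p \<in> U ==> nad s t p \<in> U" and Hf: "H = family V U" and HN: "H \<inter> grpN n = nexp ` U"
  and HA: "H \<inter> grpA n = ?D ` V" and CH: "CDS (SO2 n) H \<longleftrightarrow> fills H" and CN: "CDS (SO2 n) (H \<inter> grpN n) \<longleftrightarrow> fills (nexp ` U)"
  by (rule semidirect_coordinates[OF H]) blast
 have injD: "inj ?D" unfolding inj_def using dE_inj by (auto simp: prod_eq_iff)
 have VH: "dE s t \<in> H \<longleftrightarrow> (s, t) \<in> V" for s t
 proof -
  have "dE s t \<in> H \<longleftrightarrow> ?D (s, t) \<in> ?D ` V" using HA dE_Agrp[of s t] by (auto simp: grpA_eq)
  then show ?thesis unfolding inj_image_mem_iff[OF injD] .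
 qed
 have UH: "nexp p \<in> H \<longleftrightarrow> p \<in> U" if "p \<in> ncar" for p
 proof -
  have "nexp p \<in> H \<longleftrightarrow> nexp p \<in> nexp ` U" using HN that by (auto simp: grpN_eq Ngrp_def)
  then show ?thesis using nexp_inj[OF that] U(2) by blast
 qed
 have one: "nexp p = mat 1 \<longleftrightarrow> p = 0" if "p \<in> U" for p
  using nexp_inj[of p 0] that U subspace_0[OF subspace_ncar] by auto
 have N1: "H \<inter> grpN n ~= {mat 1} \<longleftrightarrow> U ~= {0}"
 proof -
  have "nexp ` U = {mat 1} \<longleftrightarrow> U = {0}"
  proof
   assume "nexp ` U = {mat 1}"
   then have "p = 0" if "p \<in> U" for p using that one by blast
   then show "U = {0}" using subspace_0[OF U(1)] by blast
  qed simp
  then show ?thesis unfolding HN by simp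
 qed
 have ker: "root_ker n root_alpha = ?D ` span {(1, 1)}" "root_ker n root_beta = ?D ` span {(1, 0)}"
 proof -
  have e: "root_alpha (dE s t) = exp (s - t)" "root_beta (dE s t) = exp t" for s t
   by (simp_all add: root_alpha_def root_beta_def exp_diff dE_entry)
  show "root_ker n root_alpha = ?D ` span {(1, 1)}" "root_ker n root_beta = ?D ` span {(1, 0)}"
   unfolding root_ker_def grpA_eq Agrp_def span_singleton by (auto simp: e image_image dE_Agrp[unfolded Agrp_def])
 qed
 have par: "(\<forall>h \<in> H \<inter> grpN n. P h) \<longleftrightarrow> (\<forall>(pp, x, y, et) \<in> U. P (nexp (pp, x, y, et)))" for P
  unfolding HN by fastforce
 have P: "par_phi n (nexp (pp, x, y, et)) = pp" "par_x n (nexp (pp, x, y, et)) = x" "par_y n (nexp (pp, x, y, et)) = y"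
  "par_eta n (nexp (pp, x, y, et)) = et" if "(pp, x, y, et) \<in> U" for pp x y et
  using parameters[of pp x y et] U(2) that by blast+
 have c3: "?c3 \<longleftrightarrow> V = span {(1, 1)} \<and> U ~= {0} \<and>
   (\<forall>(pp, x, y, et) \<in> U. (pp, x, y, et) ~= 0 \<longrightarrow> pp = 0 \<and> et = 0 \<and> (x ~= 0 \<or> y ~= 0) \<and> gram x y = 0)"
  unfolding N1 HA ker inj_image_eq_iff[OF injD] par dim_span_pair
 proof (intro conj_cong ball_cong refl)
  fix p assume p: "p \<in> U"
  obtain pp x y et where p': "p = (pp, x, y, et)" by (cases p) blast
  show "(case p of (pp, x, y, et) => nexp (pp, x, y, et) ~= mat 1 \<longrightarrow> par_phi n (nexp (pp, x, y, et)) = 0 \<and> par_eta n (nexp (pp, x, y, et)) = 0 \<and>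
    (par_x n (nexp (pp, x, y, et)) ~= 0 \<or> par_y n (nexp (pp, x, y, et)) ~= 0) \<and>
    gram (par_x n (nexp (pp, x, y, et))) (par_y n (nexp (pp, x, y, et))) = 0) \<longleftrightarrow>
   (case p of (pp, x, y, et) => (pp, x, y, et) ~= 0 \<longrightarrow> pp = 0 \<and> et = 0 \<and> (x ~= 0 \<or> y ~= 0) \<and> gram x y = 0)"
   unfolding p' prod.case P[OF p[unfolded p']] one[OF p[unfolded p']] ..
 qed
 have c4: "?c4 \<longleftrightarrow> V = span {(1, 0)} \<and> U ~= {0} \<and> (\<forall>(pp, x, y, et) \<in> U. y = 0 \<and> Qf pp x et = 0)"
  unfolding N1 HA ker inj_image_eq_iff[OF injD] par
 proof (intro conj_cong ball_cong refl)
  fix p assume p: "p \<in> U"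
  obtain pp x y et where p': "p = (pp, x, y, et)" by (cases p) blast
  show "(case p of (pp, x, y, et) => par_y n (nexp (pp, x, y, et)) = 0 \<and> (norm (par_x n (nexp (pp, x, y, et))))\<^sup>2 =
    - 2 * par_phi n (nexp (pp, x, y, et)) * par_eta n (nexp (pp, x, y, et))) \<longleftrightarrow>
   (case p of (pp, x, y, et) => y = 0 \<and> Qf pp x et = 0)"
   unfolding p' prod.case P[OF p[unfolded p']] Qf_def power2_norm_eq_inner by auto
 qed
 have inv: "invariant_family e1 e2 f2 f1 U a b" if "V = span {(a, b)}" "(a, b) ~= (0, 0)" for a b
 proof unfold_locales
  show "nad (l * a) (l * b) p \<in> U" if "p \<in> U" for l p
  proof (rule nad[OF _ that])
   have "l *\<^sub>R (a, b) \<in> V" unfolding \<open>V = span {(a, b)}\<close> by (intro span_scale span_base) simp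
   then show "(l * a, l * b) \<in> V" by simp
  qed
 qed (use U that in auto)
 have dlie: "dmat s t \<in> lie H \<longleftrightarrow> (s, t) \<in> V" for s t
 proof -
  have "dmat s t \<in> lie H \<longleftrightarrow> (\<forall>r. (r * s, r * t) \<in> V)" by (simp add: lie_def dmat_linear(2)[symmetric] mexp_dmat VH)
  then show ?thesis using subspace_scale[OF V, of "(s, t)"] by (auto dest: spec[of _ 1])
 qed
 have nlie: "nmat p \<in> lie H \<longleftrightarrow> p \<in> U" if p: "p \<in> ncar" for p
 proof -
  have "nmat p \<in> lie H \<longleftrightarrow> (\<forall>r. r *\<^sub>R p \<in> U)"
   using UH mexp_nmat subspace_scale[OF subspace_ncar p] by (simp add: lie_def nmat_scale[symmetric])
  moreover have "(\<forall>r. r *\<^sub>R p \<in> U) \<longleftrightarrow> p \<in> U" using subspace_scale[OF U(1)] scaleR_one[of p] by metis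
  ultimately show ?thesis by blast
 qed
 have nd: "nmat p $ i $ i = 0" for p i by (cases p; cases rule: level5[of i]) (simp_all add: nmat_def)
 have sep: "s = s' \<and> t = t' \<and> nmat p = nmat q" if "dmat s t + nmat p = dmat s' t' + nmat q" for s t s' t' p q
 proof -
  have "(dmat s t + nmat p) $ i $ i = (dmat s' t' + nmat q) $ i $ i" for i using that by simp
  from this[of e1] this[of e2] have "s = s'" "t = t'" by (simp_all add: nd dmat_def)
  then show ?thesis using that by simp
 qed
 have nmat0: "nmat 0 = 0" using nmat_scale[of 0 0] by simp
 have fA: "fills H" if "V = UNIV"
 proof (rule fills_mono[OF fills_Agrp])
  show "Agrp \<subseteq> H" using that VH by (auto simp: Agrp_def)
 qed
 \<comment> \<open>The sets \<open>\<tt>\<close> and \<open>\<uu>\<close> of condition (5) are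
   arbitrary; comparing diagonal and off-diagonal parts identifies \<open>\<tt>\<close> with the
   image of \<open>V\<close> and places \<open>U\<close> inside the root space.\<close>
 have c5: "?c5 ==> fills H"
 proof (elim bexE exE conjE)
  fix \<omega> and \<tt> \<uu> T \<C> :: "'m sqmat set"
  assume \<omega>: "\<omega> \<in> pos_roots" and t: "subspace \<tt>" "dim \<tt> = 1" "\<tt> \<subseteq> lie (grpA n)"
   and u: "subalgebra \<uu>" "\<uu> ~= {0}" "\<uu> \<subseteq> root_space n \<omega>" and lH: "lie H = {X + Y | X Y. X \<in> \<tt> \<and> Y \<in> \<uu>}"
   and T: "ray_and_region n \<omega> \<tt> T \<C>" "\<not> T - {0} \<subseteq> intA n \<C>"
  obtain v where v: "is_root \<omega> v" using pos_roots_vectors(1)[OF \<omega>] by blast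
  have vr: "v \<in> root_vectors" using v by (simp add: is_root_def)
  have uv: "\<uu> \<subseteq> nmat ` root_coords v" using u(3) root_space_coords[OF v] by simp
  have 0: "0 \<in> \<tt>" "0 \<in> \<uu>" using t(1) u(1) by (auto simp: subalgebra_def subspace_0)
  have lie_form: "\<exists>s' t' q. X = dmat s' t' + nmat q \<and> dmat s' t' \<in> \<tt> \<and> nmat q \<in> \<uu> \<and> q \<in> root_coords v" if XH: "X \<in> lie H" for X
  proof -
   obtain X1 X2 where X: "X = X1 + X2" "X1 \<in> \<tt>" "X2 \<in> \<uu>" using XH unfolding lH by blast
   obtain q where "X2 = nmat q" "q \<in> root_coords v" using X(3) uv by blast
   moreover obtain s' t' where "X1 = dmat s' t'" using X(2) t(3) torusE by blast
   ultimately show ?thesis using X by blast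
  qed
  have tV: "\<tt> = ?d ` V"
  proof (intro equalityI subsetI)
   fix X assume X: "X \<in> \<tt>"
   then obtain s' t' where st: "X = dmat s' t'" using t(3) torusE by blast
   have "X \<in> lie H" unfolding lH using X 0(2) by (metis (mono_tags, lifting) add.right_neutral mem_Collect_eq)
   then show "X \<in> ?d ` V" using dlie unfolding st by force
  next
   fix X assume "X \<in> ?d ` V"
   then obtain s t where st: "(s, t) \<in> V" "X = dmat s t" by auto
   then obtain s' t' q where q: "dmat s t = dmat s' t' + nmat q" "dmat s' t' \<in> \<tt>" using lie_form dlie by blast
   then have "dmat s t + nmat 0 = dmat s' t' + nmat q" by (simp add: nmat0)
   then show "X \<in> \<tt>" using sep q(2) unfolding st(2) by blast
  qed
  have Uv: "U \<subseteq> root_coords v"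
  proof
   fix p assume p: "p \<in> U"
   then have pn: "p \<in> ncar" using U(2) by blast
   obtain s' t' q where q: "nmat p = dmat s' t' + nmat q" "q \<in> root_coords v" using lie_form nlie[OF pn] p by blast
   then have "dmat 0 0 + nmat p = dmat s' t' + nmat q" by (simp add: dmat_linear)
   then have "nmat p = nmat q" using sep by blast
   then show "p \<in> root_coords v" using nmat_inj[OF pn] q(2) root_coords_ncar by blast
  qed
  have Un0: "U ~= {0}"
  proof -
   obtain Y where Y: "Y \<in> \<uu>" "Y ~= 0" using u(2) 0(2) by blast
   obtain q where q: "Y = nmat q" "q \<in> root_coords v" using Y(1) uv by blast
   have "Y \<in> lie H" unfolding lH using Y(1) 0(1) by (metis (mono_tags, lifting) add_0 mem_Collect_eq)
   then have "q \<in> U" using nlie q root_coords_ncar by blast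
   moreover have "q ~= 0" using Y(2) nmat0 q(1) by auto
   ultimately show ?thesis by blast
  qed
  show "fills H"
  proof (cases rule: subspace_plane_cases[OF V])
   case 1
   then have "\<tt> = {0}" using tV by (simp add: dmat_linear)
   then show ?thesis using t(2) by simp
  next
   case 2 then show ?thesis by (rule fA)
  next
   case (3 a b)
   interpret F: invariant_family e1 e2 f2 f1 U a b using inv 3 by blast
   have "\<tt> = range (\<lambda>r. dmat (r * a) (r * b))" unfolding tV 3(2) span_singleton by (simp add: image_image)
   then have "\<bar>fst v * a + snd v * b\<bar> <= \<bar>snd v * a - fst v * b\<bar>" using region_condition[OF v 3(1)] T by blast
   moreover have "(fst v, snd v) \<in> root_vectors" "U \<subseteq> root_coords (fst v, snd v)" using vr Uv by simp_all
   ultimately show ?thesis unfolding Hf 3(2) F.fills_family_iff using Un0 by blast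
  qed
 qed
 \<comment> \<open>The images of \<open>V\<close> and \<open>U\<close> serve as \<open>\<tt>\<close>
   and \<open>\<uu>\<close>. Root spaces are abelian here, so every subspace of one is a
   subalgebra.\<close>
 have c5': ?c5 if 3: "V = span {(a, b)}" "(a, b) ~= (0, 0)" and Un0: "U ~= {0}" and v: "v \<in> root_vectors" "U \<subseteq> root_coords v"
  and cond: "\<bar>fst v * a + snd v * b\<bar> <= \<bar>snd v * a - fst v * b\<bar>" for a b v
 proof -
  obtain \<omega> where \<omega>: "\<omega> \<in> pos_roots" "is_root \<omega> v" using pos_roots_vectors(2)[OF v(1)] by blast
  have lH: "lie H = {X + Y |X Y. X \<in> ?d ` V \<and> Y \<in> nmat ` U}" unfolding Hf by (rule lie_family[OF V U(1) v(2,1)])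
  have tr: "?d ` V = range (\<lambda>r. dmat (r * a) (r * b))" unfolding 3(1) span_singleton by (simp add: image_image)
  then have ts: "?d ` V = span {dmat a b}" unfolding span_singleton by (simp add: dmat_linear)
  have "dmat a b ~= 0"
  proof
   assume "dmat a b = 0"
   then have "dmat a b $ e1 $ e1 = 0" "dmat a b $ e2 $ e2 = 0" by simp_all
   then show False using 3(2) by (simp add: dmat_def)
  qed
  then have "subspace (?d ` V)" "dim (?d ` V) = 1" unfolding ts by simp_all
  moreover have "?d ` V \<subseteq> lie (grpA n)" by auto
  moreover have "subalgebra (nmat ` U)"
   unfolding subalgebra_def
  proof
   show su: "subspace (nmat ` U)" by (rule linear_subspace_image[OF _ U(1)]) (intro linearI nmat_add nmat_scale)
   show "\<forall>X\<in>nmat ` U. \<forall>Y\<in>nmat ` U. bracket X Y \<in> nmat ` U"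
   proof (intro ballI)
    fix X Y assume "X \<in> nmat ` U" "Y \<in> nmat ` U"
    then obtain p q where "X = nmat p" "Y = nmat q" "p \<in> U" "q \<in> U" by blast
    then have "bracket X Y = 0" using bracket_root_coords[OF _ _ v(1)] v(2) by blast
    then show "bracket X Y \<in> nmat ` U" using subspace_0[OF su] by simp
   qed
  qed
  moreover have "nmat ` U ~= {0}"
  proof
   assume "nmat ` U = {0}"
   then have "nmat p = nmat 0" if "p \<in> U" for p using that nmat0 by auto
   then have "p = 0" if "p \<in> U" for p using that nmat_inj[of p 0] U(2) subspace_0[OF subspace_ncar] by blast
   then show False using Un0 subspace_0[OF U(1)] by blast
  qed
  moreover have "nmat ` U \<subseteq> root_space n \<omega>" using root_space_coords[OF \<omega>(2)] v(2) by auto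
  moreover have "lie H \<inter> lie (grpN n) \<subseteq> root_space n \<omega>"
  proof
   fix X assume X: "X \<in> lie H \<inter> lie (grpN n)"
   then obtain q where q: "X = nmat q" "q \<in> ncar" unfolding lie_grpN by blast
   then have "q \<in> U" using X nlie by blast
   then show "X \<in> root_space n \<omega>" using root_space_coords[OF \<omega>(2)] v(2) q(1) by auto
  qed
  moreover have "\<exists>T \<C>. ray_and_region n \<omega> (?d ` V) T \<C> \<and> \<not> T - {0} \<subseteq> intA n \<C>"
   unfolding tr region_condition[OF \<omega>(2) 3(2)] by (rule cond)
  ultimately show ?c5 using \<omega>(1) lH by blast
 qed
 have NH: "nexp ` U \<subseteq> H" using HN by blast
 show ?thesis
 proof
  assume "?c1 \<or> ?c2 \<or> ?c3 \<or> ?c4 \<or> ?c5"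
  then consider ?c1 | ?c2 | ?c3 | ?c4 | ?c5 by blast
  then have "fills H"
  proof cases
   case 1 then show ?thesis using fills_mono[OF fills_Agrp] by (simp add: grpA_eq)
  next
   case 2 then show ?thesis using fills_mono[OF _ NH] CN by blast
  next
   case 3
   then have V1: "V = span {(1, 1)}" unfolding c3 by blast
   interpret F: invariant_family e1 e2 f2 f1 U 1 1 using inv[OF V1] by simp
   have F.alpha_exception unfolding F.alpha_exception_def using 3 unfolding c3 by blast
   then show ?thesis unfolding Hf V1 F.fills_family_iff by blast
  next
   case 4
   then have V1: "V = span {(1, 0)}" unfolding c4 by blast
   interpret F: invariant_family e1 e2 f2 f1 U 1 0 using inv[OF V1] by simp
   have F.beta_exception unfolding F.beta_exception_def using 4 unfolding c4 by blast
   then show ?thesis unfolding Hf V1 F.fills_family_iff by blast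
  next
   case 5 then show ?thesis by (rule c5)
  qed
  then show "CDS (SO2 n) H" using CH by blast
 next
  assume "CDS (SO2 n) H"
  then have f: "fills H" using CH by blast
  show "?c1 \<or> ?c2 \<or> ?c3 \<or> ?c4 \<or> ?c5"
  proof (cases rule: subspace_plane_cases[OF V])
   \<comment> \<open>Without a torus part, \<open>H\<close> coincides with
     \<open>H \<inter> N\<close>.\<close>
   case 1
   then have "H = nexp ` U" unfolding Hf family_def by (auto simp: zero_prod_def)
   then have ?c2 using f CN by simp
   then show ?thesis by blast
  next
   case 2
   then have ?c1 using VH by (auto simp: grpA_eq Agrp_def)
   then show ?thesis by blast
  next
   case (3 a b)
   interpret F: invariant_family e1 e2 f2 f1 U a b using inv 3 by blast
   consider "fills (nexp ` U)" | F.alpha_exception | F.beta_exception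
    | "U ~= {0} \<and> (\<exists>(c, d) \<in> root_vectors. U \<subseteq> root_coords (c, d) \<and> \<bar>c * a + d * b\<bar> <= \<bar>d * a - c * b\<bar>)"
    using f unfolding Hf 3(2) F.fills_family_iff by blast
   then show ?thesis
   proof cases
    case 1
    then have ?c2 using CN by blast
    then show ?thesis by blast
   next
    case 2
    then have "a = b" "a ~= 0" using 3(1) by (auto simp: F.alpha_exception_def)
    then have "V = span {(1, 1)}" using 3(2) span_pair_scale[of a 1 1] by simp
    then have ?c3 using 2 unfolding c3 F.alpha_exception_def by blast
    then show ?thesis by blast
   next
    case exc: 3
    then have "b = 0" "a ~= 0" using 3(1) by (auto simp: F.beta_exception_def)
    then have "V = span {(1, 0)}" using 3(2) span_pair_scale[of a 1 0] by simp
    then have ?c4 using exc unfolding c4 F.beta_exception_def by blast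
    then show ?thesis by blast
   next
    case 4
    then obtain c d where "U ~= {0}" "(c, d) \<in> root_vectors" "U \<subseteq> root_coords (c, d)" "\<bar>c * a + d * b\<bar> <= \<bar>d * a - c * b\<bar>" by blast
    then have ?c5 using c5'[OF 3(2,1), of "(c, d)"] by simp
    then show ?thesis by blast
   qed
  qed
 qed
qed

end
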